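(* Let $0<\beta<\frac{\pi}{2}$ be fixed. Suppose that $|\arg\nu|\le\frac{3\pi}{2}$, $|\nu|$ is large and $N=\frac12|\nu|(\tan\beta-\beta)+\rho$ is a positive integer with $\rho$ being bounded. Let $M$ be an arbitrary fixed non-negative integer, and define $R_{N,M}(\nu,\beta)$ by $$R_N(\nu,\beta) = i\frac{e^{i\nu(\tan\beta-\beta)-\frac{\pi}{4}i}}{\left(\frac12\nu\pi\tan\beta\right)^{\frac12}}\sum_{m=0}^{M-1}(-1)^m\frac{U_m(i\cot\beta)}{\nu^m}\widehat T_{2N-m+\frac12}\big(i\nu(\tan\beta-\beta)\big) - i\frac{e^{-i\nu(\tan\beta-\beta)+\frac{\pi}{4}i}}{\left(\frac12\nu\pi\tan\beta\right)^{\frac12}}\sum_{m=0}^{M-1}\frac{U_m(i\cot\beta)}{\nu^m}\widehat T_{2N-m+\frac12}\big(-i\nu(\tan\beta-\beta)\big) + R_{N,M}(\nu,\beta).$$ Then $$R_{N,M}(\nu,\beta) = \mathcal{O}_{M,\rho}\left(\frac{e^{-|\nu|(\tan\beta-\beta)}}{\left(\frac12|\nu|\pi\tan\beta\right)^{\frac12}}\frac{|U_M(i\cot\beta)|}{|\nu|^M}\right)\quad\text{for } |\arg\nu|\le\frac{\pi}{2},$$ and $$R_{N,M}(\nu,\beta) = \mathcal{O}_{M,\rho}\left(\frac{e^{\mp\Im(\nu)(\tan\beta-\beta)}}{\left(\frac12|\nu|\pi\tan\beta\right)^{\frac12}}\frac{|U_M(i\cot\beta)|}{|\nu|^M}\right)\quad\text{for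 } \frac{\pi}{2}\le\pm\arg\nu\le\frac{3\pi}{2}$$ (upper signs together, lower signs together).
   Context: The Anger--Weber function is $\mathbf{A}_{-\nu}(z) = \frac{1}{\pi}\int_0^{+\infty} e^{\nu t - z\sinh t}\,dt$ for $|\arg z|<\frac{\pi}{2}$, and $\nu\mapsto\mathbf{A}_{-\nu}(\nu\sec\beta)$ is extended from $|\arg\nu|<\frac\pi2$ to other values of $\arg\nu$ by analytic continuation on the Riemann surface of the logarithm. The remainder $R_N(\nu,\beta)$ is defined by $$\mathbf{A}_{-\nu}(\nu\sec\beta) = -\frac{1}{\pi}\sum_{n=0}^{N-1}\frac{(2n)!\,a_n(-\sec\beta)}{\nu^{2n+1}} + R_N(\nu,\beta),\qquad a_n(-\sec\beta) = -\frac{1}{(2n)!}\left[\frac{d^{2n}}{dt^{2n}}\left(\frac{t}{\sec\beta\,\sinh t - t}\right)^{2n+1}\right]_{t=0},$$ and is extended to the sector $|\arg\nu|\le\frac{3\pi}{2}$ by analytic continuation. The coefficients $U_m$ are $$U_m(i\cot\beta) = (-1)^m\frac{(i\cot\beta)^m}{2^m m!}\left[\frac{d^{2m}}{dt^{2m}}\left(\frac12\frac{t^2}{i\cot\beta\,(t-\sinh t)+\cosh t-1}\right)^{m+\frac12}\right]_{t=0}$$ (the expression in the large parentheses has value $1$ at $t=0$ and the power is the principal one there). Equivalently $U_m(x)$ are the polynomials with $U_0(x)=1$ and $U_m(x)=\frac12x^2(1-x^2)U_{m-1}'(x)+\frac18\int_0^x(1-5t^2)U_{m-1}(t)\,dt$.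 The scaled Terminant function is $$\widehat T_p(w) = \frac{e^{\pi ip}w^{1-p}e^{-w}}{2\pi i}\int_0^{+\infty}\frac{t^{p-1}e^{-t}}{w+t}\,dt\quad\text{for } p>0,\ |\arg w|<\pi,$$ and is defined by analytic continuation in $w$ (on the Riemann surface of the logarithm) elsewhere; here $\arg(\pm i\nu(\tan\beta-\beta))=\arg\nu\pm\frac{\pi}{2}$. Powers of $\nu$ are positive for $\nu>0$ and continued analytically. Conventions: subscripts in the $\mathcal{O}$ notation indicate the parameters on which the implied constant depends (dependence on $\rho$ means dependence on a bound for $|\rho|$). The estimates are for $|\nu|$ sufficiently large, with $\beta$ fixed. Empty sums are zero. *)

theory Defs
  imports "HOL-Complex_Analysis.Complex_Analysis"
begin

text \<open>
  A point \<open>\<nu>\<close> of the Riemann surface of the logarithm is represented throughout by its logarithm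
  \<open>l\<close>, an arbitrary complex number: \<open>\<nu> = exp l\<close>, \<open>\<bar>\<nu>\<bar> = norm (exp l)\<close>, \<open>arg \<nu> = Im l\<close>
  and \<open>\<nu> powr a = exp (a * l)\<close>.  Functions on the surface are functions of \<open>l\<close>, and sectors
  become horizontal strips.

  \<open>log_continuation \<delta> f l\<close> is the value at \<open>l\<close> of the analytic continuation of \<open>f\<close> from the
  sector \<open>\<bar>arg \<nu>\<bar> < \<delta>\<close> to a larger sector \<open>\<bar>arg \<nu>\<bar> < L\<close> containing \<open>l\<close>.  Strips are
  connected, so the value depends neither on the continuation nor on \<open>L\<close>.
\<close>

definition log_continuation :: "real \<Rightarrow> (complex \<Rightarrow> complex) \<Rightarrow> complex \<Rightarrow> complex" where
  "log_continuation \<delta> f l =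
     (THE v. \<exists>L F. \<delta> \<le> L \<and> \<bar>Im l\<bar> < L \<and> F holomorphic_on {u. \<bar>Im u\<bar> < L} \<and>
        (\<forall>u. \<bar>Im u\<bar> < \<delta> \<longrightarrow> F u = f u) \<and> v = F l)"

lemma log_continuation_eqI:
  assumes "0 < \<delta>" "\<delta> \<le> L" "\<bar>Im l\<bar> < L" "F holomorphic_on {u. \<bar>Im u\<bar> < L}"
    and "\<And>u. \<bar>Im u\<bar> < \<delta> \<Longrightarrow> F u = f u"
  shows "log_continuation \<delta> f l = F l"
  unfolding log_continuation_def
proof (rule the_equality)
  show "\<exists>L Fa. \<delta> \<le> L \<and> \<bar>Im l\<bar> < L \<and> Fa holomorphic_on {u. \<bar>Im u\<bar> < L} \<and>
        (\<forall>u. \<bar>Im u\<bar> < \<delta> \<longrightarrow> Fa u = f u) \<and> F l = Fa l"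
    using assms by blast
next
  have strip: "{u. \<bar>Im u\<bar> < r} = {u. Im u < r} \<inter> {u. Im u > - r}" for r
    by auto
  have op: "open {u. \<bar>Im u\<bar> < r}" for r
    unfolding strip by (intro open_Int open_halfspace_Im_lt open_halfspace_Im_gt)
  have conn: "connected {u. \<bar>Im u\<bar> < r}" for r
    unfolding strip
    by (intro convex_connected convex_Int convex_halfspace_Im_lt convex_halfspace_Im_gt)
  fix v
  assume "\<exists>L F. \<delta> \<le> L \<and> \<bar>Im l\<bar> < L \<and> F holomorphic_on {u. \<bar>Im u\<bar> < L} \<and>
        (\<forall>u. \<bar>Im u\<bar> < \<delta> \<longrightarrow> F u = f u) \<and> v = F l"
  then obtain L' G where G: "\<delta> \<le> L'" "\<bar>Im l\<bar> < L'" "G holomorphic_on {u. \<bar>Im u\<bar> < L'}"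
    "\<And>u. \<bar>Im u\<bar> < \<delta> \<Longrightarrow> G u = f u" "v = G l"
    by blast
  let ?S = "{u. \<bar>Im u\<bar> < min L L'}"
  have "F l = G l"
  proof (rule analytic_continuation_open[where f = F and g = G and z = l])
    show "open {u. \<bar>Im u\<bar> < \<delta>}" "open ?S" "connected ?S"
      by (rule op conn)+
    show "{u. \<bar>Im u\<bar> < \<delta>} \<noteq> {}" using assms(1) by (auto intro!: exI[of _ 0])
    show "{u. \<bar>Im u\<bar> < \<delta>} \<subseteq> ?S" using assms(2) G(1) by auto
    show "F holomorphic_on ?S" by (rule holomorphic_on_subset[OF assms(4)]) auto
    show "G holomorphic_on ?S" by (rule holomorphic_on_subset[OF G(3)]) auto
    show "l \<in> ?S" using assms(3) G(2) by simp
    show "F u = G u" if "u \<in> {u. \<bar>Im u\<bar> < \<delta>}" for u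
      using that assms(5) G(4) by simp
  qed
  then show "v = F l" using G(5) by simp
qed

definition anger_weber :: "complex \<Rightarrow> complex \<Rightarrow> complex" where
  "anger_weber \<mu> z = 1 / of_real pi * (LBINT t:{0<..}. exp (- \<mu> * of_real t - z * of_real (sinh t)))"

text \<open>\<open>A\<^sub>-\<^sub>\<nu>(\<nu> sec \<beta>)\<close> at \<open>\<nu> = exp l\<close> on the Riemann surface.\<close>

definition anger_weber_sec :: "real \<Rightarrow> complex \<Rightarrow> complex" where
  "anger_weber_sec \<beta> =
     log_continuation (pi / 2) (\<lambda>l. anger_weber (- exp l) (exp l / of_real (cos \<beta>)))"

text \<open>
  The coefficient \<open>a\<^sub>n(-sec \<beta>)\<close>.  \<^const>\<open>remove_sings\<close> supplies the limit at the removable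
  singularity \<open>t = 0\<close>, here and in \<open>U_coeff\<close>.
\<close>

definition a_coeff :: "nat \<Rightarrow> real \<Rightarrow> complex" where
  "a_coeff n \<beta> = - 1 / fact (2 * n) *
     (deriv ^^ (2 * n))
       (remove_sings (\<lambda>t. (t / (1 / of_real (cos \<beta>) * sinh t - t)) ^ (2 * n + 1))) 0"

definition U_coeff :: "nat \<Rightarrow> complex \<Rightarrow> complex" where
  "U_coeff m x = (- 1) ^ m * (x ^ m / (2 ^ m * fact m)) *
     (deriv ^^ (2 * m))
       (\<lambda>t. remove_sings (\<lambda>t. 1 / 2 * (t\<^sup>2 / (x * (t - sinh t) + cosh t - 1))) t
              powr (of_nat m + 1 / 2)) 0"

text \<open>The scaled Terminant function (for \<open>p > 0\<close>) as a function of the logarithm of its argument.\<close>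

definition terminant :: "real \<Rightarrow> complex \<Rightarrow> complex" where
  "terminant p = log_continuation pi
     (\<lambda>l. exp (of_real (pi * p) * \<i>) * exp (of_real (1 - p) * l) * exp (- exp l) /
            (2 * of_real pi * \<i>) *
          (LBINT t:{0<..}. of_real (t powr (p - 1) * exp (- t)) / (exp l + of_real t)))"

definition R_N :: "nat \<Rightarrow> real \<Rightarrow> complex \<Rightarrow> complex" where
  "R_N N \<beta> l = anger_weber_sec \<beta> l
     + 1 / of_real pi * (\<Sum>n<N. fact (2 * n) * a_coeff n \<beta> / exp l ^ (2 * n + 1))"

definition R_NM :: "nat \<Rightarrow> nat \<Rightarrow> real \<Rightarrow> complex \<Rightarrow> complex" where
  "R_NM N M \<beta> l =
     (let \<xi> = tan \<beta> - \<beta>;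
          x = \<i> * of_real (cot \<beta>);
          root = of_real (sqrt (pi * tan \<beta> / 2)) * exp (l / 2);
          lplus = l + \<i> * of_real (pi / 2) + of_real (ln \<xi>);
          lminus = l - \<i> * of_real (pi / 2) + of_real (ln \<xi>)
      in R_N N \<beta> l
         - (\<i> * exp (\<i> * exp l * of_real \<xi> - \<i> * of_real (pi / 4)) / root *
              (\<Sum>m<M. (- 1) ^ m * (U_coeff m x / exp l ^ m) *
                 terminant (2 * real N - real m + 1 / 2) lplus)
            - \<i> * exp (- (\<i> * exp l * of_real \<xi>) + \<i> * of_real (pi / 4)) / root *
              (\<Sum>m<M. U_coeff m x / exp l ^ m *
                 terminant (2 * real N - real m + 1 / 2) lminus)))"

end

theory Submission
 imports Defs
begin

text \<open>
  With \<open>\<xi> = tan \<beta> - \<beta>\<close>, the function \<open>\<pi> (A(i t) + A(-i t))\<close>, where \<open>A(\<nu>)\<close> is the Anger--Weber function of the theorem,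
  is the saddle point integral \<open>H(t) = \<integral> exp (i t (sinh T / cos \<beta> - T)) dT\<close>. For \<open>\<bar>arg \<nu>\<bar> < \<pi>/2\<close> a
  residue computation and Fubini express \<open>A\<close> as a Stieltjes transform of \<open>H\<close>, and expanding the kernel
  yields \<open>R\<^sub>N(\<nu>) = ((-1)\<^sup>N/\<pi>\<^sup>2) \<integral> t\<^sup>2\<^sup>N H(t) \<nu>\<^sup>-\<^sup>2\<^sup>N \<nu>/(\<nu>\<^sup>2 + t\<^sup>2) dt\<close>. The large-\<open>t\<close> expansion
  \<open>e\<^sup>t\<^sup>\<xi> H(t) \<sim> \<Sum> h\<^sub>m t\<^sup>-\<^sup>m\<^sup>-\<^sup>1\<^sup>/\<^sup>2\<close> at the saddle point \<open>T = i \<beta>\<close>, inserted term by term, produces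
  the terminants, and \<open>R\<^sub>N\<^sub>M\<close> is the same integral applied to the remainder of this expansion. Rotating the line of integration by an angle of order
  \<open>(\<bar>\<nu>\<bar> \<xi>)\<^sup>-\<^sup>1\<^sup>/\<^sup>2\<close> bounds it near the optimal \<open>N\<close>; splitting off one more term makes the constant
  independent of \<open>\<beta>\<close>, because \<open>h\<^sub>M\<close> never vanishes. The sectors \<open>\<pi>/2 \<le> \<bar>arg \<nu>\<bar> \<le> 3\<pi>/2\<close>
  follow from the connection formula relating the values of \<open>R\<^sub>N\<^sub>M\<close> at arguments that differ by \<open>\<pi>\<close>.
\<close>

section \<open>Integrals over lines and strips\<close>

text \<open>Write w = |\<nu>| \<xi>. For N near w/2 the integrand of \<open>R_N\<close> peaks at t =
  |\<nu>|, and as arg \<nu> tends to \<pi>/2 or -\<pi>/2 one of the poles t = \<i>\<nu>, -\<i>\<nu>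
  of the kernel runs into this peak. Turning the line by \<theta> costs 1/sin(2\<theta>) for the
  kernel and (cos \<theta>)^(-p), with p close to w, for the exponential. \<theta> = w^(-1/2) keeps
  the latter bounded; the former, of order w^(1/2), is just what the Stirling bound w^(p-1/2) e^(-w)
  for Gamma(p) leaves free, so no power of \<nu> is lost. The connection formula needs the remainder
  of H for all |arg t| \<le> \<pi>. Instead of a steepest descent curve for each arg t, polygonal
  legs through the saddle are used: one pair serves 0 \<le> arg t \<le> \<pi>/2, another \<pi>/2
  \<le> arg t \<le> \<pi>, and conjugation the rest. Lagrange inversion identifies the coefficients
  with U_m. That h_M is nonzero matters because the next remainder has a constant depending on
  \<beta>, which its extra factor 1/|\<nu>| absorbs only relative to h_M.\<close>

lemma integral_symmetric_tendsto:
 fixes f :: "real \<Rightarrow> complex"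
 assumes f: "integrable lborel f"
 shows "((\<lambda>R. LBINT x:{-R..R}. f x) \<longlongrightarrow> (LBINT x. f x)) at_top"
proof (rule tendsto_at_topI_sequentially)
 fix X :: "nat \<Rightarrow> real" assume X: "filterlim X at_top sequentially"
 show "(\<lambda>n. LBINT x:{-X n..X n}. f x) \<longlonglongrightarrow> (LBINT x. f x)"
  unfolding set_lebesgue_integral_def
 proof (rule integral_dominated_convergence)
  show "integrable lborel (\<lambda>x. norm (f x))"
   using f by (rule integrable_norm)
  show "AE x in lborel. (\<lambda>n. indicator {-X n..X n} x *\<^sub>R f x) \<longlonglongrightarrow> f x"
  proof
   fix x
   from X have "eventually (\<lambda>n. \<bar>x\<bar> \<le> X n) sequentially"
    unfolding filterlim_at_top_ge[where c="\<bar>x\<bar>"] by auto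
   then show "(\<lambda>n. indicator {-X n..X n} x *\<^sub>R f x) \<longlonglongrightarrow> f x"
    by (intro tendsto_eventually, elim eventually_mono) (auto split: split_indicator)
  qed
  show "\<And>n. AE x in lborel. norm (indicator {-X n..X n} x *\<^sub>R f x) \<le> norm (f x)"
   by (auto split: split_indicator)
 qed (use f in auto)
qed

lemma integral_half_line_tendsto:
 fixes f :: "real \<Rightarrow> 'a :: {banach, second_countable_topology}"
 assumes f: "set_integrable lborel {0<..} f"
 shows "((\<lambda>R. LBINT x:{0<..R}. f x) \<longlongrightarrow> (LBINT x:{0<..}. f x)) at_top"
proof -
 let ?g = "\<lambda>x. indicator {0<..} x *\<^sub>R f x"
 have g: "integrable lborel ?g"
  using f by (simp add: set_integrable_def)
 have "((\<lambda>R. LBINT x. indicator {..R} x *\<^sub>R ?g x) \<longlongrightarrow> (LBINT x. ?g x)) at_top"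
  by (rule tendsto_integral_at_top[OF _ g]) simp
 moreover have "(LBINT x. indicator {..R} x *\<^sub>R ?g x) = (LBINT x:{0<..R}. f x)" for R
  unfolding set_lebesgue_integral_def
  by (rule Bochner_Integration.integral_cong) (auto split: split_indicator)
 ultimately show ?thesis
  by (simp add: set_lebesgue_integral_def)
qed

lemma set_integral_Ioc_eq_Icc:
 fixes f :: "real \<Rightarrow> 'a :: {banach, second_countable_topology}"
 shows "(LBINT x:{a<..b}. f x) = (LBINT x:{a..b}. f x)"
 unfolding set_lebesgue_integral_def
proof (rule integral_discrete_difference[where X="{a}"])
 show "indicator {a<..b} x *\<^sub>R f x = indicator {a..b} x *\<^sub>R f x" if "x \<notin> {a}" for x
  using that by (auto split: split_indicator)
qed auto

lemma set_integrable_exp_half_line: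
 assumes "(0::real) < c"
 shows "set_integrable lborel {0<..} (\<lambda>x. exp (- c * x))"
proof -
 have "(\<lambda>x. exp (- c * x)) integrable_on {0..}"
  using integrable_on_exp_minus_to_infinity[OF assms, of 0] by (simp add: mult.commute)
 then have "(\<lambda>x. exp (- c * x)) absolutely_integrable_on {0..}"
  by (intro nonnegative_absolutely_integrable_1) auto
 then have "(\<lambda>x. exp (- c * x)) absolutely_integrable_on {0<..}"
  by (rule set_integrable_subset) auto
 then show ?thesis
  by (simp add: set_integrable_def integrable_completion)
qed

lemma integrable_exp_abs:
 assumes "(0::real) < c"
 shows "integrable lborel (\<lambda>x::real. exp (- c * \<bar>x\<bar>))"
proof -
 have 1: "integrable lborel (\<lambda>x. indicator {0<..} x *\<^sub>R exp (- c * x))"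
  using set_integrable_exp_half_line[OF assms] by (simp add: set_integrable_def)
 have 2: "integrable lborel (\<lambda>x. indicator {0<..} (-x) *\<^sub>R exp (- c * (-x)))"
  using lborel_integrable_real_affine[OF 1, of "-1" 0] by simp
 have "integrable lborel (\<lambda>x. indicator {0<..} x *\<^sub>R exp (- c * x) + indicator {0<..} (-x) *\<^sub>R exp (- c * (-x)))"
  using 1 2 by (rule Bochner_Integration.integrable_add)
 then show ?thesis
 proof (rule integrable_cong_AE_imp)
  show "AE x in lborel. indicator {0<..} x *\<^sub>R exp (- c * x) + indicator {0<..} (-x) *\<^sub>R exp (- c * (-x)) = exp (- c * \<bar>x\<bar>)"
   using AE_lborel_singleton[of "0::real"] by eventually_elim (auto split: split_indicator)
 qed simp
qed

text \<open>Multiplication by -\<i> turns the horizontal segment into a vertical one, for which the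
  contour integral is already expressed through a real integral.\<close>

lemma contour_integral_linepath_horizontal:
 fixes P :: complex
 assumes "u < v"
 shows "contour_integral (linepath (P + of_real u) (P + of_real v)) k
  = integral {u..v} (\<lambda>x. k (P + of_real x))"
proof -
 let ?f = "\<lambda>w. k (P - \<i> * w)"
 have "\<i> * integral {u..v} (\<lambda>x. k (P + of_real x))
   = contour_integral (linepath (Complex 0 u) (Complex 0 v)) ?f"
  by (subst contour_integral_linepath_same_Re[where c=0 and a=u and b=v])
   (use assms in \<open>auto simp: Complex_eq\<close>)
 also have "\<dots> = (Complex 0 v - Complex 0 u) * integral {0..1} (\<lambda>x. ?f (linepath (Complex 0 u) (Complex 0 v) x))"
  by (simp add: contour_integral_integral)
 also have "(\<lambda>x. ?f (linepath (Complex 0 u) (Complex 0 v) x)) = (\<lambda>x. k (linepath (P + of_real u) (P + of_real v) x))"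
  by (auto simp: linepath_def Complex_eq scaleR_conv_of_real algebra_simps intro!: arg_cong[where f=k])
 also have "(Complex 0 v - Complex 0 u) = \<i> * ((P + of_real v) - (P + of_real u))"
  by (simp add: Complex_eq algebra_simps)
 also have "\<dots> * integral {0..1} (\<lambda>x. k (linepath (P + of_real u) (P + of_real v) x))
   = \<i> * contour_integral (linepath (P + of_real u) (P + of_real v)) k"
  unfolding contour_integral_integral by simp
 finally show ?thesis by simp
qed

lemma set_integral_Icc_eq_integral:
 fixes g :: "real \<Rightarrow> complex"
 assumes "continuous_on {u..v} g"
 shows "(LBINT x:{u..v}. g x) = integral {u..v} g"
 using assms borel_integrable_atLeastAtMost'
 by (intro set_borel_integral_eq_integral) auto

lemma set_integral_primitive:
 fixes P :: complex and u v :: real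
 assumes "u \<le> v" and F: "\<And>x. u \<le> x \<Longrightarrow> x \<le> v \<Longrightarrow> (F has_field_derivative k (P + of_real x)) (at (P + of_real x))"
  and c: "continuous_on {u..v} (\<lambda>x. k (P + of_real x))"
 shows "(LBINT x:{u..v}. k (P + of_real x)) = F (P + of_real v) - F (P + of_real u)"
proof -
 have "((\<lambda>x. k (P + of_real x)) has_integral (F (P + of_real v) - F (P + of_real u))) {u..v}"
 proof (rule fundamental_theorem_of_calculus[OF assms(1)])
  fix x assume x: "x \<in> {u..v}"
  have "((\<lambda>x. F (P + of_real x)) has_vector_derivative 1 * k (P + of_real x)) (at x)"
   by (rule field_vector_diff_chain_at[where g=F, unfolded o_def])
    (use F[of x] x in \<open>auto intro!: derivative_eq_intros simp: has_vector_derivative_def scaleR_conv_of_real\<close>)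
  then show "((\<lambda>x. F (P + of_real x)) has_vector_derivative k (P + of_real x)) (at x within {u..v})"
   by (simp add: has_vector_derivative_at_within)
 qed
 then show ?thesis
  using set_integral_Icc_eq_integral[OF c] by (simp add: integral_unique)
qed

lemma integrable_exp_decay:
 fixes g :: "real \<Rightarrow> complex"
 assumes "continuous_on UNIV g" "0 < c" "\<And>x. norm (g x) \<le> D * exp (- c * \<bar>x\<bar>)"
 shows "integrable lborel g"
proof (rule Bochner_Integration.integrable_bound)
 show "integrable lborel (\<lambda>x. D * exp (- c * \<bar>x\<bar>))"
  using integrable_exp_abs[OF assms(2)] by simp
 show "g \<in> borel_measurable lborel"
  using borel_measurable_continuous_onI[OF assms(1)] by simp
 show "AE x in lborel. norm (g x) \<le> norm (D * exp (- c * \<bar>x\<bar>))"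
  using assms(3) by (auto intro!: AE_I2 order_trans[OF assms(3)])
qed

lemma tendsto_exp_decay: "(0::real) < c \<Longrightarrow> ((\<lambda>R. D * exp (- c * R)) \<longlongrightarrow> 0) at_top"
 by (intro tendsto_mult_right_zero filterlim_compose[OF exp_at_bot] filterlim_tendsto_neg_mult_at_bot[where c="-c"])
  (auto simp: filterlim_ident)

text \<open>Residue theorem on rectangles of half-width R; the vertical sides contribute at most 2
  (b - a) D e^(-cR). Decay is assumed everywhere on the two lines, for the convergence of their
  integrals, but inside the strip only far out, since near the pole it fails.\<close>

theorem strip_residue:
 fixes k :: "complex \<Rightarrow> complex"
 assumes S: "open S" "convex S" "{z. a \<le> Im z \<and> Im z \<le> b} \<subseteq> S" and hol: "k holomorphic_on S - {z0}"
  and z0: "a < Im z0" "Im z0 < b" and "0 < c"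
  and line: "\<And>z. Im z = a \<or> Im z = b \<Longrightarrow> norm (k z) \<le> D * exp (- c * \<bar>Re z\<bar>)"
  and decay: "\<And>z. a \<le> Im z \<Longrightarrow> Im z \<le> b \<Longrightarrow> X \<le> \<bar>Re z\<bar> \<Longrightarrow> norm (k z) \<le> D * exp (- c * \<bar>Re z\<bar>)"
 shows "(LBINT x. k (\<i> * of_real a + of_real x)) - (LBINT x. k (\<i> * of_real b + of_real x))
  = 2 * pi * \<i> * residue k z0"
proof -
 have ab: "a < b" using z0 by simp
 have contk: "continuous_on (S - {z0}) k" by (rule holomorphic_on_imp_continuous_on[OF hol])
 have cont: "continuous_on UNIV (\<lambda>x. k (\<i> * of_real y + of_real x))" if "y = a \<or> y = b" for y
  by (rule continuous_on_compose2[OF contk]) (use that z0 S(3) ab in \<open>auto intro!: continuous_intros\<close>)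
 have int: "integrable lborel (\<lambda>x. k (\<i> * of_real y + of_real x))" if "y = a \<or> y = b" for y
  by (rule integrable_exp_decay[OF cont[OF that] \<open>0 < c\<close>, of D])
   (use line[of "\<i> * of_real y + of_real x" for x] that in auto)
 define I where "I y R = (LBINT x:{-R..R}. k (\<i> * of_real y + of_real x))" for y R
 have lim: "((\<lambda>R. I a R - I b R) \<longlongrightarrow> (LBINT x. k (\<i> * of_real a + of_real x)) - (LBINT x. k (\<i> * of_real b + of_real x))) at_top"
  unfolding I_def by (intro tendsto_intros integral_symmetric_tendsto int) auto
 have est: "norm (2 * pi * \<i> * residue k z0 - (I a R - I b R)) \<le> (2 * (b - a) * D) * exp (- c * R)"
  if R: "R \<ge> 1" "R \<ge> X" "R > \<bar>Re z0\<bar>" for R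
 proof -
  define p1 where "p1 = Complex (-R) a"
  define p2 where "p2 = Complex R a"
  define p3 where "p3 = Complex R b"
  define p4 where "p4 = Complex (-R) b"
  have p: "p1 = \<i> * of_real a + of_real (-R)" "p2 = \<i> * of_real a + of_real R"
   "p3 = \<i> * of_real b + of_real R" "p4 = \<i> * of_real b + of_real (-R)"
   by (simp_all add: p1_def p2_def p3_def p4_def Complex_eq)
  have rp: "rectpath p1 p3 = linepath p1 p2 +++ linepath p2 p3 +++ linepath p3 p4 +++ linepath p4 p1"
   by (simp add: rectpath_def p1_def p3_def p2_def p4_def Let_def)
  have pim: "path_image (rectpath p1 p3) \<subseteq> S - {z0}"
  proof -
   have "path_image (rectpath p1 p3) \<subseteq> cbox p1 p3 - box p1 p3"
    by (subst path_image_rectpath_cbox_minus_box) (use ab R in \<open>auto simp: p1_def p3_def\<close>)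
   moreover have "z0 \<in> box p1 p3"
    using R z0 by (auto simp: p1_def p3_def in_box_complex_iff)
   moreover have "cbox p1 p3 \<subseteq> S"
    using S(3) by (auto simp: p1_def p3_def in_cbox_complex_iff)
   ultimately show ?thesis by auto
  qed
  have seg: "closed_segment p1 p2 \<subseteq> S - {z0}" "closed_segment p2 p3 \<subseteq> S - {z0}"
   "closed_segment p3 p4 \<subseteq> S - {z0}" "closed_segment p4 p1 \<subseteq> S - {z0}"
   using pim unfolding rp by (auto simp: path_image_join)
  have ci: "k contour_integrable_on linepath p1 p2" "k contour_integrable_on linepath p2 p3"
   "k contour_integrable_on linepath p3 p4" "k contour_integrable_on linepath p4 p1"
   by (rule contour_integrable_continuous_linepath, rule continuous_on_subset[OF contk], rule seg)+
  have "contour_integral (rectpath p1 p3) k = 2 * pi * \<i> * (\<Sum>p\<in>{z0}. winding_number (rectpath p1 p3) p * residue k p)"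
  proof (rule Residue_theorem[OF S(1)])
   show "connected S" using S(2) by (rule convex_connected)
   show "\<forall>z. z \<notin> S \<longrightarrow> winding_number (rectpath p1 p3) z = 0"
   proof (intro allI impI winding_number_rectpath_outside)
    fix z assume "z \<notin> S"
    then show "z \<notin> cbox p1 p3"
     using S(3) by (auto simp: p1_def p3_def in_cbox_complex_iff)
   qed (use ab R in \<open>auto simp: p1_def p3_def\<close>)
  qed (use hol pim in auto)
  moreover have "winding_number (rectpath p1 p3) z0 = 1"
   by (rule winding_number_rectpath) (use R z0 in \<open>auto simp: p1_def p3_def in_box_complex_iff\<close>)
  ultimately have *: "contour_integral (rectpath p1 p3) k = 2 * pi * \<i> * residue k z0"
   by simp
  have "contour_integral (rectpath p1 p3) k = contour_integral (linepath p1 p2) k + (contour_integral (linepath p2 p3) k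
   + (contour_integral (linepath p3 p4) k + contour_integral (linepath p4 p1) k))"
   unfolding rp using ci by (simp add: contour_integral_join contour_integrable_join)
  moreover have "contour_integral (linepath p1 p2) k = I a R"
   unfolding p I_def using R
   by (subst contour_integral_linepath_horizontal)
    (auto intro!: set_integral_Icc_eq_integral[symmetric] continuous_on_subset[OF cont])
  moreover have "contour_integral (linepath p3 p4) k = - I b R"
  proof -
   have "contour_integral (linepath p4 p3) k = I b R"
    unfolding p I_def using R
    by (subst contour_integral_linepath_horizontal)
     (auto intro!: set_integral_Icc_eq_integral[symmetric] continuous_on_subset[OF cont])
   then show ?thesis
    using contour_integral_reverse_linepath[of p4 p3 k] ci(3)
    by (metis add.inverse_inverse contour_integral_reverse_linepath contk continuous_on_subset seg(3))
  qed
  moreover have D0: "0 \<le> D * exp (- c * R)"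
   by (rule order_trans[OF norm_ge_zero, of "k p2"]) (use line[of p2] R in \<open>auto simp: p2_def\<close>)
  moreover have "norm (contour_integral (linepath p2 p3) k) \<le> D * exp (- c * R) * norm (p3 - p2)"
  proof (rule contour_integral_bound_linepath[OF ci(2) D0])
   fix z assume "z \<in> closed_segment p2 p3"
   then show "norm (k z) \<le> D * exp (- c * R)"
    using decay[of z] R ab by (auto simp: p2_def p3_def closed_segment_same_Re closed_segment_eq_real_ivl)
  qed
  moreover have "norm (contour_integral (linepath p4 p1) k) \<le> D * exp (- c * R) * norm (p1 - p4)"
  proof (rule contour_integral_bound_linepath[OF ci(4) D0])
   fix z assume "z \<in> closed_segment p4 p1"
   then show "norm (k z) \<le> D * exp (- c * R)"
    using decay[of z] R ab by (auto simp: p4_def p1_def closed_segment_same_Re closed_segment_eq_real_ivl)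
  qed
  moreover have "norm (p3 - p2) = b - a" "norm (p1 - p4) = b - a"
   using ab by (auto simp: p1_def p2_def p3_def p4_def cmod_def)
  ultimately have "2 * pi * \<i> * residue k z0 - (I a R - I b R) = contour_integral (linepath p2 p3) k + contour_integral (linepath p4 p1) k"
   "norm (contour_integral (linepath p2 p3) k + contour_integral (linepath p4 p1) k) \<le> (2 * (b - a) * D) * exp (- c * R)"
   using * by (auto simp: algebra_simps intro!: norm_triangle_le)
  then show ?thesis by simp
 qed
 have "((\<lambda>R. 2 * pi * \<i> * residue k z0 - (I a R - I b R)) \<longlongrightarrow> 0) at_top"
 proof (rule Lim_null_comparison[OF _ tendsto_exp_decay[OF \<open>0 < c\<close>]])
  show "\<forall>\<^sub>F R in at_top. norm (2 * pi * \<i> * residue k z0 - (I a R - I b R)) \<le> (2 * (b - a) * D) * exp (- c * R)"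
   using eventually_ge_at_top[of 1] eventually_ge_at_top[of X] eventually_gt_at_top[of "\<bar>Re z0\<bar>"]
   by eventually_elim (rule est)
 qed
 from tendsto_diff[OF tendsto_const[of "2 * pi * \<i> * residue k z0"] this]
 have "((\<lambda>R. I a R - I b R) \<longlongrightarrow> 2 * pi * \<i> * residue k z0) at_top"
  by simp
 from tendsto_unique[OF _ lim this] show ?thesis by simp
qed

corollary strip_shift:
 fixes k :: "complex \<Rightarrow> complex"
 assumes S: "open S" "convex S" "{z. a \<le> Im z \<and> Im z \<le> b} \<subseteq> S" and hol: "k holomorphic_on S"
  and "a \<le> b" "0 < c"
  and decay: "\<And>z. a \<le> Im z \<Longrightarrow> Im z \<le> b \<Longrightarrow> norm (k z) \<le> D * exp (- c * \<bar>Re z\<bar>)"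
 shows "(LBINT x. k (\<i> * of_real a + of_real x)) = (LBINT x. k (\<i> * of_real b + of_real x))"
proof (cases "a = b")
 case False
 \<comment> \<open>The residue formula wants a distinguished interior point; any one serves, with
   residue 0.\<close>
 define z0 where "z0 = \<i> * of_real ((a + b) / 2)"
 have z0: "a < Im z0" "Im z0 < b" using False \<open>a \<le> b\<close> by (auto simp: z0_def)
 have "(LBINT x. k (\<i> * of_real a + of_real x)) - (LBINT x. k (\<i> * of_real b + of_real x))
  = 2 * pi * \<i> * residue k z0"
  by (rule strip_residue[where S=S and c=c and D=D and X=0])
   (use assms z0 in \<open>auto intro: holomorphic_on_subset\<close>)
 also have "residue k z0 = 0"
  by (rule residue_holo[OF S(1)]) (use hol z0 S(3) in auto)
 finally show ?thesis by simp
qed simp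

section \<open>The Anger--Weber function and the saddle point integral\<close>

lemma set_integral_half_line_split:
 fixes f :: "real \<Rightarrow> 'a :: {banach, second_countable_topology}"
 assumes "set_integrable lborel {0<..} f" "0 \<le> a"
 shows "(LBINT x:{0<..}. f x) = (LBINT x:{0<..a}. f x) + (LBINT x:{a<..}. f x)"
proof -
 have U: "{0<..} = {0<..a} \<union> {a<..}" using assms(2) by auto
 have "(LBINT x:{0<..a} \<union> {a<..}. f x) = (LBINT x:{0<..a}. f x) + (LBINT x:{a<..}. f x)"
  by (rule set_integral_Un) (use assms(2) in \<open>auto intro!: set_integrable_subset[OF assms(1)]\<close>)
 then show ?thesis by (simp only: U[symmetric])
qed

text \<open>The integrals over [0, n] are holomorphic by differentiation under the integral sign,
  and they converge uniformly because the tail of the dominating g bounds the tail of every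
  \<open>k z\<close>.\<close>

lemma holomorphic_half_line_integral:
 fixes k :: "complex \<Rightarrow> real \<Rightarrow> complex"
 assumes U: "convex U" "open U"
  and der: "\<And>z x. z \<in> U \<Longrightarrow> 0 \<le> x \<Longrightarrow> ((\<lambda>z. k z x) has_field_derivative k' z x) (at z)"
  and cont: "\<And>z. z \<in> U \<Longrightarrow> continuous_on {0..} (k z)"
  and cont': "continuous_on (U \<times> {0..}) (\<lambda>(z, x). k' z x)"
  and g: "set_integrable lborel {0<..} g" "\<And>z x. z \<in> U \<Longrightarrow> 0 < x \<Longrightarrow> norm (k z x) \<le> g x"
 shows "(\<lambda>z. LBINT x:{0<..}. k z x) holomorphic_on U"
proof (rule holomorphic_uniform_sequence[OF U(2)])
 fix n :: nat
 show "(\<lambda>z. integral (cbox 0 (real n)) (k z)) holomorphic_on U"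
 proof (rule leibniz_rule_holomorphic[where fx = k'])
  show "((\<lambda>z. k z x) has_field_derivative k' z x) (at z within U)" if "z \<in> U" "x \<in> cbox 0 (real n)" for z x
   using der[of z x] that by (auto intro: has_field_derivative_at_within)
  show "k z integrable_on cbox 0 (real n)" if "z \<in> U" for z
   using that by (intro integrable_continuous continuous_on_subset[OF cont]) auto
  show "continuous_on (U \<times> cbox 0 (real n)) (\<lambda>(z, x). k' z x)"
   by (rule continuous_on_subset[OF cont']) auto
 qed (rule U)
next
 have int: "set_integrable lborel {0<..} (k z)" if "z \<in> U" for z
  unfolding set_integrable_def
 proof (rule Bochner_Integration.integrable_bound)
  show "integrable lborel (\<lambda>x. indicator {0<..} x *\<^sub>R g x)"
   using g(1) by (simp add: set_integrable_def)
  have "continuous_on {0<..} (k z)"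
   by (rule continuous_on_subset[OF cont[OF that]]) auto
  then show "(\<lambda>x. indicator {0<..} x *\<^sub>R k z x) \<in> borel_measurable lborel"
   using borel_measurable_continuous_on_indicator[of "{0<..}" "k z"] by simp
  show "AE x in lborel. norm (indicator {0<..} x *\<^sub>R k z x) \<le> norm (indicator {0<..} x *\<^sub>R g x)"
  proof (rule AE_I2)
   show "norm (indicator {0<..} x *\<^sub>R k z x) \<le> norm (indicator {0<..} x *\<^sub>R g x)" for x
    using g(2)[OF that, of x] by (cases "x > 0") auto
  qed
 qed
 define t where "t n = (LBINT x:{real n<..}. g x)" for n :: nat
 have t0: "t \<longlonglongrightarrow> 0"
 proof -
  have "(\<lambda>n. LBINT x:{0<..real n}. g x) \<longlonglongrightarrow> (LBINT x:{0<..}. g x)"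
   by (rule filterlim_compose[OF integral_half_line_tendsto[OF g(1)] filterlim_real_sequentially])
  from tendsto_diff[OF tendsto_const[of "LBINT x:{0<..}. g x"] this]
  moreover have "(LBINT x:{0<..}. g x) - (LBINT x:{0<..real n}. g x) = t n" for n
   using set_integral_half_line_split[OF g(1), of "real n"] by (simp add: t_def)
  ultimately show ?thesis by simp
 qed
 have est: "dist (integral (cbox 0 (real n)) (k z)) (LBINT x:{0<..}. k z x) \<le> t n" if "z \<in> U" for z n
 proof -
  have c: "continuous_on {0..real n} (k z)"
   by (rule continuous_on_subset[OF cont[OF that]]) auto
  have "integral (cbox 0 (real n)) (k z) = (LBINT x:{0<..real n}. k z x)"
   by (simp add: set_integral_Icc_eq_integral[OF c] set_integral_Ioc_eq_Icc)
  then have "dist (integral (cbox 0 (real n)) (k z)) (LBINT x:{0<..}. k z x) = norm (LBINT x:{real n<..}. k z x)"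
   by (simp add: set_integral_half_line_split[OF int[OF that], of "real n"] dist_norm)
  also have "\<dots> \<le> t n"
   unfolding t_def set_lebesgue_integral_def
  proof (rule Bochner_Integration.integral_norm_bound_integral)
   show "integrable lborel (\<lambda>x. indicator {real n<..} x *\<^sub>R k z x)"
    using set_integrable_subset[OF int[OF that], of "{real n<..}"] by (auto simp: set_integrable_def)
   show "integrable lborel (\<lambda>x. indicator {real n<..} x *\<^sub>R g x)"
    using set_integrable_subset[OF g(1), of "{real n<..}"] by (auto simp: set_integrable_def)
   show "norm (indicator {real n<..} x *\<^sub>R k z x) \<le> indicator {real n<..} x *\<^sub>R g x" for x
    using g(2)[OF that, of x] by (auto split: split_indicator)
  qed
  finally show ?thesis .
 qed
 fix z assume "z \<in> U"
 show "\<exists>d>0. cball z d \<subseteq> U \<and> uniform_limit (cball z d) (\<lambda>n z. integral (cbox 0 (real n)) (k z)) (\<lambda>z. LBINT x:{0<..}. k z x) sequentially"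
 proof -
  obtain d where d: "d > 0" "cball z d \<subseteq> U"
   using U(2) \<open>z \<in> U\<close> open_contains_cball by blast
  have "uniform_limit (cball z d) (\<lambda>n z. integral (cbox 0 (real n)) (k z)) (\<lambda>z. LBINT x:{0<..}. k z x) sequentially"
  proof (rule uniform_limitI)
   fix e :: real assume "e > 0"
   with t0 have "eventually (\<lambda>n. t n < e) sequentially"
    by (rule order_tendstoD)
   then show "\<forall>\<^sub>F n in sequentially. \<forall>x\<in>cball z d. dist (integral (cbox 0 (real n)) (k x)) (LBINT xa:{0<..}. k x xa) < e"
   proof eventually_elim
    case (elim n)
    then show ?case using est[of _ n] d by (meson le_less_trans subsetD)
   qed
  qed
  with d show ?thesis by blast
 qed
qed

section \<open>The phase and the entire continuation in the logarithm of \<nu>\<close>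

definition phase :: "real \<Rightarrow> complex \<Rightarrow> complex" where
 "phase \<beta> T = sinh T / of_real (cos \<beta>) - T"

definition phase_exp :: "real \<Rightarrow> complex \<Rightarrow> complex \<Rightarrow> complex" where
 "phase_exp \<beta> l T = exp (- (exp l * phase \<beta> T))"

definition phase_tail :: "real \<Rightarrow> complex \<Rightarrow> complex \<Rightarrow> complex" where
 "phase_tail \<beta> l P = (LBINT x:{0<..}. phase_exp \<beta> l (P + of_real x))"

lemma phase_deriv:
 assumes "cos \<beta> \<noteq> 0"
 shows "(phase \<beta> has_field_derivative (cosh T / of_real (cos \<beta>) - 1)) (at T within A)"
 unfolding phase_def by (rule derivative_eq_intros refl | use assms in simp)+

lemma phase_holomorphic [holomorphic_intros]: "g holomorphic_on A \<Longrightarrow> (\<lambda>z. phase \<beta> (g z)) holomorphic_on A"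
 unfolding phase_def sinh_field_def by (auto intro!: holomorphic_intros)

lemma continuous_on_phase [continuous_intros]: "continuous_on A g \<Longrightarrow> continuous_on A (\<lambda>z. phase \<beta> (g z))"
 unfolding phase_def sinh_field_def divide_inverse by (auto intro!: continuous_intros)

lemma phase_exp_holomorphic: "phase_exp \<beta> l holomorphic_on A"
 unfolding phase_exp_def by (auto intro!: holomorphic_intros)

lemma continuous_on_phase_exp [continuous_intros]:
 "continuous_on A g \<Longrightarrow> continuous_on A (\<lambda>z. phase_exp \<beta> l (g z))"
 unfolding phase_exp_def by (auto intro!: continuous_intros)

lemma phase_minus: "phase \<beta> (- T) = - phase \<beta> T"
 by (simp add: phase_def)

text \<open>Since e^x \<ge> x^2/2, completing the square bounds (B+1) x - A x^2/2 by (B+1)^2/(2A).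
  The spare 1 in B + 1 produces the factor e^(-x). D depends only on A, B, C, which makes all later
  convergence uniform.\<close>

lemma exp_dominated:
 fixes A B C :: real
 assumes "A > 0"
 obtains D where "\<And>a b c x. A \<le> a \<Longrightarrow> b \<le> B \<Longrightarrow> c \<le> C \<Longrightarrow> 0 \<le> x \<Longrightarrow> exp (- a * exp x + b * x + c) \<le> D * exp (- x)"
proof
 fix a b c x :: real assume h: "A \<le> a" "b \<le> B" "c \<le> C" "0 \<le> x"
 have "x\<^sup>2 / 2 \<le> exp x"
  using exp_lower_Taylor_quadratic[OF h(4)] h(4) by linarith
 have "A * (x\<^sup>2 / 2) \<le> a * exp x"
  using assms h \<open>x\<^sup>2 / 2 \<le> exp x\<close> by (intro mult_mono) auto
 moreover have "b * x \<le> B * x" using h by (intro mult_right_mono) auto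
 moreover have "(B + 1) * x - A * (x\<^sup>2 / 2) \<le> (B + 1)\<^sup>2 / (2 * A)"
 proof -
  have "0 \<le> (A * x - (B + 1))\<^sup>2 / (2 * A)" using assms by auto
  also have "\<dots> = (B + 1)\<^sup>2 / (2 * A) - ((B + 1) * x - A * (x\<^sup>2 / 2))"
   using assms by (simp add: field_simps power2_eq_square)
  finally show ?thesis by simp
 qed
 ultimately have "- a * exp x + b * x + c \<le> ((B + 1)\<^sup>2 / (2 * A) + C) + (- x)"
  using h by (simp add: algebra_simps)
 then show "exp (- a * exp x + b * x + c) \<le> exp ((B + 1)\<^sup>2 / (2 * A) + C) * exp (- x)"
  by (simp add: exp_add[symmetric])
qed

lemma exp_sinh_eq: "exp l * sinh T = (exp (l + T) - exp (l - T)) / 2" for l T :: complex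
 by (simp add: sinh_field_def exp_add exp_diff exp_minus field_simps)

text \<open>Only e^(l+T) grows to the right, so the sign of cos (Im l + Im T) decides about
  convergence there; the other two terms are estimated crudely.\<close>

lemma norm_phase_exp_le:
 assumes "0 < cos \<beta>"
 shows "norm (phase_exp \<beta> l T) \<le> exp (- (exp (Re l + Re T) * cos (Im l + Im T)) / (2 * cos \<beta>)
  + exp (Re l - Re T) / (2 * cos \<beta>) + exp (Re l) * norm T)"
proof -
 have "norm (phase_exp \<beta> l T) = exp (- Re (exp l * phase \<beta> T))"
  by (simp add: phase_exp_def)
 also have "exp l * phase \<beta> T = (exp (l + T) - exp (l - T)) / of_real (2 * cos \<beta>) - exp l * T"
  using exp_sinh_eq[of l T] assms by (simp add: phase_def field_simps)
 also have "- Re \<dots> = - (exp (Re l + Re T) * cos (Im l + Im T)) / (2 * cos \<beta>)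
  + exp (Re l - Re T) * cos (Im l - Im T) / (2 * cos \<beta>) + Re (exp l * T)"
  by (simp add: Re_exp Re_divide_of_real diff_divide_distrib del: of_real_mult)
 also have "\<dots> \<le> - (exp (Re l + Re T) * cos (Im l + Im T)) / (2 * cos \<beta>)
  + exp (Re l - Re T) / (2 * cos \<beta>) + exp (Re l) * norm T"
 proof (intro add_mono order_refl)
  show "exp (Re l - Re T) * cos (Im l - Im T) / (2 * cos \<beta>) \<le> exp (Re l - Re T) / (2 * cos \<beta>)"
   using assms by (intro divide_right_mono) auto
  show "Re (exp l * T) \<le> exp (Re l) * norm T"
   using complex_Re_le_cmod[of "exp l * T"] by (simp add: norm_mult)
 qed
 finally show ?thesis by simp
qed

text \<open>Uniformity in bounded l and P is what later permits holomorphy in l and sliding of the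
  starting point. For negative \<eta> no l and P qualify, and D = 0 serves.\<close>

lemma phase_exp_decay:
 assumes "0 < cos \<beta>" "0 \<le> R" "\<eta> < pi / 2"
 obtains D where "\<And>l P x. norm l \<le> R \<Longrightarrow> norm P \<le> R \<Longrightarrow> \<bar>Im l + Im P\<bar> \<le> \<eta> \<Longrightarrow> 0 \<le> x \<Longrightarrow>
  norm (phase_exp \<beta> l (P + of_real x)) \<le> D * exp (- x)"
proof (cases "0 \<le> \<eta>")
 case True
 have c\<eta>: "0 < cos \<eta>" using True assms by (intro cos_gt_zero_pi) auto
 define A where "A = exp (- (2 * R)) * cos \<eta> / (2 * cos \<beta>)"
 define B where "B = exp R"
 define C where "C = exp (2 * R) / (2 * cos \<beta>) + exp R * R"
 have "A > 0" using c\<eta> assms by (simp add: A_def)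
 then obtain D where D: "\<And>a b c x. A \<le> a \<Longrightarrow> b \<le> B \<Longrightarrow> c \<le> C \<Longrightarrow> 0 \<le> x \<Longrightarrow> exp (- a * exp x + b * x + c) \<le> D * exp (- x)"
  using exp_dominated[of A B C] by blast
 show ?thesis
 proof (rule that)
  fix l P :: complex and x :: real
  assume h: "norm l \<le> R" "norm P \<le> R" "\<bar>Im l + Im P\<bar> \<le> \<eta>" "0 \<le> x"
  have r: "\<bar>Re l\<bar> \<le> R" "\<bar>Re P\<bar> \<le> R"
   using h abs_Re_le_cmod[of l] abs_Re_le_cmod[of P] by linarith+
  define a where "a = exp (Re l + Re P) * cos (Im l + Im P) / (2 * cos \<beta>)"
  have cc: "cos \<eta> \<le> cos (Im l + Im P)"
   using cos_monotone_0_pi_le[of "\<bar>Im l + Im P\<bar>" \<eta>] h assms by simp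
  have "A \<le> a"
   unfolding A_def a_def using r cc c\<eta> assms by (intro divide_right_mono mult_mono) auto
  have "norm (phase_exp \<beta> l (P + of_real x)) \<le> exp (- (exp (Re l + (Re P + x)) * cos (Im l + Im P)) / (2 * cos \<beta>)
   + exp (Re l - (Re P + x)) / (2 * cos \<beta>) + exp (Re l) * norm (P + of_real x))"
   using norm_phase_exp_le[OF assms(1), of l "P + of_real x"] by simp
  also have "\<dots> \<le> exp (- a * exp x + exp (Re l) * x + C)"
  proof -
   have "exp (Re l - (Re P + x)) \<le> exp (2 * R)" using r h by simp
   then have "exp (Re l - (Re P + x)) / (2 * cos \<beta>) \<le> exp (2 * R) / (2 * cos \<beta>)"
    using assms by (intro divide_right_mono) auto
   moreover have "exp (Re l) * norm (P + of_real x) \<le> exp (Re l) * x + exp R * R"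
   proof -
    have "exp (Re l) * norm (P + of_real x) \<le> exp (Re l) * (norm P + x)"
     using norm_triangle_ineq[of P "of_real x"] h by (intro mult_left_mono) auto
    also have "\<dots> = exp (Re l) * x + exp (Re l) * norm P" by (simp add: algebra_simps)
    also have "exp (Re l) * norm P \<le> exp R * R" using r h by (intro mult_mono) auto
    finally show ?thesis by simp
   qed
   moreover have "- (exp (Re l + (Re P + x)) * cos (Im l + Im P)) / (2 * cos \<beta>) = - a * exp x"
    by (simp add: a_def exp_add)
   ultimately show ?thesis unfolding C_def by simp
  qed
  also have "\<dots> \<le> D * exp (- x)"
   by (rule D) (use \<open>A \<le> a\<close> r h in \<open>auto simp: B_def\<close>)
  finally show "norm (phase_exp \<beta> l (P + of_real x)) \<le> D * exp (- x)" .
 qed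
next
 case False
 then show ?thesis by (intro that[of 0]) auto
qed

lemma set_integrable_exp_bound:
 fixes g :: "real \<Rightarrow> complex"
 assumes "continuous_on {0<..} g" "0 < c" "\<And>x. 0 < x \<Longrightarrow> norm (g x) \<le> D * exp (- c * x)"
 shows "set_integrable lborel {0<..} g"
 unfolding set_integrable_def
proof (rule Bochner_Integration.integrable_bound)
 show "integrable lborel (\<lambda>x. D * (indicator {0<..} x *\<^sub>R exp (- c * x)))"
  using set_integrable_exp_half_line[OF assms(2)] unfolding set_integrable_def by (rule integrable_mult_right)
 show "(\<lambda>x. indicator {0<..} x *\<^sub>R g x) \<in> borel_measurable lborel"
  using borel_measurable_continuous_on_indicator[of "{0<..}" g] assms(1) by simp
 show "AE x in lborel. norm (indicator {0<..} x *\<^sub>R g x) \<le> norm (D * (indicator {0<..} x *\<^sub>R exp (- c * x)))"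
 proof (rule AE_I2)
  show "norm (indicator {0<..} x *\<^sub>R g x) \<le> norm (D * (indicator {0<..} x *\<^sub>R exp (- c * x)))" for x
   using assms(3)[of x] by (cases "x > 0") (auto intro: order_trans[OF _ abs_ge_self])
 qed
qed

lemma phase_exp_set_integrable:
 assumes "0 < cos \<beta>" "\<bar>Im l + Im P\<bar> < pi / 2"
 shows "set_integrable lborel {0<..} (\<lambda>x. phase_exp \<beta> l (P + of_real x))"
proof -
 obtain D where "\<And>l' P' x. norm l' \<le> norm l + norm P \<Longrightarrow> norm P' \<le> norm l + norm P \<Longrightarrow> \<bar>Im l' + Im P'\<bar> \<le> \<bar>Im l + Im P\<bar> \<Longrightarrow> 0 \<le> x \<Longrightarrow>
  norm (phase_exp \<beta> l' (P' + of_real x)) \<le> D * exp (- x)"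
  using phase_exp_decay[OF assms(1), of "norm l + norm P" "\<bar>Im l + Im P\<bar>"] assms(2) by auto
 then show ?thesis
  by (intro set_integrable_exp_bound[where c=1 and D=D]) (auto intro!: continuous_intros)
qed

text \<open>Both sides are the limit of the primitive F at the right end of the sector |Im l + Im T|
  < \<pi>/2: the segment from P + X to Q + X has fixed length and the derivative of F on it is of
  order e^(-X). Hence the horizontal ray may start at any admissible point.\<close>

lemma phase_tail_shift:
 assumes \<beta>: "0 < cos \<beta>" and P: "\<bar>Im l + Im P\<bar> < pi / 2" "\<bar>Im l + Im Q\<bar> < pi / 2"
  and F: "\<And>T. (F has_field_derivative phase_exp \<beta> l T) (at T)"
 shows "F P + phase_tail \<beta> l P = F Q + phase_tail \<beta> l Q"
proof -
 define R where "R = norm l + norm P + norm Q"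
 define \<eta> where "\<eta> = max \<bar>Im l + Im P\<bar> \<bar>Im l + Im Q\<bar>"
 obtain D where D: "\<And>l P x. norm l \<le> R \<Longrightarrow> norm P \<le> R \<Longrightarrow> \<bar>Im l + Im P\<bar> \<le> \<eta> \<Longrightarrow> 0 \<le> x \<Longrightarrow>
  norm (phase_exp \<beta> l (P + of_real x)) \<le> D * exp (- x)"
  by (rule phase_exp_decay[OF \<beta>, of R \<eta>]) (use P in \<open>auto simp: R_def \<eta>_def\<close>)
 have lim: "((\<lambda>X. F (Z + of_real X)) \<longlongrightarrow> F Z + phase_tail \<beta> l Z) at_top" if "\<bar>Im l + Im Z\<bar> < pi / 2" for Z
 proof -
  have "((\<lambda>X. LBINT x:{0<..X}. phase_exp \<beta> l (Z + of_real x)) \<longlongrightarrow> phase_tail \<beta> l Z) at_top"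
   unfolding phase_tail_def by (rule integral_half_line_tendsto[OF phase_exp_set_integrable[OF \<beta> that]])
  from tendsto_add[OF tendsto_const[of "F Z"] this]
  show ?thesis
  proof (rule Lim_transform_eventually)
   show "\<forall>\<^sub>F X in at_top. F Z + (LBINT x:{0<..X}. phase_exp \<beta> l (Z + of_real x)) = F (Z + of_real X)"
    using eventually_ge_at_top[of 0]
   proof eventually_elim
    case (elim X)
    have "(LBINT x:{0..X}. phase_exp \<beta> l (Z + of_real x)) = F (Z + of_real X) - F (Z + of_real 0)"
     by (rule set_integral_primitive[OF elim]) (auto intro!: F continuous_intros)
    then show ?case by (simp add: set_integral_Ioc_eq_Icc)
   qed
  qed
 qed
 have "((\<lambda>X. F (P + of_real X) - F (Q + of_real X)) \<longlongrightarrow> 0) at_top"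
 proof (rule Lim_null_comparison[OF _ tendsto_exp_decay[where c=1 and D="D * norm (P - Q)"]])
  show "\<forall>\<^sub>F X in at_top. norm (F (P + of_real X) - F (Q + of_real X)) \<le> D * norm (P - Q) * exp (- 1 * X)"
   using eventually_ge_at_top[of 0]
  proof eventually_elim
   case (elim X)
   have "norm (F (P + of_real X) - F (Q + of_real X)) \<le> D * exp (- X) * norm ((P + of_real X) - (Q + of_real X))"
   proof (rule field_differentiable_bound)
    show "convex (closed_segment (P + of_real X) (Q + of_real X))" by simp
    show "(F has_field_derivative phase_exp \<beta> l T) (at T within closed_segment (P + of_real X) (Q + of_real X))" for T
     by (rule has_field_derivative_at_within[OF F])
    fix T assume "T \<in> closed_segment (P + of_real X) (Q + of_real X)"
    then obtain u where u: "0 \<le> u" "u \<le> 1" "T = (1 - u) *\<^sub>R (P + of_real X) + u *\<^sub>R (Q + of_real X)"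
     by (auto simp: closed_segment_def)
    define V where "V = (1 - u) *\<^sub>R P + u *\<^sub>R Q"
    have T: "T = V + of_real X"
     by (simp add: u V_def algebra_simps scaleR_conv_of_real)
    have "V \<in> closed_segment P Q" using u by (auto simp: V_def closed_segment_def)
    then have nV: "norm V \<le> norm P + norm Q"
     by (smt (verit, ccfv_SIG) V_def norm_scaleR norm_triangle_ineq mult_left_le_one_le norm_ge_zero u(1) u(2))
    have nR: "norm l \<le> R" "norm V \<le> R"
     unfolding R_def using nV norm_ge_zero[of l] norm_ge_zero[of P] norm_ge_zero[of Q] by linarith+
    have "Im l + Im V = (1 - u) * (Im l + Im P) + u * (Im l + Im Q)"
     by (simp add: V_def algebra_simps)
    also have "\<bar>\<dots>\<bar> \<le> (1 - u) * \<eta> + u * \<eta>"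
     using u by (intro order_trans[OF abs_triangle_ineq] add_mono) (auto simp: abs_mult \<eta>_def intro!: mult_left_mono)
    finally have "\<bar>Im l + Im V\<bar> \<le> \<eta>" by (simp add: algebra_simps)
    then show "norm (phase_exp \<beta> l T) \<le> D * exp (- X)"
     unfolding T using elim by (intro D nR) auto
   qed auto
   then show ?case by (simp add: mult_ac)
  qed
 qed auto
 moreover have "((\<lambda>X. F (P + of_real X) - F (Q + of_real X)) \<longlongrightarrow> (F P + phase_tail \<beta> l P) - (F Q + phase_tail \<beta> l Q)) at_top"
  by (intro tendsto_diff lim P)
 ultimately have "(F P + phase_tail \<beta> l P) - (F Q + phase_tail \<beta> l Q) = 0"
  by (intro tendsto_unique[of at_top]) auto
 then show ?thesis by simp
qed

text \<open>The contour runs from 0 to -l and then horizontally to the right. On the ray Im l + Im T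
  = 0, so the integral converges for every l, and the corner moves holomorphically with l. One
  formula thus covers the whole Riemann surface.\<close>

definition anger_weber_ext :: "real \<Rightarrow> complex \<Rightarrow> complex" where
 "anger_weber_ext \<beta> l =
  (contour_integral (linepath 0 (- l)) (phase_exp \<beta> l) + phase_tail \<beta> l (- l)) / of_real pi"

lemma contour_integral_linepath_primitive:
 assumes "\<And>T. (F has_field_derivative k T) (at T)"
 shows "contour_integral (linepath a b) k = F b - F a"
 by (rule contour_integral_unique)
  (use contour_integral_primitive[of UNIV F k "linepath a b"] assms in auto)

lemma phase_exp_primitive:
 obtains F where "\<And>T. (F has_field_derivative phase_exp \<beta> l T) (at T)"
 using holomorphic_convex_primitive'[of UNIV "phase_exp \<beta> l"] phase_exp_holomorphic by auto

lemma anger_weber_ext_eq: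
 assumes "0 < cos \<beta>" "\<bar>Im l + Im P\<bar> < pi / 2"
  and F: "\<And>T. (F has_field_derivative phase_exp \<beta> l T) (at T)"
 shows "of_real pi * anger_weber_ext \<beta> l = F P - F 0 + phase_tail \<beta> l P"
 using phase_tail_shift[OF assms(1) _ assms(2) F, of "- l"]
 by (simp add: anger_weber_ext_def contour_integral_linepath_primitive[OF F])

lemma sinh_of_real_complex: "sinh (of_real x :: complex) = of_real (sinh x)"
 by (simp add: sinh_field_def exp_of_real flip: of_real_minus)

lemma anger_weber_ext_eq_anger_weber:
 assumes "0 < cos \<beta>" "\<bar>Im l\<bar> < pi / 2"
 shows "anger_weber_ext \<beta> l = anger_weber (- exp l) (exp l / of_real (cos \<beta>))"
proof -
 obtain F where F: "\<And>T. (F has_field_derivative phase_exp \<beta> l T) (at T)"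
  by (rule phase_exp_primitive) blast
 have "phase_exp \<beta> l (of_real x) = exp (- (- exp l) * of_real x - exp l / of_real (cos \<beta>) * of_real (sinh x))" for x
  by (simp add: phase_exp_def phase_def algebra_simps sinh_of_real_complex)
 then show ?thesis
  using anger_weber_ext_eq[OF assms(1) _ F, of 0] assms(2)
  by (simp add: anger_weber_def phase_tail_def field_simps)
qed

lemma norm_phase_exp_deriv_cont:
 "((\<lambda>l. phase_exp \<beta> l (- l + z)) has_field_derivative
  phase_exp \<beta> l (- l + z) * - (exp l * phase \<beta> (- l + z) - exp l * (cosh (- l + z) / of_real (cos \<beta>) - 1))) (at l)"
 if "cos \<beta> \<noteq> 0"
proof -
 have "((\<lambda>l. phase \<beta> (- l + z)) has_field_derivative (cosh (- l + z) / of_real (cos \<beta>) - 1) * (-1)) (at l)"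
  by (rule DERIV_chain2[OF phase_deriv[OF that]]) (auto intro!: derivative_eq_intros)
 then show ?thesis
  unfolding phase_exp_def by (auto intro!: derivative_eq_intros simp: algebra_simps)
qed

text \<open>Both pieces are parametrised so that l enters the integrand holomorphically over a fixed
  range. The dominating function for the ray is uniform only for bounded l, hence the detour through
  balls.\<close>

lemma anger_weber_ext_holomorphic:
 assumes \<beta>: "0 < cos \<beta>"
 shows "anger_weber_ext \<beta> holomorphic_on UNIV"
proof -
 have 1: "(\<lambda>l. contour_integral (linepath 0 (- l)) (phase_exp \<beta> l)) holomorphic_on UNIV"
 proof -
  have "contour_integral (linepath 0 (- l)) (phase_exp \<beta> l)
    = (- l) * integral (cbox 0 1) (\<lambda>u. phase_exp \<beta> l (- (of_real u * l)))" for l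
   by (simp add: contour_integral_integral linepath_def scaleR_conv_of_real)
  moreover have "(\<lambda>l. integral (cbox 0 (1::real)) (\<lambda>u. phase_exp \<beta> l (- (of_real u * l)))) holomorphic_on UNIV"
  proof (rule leibniz_rule_holomorphic)
   show "((\<lambda>l. phase_exp \<beta> l (- (of_real u * l))) has_field_derivative
    (\<lambda>l u. phase_exp \<beta> l (- (of_real u * l)) * - (exp l * phase \<beta> (- (of_real u * l))
      - exp l * of_real u * (cosh (- (of_real u * l)) / of_real (cos \<beta>) - 1))) l u) (at l within UNIV)" for l and u :: real
   proof -
    have "((\<lambda>l. phase \<beta> (- (of_real u * l))) has_field_derivative (cosh (- (of_real u * l)) / of_real (cos \<beta>) - 1) * (- of_real u)) (at l)"
     by (rule DERIV_chain2[OF phase_deriv]) (use \<beta> in \<open>auto intro!: derivative_eq_intros\<close>)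
    then show ?thesis
     unfolding phase_exp_def by (auto intro!: derivative_eq_intros simp: algebra_simps)
   qed
   show "(\<lambda>u. phase_exp \<beta> l (- (of_real u * l))) integrable_on cbox 0 (1::real)" for l
    by (intro integrable_continuous continuous_intros)
   show "continuous_on (UNIV \<times> cbox 0 (1::real)) (\<lambda>(l, u). phase_exp \<beta> l (- (of_real u * l)) * - (exp l * phase \<beta> (- (of_real u * l))
      - exp l * of_real u * (cosh (- (of_real u * l)) / of_real (cos \<beta>) - 1)))"
    unfolding split_def phase_exp_def cosh_field_def divide_inverse by (auto intro!: continuous_intros)
  qed auto
  ultimately show ?thesis by (simp add: holomorphic_intros)
 qed
 have 2: "(\<lambda>l. phase_tail \<beta> l (- l)) holomorphic_on ball 0 R" if R: "R > 0" for R
 proof -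
  obtain D where D: "\<And>l P x. norm l \<le> R \<Longrightarrow> norm P \<le> R \<Longrightarrow> \<bar>Im l + Im P\<bar> \<le> 0 \<Longrightarrow> 0 \<le> x \<Longrightarrow>
   norm (phase_exp \<beta> l (P + of_real x)) \<le> D * exp (- x)"
   by (rule phase_exp_decay[OF \<beta>, of R 0]) (use R in auto)
  show ?thesis
   unfolding phase_tail_def
  proof (rule holomorphic_half_line_integral)
   show "((\<lambda>l. phase_exp \<beta> l (- l + of_real x)) has_field_derivative
    (\<lambda>l x. phase_exp \<beta> l (- l + of_real x) * - (exp l * phase \<beta> (- l + of_real x)
      - exp l * (cosh (- l + of_real x) / of_real (cos \<beta>) - 1))) l x) (at l)" for l x
    using norm_phase_exp_deriv_cont[of \<beta> "of_real x" l] \<beta> by simp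
   show "continuous_on (ball 0 R \<times> {0..}) (\<lambda>(l, x). phase_exp \<beta> l (- l + of_real x) * - (exp l * phase \<beta> (- l + of_real x)
      - exp l * (cosh (- l + of_real x) / of_real (cos \<beta>) - 1)))"
    unfolding split_def phase_exp_def cosh_field_def divide_inverse by (auto intro!: continuous_intros)
   show "set_integrable lborel {0<..} (\<lambda>x. D * exp (- 1 * x))"
    using set_integrable_exp_half_line[of 1] by simp
   show "norm (phase_exp \<beta> l (- l + of_real x)) \<le> D * exp (- 1 * x)" if "l \<in> ball 0 R" "0 < x" for l x
    using that D[of l "- l" x] by simp
  qed (auto intro!: continuous_intros)
 qed
 have "(\<lambda>l. phase_tail \<beta> l (- l)) field_differentiable (at z)" for z
 proof (rule holomorphic_on_imp_differentiable_at[OF 2])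
  show "0 < norm z + 1" using norm_ge_zero[of z] by linarith
 qed auto
 then have "(\<lambda>l. phase_tail \<beta> l (- l)) holomorphic_on UNIV"
  by (simp add: holomorphic_on_def)
 with 1 show ?thesis
  unfolding anger_weber_ext_def by (intro holomorphic_intros) auto
qed

lemma anger_weber_sec_eq:
 assumes "0 < cos \<beta>"
 shows "anger_weber_sec \<beta> l = anger_weber_ext \<beta> l"
 unfolding anger_weber_sec_def
 by (rule log_continuation_eqI[where L = "\<bar>Im l\<bar> + pi"])
  (use assms anger_weber_ext_eq_anger_weber in
   \<open>auto intro: holomorphic_on_subset[OF anger_weber_ext_holomorphic]\<close>)

lemma integral_line_split:
 fixes g :: "real \<Rightarrow> 'a :: {banach, second_countable_topology}"
 assumes "integrable lborel g"
 shows "(LBINT x. g x) = (LBINT x:{0<..}. g x) + (LBINT x:{0<..}. g (- x))"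
proof -
 have si: "set_integrable lborel A g" if "A \<in> sets lborel" for A
  using assms that unfolding set_integrable_def by (rule integrable_mult_indicator[rotated])
 have 1: "integrable lborel (\<lambda>x. indicator {0<..} x *\<^sub>R g x)" "integrable lborel (\<lambda>x. indicator {..<0} x *\<^sub>R g x)"
  using si[of "{0<..}"] si[of "{..<0}"] by (auto simp: set_integrable_def)
 have "(LBINT x. g x) = (LBINT x. indicator {0<..} x *\<^sub>R g x + indicator {..<0} x *\<^sub>R g x)"
 proof (rule integral_discrete_difference[where X="{0}"])
  show "g x = indicator {0<..} x *\<^sub>R g x + indicator {..<0} x *\<^sub>R g x" if "x \<notin> {0}" for x
   using that by (auto split: split_indicator)
 qed auto
 also have "\<dots> = (LBINT x:{0<..}. g x) + (LBINT x. indicator {..<0} x *\<^sub>R g x)"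
  using 1 by (simp add: set_lebesgue_integral_def)
 also have "(LBINT x. indicator {..<0} x *\<^sub>R g x) = (LBINT x. indicator {..<0} (- x) *\<^sub>R g (- x))"
  using lborel_integral_real_affine[of "-1" "\<lambda>x. indicator {..<0} x *\<^sub>R g x" 0] by simp
 also have "\<dots> = (LBINT x:{0<..}. g (- x))"
  unfolding set_lebesgue_integral_def
  by (rule Bochner_Integration.integral_cong) (auto split: split_indicator)
 finally show ?thesis .
qed

lemma integral_line_reflect:
 fixes g :: "real \<Rightarrow> 'a :: {banach, second_countable_topology}"
 shows "(LBINT x. g (- x)) = (LBINT x. g x)"
 using lborel_integral_real_affine[of "-1" g 0] by simp

lemma half_line_FTC:
 fixes F :: "real \<Rightarrow> complex"
 assumes der: "\<And>x. 0 \<le> x \<Longrightarrow> (F has_vector_derivative f x) (at x)"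
  and cont: "continuous_on {0..} f" and int: "set_integrable lborel {0<..} f"
  and lim: "(F \<longlongrightarrow> L) at_top"
 shows "(LBINT x:{0<..}. f x) = L - F 0"
proof -
 have "((\<lambda>X. LBINT x:{0<..X}. f x) \<longlongrightarrow> L - F 0) at_top"
 proof (rule Lim_transform_eventually[OF tendsto_diff[OF lim tendsto_const]])
  show "\<forall>\<^sub>F X in at_top. F X - F 0 = (LBINT x:{0<..X}. f x)"
   using eventually_ge_at_top[of 0]
  proof eventually_elim
   case (elim X)
   have c: "continuous_on {0..X} f" using cont by (rule continuous_on_subset) auto
   have "(f has_integral (F X - F 0)) {0..X}"
    by (rule fundamental_theorem_of_calculus[OF elim]) (auto intro!: has_vector_derivative_at_within der)
   then show ?case
    by (simp add: set_integral_Ioc_eq_Icc set_integral_Icc_eq_integral[OF c] integral_unique)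
  qed
 qed
 from tendsto_unique[OF _ integral_half_line_tendsto[OF int] this] show ?thesis by simp
qed

section \<open>The saddle point integral as a function of the logarithm of t\<close>

definition phase_wave :: "real \<Rightarrow> complex \<Rightarrow> complex \<Rightarrow> complex" where
 "phase_wave \<beta> s T = exp (\<i> * exp s * phase \<beta> T)"

text \<open>Here t = exp s. Defined by the two continued functions, it is entire in s at once; its
  integral forms hold only for contours adapted to Im s.\<close>

definition saddle_integral :: "real \<Rightarrow> complex \<Rightarrow> complex" where
 "saddle_integral \<beta> s = of_real pi *
  (anger_weber_ext \<beta> (s + \<i> * of_real (pi / 2)) + anger_weber_ext \<beta> (s - \<i> * of_real (pi / 2)))"

lemma exp_add_i_half_pi: "exp (s + \<i> * of_real (pi / 2)) = \<i> * exp s"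
 and exp_diff_i_half_pi: "exp (s - \<i> * of_real (pi / 2)) = - \<i> * exp s"
proof -
 have *: "exp (\<i> * of_real (pi / 2)) = \<i>"
  by (simp only: cis_conv_exp[symmetric] cis_pi_half)
 show "exp (s + \<i> * of_real (pi / 2)) = \<i> * exp s"
  by (simp only: exp_add * mult.commute)
 have "exp s = \<i> * exp (s - \<i> * of_real (pi / 2))"
  by (subst *[symmetric]) (simp only: exp_add[symmetric], simp)
 then show "exp (s - \<i> * of_real (pi / 2)) = - \<i> * exp s"
  by simp
qed

lemma phase_wave_eq: "phase_wave \<beta> s T = phase_exp \<beta> (s - \<i> * of_real (pi / 2)) T"
 "phase_wave \<beta> s (- T) = phase_exp \<beta> (s + \<i> * of_real (pi / 2)) T"
 unfolding phase_exp_def phase_wave_def exp_add_i_half_pi exp_diff_i_half_pi phase_minus by simp_all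

lemma phase_wave_primitive:
 obtains F where "\<And>T. (F has_field_derivative phase_wave \<beta> s T) (at T)"
 using phase_exp_primitive[of \<beta> "s - \<i> * of_real (pi / 2)"] phase_wave_eq(1) by metis

lemma continuous_on_phase_wave [continuous_intros]:
 "continuous_on A g \<Longrightarrow> continuous_on A (\<lambda>z. phase_wave \<beta> s (g z))"
 unfolding phase_wave_def by (auto intro!: continuous_intros)

lemma saddle_integral_holomorphic:
 assumes "0 < cos \<beta>"
 shows "saddle_integral \<beta> holomorphic_on UNIV"
 unfolding saddle_integral_def
 using holomorphic_on_compose[OF _ holomorphic_on_subset[OF anger_weber_ext_holomorphic[OF assms]], of "\<lambda>s. s + \<i> * of_real (pi / 2)" UNIV]
  holomorphic_on_compose[OF _ holomorphic_on_subset[OF anger_weber_ext_holomorphic[OF assms]], of "\<lambda>s. s - \<i> * of_real (pi / 2)" UNIV]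
 by (intro holomorphic_on_mult holomorphic_on_add holomorphic_on_const) (simp_all add: o_def holomorphic_intros)

text \<open>The value of A at -\<i>t supplies the ray to the right; since the phase is odd, the
  value at \<i>t supplies, after T is replaced by -T, the ray to the left. P and Q are independent,
  each restricted only by the convergence sector of its own ray, and the primitive F stands for any
  path joining them.\<close>

lemma saddle_integral_eq:
 assumes \<beta>: "0 < cos \<beta>" and P: "0 < Im P + Im s" "Im P + Im s < pi" and Q: "0 < Im Q - Im s" "Im Q - Im s < pi"
  and F: "\<And>T. (F has_field_derivative phase_wave \<beta> s T) (at T)"
 shows "saddle_integral \<beta> s = F P - F Q + (LBINT x:{0<..}. phase_wave \<beta> s (P + of_real x))
  + (LBINT x:{0<..}. phase_wave \<beta> s (Q - of_real x))"
  and "set_integrable lborel {0<..} (\<lambda>x. phase_wave \<beta> s (P + of_real x))"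
  and "set_integrable lborel {0<..} (\<lambda>x. phase_wave \<beta> s (Q - of_real x))"
proof -
 define G where "G T = - F (- T)" for T
 have G: "(G has_field_derivative phase_exp \<beta> (s + \<i> * of_real (pi / 2)) T) (at T)" for T
 proof -
  have "((\<lambda>T. F (- T)) has_field_derivative phase_wave \<beta> s (- T) * (- 1)) (at T)"
   by (rule DERIV_chain2[OF F]) (auto intro!: derivative_eq_intros)
  from DERIV_minus[OF this] show ?thesis
   unfolding G_def[abs_def] phase_wave_eq(2)[symmetric] by simp
 qed
 have F': "(F has_field_derivative phase_exp \<beta> (s - \<i> * of_real (pi / 2)) T) (at T)" for T
  using F[of T] by (simp add: phase_wave_eq(1))
 have cP: "\<bar>Im (s - \<i> * of_real (pi / 2)) + Im P\<bar> < pi / 2"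
 proof -
  have "Im (s - \<i> * of_real (pi / 2)) = Im s - pi / 2" by simp
  then show ?thesis unfolding abs_less_iff using P by linarith
 qed
 have cQ: "\<bar>Im (s + \<i> * of_real (pi / 2)) + Im (- Q)\<bar> < pi / 2"
 proof -
  have "Im (s + \<i> * of_real (pi / 2)) = Im s + pi / 2" "Im (- Q) = - Im Q" by simp_all
  then show ?thesis unfolding abs_less_iff using Q by linarith
 qed
 have "of_real pi * anger_weber_ext \<beta> (s - \<i> * of_real (pi / 2)) = F P - F 0 + phase_tail \<beta> (s - \<i> * of_real (pi / 2)) P"
  by (rule anger_weber_ext_eq[OF \<beta> cP F'])
 moreover have "of_real pi * anger_weber_ext \<beta> (s + \<i> * of_real (pi / 2)) = G (- Q) - G 0 + phase_tail \<beta> (s + \<i> * of_real (pi / 2)) (- Q)"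
  by (rule anger_weber_ext_eq[OF \<beta> cQ G])
 moreover have eq: "phase_exp \<beta> (s + \<i> * of_real (pi / 2)) (- Q + of_real x) = phase_wave \<beta> s (Q - of_real x)" for x
  using phase_wave_eq(2)[of \<beta> s "- (Q - of_real x)"] by simp
 ultimately show "saddle_integral \<beta> s = F P - F Q + (LBINT x:{0<..}. phase_wave \<beta> s (P + of_real x))
  + (LBINT x:{0<..}. phase_wave \<beta> s (Q - of_real x))"
  by (simp add: saddle_integral_def phase_tail_def G_def ring_distribs phase_wave_eq(1))
 show "set_integrable lborel {0<..} (\<lambda>x. phase_wave \<beta> s (P + of_real x))"
  using phase_exp_set_integrable[OF \<beta> cP] by (simp add: phase_wave_eq(1))
 show "set_integrable lborel {0<..} (\<lambda>x. phase_wave \<beta> s (Q - of_real x))"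
  using phase_exp_set_integrable[OF \<beta> cQ] by (simp only: eq)
qed

lemma integrable_lineI:
 fixes g :: "real \<Rightarrow> complex"
 assumes "continuous_on UNIV g" "set_integrable lborel {0<..} g" "set_integrable lborel {0<..} (\<lambda>x. g (- x))"
 shows "integrable lborel g"
proof -
 have 1: "integrable lborel (\<lambda>x. indicator {0<..} x *\<^sub>R g x)"
  using assms(2) by (simp add: set_integrable_def)
 have "integrable lborel (\<lambda>x. indicator {0<..} x *\<^sub>R g (- x))"
  using assms(3) by (simp add: set_integrable_def)
 from lborel_integrable_real_affine[OF this, of "-1" 0]
 have 2: "integrable lborel (\<lambda>x. indicator {0<..} (- x) *\<^sub>R g x)" by simp
 show ?thesis
 proof (rule integrable_cong_AE_imp[OF Bochner_Integration.integrable_add[OF 1 2]])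
  show "AE x in lborel. indicator {0<..} x *\<^sub>R g x + indicator {0<..} (- x) *\<^sub>R g x = g x"
   using AE_lborel_singleton[of "0::real"] by eventually_elim (auto split: split_indicator)
  show "g \<in> borel_measurable lborel"
   using borel_measurable_continuous_onI[OF assms(1)] by simp
 qed
qed

text \<open>The case P = Q = \<i>b. A height b that suits both rays exists exactly when |Im s| <
  \<pi>/2.\<close>

lemma saddle_integral_line:
 assumes \<beta>: "0 < cos \<beta>" and b: "\<bar>Im s\<bar> < b" "b < pi - \<bar>Im s\<bar>"
 shows "saddle_integral \<beta> s = (LBINT x. phase_wave \<beta> s (\<i> * of_real b + of_real x))"
  and "integrable lborel (\<lambda>x. phase_wave \<beta> s (\<i> * of_real b + of_real x))"
proof -
 obtain F where F: "\<And>T. (F has_field_derivative phase_wave \<beta> s T) (at T)"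
  using phase_wave_primitive[of \<beta> s] by blast
 note * = saddle_integral_eq[OF \<beta> _ _ _ _ F, of "\<i> * of_real b" "\<i> * of_real b"]
 show int: "integrable lborel (\<lambda>x. phase_wave \<beta> s (\<i> * of_real b + of_real x))"
  by (rule integrable_lineI) (use b *(2,3) in \<open>auto intro!: continuous_intros\<close>)
 show "saddle_integral \<beta> s = (LBINT x. phase_wave \<beta> s (\<i> * of_real b + of_real x))"
  unfolding integral_line_split[OF int] using *(1) b by simp
qed

lemma phase_parts:
 "Re (phase \<beta> (Complex x y)) = sinh x * cos y / cos \<beta> - x"
 "Im (phase \<beta> (Complex x y)) = cosh x * sin y / cos \<beta> - y"
proof -
 have "sinh (Complex x y) = Complex (sinh x * cos y) (cosh x * sin y)"
  by (simp add: sinh_field_def cosh_field_def complex_eq_iff Re_exp Im_exp algebra_simps diff_divide_distrib add_divide_distrib)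
 then show "Re (phase \<beta> (Complex x y)) = sinh x * cos y / cos \<beta> - x"
  "Im (phase \<beta> (Complex x y)) = cosh x * sin y / cos \<beta> - y"
  by (simp_all add: phase_def Re_divide_of_real Im_divide_of_real)
qed

lemma mult_cos_less_sin:
 assumes "0 < y" "y < pi"
 shows "y * cos y < sin (y::real)"
proof -
 have "(\<lambda>y. sin y - y * cos y) 0 < (\<lambda>y. sin y - y * cos y) y"
 proof (rule DERIV_pos_imp_increasing_open[OF assms(1)])
  fix x assume "0 < x" "x < y"
  then show "\<exists>d. ((\<lambda>y. sin y - y * cos y) has_real_derivative d) (at x) \<and> 0 < d"
   using assms by (intro exI[of _ "x * sin x"]) (auto intro!: derivative_eq_intros mult_pos_pos sin_gt_zero simp: algebra_simps)
 qed (auto intro!: continuous_intros)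
 then show ?thesis by simp
qed

lemma mult_cos_less_sin':
 assumes "0 < y" "y \<le> \<beta>" "\<beta> < pi / 2"
 shows "y * cos \<beta> < sin y"
proof -
 have "cos \<beta> \<le> cos y" using assms by (intro cos_monotone_0_pi_le) auto
 then have "y * cos \<beta> \<le> y * cos y" using assms by (intro mult_left_mono) auto
 also have "\<dots> < sin y" using assms by (intro mult_cos_less_sin) auto
 finally show ?thesis .
qed

section \<open>Laplace transforms\<close>

lemma square_plus_square_nonzero:
 assumes "0 < Re G"
 shows "G\<^sup>2 + of_real (v\<^sup>2) \<noteq> (0 :: complex)"
proof
 assume "G\<^sup>2 + of_real (v\<^sup>2) = 0"
 then have "(G - \<i> * of_real v) * (G + \<i> * of_real v) = 0"
  by (simp add: algebra_simps power2_eq_square)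
 then have "G = \<i> * of_real v \<or> G = - \<i> * of_real v" by (auto simp: eq_neg_iff_add_eq_0)
 with assms show False by auto
qed

text \<open>For Re G > 0, the primitive of e^(-tG) cos(vt) that vanishes at infinity.\<close>

definition damped_cos_primitive :: "complex \<Rightarrow> real \<Rightarrow> real \<Rightarrow> complex" where
 "damped_cos_primitive G v t =
  exp (- (of_real t * G)) * (of_real (v * sin (v * t)) - G * of_real (cos (v * t))) / (G\<^sup>2 + of_real (v\<^sup>2))"

lemma damped_cos_primitive_deriv:
 assumes "0 < Re G"
 shows "(damped_cos_primitive G v has_vector_derivative exp (- (of_real t * G)) * of_real (cos (v * t))) (at t)"
proof -
 note nz = square_plus_square_nonzero[OF assms, of v]
 have 1: "((\<lambda>t. exp (- (of_real t * G))) has_vector_derivative (- G * exp (- (of_real t * G)))) (at t)"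
  by (rule has_vector_derivative_real_field) (auto intro!: derivative_eq_intros)
 have 2: "((\<lambda>t. of_real (v * sin (v * t)) - G * of_real (cos (v * t))) has_vector_derivative
  (of_real (v * (v * cos (v * t))) + G * of_real (v * sin (v * t)))) (at t)"
 proof -
  have "((\<lambda>t. v * sin (v * t)) has_vector_derivative v * (v * cos (v * t))) (at t)"
   "((\<lambda>t. cos (v * t)) has_vector_derivative - (v * sin (v * t))) (at t)"
   by (auto simp: has_real_derivative_iff_has_vector_derivative[symmetric] intro!: derivative_eq_intros)
  then show ?thesis
   by (auto intro!: derivative_eq_intros has_vector_derivative_of_real)
 qed
 have "((\<lambda>t. exp (- (of_real t * G)) * (of_real (v * sin (v * t)) - G * of_real (cos (v * t))) / (G\<^sup>2 + of_real (v\<^sup>2))) has_vector_derivative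
  (exp (- (of_real t * G)) * (of_real (v * (v * cos (v * t))) + G * of_real (v * sin (v * t)))
   + (- G * exp (- (of_real t * G))) * (of_real (v * sin (v * t)) - G * of_real (cos (v * t)))) / (G\<^sup>2 + of_real (v\<^sup>2))) (at t)"
  by (intro has_vector_derivative_divide has_vector_derivative_mult 1 2)
 moreover have "(exp (- (of_real t * G)) * (of_real (v * (v * cos (v * t))) + G * of_real (v * sin (v * t)))
   + (- G * exp (- (of_real t * G))) * (of_real (v * sin (v * t)) - G * of_real (cos (v * t)))) / (G\<^sup>2 + of_real (v\<^sup>2))
  = exp (- (of_real t * G)) * of_real (cos (v * t))"
 proof -
  have "exp (- (of_real t * G)) * (of_real (v * (v * cos (v * t))) + G * of_real (v * sin (v * t)))
   + (- G * exp (- (of_real t * G))) * (of_real (v * sin (v * t)) - G * of_real (cos (v * t)))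
   = exp (- (of_real t * G)) * of_real (cos (v * t)) * (G\<^sup>2 + of_real (v\<^sup>2))"
   by (simp add: algebra_simps power2_eq_square)
  then show ?thesis using nz by (simp only: nonzero_mult_div_cancel_right not_False_eq_True)
 qed
 ultimately show ?thesis
  by (simp only: damped_cos_primitive_def[abs_def])
qed

lemma norm_damped_cos_primitive_le:
 "norm (damped_cos_primitive G v t) \<le> ((\<bar>v\<bar> + norm G) / norm (G\<^sup>2 + of_real (v\<^sup>2))) * exp (- Re G * t)"
proof -
 have "norm (of_real (v * sin (v * t)) - G * of_real (cos (v * t))) \<le> \<bar>v\<bar> * 1 + norm G * 1"
  by (rule order_trans[OF norm_triangle_ineq4], unfold norm_mult norm_of_real abs_mult, intro add_mono mult_left_mono) auto
 then show ?thesis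
  by (simp add: damped_cos_primitive_def norm_mult norm_divide mult.commute divide_right_mono mult_left_mono)
qed

lemma damped_cos_primitive_0: "damped_cos_primitive G v 0 = - (G / (G\<^sup>2 + of_real (v\<^sup>2)))"
 by (simp add: damped_cos_primitive_def)

lemma laplace_cos:
 fixes G :: complex and v :: real
 assumes "0 < Re G"
 shows "set_integrable lborel {0<..} (\<lambda>t. exp (- (of_real t * G)) * of_real (cos (v * t)))"
  and "(LBINT t:{0<..}. exp (- (of_real t * G)) * of_real (cos (v * t))) = G / (G\<^sup>2 + of_real (v\<^sup>2))"
proof -
 show int: "set_integrable lborel {0<..} (\<lambda>t. exp (- (of_real t * G)) * of_real (cos (v * t)))"
 proof (rule set_integrable_exp_bound[OF _ assms, of _ 1])
  show "norm (exp (- (of_real t * G)) * of_real (cos (v * t))) \<le> 1 * exp (- Re G * t)" for t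
   using mult_left_mono[OF abs_cos_le_one[of "v * t"], of "exp (- Re G * t)"]
   by (simp add: norm_mult mult.commute)
 qed (auto intro!: continuous_intros)
 have "(LBINT t:{0<..}. exp (- (of_real t * G)) * of_real (cos (v * t))) = 0 - damped_cos_primitive G v 0"
 proof (rule half_line_FTC[OF damped_cos_primitive_deriv[OF assms] _ int])
  show "(damped_cos_primitive G v \<longlongrightarrow> 0) at_top"
   by (rule Lim_null_comparison[OF _ tendsto_exp_decay[OF assms]])
    (rule always_eventually, rule allI, rule norm_damped_cos_primitive_le)
 qed (auto intro!: continuous_intros)
 then show "(LBINT t:{0<..}. exp (- (of_real t * G)) * of_real (cos (v * t))) = G / (G\<^sup>2 + of_real (v\<^sup>2))"
  by (simp add: damped_cos_primitive_0)
qed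

lemma exp_mult_power_le:
 assumes "0 < (c::real)"
 obtains D where "\<And>t. 0 \<le> t \<Longrightarrow> t ^ n * exp (- c * t) \<le> D * exp (- (c / 2) * t)"
proof
 fix t :: real assume "0 \<le> t"
 define z where "z = c / 2"
 have z: "0 < z" using assms by (simp add: z_def)
 \<comment> \<open>A single term of the exponential series bounds the power; half of the rate c is
   spent on it.\<close>
 have "(\<Sum>i\<in>{n}. (z * t) ^ i /\<^sub>R fact i) \<le> exp (z * t)"
  unfolding exp_def using \<open>0 \<le> t\<close> z by (intro sum_le_suminf summable_exp_generic) auto
 then have "z ^ n * t ^ n / fact n \<le> exp (z * t)"
  by (simp add: power_mult_distrib divide_inverse_commute)
 then have "t ^ n \<le> (fact n / z ^ n) * exp (z * t)"
  using z by (simp add: field_simps)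
 then have "t ^ n * exp (- c * t) \<le> (fact n / z ^ n) * exp (z * t) * exp (- c * t)"
  by (intro mult_right_mono) auto
 also have "\<dots> = (fact n / z ^ n) * exp (- (c / 2) * t)"
  by (simp only: mult.assoc exp_add[symmetric]) (simp add: z_def algebra_simps)
 finally show "t ^ n * exp (- c * t) \<le> (fact n / z ^ n) * exp (- (c / 2) * t)" .
qed

lemma laplace_power:
 fixes G :: complex
 assumes "0 < Re G"
 shows "set_integrable lborel {0<..} (\<lambda>t. of_real (t ^ n) * exp (- (of_real t * G)))"
  and "(LBINT t:{0<..}. of_real (t ^ n) * exp (- (of_real t * G))) = fact n / G ^ Suc n"
proof -
 have G0: "G \<noteq> 0" using assms by auto
 show int: "set_integrable lborel {0<..} (\<lambda>t. of_real (t ^ n) * exp (- (of_real t * G)))" for n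
 proof -
  obtain D where D: "\<And>t. 0 \<le> t \<Longrightarrow> t ^ n * exp (- Re G * t) \<le> D * exp (- (Re G / 2) * t)"
   using exp_mult_power_le[OF assms, of n] by blast
  show ?thesis
  proof (rule set_integrable_exp_bound[where c="Re G / 2" and D=D])
   show "norm (of_real (t ^ n) * exp (- (of_real t * G))) \<le> D * exp (- (Re G / 2) * t)" if "0 < t" for t
    using D[of t] that by (simp add: norm_mult norm_power mult.commute)
  qed (use assms in \<open>auto intro!: continuous_intros\<close>)
 qed
 show "(LBINT t:{0<..}. of_real (t ^ n) * exp (- (of_real t * G))) = fact n / G ^ Suc n"
 proof (induction n)
  case 0
  show ?case using laplace_cos(2)[OF assms, of 0] G0 by (simp add: power2_eq_square field_simps)
 next
  case (Suc n)
  \<comment> \<open>Integration by parts in disguise: ?F is a primitive of the integrand for n + 1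
    minus (n + 1)/G times the integrand for n.\<close>
  let ?F = "\<lambda>t. - (of_real t ^ Suc n * exp (- (of_real t * G)) / G)"
  have "(LBINT t:{0<..}. of_real (t ^ Suc n) * exp (- (of_real t * G)) - (of_nat (Suc n) / G) * (of_real (t ^ n) * exp (- (of_real t * G)))) = 0 - ?F 0"
  proof (rule half_line_FTC)
   fix t :: real
   show "(?F has_vector_derivative of_real (t ^ Suc n) * exp (- (of_real t * G)) - (of_nat (Suc n) / G) * (of_real (t ^ n) * exp (- (of_real t * G)))) (at t)"
   proof (rule has_vector_derivative_real_field)
    have 1: "((\<lambda>z::complex. z ^ Suc n) has_field_derivative of_nat (Suc n) * of_real t ^ n) (at (of_real t))"
     using DERIV_power_Suc[OF DERIV_ident, where n=n and x="of_real t :: complex" and s=UNIV] by simp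
    have 2: "((\<lambda>z. exp (- (z * G))) has_field_derivative - G * exp (- (of_real t * G))) (at (of_real t))"
     by (auto intro!: derivative_eq_intros)
    show "((\<lambda>z. - (z ^ Suc n * exp (- (z * G)) / G)) has_field_derivative of_real (t ^ Suc n) * exp (- (of_real t * G)) - (of_nat (Suc n) / G) * (of_real (t ^ n) * exp (- (of_real t * G)))) (at (of_real t))"
     by (rule DERIV_cong[OF DERIV_minus[OF DERIV_cdivide[OF DERIV_mult[OF 1 2]]]])
      (use G0 in \<open>simp add: field_simps\<close>)
   qed
  next
   show "set_integrable lborel {0<..} (\<lambda>t. of_real (t ^ Suc n) * exp (- (of_real t * G)) - (of_nat (Suc n) / G) * (of_real (t ^ n) * exp (- (of_real t * G))))"
    by (intro set_integral_diff set_integrable_mult_right int)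
   obtain D where D: "\<And>t. 0 \<le> t \<Longrightarrow> t ^ Suc n * exp (- Re G * t) \<le> D * exp (- (Re G / 2) * t)"
    using exp_mult_power_le[OF assms, of "Suc n"] by blast
   show "(?F \<longlongrightarrow> 0) at_top"
   proof (rule Lim_null_comparison[OF _ tendsto_exp_decay[where c="Re G / 2"]])
    show "\<forall>\<^sub>F t in at_top. norm (?F t) \<le> (D / norm G) * exp (- (Re G / 2) * t)"
     using eventually_ge_at_top[of 0]
    proof eventually_elim
     case (elim t)
     then show ?case using D[OF elim]
      by (simp add: norm_mult norm_divide norm_power mult.commute divide_right_mono)
    qed
   qed (use assms in auto)
  qed (use G0 in \<open>auto intro!: continuous_intros\<close>)
  then have "(LBINT t:{0<..}. of_real (t ^ Suc n) * exp (- (of_real t * G)))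
   = (of_nat (Suc n) / G) * (LBINT t:{0<..}. of_real (t ^ n) * exp (- (of_real t * G)))"
   by (subst (asm) set_integral_diff(2)[OF int set_integrable_mult_right[OF int]]) simp
  also have "\<dots> = fact (Suc n) / G ^ Suc (Suc n)"
   by (simp only: Suc.IH) (simp add: field_simps)
  finally show ?case .
 qed
qed

lemma laplace_exp_real:
 assumes "0 < (c::real)"
 shows "(LBINT t:{0<..}. exp (- c * t)) = 1 / c"
proof -
 have "complex_of_real (LBINT t:{0<..}. exp (- c * t)) = (LBINT t:{0<..}. complex_of_real (exp (- c * t)))"
  by (simp add: set_integral_complex_of_real)
 also have "\<dots> = (LBINT t:{0<..}. of_real (t ^ 0) * exp (- (of_real t * of_real c)))"
  by (simp add: exp_of_real[symmetric] mult.commute)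
 also have "\<dots> = of_real (1 / c)"
  using laplace_power(2)[of "of_real c" 0] assms by simp
 finally show ?thesis by (simp only: of_real_eq_iff)
qed

section \<open>The line Im T = \<beta>/2 and Fubini's theorem for H\<close>

locale phase_setup =
 fixes \<beta> :: real
 assumes \<beta>: "0 < \<beta>" "\<beta> < pi / 2"
begin

lemma cos_pos: "0 < cos \<beta>" using \<beta> by (intro cos_gt_zero_pi) auto

definition "\<xi> = tan \<beta> - \<beta>"

text \<open>This height lies strictly between the real axis, where the residues will sit, and the
  height \<beta> of the saddle, up to which the phase takes no real value off the axis. On the line
  the exponential is exp(-t G) with Re G > 0.\<close>

definition b0 :: real where "b0 = \<beta> / 2"

definition G :: "real \<Rightarrow> complex" where "G x = - \<i> * phase \<beta> (\<i> * of_real b0 + of_real x)"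

definition c0 :: real where "c0 = sin b0 / cos \<beta> - b0"

lemma b0: "0 < b0" "b0 < \<beta>" using \<beta> by (auto simp: b0_def)

lemma c0_pos: "0 < c0"
 using mult_cos_less_sin'[of b0 \<beta>] b0 \<beta> cos_pos by (simp add: c0_def field_simps)

lemma Re_G: "Re (G x) = cosh x * sin b0 / cos \<beta> - b0"
 and Im_G: "Im (G x) = - (sinh x * cos b0 / cos \<beta> - x)"
 using phase_parts[of \<beta> x b0] by (simp_all add: G_def Complex_eq add.commute)

lemma Re_G_ge: "c0 * cosh x \<le> Re (G x)"
proof -
 have "b0 * 1 \<le> b0 * cosh x" using b0 cosh_real_ge_1[of x] by (intro mult_left_mono) auto
 then show ?thesis by (simp add: Re_G c0_def algebra_simps)
qed

lemma Re_G_pos: "0 < Re (G x)"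
 using Re_G_ge[of x] c0_pos cosh_real_pos[of x] by (meson less_le_trans mult_pos_pos)

lemma cosh_ge_exp: "exp \<bar>x\<bar> / 2 \<le> cosh (x::real)"
 by (simp add: cosh_field_def abs_if)

lemma continuous_G [continuous_intros]: "continuous_on A g \<Longrightarrow> continuous_on A (\<lambda>x. G (g x))"
 unfolding G_def by (auto intro!: continuous_intros)

lemma G_measurable [measurable]: "G \<in> borel_measurable borel"
 by (intro borel_measurable_continuous_onI continuous_intros)

text \<open>The saddle point integral H for positive real t, taken along the line Im T =
  \<open>b0\<close>.\<close>

definition W :: "real \<Rightarrow> complex" where "W t = (LBINT y. exp (- (of_real t * G y)))"

lemma phase_wave_line: "phase_wave \<beta> (of_real s) (\<i> * of_real b0 + of_real x) = exp (- (of_real (exp s) * G x))"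
 by (simp add: phase_wave_def G_def exp_of_real mult_ac)

lemma saddle_integral_real: "saddle_integral \<beta> (of_real s) = W (exp s)"
 using saddle_integral_line[OF cos_pos, of "of_real s" b0] b0 \<beta>
 by (simp add: W_def phase_wave_line)

text \<open>Half of Re (G y) \<ge> c0 cosh y absorbs the growth e^(c0 t/2) allowed to m. The other
  half is at least (c0/4) e^|y|, and its Laplace integral in t is of order e^(-|y|), which is
  integrable in y.\<close>

lemma fubini_W:
 fixes m :: "real \<Rightarrow> complex"
 assumes m: "continuous_on UNIV m" "\<And>t. 0 < t \<Longrightarrow> norm (m t) \<le> D * exp (c0 / 2 * t)" 
 shows "set_integrable lborel {0<..} (\<lambda>t. m t * W t)"
  and "(LBINT t:{0<..}. m t * W t) = (LBINT y. LBINT t:{0<..}. m t * exp (- (of_real t * G y)))"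
  and "integrable lborel (\<lambda>y. LBINT t:{0<..}. m t * exp (- (of_real t * G y)))"
proof -
 define k where "k y t = indicator {0<..} t *\<^sub>R (m t * exp (- (of_real t * G y)))" for y t
 have [measurable]: "m \<in> borel_measurable borel" by (rule borel_measurable_continuous_onI[OF m(1)])
 have meas: "case_prod k \<in> borel_measurable (lborel \<Otimes>\<^sub>M lborel)"
  unfolding k_def by measurable
 have bound: "norm (k y t) \<le> indicator {0<..} t *\<^sub>R (D * exp (- (c0 / 4 * exp \<bar>y\<bar>) * t))" for y t
 proof (cases "0 < t")
  case True
  have "c0 / 2 * t - t * Re (G y) \<le> - (c0 / 4 * exp \<bar>y\<bar>) * t"
  proof -
   have "c0 / 2 + c0 / 4 * exp \<bar>y\<bar> \<le> c0 * cosh y"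
    using mult_left_mono[of "1 / 2 + exp \<bar>y\<bar> / 4" "cosh y" c0] cosh_ge_exp[of y] cosh_real_ge_1[of y] c0_pos
    by (simp add: algebra_simps)
   then have "(c0 / 2 + c0 / 4 * exp \<bar>y\<bar>) * t \<le> Re (G y) * t"
    using Re_G_ge[of y] True by (intro mult_right_mono) auto
   then show ?thesis by (simp add: algebra_simps)
  qed
  moreover have "norm (k y t) \<le> D * exp (c0 / 2 * t) * exp (- (t * Re (G y)))"
   using m(2)[OF True] True by (simp add: k_def norm_mult mult_right_mono)
  moreover have "0 \<le> D" using order_trans[OF norm_ge_zero m(2)[OF True]] by (simp add: zero_le_mult_iff)
  moreover have "exp (c0 / 2 * t) * exp (- (t * Re (G y))) = exp (c0 / 2 * t - t * Re (G y))"
   by (simp add: exp_add[symmetric])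
  ultimately have "norm (k y t) \<le> D * exp (c0 / 2 * t - t * Re (G y))"
   and "D * exp (c0 / 2 * t - t * Re (G y)) \<le> D * exp (- (c0 / 4 * exp \<bar>y\<bar>) * t)"
   by (simp_all only: mult.assoc exp_le_cancel_iff mult_left_mono)
  then have "norm (k y t) \<le> D * exp (- (c0 / 4 * exp \<bar>y\<bar>) * t)" by (rule order_trans)
  then show ?thesis using True by simp
 qed (simp add: k_def)
 have int_t: "integrable lborel (\<lambda>t. indicator {0<..} t *\<^sub>R (D * exp (- (c0 / 4 * exp \<bar>y\<bar>) * t)))" for y
 proof -
  have "integrable lborel (\<lambda>t. indicator {0<..} t *\<^sub>R exp (- (c0 / 4 * exp \<bar>y\<bar>) * t))"
   using set_integrable_exp_half_line[of "c0 / 4 * exp \<bar>y\<bar>"] c0_pos by (simp only: set_integrable_def) simp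
  then show ?thesis
   unfolding real_scaleR_def mult.left_commute[of _ D] by (rule integrable_mult_right)
 qed
 have int_k: "integrable lborel (k y)" for y
 proof (rule Bochner_Integration.integrable_bound[OF int_t])
  show "k y \<in> borel_measurable lborel" unfolding k_def by measurable
  show "AE t in lborel. norm (k y t) \<le> norm (indicator {0<..} t *\<^sub>R (D * exp (- (c0 / 4 * exp \<bar>y\<bar>) * t)))"
   unfolding real_norm_def by (intro AE_I2 order_trans[OF bound abs_ge_self])
 qed
 have val: "(LBINT t. norm (k y t)) \<le> (4 * D / c0) * exp (- 1 * \<bar>y\<bar>)" for y
 proof -
  have "(LBINT t. norm (k y t)) \<le> (LBINT t. indicator {0<..} t *\<^sub>R (D * exp (- (c0 / 4 * exp \<bar>y\<bar>) * t)))"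
   by (rule integral_mono[OF integrable_norm[OF int_k] int_t bound])
  also have "\<dots> = (4 * D / c0) * exp (- 1 * \<bar>y\<bar>)"
  proof -
   have "(LBINT t:{0<..}. exp (- (c0 / 4 * exp \<bar>y\<bar>) * t)) = 1 / (c0 / 4 * exp \<bar>y\<bar>)"
    by (rule laplace_exp_real) (use c0_pos in auto)
   also have "\<dots> = 4 / c0 * exp (- 1 * \<bar>y\<bar>)"
    using c0_pos by (simp add: exp_minus field_simps)
   finally have "(LBINT t. indicator {0<..} t * exp (- (c0 / 4 * exp \<bar>y\<bar>) * t)) = 4 / c0 * exp (- 1 * \<bar>y\<bar>)"
    by (simp only: set_lebesgue_integral_def real_scaleR_def)
   then show ?thesis
    unfolding real_scaleR_def mult.left_commute[of _ D] integral_mult_right_zero by (simp only:) simp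
  qed
  finally show ?thesis .
 qed
 have int2: "integrable (lborel \<Otimes>\<^sub>M lborel) (case_prod k)"
 proof (rule lborel_pair.Fubini_integrable[OF meas])
  show "integrable lborel (\<lambda>y. LBINT t. norm (case_prod k (y, t)))"
  proof (rule Bochner_Integration.integrable_bound)
   show "integrable lborel (\<lambda>y::real. (4 * D / c0) * exp (- 1 * \<bar>y\<bar>))"
    using integrable_exp_abs[of 1] by simp
   show "AE y in lborel. norm (LBINT t. norm (case_prod k (y, t))) \<le> norm ((4 * D / c0) * exp (- 1 * \<bar>y\<bar>))"
   proof (rule AE_I2)
    fix y
    have "0 \<le> (LBINT t. norm (k y t))" by (rule integral_nonneg_AE) auto
    then show "norm (LBINT t. norm (case_prod k (y, t))) \<le> norm ((4 * D / c0) * exp (- 1 * \<bar>y\<bar>))"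
     using order_trans[OF val[of y] abs_ge_self] by simp
   qed
   have "(\<lambda>(y, t). norm (k y t)) \<in> borel_measurable (lborel \<Otimes>\<^sub>M lborel)"
    using measurable_compose[OF meas borel_measurable_norm] by (simp add: split_def)
   from lborel.borel_measurable_lebesgue_integral[OF this]
   show "(\<lambda>y. LBINT t. norm (case_prod k (y, t))) \<in> borel_measurable lborel"
    by simp
  qed
  show "AE y in lborel. integrable lborel (\<lambda>t. case_prod k (y, t))"
   using int_k by simp
 qed
 have eq: "(LBINT y. k y t) = indicator {0<..} t *\<^sub>R (m t * W t)" for t
  by (simp add: k_def W_def)
 show "set_integrable lborel {0<..} (\<lambda>t. m t * W t)"
  using lborel_pair.integrable_snd[OF int2] by (simp add: eq set_integrable_def)
 show "(LBINT t:{0<..}. m t * W t) = (LBINT y. LBINT t:{0<..}. m t * exp (- (of_real t * G y)))"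
  using lborel_pair.Fubini_integral[OF int2] by (simp add: eq) (simp add: k_def set_lebesgue_integral_def)
 show "integrable lborel (\<lambda>y. LBINT t:{0<..}. m t * exp (- (of_real t * G y)))"
  using lborel_pair.integrable_fst[OF int2] by (simp add: k_def set_lebesgue_integral_def)
qed

end

section \<open>Residues in the strip |Im T| < \<beta>\<close>

lemma exp_dominates_linear:
 assumes "0 \<le> (K::real)" "16 * K + 16 \<le> x"
 shows "exp x / 8 \<le> (exp x - exp (- x)) / 2 - x - K"
proof -
 have x0: "0 \<le> x" using assms by linarith
 have "x\<^sup>2 / 2 \<le> exp x" using exp_lower_Taylor_quadratic[OF x0] x0 by linarith
 moreover have "x * (16 * K + 16) \<le> x * x" using assms x0 by (intro mult_left_mono) auto
 moreover have "K * 1 \<le> K * x" using assms by (intro mult_left_mono) auto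
 moreover have "x * (16 * K + 16) = 16 * (K * x) + 16 * x" by (simp add: algebra_simps)
 ultimately have "8 * K + 8 * x \<le> exp x" unfolding power2_eq_square by linarith
 moreover have "exp (- x) \<le> 1" using x0 by simp
 moreover have "16 \<le> x" using assms by linarith
 ultimately have "3 * exp x \<ge> 4 * exp (- x) + 8 * x + 8 * K" using assms(1) by linarith
 then show ?thesis by (simp add: diff_divide_distrib)
qed

lemma norm_sinh_ge: "(exp \<bar>Re T\<bar> - exp (- \<bar>Re T\<bar>)) / 2 \<le> norm (sinh T)"
proof -
 have "\<bar>norm (exp T) - norm (exp (- T))\<bar> \<le> norm (exp T - exp (- T))"
  by (rule norm_triangle_ineq3)
 then have "\<bar>exp (Re T) - exp (- Re T)\<bar> \<le> norm (exp T - exp (- T))" by simp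
 then have "exp \<bar>Re T\<bar> - exp (- \<bar>Re T\<bar>) \<le> norm (exp T - exp (- T))"
  by (cases "0 \<le> Re T") (auto simp: abs_if)
 then show ?thesis by (simp add: sinh_field_def norm_divide)
qed

text \<open>Serves to replace the punctured expressions inside \<open>a_coeff\<close> and
  \<open>U_coeff\<close> by holomorphic functions on a whole neighbourhood of 0, as needed before
  taking derivatives there.\<close>

lemma remove_sings_eq_analytic:
 assumes "open A" "g holomorphic_on A" "\<And>z. z \<in> A - {z0} \<Longrightarrow> f z = g z" "z \<in> A"
 shows "remove_sings f z = g z"
proof -
 have "eventually (\<lambda>w. w \<in> A - {z0} - {z}) (at z)"
 proof -
  have "eventually (\<lambda>w. w \<in> A) (at z)" using assms by (intro eventually_at_in_open') auto
  moreover have "eventually (\<lambda>w. w \<noteq> z0) (at z)" by (rule eventually_neq_at_within)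
  moreover have "eventually (\<lambda>w. w \<noteq> z) (at z)" by (rule eventually_neq_at_within)
  ultimately show ?thesis by eventually_elim auto
 qed
 then have "eventually (\<lambda>w. f w = g w) (at z)"
  by eventually_elim (use assms(3) in auto)
 then have "remove_sings f z = remove_sings g z" by (rule remove_sings_cong) simp
 also have "g analytic_on {z}" using assms(1,2,4) analytic_on_holomorphic by (metis empty_subsetI insert_subset)
 then have "remove_sings g z = g z" by simp
 finally show ?thesis .
qed

lemma holomorphic_factor_zero:
 assumes "f holomorphic_on UNIV" "f (0::complex) = 0"
 obtains q where "q holomorphic_on UNIV" "\<And>z. f z = z * q z" "q 0 = deriv f 0"
proof
 let ?q = "\<lambda>z. if z = 0 then deriv f 0 else (f z - f 0) / (z - 0)"
 show "?q holomorphic_on UNIV" using pole_lemma[OF assms(1), of 0] by simp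
 show "f z = z * ?q z" for z using assms(2) by simp
qed simp

context phase_setup
begin

definition rphase :: "real \<Rightarrow> real" where "rphase x = sinh x / cos \<beta> - x"

lemma phase_of_real: "phase \<beta> (of_real x) = of_real (rphase x)"
 by (simp add: phase_def rphase_def sinh_of_real_complex)

lemma cos_less_1: "cos \<beta> < 1"
 using cos_monotone_0_pi[of 0 \<beta>] \<beta> by simp

lemma rphase_deriv: "(rphase has_real_derivative (cosh x / cos \<beta> - 1)) (at x)"
 unfolding rphase_def using cos_pos by (auto intro!: derivative_eq_intros)

lemma rphase_deriv_pos: "0 < cosh x / cos \<beta> - 1"
proof -
 have "1 < 1 / cos \<beta>" using cos_less_1 cos_pos by simp
 also have "\<dots> \<le> cosh x / cos \<beta>" using cosh_real_ge_1[of x] cos_pos by (intro divide_right_mono) auto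
 finally show ?thesis by simp
qed

lemma rphase_less: "x < y \<Longrightarrow> rphase x < rphase y"
 by (rule DERIV_pos_imp_increasing) (use rphase_deriv rphase_deriv_pos in blast)+

text \<open>For 0 < y < \<beta> already sin y / cos \<beta> exceeds y, and the factor cosh x \<ge> 1
  only helps; oddness covers negative y.\<close>

lemma Im_phase_nz:
 assumes "0 < \<bar>y\<bar>" "\<bar>y\<bar> < \<beta>"
 shows "Im (phase \<beta> (Complex x y)) \<noteq> 0"
proof -
 have *: "0 < Im (phase \<beta> (Complex x y))" if "0 < y" "y < \<beta>" for x y
 proof -
  have "y * cos \<beta> < sin y" using mult_cos_less_sin'[of y \<beta>] that \<beta> by auto
  then have "y < 1 * (sin y / cos \<beta>)" using cos_pos by (simp add: field_simps)
  also have "\<dots> \<le> cosh x * (sin y / cos \<beta>)"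
   using cosh_real_ge_1[of x] that \<beta> cos_pos
   by (intro mult_right_mono divide_nonneg_pos sin_ge_zero) auto
  finally show ?thesis by (simp add: phase_parts)
 qed
 show ?thesis
  using *[of y x] *[of "- y" x] assms by (cases "0 < y") (auto simp: phase_parts)
qed

text \<open>Off the real axis the phase is not real, and on it \<open>rphase\<close> is strictly
  increasing. So the reciprocal of phase minus a real value has a single pole in the strip.\<close>

lemma phase_eq_rphase_iff:
 assumes "\<bar>Im T\<bar> < \<beta>"
 shows "phase \<beta> T = of_real (rphase x0) \<longleftrightarrow> T = of_real x0"
proof
 assume eq: "phase \<beta> T = of_real (rphase x0)"
 have T: "T = Complex (Re T) (Im T)" by simp
 have "Im (phase \<beta> (Complex (Re T) (Im T))) = 0" using eq by simp
 then have "Im T = 0" using Im_phase_nz[of "Im T" "Re T"] assms by force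
 then have "T = of_real (Re T)" by (simp add: complex_eq_iff)
 with eq have "rphase (Re T) = rphase x0" by (metis phase_of_real of_real_eq_iff)
 then have "Re T = x0" using rphase_less[of "Re T" x0] rphase_less[of x0 "Re T"] by linarith
 with \<open>T = of_real (Re T)\<close> show "T = of_real x0" by simp
qed (simp add: phase_of_real)

lemma phase_line_upper: "phase \<beta> (\<i> * of_real b0 + of_real x) = \<i> * G x"
 by (simp add: G_def)

lemma phase_line_lower: "phase \<beta> (\<i> * of_real (- b0) + of_real x) = - \<i> * G (- x)"
 using phase_minus[of \<beta> "\<i> * of_real b0 + of_real (- x)"] by (simp add: G_def)

lemma norm_phase_line_ge:
 assumes "\<bar>Im T\<bar> = b0"
 shows "c0 / 2 * exp \<bar>Re T\<bar> \<le> norm (phase \<beta> T - of_real v)"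
proof -
 have "c0 / 2 * exp \<bar>Re T\<bar> \<le> c0 * cosh (Re T)"
  using mult_left_mono[OF cosh_ge_exp[of "Re T"], of c0] c0_pos by simp
 also have "\<dots> \<le> \<bar>Im (phase \<beta> T)\<bar>"
 proof (cases "Im T = b0")
  case True
  then have T: "T = \<i> * of_real b0 + of_real (Re T)" by (simp add: complex_eq_iff)
  have "Im (phase \<beta> T) = Re (G (Re T))" by (subst T) (simp only: phase_line_upper, simp)
  then show ?thesis using Re_G_ge[of "Re T"] by simp
 next
  case False
  then have T: "T = \<i> * of_real (- b0) + of_real (Re T)" using assms by (auto simp: complex_eq_iff abs_if split: if_splits)
  have "Im (phase \<beta> T) = - Re (G (- Re T))" by (subst T) (simp only: phase_line_lower, simp)
  then show ?thesis using Re_G_ge[of "- Re T"] by simp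
 qed
 also have "\<dots> \<le> norm (phase \<beta> T - of_real v)"
  using abs_Im_le_cmod[of "phase \<beta> T - of_real v"] by simp
 finally show ?thesis .
qed

lemma norm_phase_far_ge:
 assumes "\<bar>Im T\<bar> \<le> b0" "16 * (b0 + \<bar>v\<bar> + 1) \<le> \<bar>Re T\<bar>"
 shows "exp \<bar>Re T\<bar> / 8 \<le> norm (phase \<beta> T - of_real v)"
proof -
 have "exp \<bar>Re T\<bar> / 8 \<le> (exp \<bar>Re T\<bar> - exp (- \<bar>Re T\<bar>)) / 2 - \<bar>Re T\<bar> - (b0 + \<bar>v\<bar>)"
  by (rule exp_dominates_linear) (use assms b0 in auto)
 also have "\<dots> \<le> norm (sinh T) / cos \<beta> - norm T - \<bar>v\<bar>"
 proof -
  have "norm (sinh T) * 1 \<le> norm (sinh T) * (1 / cos \<beta>)"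
   using cos_less_1 cos_pos by (intro mult_left_mono) (auto simp: field_simps)
  moreover have "norm T \<le> \<bar>Re T\<bar> + b0" using cmod_le[of T] assms by linarith
  ultimately show ?thesis using norm_sinh_ge[of T] by (simp add: diff_divide_distrib)
 qed
 also have "\<dots> \<le> norm (phase \<beta> T - of_real v)"
 proof -
  have "norm (sinh T / of_real (cos \<beta>)) \<le> norm (phase \<beta> T - of_real v) + norm (T + of_real v)"
   using norm_triangle_ineq[of "phase \<beta> T - of_real v" "T + of_real v"] by (simp add: phase_def)
  moreover have "norm (T + of_real v) \<le> norm T + \<bar>v\<bar>" using norm_triangle_ineq[of T "of_real v"] by simp
  ultimately show ?thesis using cos_pos by (simp add: norm_divide)
 qed
 finally show ?thesis .
qed

text \<open>Used twice: n = 0 with general x0 gives the cosine transform of \<open>W\<close>, and x0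
  = 0 with even n gives the coefficients a_n.\<close>

lemma strip_phase_residue:
 defines "k \<equiv> \<lambda>x0 n T. 1 / (phase \<beta> T - of_real (rphase x0)) ^ Suc n"
 shows "(LBINT x. k x0 n (\<i> * of_real (- b0) + of_real x)) - (LBINT x. k x0 n (\<i> * of_real b0 + of_real x))
  = 2 * pi * \<i> * residue (k x0 n) (of_real x0)"
  and "integrable lborel (\<lambda>x. k x0 n (\<i> * of_real b0 + of_real x))"
  and "integrable lborel (\<lambda>x. k x0 n (\<i> * of_real (- b0) + of_real x))"
proof -
 define v where "v = rphase x0"
 define S where "S = {T. \<bar>Im T\<bar> < \<beta>}"
 have S: "S = {T. Im T < \<beta>} \<inter> {T. Im T > - \<beta>}" by (auto simp: S_def)
 \<comment> \<open>2/c0 belongs to the lower bound of the phase on the two lines, 8 to the one far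
   out inside the strip.\<close>
 define D where "D = max ((2 / c0) ^ Suc n) (8 ^ Suc n)"
 have pw: "norm (k x0 n T) \<le> D * exp (- 1 * \<bar>Re T\<bar>)"
  if "r * exp \<bar>Re T\<bar> \<le> norm (phase \<beta> T - of_real v)" "0 < r" "(1 / r) ^ Suc n \<le> D" for r T
 proof -
  have "norm (k x0 n T) = (1 / norm (phase \<beta> T - of_real v)) ^ Suc n"
   by (simp add: k_def v_def norm_divide norm_power power_divide norm_mult)
  also have "\<dots> \<le> (1 / (r * exp \<bar>Re T\<bar>)) ^ Suc n"
  proof -
   have "0 < r * exp \<bar>Re T\<bar>" using that by simp
   moreover from this that(1) have "0 < norm (phase \<beta> T - of_real v)" by linarith
   ultimately show ?thesis using that(1)
    by (intro power_mono divide_left_mono mult_pos_pos[of "norm (phase \<beta> T - of_real v)"]) simp_all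
  qed
  also have "\<dots> = (1 / r) ^ Suc n * exp (- \<bar>Re T\<bar>) ^ Suc n"
   by (simp only: power_mult_distrib[symmetric] exp_minus divide_inverse inverse_mult_distrib mult_1_left)
  also have "\<dots> \<le> D * exp (- \<bar>Re T\<bar>)"
  proof (rule mult_mono)
   have "exp (- \<bar>Re T\<bar>) ^ Suc n \<le> exp (- \<bar>Re T\<bar>) ^ 1" by (rule power_decreasing) auto
   then show "exp (- \<bar>Re T\<bar>) ^ Suc n \<le> exp (- \<bar>Re T\<bar>)" by simp
   show "0 \<le> D" by (simp add: D_def le_max_iff_disj)
  qed (use that in auto)
  finally show ?thesis by simp
 qed
 have line: "norm (k x0 n T) \<le> D * exp (- 1 * \<bar>Re T\<bar>)" if "\<bar>Im T\<bar> = b0" for T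
  by (rule pw[where r="c0 / 2"]) (use norm_phase_line_ge[OF that] c0_pos in \<open>auto simp: D_def\<close>)
 have nz: "phase \<beta> T - of_real v \<noteq> 0" if "T \<in> S - {of_real x0}" for T
  using phase_eq_rphase_iff[of T x0] that by (auto simp: S_def v_def)
 show "(LBINT x. k x0 n (\<i> * of_real (- b0) + of_real x)) - (LBINT x. k x0 n (\<i> * of_real b0 + of_real x))
  = 2 * pi * \<i> * residue (k x0 n) (of_real x0)"
 proof (rule strip_residue[where S=S and c=1 and D=D and X="16 * (b0 + \<bar>v\<bar> + 1)"])
  show "open S" unfolding S by (intro open_Int open_halfspace_Im_lt open_halfspace_Im_gt)
  show "convex S" unfolding S by (intro convex_Int convex_halfspace_Im_lt convex_halfspace_Im_gt)
  show "k x0 n holomorphic_on S - {of_real x0}"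
   unfolding k_def using nz by (intro holomorphic_intros) (auto simp: v_def)
  show "norm (k x0 n T) \<le> D * exp (- 1 * \<bar>Re T\<bar>)" if "- b0 \<le> Im T" "Im T \<le> b0" "16 * (b0 + \<bar>v\<bar> + 1) \<le> \<bar>Re T\<bar>" for T
   by (rule pw[where r="1 / 8"]) (use norm_phase_far_ge[of T v] that in \<open>auto simp: D_def\<close>)
 qed (use b0 line in \<open>auto simp: S_def\<close>)
 have "integrable lborel (\<lambda>x. k x0 n (\<i> * of_real y + of_real x))" if "\<bar>y\<bar> = b0" for y
 proof (rule integrable_exp_decay[where c=1 and D=D])
  show "norm (k x0 n (\<i> * of_real y + of_real x)) \<le> D * exp (- 1 * \<bar>x\<bar>)" for x
   using line[of "\<i> * of_real y + of_real x"] that by simp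
  have "phase \<beta> (\<i> * of_real y + of_real x) - of_real v \<noteq> 0" for x
   by (rule nz) (use that b0 in \<open>auto simp: S_def complex_eq_iff\<close>)
  then show "continuous_on UNIV (\<lambda>x. k x0 n (\<i> * of_real y + of_real x))"
   unfolding k_def v_def by (intro continuous_intros) auto
 qed simp
 from this[of b0] this[of "- b0"] b0
 show "integrable lborel (\<lambda>x. k x0 n (\<i> * of_real b0 + of_real x))" "integrable lborel (\<lambda>x. k x0 n (\<i> * of_real (- b0) + of_real x))"
  by auto
qed

text \<open>The upper line carries 1/(\<i>G - v) and the lower one, reflected by oddness of the
  phase, 1/(-\<i>G - v). Their difference is 2\<i> G/(G^2 + v^2), while the simple pole contributes
  the reciprocal of the derivative of the phase at x0.\<close>

lemma integral_lorentz_G: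
 "(LBINT y. G y / ((G y)\<^sup>2 + of_real ((rphase x0)\<^sup>2))) = of_real (pi / (cosh x0 / cos \<beta> - 1))"
proof -
 define v where "v = rphase x0"
 have nz: "\<i> * G y - of_real v \<noteq> 0" "- \<i> * G y - of_real v \<noteq> 0" for y
  using Re_G_pos[of y] by (auto simp: complex_eq_iff)
 note sp = strip_phase_residue[of x0 0, unfolded phase_line_upper phase_line_lower, folded v_def, simplified]
 have "residue (\<lambda>T. 1 / (phase \<beta> T - of_real v)) (of_real x0) = 1 / (cosh (of_real x0) / of_real (cos \<beta>) - 1)"
 proof (rule residue_simple_pole_deriv[where s=UNIV])
  show "((\<lambda>T. phase \<beta> T - of_real v) has_field_derivative cosh (of_real x0) / of_real (cos \<beta>) - 1) (at (of_real x0))"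
   using cos_pos by (auto intro!: derivative_eq_intros phase_deriv)
  have "cosh (of_real x0 :: complex) = of_real (cosh x0)"
   by (simp add: cosh_field_def exp_of_real flip: of_real_minus)
  then have "cosh (of_real x0) / of_real (cos \<beta>) - 1 = complex_of_real (cosh x0 / cos \<beta> - 1)"
   by simp
  then show "cosh (of_real x0) / of_real (cos \<beta>) - 1 \<noteq> (0::complex)"
   using rphase_deriv_pos[of x0] by (simp only: of_real_eq_0_iff)
  show "phase \<beta> (of_real x0) - of_real v = 0" by (simp add: phase_of_real v_def)
 qed (auto intro!: holomorphic_intros)
 also have "cosh (of_real x0 :: complex) = of_real (cosh x0)"
  by (simp add: cosh_field_def exp_of_real flip: of_real_minus)
 finally have res: "residue (\<lambda>T. 1 / (phase \<beta> T - of_real v)) (of_real x0) = 1 / of_real (cosh x0 / cos \<beta> - 1)" by simp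
 have "(LBINT y. 1 / (- (\<i> * G (- y)) - of_real v)) = (LBINT y. 1 / (- (\<i> * G y) - of_real v))"
  using integral_line_reflect[of "\<lambda>y. 1 / (- (\<i> * G y) - of_real v)"] by simp
 moreover have i2: "integrable lborel (\<lambda>y. 1 / (- (\<i> * G y) - of_real v))"
  using lborel_integrable_real_affine[OF sp(3), of "-1" 0] by simp
 ultimately have "(LBINT y. 1 / (- (\<i> * G y) - of_real v) - 1 / (\<i> * G y - of_real v)) = 2 * pi * \<i> / of_real (cosh x0 / cos \<beta> - 1)"
  using sp(1,2) unfolding res by (simp add: Bochner_Integration.integral_diff)
 moreover have "1 / (- (\<i> * G y) - of_real v) - 1 / (\<i> * G y - of_real v) = 2 * \<i> * (G y / ((G y)\<^sup>2 + of_real (v\<^sup>2)))" for y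
 proof -
  have e: "(G y)\<^sup>2 + of_real (v\<^sup>2) = (\<i> * G y - of_real v) * (- \<i> * G y - of_real v)"
   by (simp add: algebra_simps power2_eq_square)
  show ?thesis unfolding e using nz[of y] by (simp add: divide_simps)
 qed
 ultimately have "2 * \<i> * (LBINT y. G y / ((G y)\<^sup>2 + of_real (v\<^sup>2))) = 2 * pi * \<i> / of_real (cosh x0 / cos \<beta> - 1)"
  by (simp only: Bochner_Integration.integral_mult_right_zero)
 moreover have "2 * pi * \<i> / of_real (cosh x0 / cos \<beta> - 1) = 2 * \<i> * of_real (pi / (cosh x0 / cos \<beta> - 1))"
  by simp
 ultimately have "2 * \<i> * (LBINT y. G y / ((G y)\<^sup>2 + of_real (v\<^sup>2))) = 2 * \<i> * of_real (pi / (cosh x0 / cos \<beta> - 1))"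
  by (simp only:)
 then show ?thesis by (simp only: mult_cancel_left v_def) simp
qed

text \<open>Writing phase(T) = T q(T), the residue of phase^(-2n-1) at 0 is the Taylor coefficient
  of order 2n of q^(-2n-1), which is -a_n. The exponent being odd, the reflected lower line
  contributes the negative of the upper one, so the two add up in the difference.\<close>

lemma integral_power_G:
 "(LBINT y. 1 / G y ^ Suc (2 * n)) = pi * (- 1) ^ Suc n * a_coeff n \<beta>"
proof -
 have nz: "G y \<noteq> 0" for y using Re_G_pos[of y] by auto
 have r0: "rphase 0 = 0" by (simp add: rphase_def)
 define J where "J = (LBINT y. 1 / (\<i> * G y) ^ Suc (2 * n))"
 have sp: "(LBINT x. 1 / (- \<i> * G (- x)) ^ Suc (2 * n)) - J = 2 * pi * \<i> * residue (\<lambda>T. 1 / phase \<beta> T ^ Suc (2 * n)) 0"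
  using strip_phase_residue(1)[of 0 "2 * n"] unfolding J_def
  by (simp only: phase_line_upper phase_line_lower r0 of_real_0 diff_zero)
 obtain q where q: "q holomorphic_on UNIV" "\<And>z. phase \<beta> z = z * q z" "q 0 = deriv (phase \<beta>) 0"
 proof (rule holomorphic_factor_zero)
  show "phase \<beta> holomorphic_on UNIV" by (auto intro!: holomorphic_intros)
  show "phase \<beta> 0 = 0" by (simp add: phase_def)
 qed blast
 have q0: "q 0 \<noteq> 0"
 proof -
  have "deriv (phase \<beta>) 0 = cosh 0 / of_real (cos \<beta>) - 1"
   by (rule DERIV_imp_deriv[OF phase_deriv]) (use cos_pos in auto)
  also have "\<dots> = complex_of_real (cosh 0 / cos \<beta> - 1)" by simp
  finally show ?thesis using rphase_deriv_pos[of 0] q(3) by (simp only: of_real_eq_0_iff)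
 qed
 have "isCont q 0" using holomorphic_on_imp_continuous_on[OF q(1)] by (simp add: continuous_on_eq_continuous_at)
 \<comment> \<open>On this ball the quotient in \<open>a_coeff\<close> extends holomorphically over
   0, namely to g below.\<close>
 then obtain r where r: "r > 0" "\<And>z. z \<in> ball 0 r \<Longrightarrow> q z \<noteq> 0"
  using continuous_at_avoid[of 0 q 0] q0 by (metis dist_commute mem_ball)
 define h where "h = (\<lambda>t :: complex. (t / (1 / of_real (cos \<beta>) * sinh t - t)) ^ (2 * n + 1))"
 define g where "g = (\<lambda>t. (1 / q t) ^ (2 * n + 1))"
 have hol_g: "g holomorphic_on ball 0 r" unfolding g_def
  using r by (intro holomorphic_intros holomorphic_on_subset[OF q(1)]) auto
 have hg: "h t = g t" if "t \<in> ball 0 r - {0}" for t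
  using that q(2)[of t] r(2)[of t] by (simp add: h_def g_def phase_def)
 have rem: "remove_sings h t = g t" if "t \<in> ball 0 r" for t
  by (rule remove_sings_eq_analytic[OF open_ball hol_g hg that]) 
 have "(deriv ^^ (2 * n)) (remove_sings h) 0 = (deriv ^^ (2 * n)) g 0"
 proof (rule higher_deriv_cong_ev)
  show "eventually (\<lambda>t. remove_sings h t = g t) (nhds 0)"
   using r rem by (intro eventually_nhds_in_open[THEN eventually_mono, of "ball 0 r"]) auto
 qed simp
 then have a: "a_coeff n \<beta> = - (1 / fact (2 * n)) * (deriv ^^ (2 * n)) g 0"
  by (simp add: a_coeff_def h_def)
 have "residue (\<lambda>T. 1 / phase \<beta> T ^ Suc (2 * n)) 0 = residue (\<lambda>T. g T / T ^ Suc (2 * n)) 0"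
 proof (rule residue_cong)
  have "eventually (\<lambda>T. T \<in> ball 0 r - {0}) (at 0)"
   using r by (intro eventually_at_in_open) auto
  then show "eventually (\<lambda>T. 1 / phase \<beta> T ^ Suc (2 * n) = g T / T ^ Suc (2 * n)) (at 0)"
   by eventually_elim (simp add: g_def q(2) power_divide power_mult_distrib mult_ac)
 qed simp
 also have "\<dots> = (deriv ^^ (2 * n)) g 0 / fact (2 * n)"
  by (rule residue_holomorphic_over_power'[OF open_ball _ hol_g]) (use r in auto)
 finally have res: "residue (\<lambda>T. 1 / phase \<beta> T ^ Suc (2 * n)) 0 = - a_coeff n \<beta>"
  using a by simp
 have odd: "(- \<i> * z) ^ Suc (2 * n) = - ((\<i> * z) ^ Suc (2 * n))" for z :: complex
  by (simp only: mult_minus_left power_minus_odd even_Suc even_mult_iff even_numeral simp_thms)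
 have "(LBINT y. 1 / (- \<i> * G (- y)) ^ Suc (2 * n)) = (LBINT y. 1 / (- \<i> * G y) ^ Suc (2 * n))"
  by (rule integral_line_reflect[of "\<lambda>y. 1 / (- \<i> * G y) ^ Suc (2 * n)"])
 also have "\<dots> = - J"
  unfolding odd J_def by (simp only: divide_minus_right Bochner_Integration.integral_minus)
 finally have "- J - J = 2 * pi * \<i> * (- a_coeff n \<beta>)"
  using sp res by (simp only:)
 then have J: "J = pi * \<i> * a_coeff n \<beta>" by (simp add: algebra_simps)
 have "1 / (\<i> * G y) ^ Suc (2 * n) = (- \<i> * (- 1) ^ n) * (1 / G y ^ Suc (2 * n))" for y
 proof -
  have "\<i> ^ Suc (2 * n) = \<i> * (- 1) ^ n" by (simp add: power_mult)
  moreover have "1 / (\<i> * (- 1) ^ n) = - \<i> * (- 1 :: complex) ^ n"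
   by (cases "even n") (auto simp: divide_simps)
  ultimately show ?thesis by (simp only: power_mult_distrib divide_divide_eq_left[symmetric]) simp
 qed
 then have "J = (- \<i> * (- 1) ^ n) * (LBINT y. 1 / G y ^ Suc (2 * n))"
  unfolding J_def by (simp only: Bochner_Integration.integral_mult_right_zero)
 with J have "(- \<i> * (- 1) ^ n) * (LBINT y. 1 / G y ^ Suc (2 * n)) = pi * \<i> * a_coeff n \<beta>"
  by (simp only:)
 then have "(\<i> * (- 1) ^ n) * ((- \<i> * (- 1) ^ n) * (LBINT y. 1 / G y ^ Suc (2 * n))) = (\<i> * (- 1) ^ n) * (pi * \<i> * a_coeff n \<beta>)"
  by simp
 moreover have "\<i> * (pi * \<i> * a_coeff n \<beta>) = - (pi * a_coeff n \<beta>)"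
  by (simp add: complex_eq_iff)
 ultimately show ?thesis by (cases "even n") auto
qed

text \<open>In other words, the cosine transform of \<open>W\<close> at v is \<pi> times the
  derivative of the inverse function of \<open>rphase\<close> at v. This is the bridge from H back
  to the Anger-Weber integral.\<close>

lemma integral_W_cos:
 "set_integrable lborel {0<..} (\<lambda>t. of_real (cos (v * t)) * W t)"
 "(LBINT t:{0<..}. of_real (cos (rphase x * t)) * W t) = of_real (pi / (cosh x / cos \<beta> - 1))"
proof -
 have *: "norm (of_real (cos (v * t)) :: complex) \<le> 1 * exp (c0 / 2 * t)" if "0 < t" for v t
 proof -
  have "0 \<le> c0 / 2 * t" using that c0_pos by simp
  then have "1 \<le> exp (c0 / 2 * t)" by (simp only: one_le_exp_iff)
  then show ?thesis using abs_cos_le_one[of "v * t"] by (simp only: norm_of_real mult_1_left)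
 qed
 have c: "continuous_on UNIV (\<lambda>t. of_real (cos (v * t)) :: complex)" for v by (intro continuous_intros)
 show "set_integrable lborel {0<..} (\<lambda>t. of_real (cos (v * t)) * W t)"
  by (rule fubini_W(1)[OF c *])
 have "(LBINT t:{0<..}. of_real (cos (rphase x * t)) * W t) = (LBINT y. LBINT t:{0<..}. of_real (cos (rphase x * t)) * exp (- (of_real t * G y)))"
  by (rule fubini_W(2)[OF c *])
 also have "\<dots> = (LBINT y. G y / ((G y)\<^sup>2 + of_real ((rphase x)\<^sup>2)))"
  by (simp only: mult.commute[of "of_real (cos _)"] laplace_cos(2)[OF Re_G_pos])
 finally show "(LBINT t:{0<..}. of_real (cos (rphase x * t)) * W t) = of_real (pi / (cosh x / cos \<beta> - 1))"
  by (simp only: integral_lorentz_G)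
qed

lemma W_integrable: "set_integrable lborel {0<..} W"
 using integral_W_cos(1)[of 0] by simp

text \<open>The even moments of \<open>W\<close> are, up to sign and \<pi>, the asymptotic
  coefficients of the Anger-Weber function; they are what an expansion of the kernel in powers of
  t^2 picks up.\<close>

lemma integral_W_power:
 "set_integrable lborel {0<..} (\<lambda>t. of_real (t ^ n) * W t)"
 "(LBINT t:{0<..}. of_real (t ^ (2 * n)) * W t) = pi * (- 1) ^ Suc n * fact (2 * n) * a_coeff n \<beta>"
proof -
 have *: "\<exists>D. \<forall>t>0. norm (of_real (t ^ n) :: complex) \<le> D * exp (c0 / 2 * t)" for n
 proof -
  obtain D where D: "\<And>t. 0 \<le> t \<Longrightarrow> t ^ n * exp (- (c0 / 2) * t) \<le> D * exp (- (c0 / 2 / 2) * t)"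
   using exp_mult_power_le[of "c0 / 2" n] c0_pos by auto
  have "t ^ n \<le> D * exp (c0 / 2 * t)" if "0 < t" for t
  proof -
   have "0 \<le> D * exp (- (c0 / 2 / 2) * t)" using D[of t] that by (intro order_trans[OF _ D]) auto
   then have "D \<ge> 0" by (simp add: zero_le_mult_iff)
   then have "D * exp (- (c0 / 2 / 2) * t) \<le> D * 1"
    using that c0_pos by (intro mult_left_mono) auto
   with D[of t] that have "t ^ n * exp (- (c0 / 2) * t) \<le> D" by simp
   then have "t ^ n * exp (- (c0 / 2) * t) * exp (c0 / 2 * t) \<le> D * exp (c0 / 2 * t)"
    by (intro mult_right_mono) auto
   then show ?thesis by (simp add: mult.assoc flip: exp_add)
  qed
  then show ?thesis by (intro exI[of _ D]) (auto simp: norm_power)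
 qed
 have c: "continuous_on UNIV (\<lambda>t. of_real (t ^ n) :: complex)" for n by (intro continuous_intros)
 show "set_integrable lborel {0<..} (\<lambda>t. of_real (t ^ n) * W t)"
  using *[of n] fubini_W(1)[OF c] by blast
 have "(LBINT t:{0<..}. of_real (t ^ (2 * n)) * W t) = (LBINT y. LBINT t:{0<..}. of_real (t ^ (2 * n)) * exp (- (of_real t * G y)))"
  using *[of "2 * n"] fubini_W(2)[OF c] by blast
 also have "\<dots> = (LBINT y. fact (2 * n) * (1 / G y ^ Suc (2 * n)))"
  by (simp only: laplace_power(2)[OF Re_G_pos]) simp
 also have "\<dots> = pi * (- 1) ^ Suc n * fact (2 * n) * a_coeff n \<beta>"
  by (simp only: Bochner_Integration.integral_mult_right_zero integral_power_G) simp
 finally show "(LBINT t:{0<..}. of_real (t ^ (2 * n)) * W t) = pi * (- 1) ^ Suc n * fact (2 * n) * a_coeff n \<beta>" .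
qed

end

section \<open>The Stieltjes transform and the remainder \<open>R_N\<close>\<close>

lemma integrable_product_mult:
 fixes f g :: "real \<Rightarrow> real"
 assumes f: "integrable lborel f" and g: "integrable lborel g"
 shows "integrable (lborel \<Otimes>\<^sub>M lborel) (\<lambda>(x, y). f x * g y)"
proof (rule lborel_pair.Fubini_integrable)
 have [measurable]: "f \<in> borel_measurable borel" "g \<in> borel_measurable borel"
  using borel_measurable_integrable[OF f] borel_measurable_integrable[OF g] by simp_all
 show "(\<lambda>(x, y). f x * g y) \<in> borel_measurable (lborel \<Otimes>\<^sub>M lborel)"
  by measurable
 have "(LBINT y. norm (case (x, y) of (x, y) \<Rightarrow> f x * g y)) = norm (f x) * (LBINT y. norm (g y))" for x
  by (simp only: prod.case norm_mult Bochner_Integration.integral_mult_right_zero)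
 then show "integrable lborel (\<lambda>x. LBINT y. norm (case (x, y) of (x, y) \<Rightarrow> f x * g y))"
  using integrable_norm[OF f] by simp
 show "AE x in lborel. integrable lborel (\<lambda>y. case (x, y) of (x, y) \<Rightarrow> f x * g y)"
  using g by simp
qed

context phase_setup
begin

lemma rphase_0: "rphase 0 = 0"
 by (simp add: rphase_def)

lemma rphase_exp_bound:
 assumes "0 < a"
 obtains D where "\<And>x. 0 \<le> x \<Longrightarrow> exp (- a * rphase x) * (cosh x / cos \<beta> - 1) \<le> D * exp (- x)"
proof -
 define A where "A = a / (2 * cos \<beta>)"
 have A: "A > 0" using assms cos_pos by (simp add: A_def)
 obtain D where D: "\<And>a' b c x. A \<le> a' \<Longrightarrow> b \<le> a + 1 \<Longrightarrow> c \<le> A \<Longrightarrow> 0 \<le> x \<Longrightarrow> exp (- a' * exp x + b * x + c) \<le> D * exp (- x)"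
  using exp_dominated[OF A, of "a + 1" A] by blast
 show ?thesis
 proof (rule that)
  fix x :: real assume x: "0 \<le> x"
  have "cosh x \<le> exp x" using x by (simp add: cosh_field_def)
  then have "cosh x / cos \<beta> - 1 \<le> exp x / cos \<beta>"
   using divide_right_mono[of "cosh x" "exp x" "cos \<beta>"] cos_pos by simp
  then have "exp (- a * rphase x) * (cosh x / cos \<beta> - 1) \<le> exp (- a * rphase x) * (exp x / cos \<beta>)"
   by (intro mult_left_mono) auto
  also have "\<dots> = exp (- a * rphase x + x) / cos \<beta>" by (simp only: exp_add times_divide_eq_right)
  also have "\<dots> \<le> exp (- A * exp x + (a + 1) * x + A) / cos \<beta>"
  proof -
   have "A * exp (- x) \<le> A" using A x by (simp add: mult_left_le)
   moreover have "a * rphase x = A * exp x - A * exp (- x) - a * x"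
    using cos_pos by (simp add: rphase_def sinh_field_def A_def field_simps)
   ultimately have "- a * rphase x + x \<le> - A * exp x + (a + 1) * x + A" by (simp add: algebra_simps)
   then show ?thesis using cos_pos by (intro divide_right_mono) auto
  qed
  also have "\<dots> \<le> (D * exp (- x)) / cos \<beta>"
   using D[of A "a + 1" A x] x cos_pos by (intro divide_right_mono) auto
  finally show "exp (- a * rphase x) * (cosh x / cos \<beta> - 1) \<le> (D / cos \<beta>) * exp (- x)" by simp
 qed
qed

lemma continuous_on_rphase [continuous_intros]:
 "continuous_on A g \<Longrightarrow> continuous_on A (\<lambda>x. rphase (g x))"
 unfolding rphase_def sinh_field_def divide_inverse by (intro continuous_intros)

text \<open>\<open>laplace_cos\<close> under the substitution of \<open>rphase x\<close> for the
  variable. It is carried out on the primitive, so that no inverse function is needed.\<close>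

lemma integral_exp_rphase_cos:
 fixes \<nu> :: complex
 assumes \<nu>: "0 < Re \<nu>"
 defines "f t \<equiv> \<lambda>x. of_real (cosh x / cos \<beta> - 1) * (exp (- (of_real (rphase x) * \<nu>)) * of_real (cos (t * rphase x)))"
 shows "set_integrable lborel {0<..} (f t)" "(LBINT x:{0<..}. f t x) = \<nu> / (\<nu>\<^sup>2 + of_real (t\<^sup>2))"
proof -
 obtain D where D: "\<And>x. 0 \<le> x \<Longrightarrow> exp (- Re \<nu> * rphase x) * (cosh x / cos \<beta> - 1) \<le> D * exp (- x)"
  using rphase_exp_bound[OF \<nu>] by blast
 have cont: "continuous_on A (f t)" for A
  unfolding f_def cosh_field_def divide_inverse by (intro continuous_intros)
 have n: "norm (f t x) \<le> exp (- Re \<nu> * rphase x) * (cosh x / cos \<beta> - 1)" for x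
 proof -
  have "norm (f t x) = (cosh x / cos \<beta> - 1) * (exp (- Re \<nu> * rphase x) * \<bar>cos (t * rphase x)\<bar>)"
   using rphase_deriv_pos[of x] by (simp only: f_def norm_mult norm_of_real norm_exp_eq_Re abs_of_pos) simp
  also have "\<dots> \<le> (cosh x / cos \<beta> - 1) * (exp (- Re \<nu> * rphase x) * 1)"
   using rphase_deriv_pos[of x] by (intro mult_left_mono) auto
  finally show ?thesis by (simp only: mult.commute mult_1_right)
 qed
 show int: "set_integrable lborel {0<..} (f t)"
  by (rule set_integrable_exp_bound[OF cont, of 1 D]) (use D order_trans[OF n D] in auto)
 let ?F = "\<lambda>x. damped_cos_primitive \<nu> t (rphase x)"
 have "(LBINT x:{0<..}. f t x) = 0 - ?F 0"
 proof (rule half_line_FTC[OF _ cont int])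
  fix x
  have "(damped_cos_primitive \<nu> t \<circ> rphase has_vector_derivative (cosh x / cos \<beta> - 1) *\<^sub>R (exp (- (of_real (rphase x) * \<nu>)) * of_real (cos (t * rphase x)))) (at x)"
   by (rule vector_diff_chain_at[OF _ damped_cos_primitive_deriv[OF \<nu>]])
    (use rphase_deriv in \<open>simp add: has_real_derivative_iff_has_vector_derivative\<close>)
  then show "(?F has_vector_derivative f t x) (at x)"
   by (simp only: f_def o_def scaleR_conv_of_real)
 next
  define K where "K = (\<bar>t\<bar> + norm \<nu>) / norm (\<nu>\<^sup>2 + of_real (t\<^sup>2))"
  define d where "d = 1 / cos \<beta> - 1"
  have d: "d > 0" using rphase_deriv_pos[of 0] by (simp add: d_def)
  have K: "K \<ge> 0" by (simp add: K_def)
  show "(?F \<longlongrightarrow> 0) at_top"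
  proof (rule Lim_null_comparison[OF _ tendsto_exp_decay[where c=1 and D="K * (D / d)"]])
   show "\<forall>\<^sub>F x in at_top. norm (?F x) \<le> K * (D / d) * exp (- 1 * x)"
    using eventually_ge_at_top[of 0]
   proof eventually_elim
    case (elim x)
    have "d \<le> cosh x / cos \<beta> - 1"
     unfolding d_def using cosh_real_ge_1[of x] cos_pos by (simp add: divide_right_mono)
    then have "exp (- Re \<nu> * rphase x) * d \<le> exp (- Re \<nu> * rphase x) * (cosh x / cos \<beta> - 1)"
     by (intro mult_left_mono) auto
    also have "\<dots> \<le> D * exp (- x)" by (rule D[OF elim])
    finally have "exp (- Re \<nu> * rphase x) \<le> D * exp (- x) / d" using d by (simp add: pos_le_divide_eq)
    then have "K * exp (- Re \<nu> * rphase x) \<le> K * (D * exp (- x) / d)" using K by (intro mult_left_mono)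
    with norm_damped_cos_primitive_le[of \<nu> t "rphase x"]
    show ?case unfolding K_def[symmetric] by simp
   qed
  qed auto
 qed
 then show "(LBINT x:{0<..}. f t x) = \<nu> / (\<nu>\<^sup>2 + of_real (t\<^sup>2))"
  by (simp add: rphase_0 damped_cos_primitive_0)
qed

text \<open>In the integral of exp(-\<nu> \<open>rphase x\<close>) the factor 1 is written as the
  derivative of \<open>rphase\<close> times its reciprocal, and the reciprocal as a cosine integral
  of \<open>W\<close> by \<open>integral_W_cos\<close>. After exchanging the integrals, the inner
  one is \<open>integral_exp_rphase_cos\<close>.\<close>

lemma anger_weber_integral:
 assumes l: "\<bar>Im l\<bar> < pi / 2"
 defines "\<nu> \<equiv> exp l"
 shows "of_real pi * anger_weber_ext \<beta> l = (LBINT t:{0<..}. (\<nu> / (\<nu>\<^sup>2 + of_real (t\<^sup>2))) * W t) / of_real pi"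
proof -
 have \<nu>: "0 < Re \<nu>" using l by (auto simp: \<nu>_def Re_exp intro!: mult_pos_pos cos_gt_zero_pi)
 obtain F where F: "\<And>T. (F has_field_derivative phase_exp \<beta> l T) (at T)"
  by (rule phase_exp_primitive) blast
 have pw: "of_real pi * anger_weber_ext \<beta> l = (LBINT x:{0<..}. exp (- (of_real (rphase x) * \<nu>)))"
  using anger_weber_ext_eq[OF cos_pos _ F, of 0] l
  by (simp add: phase_tail_def phase_exp_def phase_of_real \<nu>_def mult.commute)
 define g where "g t x = of_real (cosh x / cos \<beta> - 1) * (exp (- (of_real (rphase x) * \<nu>)) * of_real (cos (t * rphase x)))" for t x
 \<comment> \<open>Measurability of W on the half line comes for free from its integrability there,
   so the indicator is built in.\<close>
 define w where "w t = indicator {0<..} t *\<^sub>R W t" for t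
 have w_int: "integrable lborel w" using W_integrable by (simp add: w_def[abs_def] set_integrable_def)
 have [measurable]: "w \<in> borel_measurable borel" using borel_measurable_integrable[OF w_int] by simp
 have [measurable]: "rphase \<in> borel_measurable borel"
  by (intro borel_measurable_continuous_onI continuous_intros)
 have [measurable]: "(cosh :: real \<Rightarrow> real) \<in> borel_measurable borel"
  unfolding cosh_field_def[abs_def] by measurable
 define k where "k x t = indicator {0<..} x *\<^sub>R (g t x * w t)" for x t
 have meas: "case_prod k \<in> borel_measurable (lborel \<Otimes>\<^sub>M lborel)"
  unfolding k_def g_def by measurable
 obtain D where D: "\<And>x. 0 \<le> x \<Longrightarrow> exp (- Re \<nu> * rphase x) * (cosh x / cos \<beta> - 1) \<le> D * exp (- x)"
  using rphase_exp_bound[OF \<nu>] by blast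
 have bound: "norm (k x t) \<le> norm ((indicator {0<..} x * (D * exp (- 1 * x))) * norm (w t))" for x t
 proof (cases "0 < x")
  case True
  have "norm (g t x) = (exp (- Re \<nu> * rphase x) * (cosh x / cos \<beta> - 1)) * \<bar>cos (t * rphase x)\<bar>"
   using rphase_deriv_pos[of x] by (simp only: g_def norm_mult norm_of_real norm_exp_eq_Re abs_of_pos) simp
  also have "\<dots> \<le> (exp (- Re \<nu> * rphase x) * (cosh x / cos \<beta> - 1)) * 1"
   using rphase_deriv_pos[of x] by (intro mult_left_mono) auto
  also have "\<dots> \<le> D * exp (- x)" using D[of x] True by simp
  finally have "norm (g t x) \<le> D * exp (- x)" .
  then have "norm (g t x * w t) \<le> D * exp (- x) * norm (w t)"
   unfolding norm_mult by (intro mult_right_mono) auto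
  then show ?thesis using True by (simp add: k_def)
 qed (simp add: k_def)
 have exp_int: "integrable lborel (\<lambda>x::real. indicator {0<..} x * (D * exp (- 1 * x)))"
 proof -
  have "integrable lborel (\<lambda>x::real. D * (indicator {0<..} x * exp (- 1 * x)))"
   using set_integrable_exp_half_line[of 1] unfolding set_integrable_def real_scaleR_def by (intro integrable_mult_right) auto
  then show ?thesis by (simp only: mult.left_commute)
 qed
 have int_k: "integrable lborel (k x)" for x
 proof (rule Bochner_Integration.integrable_bound)
  show "integrable lborel (\<lambda>t. (indicator {0<..} x * (D * exp (- 1 * x))) * norm (w t))"
   using w_int by (intro integrable_mult_right integrable_norm)
  show "k x \<in> borel_measurable lborel" unfolding k_def g_def by measurable
 qed (use bound in auto)
 have int2: "integrable (lborel \<Otimes>\<^sub>M lborel) (case_prod k)"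
 proof (rule Bochner_Integration.integrable_bound[OF _ meas])
  show "integrable (lborel \<Otimes>\<^sub>M lborel) (\<lambda>(x, t). (indicator {0<..} x * (D * exp (- 1 * x))) * norm (w t))"
   by (rule integrable_product_mult[OF exp_int integrable_norm[OF w_int]])
  show "AE xt in lborel \<Otimes>\<^sub>M lborel. norm (case_prod k xt) \<le> norm (case xt of (x, t) \<Rightarrow> (indicator {0<..} x * (D * exp (- 1 * x))) * norm (w t))"
   by (rule AE_I2) (use bound in \<open>auto split: prod.split\<close>)
 qed
 have inner_t: "(LBINT t. k x t) = indicator {0<..} x *\<^sub>R (of_real pi * exp (- (of_real (rphase x) * \<nu>)))" for x
 proof -
  have nz: "of_real (cosh x / cos \<beta> - 1) \<noteq> (0 :: complex)" using rphase_deriv_pos[of x] by (simp only: of_real_eq_0_iff)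
  have "(LBINT t. g t x * w t) = (LBINT t. (of_real (cosh x / cos \<beta> - 1) * exp (- (of_real (rphase x) * \<nu>))) * (indicator {0<..} t *\<^sub>R (of_real (cos (rphase x * t)) * W t)))"
   by (rule Bochner_Integration.integral_cong) (simp_all add: g_def w_def mult_ac)
  also have "\<dots> = (of_real (cosh x / cos \<beta> - 1) * exp (- (of_real (rphase x) * \<nu>))) * of_real (pi / (cosh x / cos \<beta> - 1))"
   using integral_W_cos(2)[of x] by (simp only: Bochner_Integration.integral_mult_right_zero set_lebesgue_integral_def)
  also have "\<dots> = of_real pi * exp (- (of_real (rphase x) * \<nu>))"
   using nz by (simp only: of_real_divide) (simp only: times_divide_eq_right nonzero_divide_eq_eq mult_ac not_False_eq_True)
  finally show ?thesis by (simp add: k_def)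
 qed
 have inner_x: "(LBINT x. k x t) = indicator {0<..} t *\<^sub>R ((\<nu> / (\<nu>\<^sup>2 + of_real (t\<^sup>2))) * W t)" for t
 proof -
  have "(LBINT x. k x t) = (LBINT x. (indicator {0<..} x *\<^sub>R g t x) * w t)"
   by (rule Bochner_Integration.integral_cong) (simp_all add: k_def)
  also have "\<dots> = (LBINT x:{0<..}. g t x) * w t"
   by (simp only: Bochner_Integration.integral_mult_left_zero set_lebesgue_integral_def)
  also have "(LBINT x:{0<..}. g t x) = \<nu> / (\<nu>\<^sup>2 + of_real (t\<^sup>2))"
   unfolding g_def by (rule integral_exp_rphase_cos(2)[OF \<nu>])
  finally show ?thesis by (simp add: w_def)
 qed
 have "(LBINT t. LBINT x. k x t) = (LBINT x. LBINT t. k x t)"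
  by (rule lborel_pair.Fubini_integral[OF int2])
 then have "(LBINT t:{0<..}. (\<nu> / (\<nu>\<^sup>2 + of_real (t\<^sup>2))) * W t) = (LBINT x:{0<..}. of_real pi * exp (- (of_real (rphase x) * \<nu>)))"
  unfolding inner_x inner_t set_lebesgue_integral_def .
 also have "\<dots> = of_real pi * (of_real pi * anger_weber_ext \<beta> l)"
  unfolding pw by simp
 finally show ?thesis by simp
qed

lemma norm_lorentz_le:
 assumes "0 < Re \<nu>"
 shows "norm (\<nu> / (\<nu>\<^sup>2 + of_real (t\<^sup>2))) \<le> norm \<nu> / (Re \<nu>)\<^sup>2"
proof -
 have "\<nu>\<^sup>2 + of_real (t\<^sup>2) = (\<nu> + \<i> * of_real t) * (\<nu> - \<i> * of_real t)"
  by (simp add: algebra_simps power2_eq_square)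
 moreover have "Re \<nu> \<le> norm (\<nu> + \<i> * of_real t)" "Re \<nu> \<le> norm (\<nu> - \<i> * of_real t)"
  using complex_Re_le_cmod[of "\<nu> + \<i> * of_real t"] complex_Re_le_cmod[of "\<nu> - \<i> * of_real t"] by simp_all
 moreover from this have "Re \<nu> * Re \<nu> \<le> norm (\<nu> + \<i> * of_real t) * norm (\<nu> - \<i> * of_real t)"
  using assms by (intro mult_mono) auto
 ultimately have "(Re \<nu>)\<^sup>2 \<le> norm (\<nu>\<^sup>2 + of_real (t\<^sup>2))"
  by (simp only: norm_mult power2_eq_square)
 then show ?thesis
  using assms by (simp add: norm_divide frac_le)
qed

lemma lorentz_W_integrable:
 assumes "0 < Re \<nu>"
 shows "set_integrable lborel {0<..} (\<lambda>t. of_real (t ^ n) * (\<nu> / (\<nu>\<^sup>2 + of_real (t\<^sup>2))) * W t)"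
 unfolding set_integrable_def
proof (rule Bochner_Integration.integrable_bound)
 have i: "integrable lborel (\<lambda>t. indicator {0<..} t *\<^sub>R (of_real (t ^ n) * W t))"
  using integral_W_power(1)[of n] by (simp only: set_integrable_def)
 then show "integrable lborel (\<lambda>t. (norm \<nu> / (Re \<nu>)\<^sup>2) * norm (indicator {0<..} t *\<^sub>R (of_real (t ^ n) * W t)))"
  by (intro integrable_mult_right integrable_norm)
 have "(\<lambda>t. indicator {0<..} t *\<^sub>R W t) \<in> borel_measurable lborel"
  using borel_measurable_integrable[OF W_integrable[unfolded set_integrable_def]] .
 then have "(\<lambda>t. (of_real (t ^ n) * (\<nu> / (\<nu>\<^sup>2 + of_real (t\<^sup>2)))) * (indicator {0<..} t *\<^sub>R W t)) \<in> borel_measurable lborel"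
  by (rule borel_measurable_times[rotated]) measurable
 then show "(\<lambda>t. indicator {0<..} t *\<^sub>R (of_real (t ^ n) * (\<nu> / (\<nu>\<^sup>2 + of_real (t\<^sup>2))) * W t)) \<in> borel_measurable lborel"
  by (simp only: mult_scaleR_right)
 show "AE t in lborel. norm (indicator {0<..} t *\<^sub>R (of_real (t ^ n) * (\<nu> / (\<nu>\<^sup>2 + of_real (t\<^sup>2))) * W t))
  \<le> norm ((norm \<nu> / (Re \<nu>)\<^sup>2) * norm (indicator {0<..} t *\<^sub>R (of_real (t ^ n) * W t)))"
 proof (rule AE_I2)
  fix t :: real
  have "norm (indicator {0<..} t *\<^sub>R (of_real (t ^ n) * (\<nu> / (\<nu>\<^sup>2 + of_real (t\<^sup>2))) * W t))
   = norm (\<nu> / (\<nu>\<^sup>2 + of_real (t\<^sup>2))) * norm (indicator {0<..} t *\<^sub>R (of_real (t ^ n) * W t))"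
   by (simp only: norm_scaleR norm_mult mult_ac)
  also have "\<dots> \<le> (norm \<nu> / (Re \<nu>)\<^sup>2) * norm (indicator {0<..} t *\<^sub>R (of_real (t ^ n) * W t))"
   by (intro mult_right_mono norm_lorentz_le assms) auto
  finally show "norm (indicator {0<..} t *\<^sub>R (of_real (t ^ n) * (\<nu> / (\<nu>\<^sup>2 + of_real (t\<^sup>2))) * W t))
   \<le> norm ((norm \<nu> / (Re \<nu>)\<^sup>2) * norm (indicator {0<..} t *\<^sub>R (of_real (t ^ n) * W t)))"
   by (rule order_trans) (simp only: real_norm_def abs_ge_self)
 qed
qed

text \<open>Induction on N: t^2 times the kernel \<nu>/(\<nu>^2 + t^2) is \<nu> minus \<nu>^2 times
  the kernel, and the moment of \<open>W\<close> produced by the first summand is exactly the next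
  term of the finite sum.\<close>

lemma R_N_integral:
 assumes l: "\<bar>Im l\<bar> < pi / 2"
 defines "\<nu> \<equiv> exp l"
 shows "R_N N \<beta> l = (- 1) ^ N / (of_real (pi\<^sup>2) * \<nu> ^ (2 * N)) *
  (LBINT t:{0<..}. of_real (t ^ (2 * N)) * (\<nu> / (\<nu>\<^sup>2 + of_real (t\<^sup>2))) * W t)"
proof -
 have \<nu>: "0 < Re \<nu>" using l by (auto simp: \<nu>_def Re_exp intro!: mult_pos_pos cos_gt_zero_pi)
 have \<nu>0: "\<nu> \<noteq> 0" by (simp add: \<nu>_def)
 note int = lorentz_W_integrable[OF \<nu>]
 define I where "I N = (LBINT t:{0<..}. of_real (t ^ (2 * N)) * (\<nu> / (\<nu>\<^sup>2 + of_real (t\<^sup>2))) * W t)" for N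
 have step: "I (Suc N) = \<nu> * (pi * (- 1) ^ Suc N * fact (2 * N) * a_coeff N \<beta>) - \<nu>\<^sup>2 * I N" for N
 proof -
  have e: "of_real (t ^ (2 * Suc N)) * (\<nu> / (\<nu>\<^sup>2 + of_real (t\<^sup>2))) * W t =
   \<nu> * (of_real (t ^ (2 * N)) * W t) - \<nu>\<^sup>2 * (of_real (t ^ (2 * N)) * (\<nu> / (\<nu>\<^sup>2 + of_real (t\<^sup>2))) * W t)" for t :: real
  proof -
   have "of_real (t\<^sup>2) * (\<nu> / (\<nu>\<^sup>2 + of_real (t\<^sup>2))) = \<nu> - \<nu>\<^sup>2 * (\<nu> / (\<nu>\<^sup>2 + of_real (t\<^sup>2)))"
    using square_plus_square_nonzero[OF \<nu>, of t] by (simp add: field_simps)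
   then have "of_real (t ^ (2 * N)) * W t * (of_real (t\<^sup>2) * (\<nu> / (\<nu>\<^sup>2 + of_real (t\<^sup>2))))
    = of_real (t ^ (2 * N)) * W t * (\<nu> - \<nu>\<^sup>2 * (\<nu> / (\<nu>\<^sup>2 + of_real (t\<^sup>2))))" by (simp only:)
   moreover have "t ^ (2 * Suc N) = t ^ (2 * N) * t\<^sup>2" by (simp add: power_add[symmetric])
   ultimately show ?thesis by (simp only: of_real_mult right_diff_distrib mult_ac)
  qed
  show ?thesis
   unfolding I_def e
   by (simp only: set_integral_diff(2)[OF set_integrable_mult_right[OF integral_W_power(1)] set_integrable_mult_right[OF int]]
    set_integral_mult_right integral_W_power(2))
 qed
 have "R_N N \<beta> l = (- 1) ^ N / (of_real (pi\<^sup>2) * \<nu> ^ (2 * N)) * I N"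
 proof (induction N)
  case 0
  have "of_real pi * anger_weber_ext \<beta> l = I 0 / of_real pi"
   using anger_weber_integral[OF l] by (simp add: I_def \<nu>_def)
  then show ?case
   by (simp add: R_N_def anger_weber_sec_eq[OF cos_pos] field_simps power2_eq_square)
 next
  case (Suc N)
  have "R_N (Suc N) \<beta> l = R_N N \<beta> l + fact (2 * N) * a_coeff N \<beta> / (of_real pi * \<nu> ^ (2 * N + 1))"
   by (simp add: R_N_def \<nu>_def field_simps)
  also have "\<dots> = (- 1) ^ Suc N / (of_real (pi\<^sup>2) * \<nu> ^ (2 * Suc N)) * I (Suc N)"
   unfolding Suc.IH step using \<nu>0
   by (cases "even N") (simp_all add: field_simps power2_eq_square)
  finally show ?case .
 qed
 then show ?thesis by (simp only: I_def)
qed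

end

section \<open>The terminant function\<close>

lemma gamma_integral_scaled:
 fixes p c :: real
 assumes "0 < p" "0 < c"
 shows "set_integrable lborel {0<..} (\<lambda>t. t powr (p - 1) * exp (- (c * t)))"
  and "(LBINT t:{0<..}. t powr (p - 1) * exp (- (c * t))) = Gamma p / c powr p"
proof -
 have h: "((\<lambda>t. t powr (p - 1) * exp (- t)) has_integral Gamma p) {0<..}"
 proof -
  have "((\<lambda>t. t powr (p - 1) / exp t) has_integral Gamma p) {0<..}"
   by (rule has_integral_spike_set_eq[THEN iffD1, OF _ _ Gamma_integral_real[OF assms(1)]])
    (auto intro: negligible_subset[of "{0}"])
  then show ?thesis by (simp add: exp_minus divide_inverse)
 qed
 then have "(\<lambda>t. t powr (p - 1) * exp (- t)) absolutely_integrable_on {0<..}"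
  by (intro nonnegative_absolutely_integrable_1) auto
 then have i1: "set_integrable lborel {0<..} (\<lambda>t. t powr (p - 1) * exp (- t))"
  by (simp add: set_integrable_def integrable_completion)
 have v1: "(LBINT t:{0<..}. t powr (p - 1) * exp (- t)) = Gamma p"
  using set_borel_integral_eq_integral(2)[OF i1] h by (simp add: integral_unique)
 have eq: "indicator {0<..} t *\<^sub>R (t powr (p - 1) * exp (- (c * t)))
  = (1 / c powr (p - 1)) * (indicator {0<..} (0 + c * t) *\<^sub>R ((0 + c * t) powr (p - 1) * exp (- (0 + c * t))))" for t
  using assms by (cases "0 < t") (auto simp: powr_mult zero_less_mult_iff)
 have "integrable lborel (\<lambda>t. indicator {0<..} (0 + c * t) *\<^sub>R ((0 + c * t) powr (p - 1) * exp (- (0 + c * t))))"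
  using i1 assms unfolding set_integrable_def by (intro lborel_integrable_real_affine) auto
 then show "set_integrable lborel {0<..} (\<lambda>t. t powr (p - 1) * exp (- (c * t)))"
  unfolding set_integrable_def eq by (rule integrable_mult_right)
 have "Gamma p = c * (LBINT t. indicator {0<..} (0 + c * t) *\<^sub>R ((0 + c * t) powr (p - 1) * exp (- (0 + c * t))))"
  using lborel_integral_real_affine[of c "\<lambda>t. indicator {0<..} t *\<^sub>R (t powr (p - 1) * exp (- t))" 0] assms v1
  by (simp add: set_lebesgue_integral_def)
 then have "(LBINT t. indicator {0<..} (0 + c * t) *\<^sub>R ((0 + c * t) powr (p - 1) * exp (- (0 + c * t)))) = Gamma p / c"
  using assms by (simp add: field_simps)
 then have "(LBINT t:{0<..}. t powr (p - 1) * exp (- (c * t))) = (1 / c powr (p - 1)) * (Gamma p / c)"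
  unfolding set_lebesgue_integral_def eq by (simp only: Bochner_Integration.integral_mult_right_zero)
 also have "\<dots> = Gamma p / c powr p"
  using assms by (simp add: powr_diff)
 finally show "(LBINT t:{0<..}. t powr (p - 1) * exp (- (c * t))) = Gamma p / c powr p" .
qed

section \<open>The upper incomplete gamma function in the logarithm of its argument\<close>

definition gamma_kernel :: "real \<Rightarrow> complex \<Rightarrow> complex" where
 "gamma_kernel p s = exp (of_real (1 - p) * s - exp s)"

text \<open>With w = exp s this is Gamma(1 - p, w), the integral of u^(-p) e^(-u) from w to
  infinity; \<open>gamma_kernel\<close> is its integrand in the variable log u. As a primitive of an
  entire function it is defined on the whole Riemann surface, and vanishing at the right end of the
  real axis makes the choice unique.\<close>

definition upper_gamma :: "real \<Rightarrow> complex \<Rightarrow> complex" where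
 "upper_gamma p = (SOME F. (\<forall>s. (F has_field_derivative - gamma_kernel p s) (at s)) \<and>
  ((\<lambda>x. F (of_real x)) \<longlongrightarrow> 0) at_top)"

lemma gamma_kernel_integrable:
 "set_integrable lborel {0<..} (\<lambda>x. gamma_kernel p (of_real L + of_real x))"
proof -
 obtain D where D: "\<And>a b c x. exp L \<le> a \<Longrightarrow> b \<le> 1 - p \<Longrightarrow> c \<le> (1 - p) * L \<Longrightarrow> 0 \<le> x \<Longrightarrow> exp (- a * exp x + b * x + c) \<le> D * exp (- x)"
  using exp_dominated[of "exp L" "1 - p" "(1 - p) * L"] by auto
 show ?thesis
 proof (rule set_integrable_exp_bound[where c=1 and D=D])
  show "norm (gamma_kernel p (of_real L + of_real x)) \<le> D * exp (- 1 * x)" if "0 < x" for x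
   using D[of "exp L" "1 - p" "(1 - p) * L" x] that
   by (simp add: gamma_kernel_def exp_of_real exp_add algebra_simps flip: of_real_add)
 qed (auto simp: gamma_kernel_def intro!: continuous_intros)
qed

lemma upper_gamma:
 shows upper_gamma_deriv: "(upper_gamma p has_field_derivative - gamma_kernel p s) (at s)"
  and upper_gamma_tendsto: "((\<lambda>x. upper_gamma p (of_real x)) \<longlongrightarrow> 0) at_top"
proof -
 have "(\<lambda>s. - gamma_kernel p s) holomorphic_on UNIV"
  unfolding gamma_kernel_def by (intro holomorphic_intros)
 then obtain F0 where F0: "\<And>s. (F0 has_field_derivative - gamma_kernel p s) (at s)"
  using holomorphic_convex_primitive'[of UNIV "\<lambda>s. - gamma_kernel p s"] by auto
 define C where "C = (LBINT x:{0<..}. gamma_kernel p (of_real 0 + of_real x))"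
 have "((\<lambda>X. F0 0 - (LBINT x:{0<..X}. gamma_kernel p (of_real 0 + of_real x))) \<longlongrightarrow> F0 0 - C) at_top"
  unfolding C_def by (intro tendsto_intros integral_half_line_tendsto gamma_kernel_integrable)
 then have lim: "((\<lambda>X. F0 (of_real X)) \<longlongrightarrow> F0 0 - C) at_top"
 proof (rule Lim_transform_eventually)
  show "\<forall>\<^sub>F X in at_top. F0 0 - (LBINT x:{0<..X}. gamma_kernel p (of_real 0 + of_real x)) = F0 (of_real X)"
   using eventually_ge_at_top[of 0]
  proof eventually_elim
   case (elim X)
   have "(LBINT x:{0..X}. gamma_kernel p (0 + of_real x)) = - F0 (0 + of_real X) - - F0 (0 + of_real 0)"
    using DERIV_minus[OF F0] by (intro set_integral_primitive[OF elim, where F="\<lambda>s. - F0 s"]) 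
     (auto simp: gamma_kernel_def intro!: continuous_intros)
   then show ?case by (simp add: set_integral_Ioc_eq_Icc)
  qed
 qed
 define F where "F s = F0 s - (F0 0 - C)" for s
 have "(\<forall>s. (F has_field_derivative - gamma_kernel p s) (at s)) \<and> ((\<lambda>x. F (of_real x)) \<longlongrightarrow> 0) at_top"
 proof (intro conjI allI)
  show "(F has_field_derivative - gamma_kernel p s) (at s)" for s
   unfolding F_def using DERIV_diff[OF F0 DERIV_const] by simp
  show "((\<lambda>x. F (of_real x)) \<longlongrightarrow> 0) at_top"
   unfolding F_def using tendsto_diff[OF lim tendsto_const[of "F0 0 - C"]] by simp
 qed
 then have "(\<forall>s. (upper_gamma p has_field_derivative - gamma_kernel p s) (at s)) \<and> ((\<lambda>x. upper_gamma p (of_real x)) \<longlongrightarrow> 0) at_top"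
  unfolding upper_gamma_def
  by (rule someI_ex[of "\<lambda>F. (\<forall>s. (F has_field_derivative - gamma_kernel p s) (at s)) \<and> ((\<lambda>x. F (of_real x)) \<longlongrightarrow> 0) at_top", OF exI])
 then show "(upper_gamma p has_field_derivative - gamma_kernel p s) (at s)" "((\<lambda>x. upper_gamma p (of_real x)) \<longlongrightarrow> 0) at_top"
  by auto
qed

lemma zero_derivative_imp_eq:
 assumes "\<And>s. (g has_field_derivative 0) (at s)"
 shows "g a = (g b :: complex)"
 using has_field_derivative_zero_constant[of UNIV g] assms by force

lemma primitive_unique_at_top:
 assumes "\<And>s. (F has_field_derivative f s) (at s)" "((\<lambda>x. F (of_real x)) \<longlongrightarrow> 0) at_top"
  and "\<And>s. (G has_field_derivative f s) (at s)" "((\<lambda>x. G (of_real x)) \<longlongrightarrow> 0) at_top"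
 shows "F s = (G s :: complex)"
proof -
 have "\<And>s. ((\<lambda>s. F s - G s) has_field_derivative 0) (at s)"
  using DERIV_diff[OF assms(1) assms(3)] by simp
 from zero_derivative_imp_eq[OF this] obtain c where c: "\<And>s. F s - G s = c"
  by metis
 have "((\<lambda>x. F (of_real x) - G (of_real x)) \<longlongrightarrow> 0 - 0) at_top"
  by (intro tendsto_diff assms)
 then have "c = 0" unfolding c using tendsto_unique[OF _ tendsto_const] by force
 with c[of s] show ?thesis by simp
qed

lemma upper_gamma_real:
 "upper_gamma p (of_real L) = (LBINT x:{0<..}. gamma_kernel p (of_real L + of_real x))"
proof -
 have "(LBINT x:{0<..}. - gamma_kernel p (of_real L + of_real x)) = 0 - upper_gamma p (of_real L + of_real 0)"
 proof (rule half_line_FTC)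
  show "((\<lambda>x. upper_gamma p (of_real L + of_real x)) has_vector_derivative - gamma_kernel p (of_real L + of_real x)) (at x)" for x
  proof -
   have "((\<lambda>z. upper_gamma p (of_real L + z)) has_field_derivative - gamma_kernel p (of_real L + of_real x) * 1) (at (of_real x))"
    by (rule DERIV_chain2[OF upper_gamma_deriv]) (auto intro!: derivative_eq_intros)
   then show ?thesis by (intro has_vector_derivative_real_field) simp
  qed
  show "set_integrable lborel {0<..} (\<lambda>x. - gamma_kernel p (of_real L + of_real x))"
   using set_integrable_mult_right[OF gamma_kernel_integrable[of p L], of "-1"] by simp
  show "((\<lambda>x. upper_gamma p (of_real L + of_real x)) \<longlongrightarrow> 0) at_top"
   using filterlim_compose[OF upper_gamma_tendsto filterlim_tendsto_add_at_top[OF tendsto_const filterlim_ident], of p L]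
   by simp
 qed (auto simp: gamma_kernel_def intro!: continuous_intros)
 then show ?thesis by (simp add: set_lebesgue_integral_def)
qed

text \<open>For half-integral p the factor w^(1-p) changes sign when w turns once around 0.\<close>

lemma gamma_kernel_shift:
 "gamma_kernel (real k + 1 / 2) (s - 2 * of_real pi * \<i>) = - gamma_kernel (real k + 1 / 2) s"
proof -
 have "of_real (1 - (real k + 1 / 2)) * (s - 2 * of_real pi * \<i>) - exp (s - 2 * of_real pi * \<i>)
  = (of_real (1 - (real k + 1 / 2)) * s - exp s) + (2 * of_real pi * \<i> * of_nat k - \<i> * of_real pi)"
  by (simp add: exp_diff exp_two_pi_i algebra_simps)
 moreover have "exp (2 * of_real pi * \<i> * of_nat k - \<i> * of_real pi) = -1"
  using exp_of_nat_mult[of k "2 * of_real pi * \<i>"] by (simp add: exp_diff mult_ac)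
 ultimately show ?thesis by (simp only: gamma_kernel_def exp_add) simp
qed

lemma exp_tendsto_kernel: "((\<lambda>x. gamma_kernel p (of_real x)) \<longlongrightarrow> 0) at_top"
proof -
 obtain D where D: "\<And>a b c x. 1 \<le> a \<Longrightarrow> b \<le> 1 - p \<Longrightarrow> c \<le> 0 \<Longrightarrow> 0 \<le> x \<Longrightarrow> exp (- a * exp x + b * x + c) \<le> D * exp (- x)"
  using exp_dominated[of 1 "1 - p" 0] by auto
 show ?thesis
 proof (rule Lim_null_comparison[OF _ tendsto_exp_decay[where c=1 and D=D]])
  show "\<forall>\<^sub>F x in at_top. norm (gamma_kernel p (of_real x)) \<le> D * exp (- 1 * x)"
   using eventually_ge_at_top[of 0]
   by eventually_elim (use D[of 1 "1 - p" 0] in \<open>simp add: gamma_kernel_def Re_exp algebra_simps\<close>)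
 qed auto
qed

text \<open>The recurrence p Gamma(-p, w) = w^(-p) e^(-w) - Gamma(1-p, w). Both sides have the same
  derivative in log w and vanish at infinity.\<close>

lemma upper_gamma_recurrence:
 "of_real p * upper_gamma (p + 1) s = gamma_kernel (p + 1) s - upper_gamma p s"
proof -
 have "gamma_kernel (p + 1) s - upper_gamma p s = of_real p * upper_gamma (p + 1) s"
 proof (rule primitive_unique_at_top[where f="\<lambda>s. - (of_real p * gamma_kernel (p + 1) s)"
   and F="\<lambda>s. gamma_kernel (p + 1) s - upper_gamma p s" and G="\<lambda>s. of_real p * upper_gamma (p + 1) s"])
  have e: "gamma_kernel p s = exp s * gamma_kernel (p + 1) s" for s
   unfolding gamma_kernel_def exp_add[symmetric] by (simp add: algebra_simps)
  show "((\<lambda>s. gamma_kernel (p + 1) s - upper_gamma p s) has_field_derivative - (of_real p * gamma_kernel (p + 1) s)) (at s)" for s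
  proof -
   have "(gamma_kernel (p + 1) has_field_derivative gamma_kernel (p + 1) s * (- of_real p - exp s)) (at s)"
    unfolding gamma_kernel_def by (auto intro!: derivative_eq_intros)
   from DERIV_diff[OF this upper_gamma_deriv[of p s]] show ?thesis
    by (rule DERIV_cong) (simp add: e algebra_simps)
  qed
  show "((\<lambda>s. of_real p * upper_gamma (p + 1) s) has_field_derivative - (of_real p * gamma_kernel (p + 1) s)) (at s)" for s
   using DERIV_cmult[OF upper_gamma_deriv[of "p + 1" s], of "of_real p"] by simp
  show "((\<lambda>x. gamma_kernel (p + 1) (of_real x) - upper_gamma p (of_real x)) \<longlongrightarrow> 0) at_top"
   using tendsto_diff[OF exp_tendsto_kernel upper_gamma_tendsto] by simp
  show "((\<lambda>x. of_real p * upper_gamma (p + 1) (of_real x)) \<longlongrightarrow> 0) at_top"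
   using tendsto_mult_left[OF upper_gamma_tendsto, of "of_real p" "p + 1"] by simp
 qed
 then show ?thesis by simp
qed

text \<open>Gamma(1/2, w) is \<surd>\<pi> times the complementary error function of the root u of w.
  It is entire in u, so a full turn of w amounts to the change from u to -u.\<close>

lemma upper_gamma_half:
 obtains \<Phi> where "\<And>u. (\<Phi> has_field_derivative - (2 * exp (- (u\<^sup>2)))) (at u)"
  "\<And>s. upper_gamma (1 / 2) s = \<Phi> (exp (s / 2))"
proof -
 have "(\<lambda>u::complex. - (2 * exp (- (u\<^sup>2)))) holomorphic_on UNIV" by (intro holomorphic_intros)
 then obtain P where P: "\<And>u::complex. (P has_field_derivative - (2 * exp (- (u\<^sup>2)))) (at u)"
  using holomorphic_convex_primitive'[of UNIV "\<lambda>u. - (2 * exp (- (u\<^sup>2)))"] by auto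
 have "((\<lambda>s. upper_gamma (1 / 2) s - P (exp (s / 2))) has_field_derivative 0) (at s)" for s
 proof -
  have "((\<lambda>s. P (exp (s / 2))) has_field_derivative - (2 * exp (- ((exp (s / 2))\<^sup>2))) * (exp (s / 2) * (1 / 2))) (at s)"
   by (rule DERIV_chain2[OF P]) (auto intro!: derivative_eq_intros)
  from DERIV_diff[OF upper_gamma_deriv[of "1 / 2" s] this] show ?thesis
  proof (rule DERIV_cong)
   have "(exp (s / 2))\<^sup>2 = exp s" by (simp add: exp_double[symmetric])
   moreover have "gamma_kernel (1 / 2) s = exp (- exp s) * exp (s / 2)"
    by (simp add: gamma_kernel_def flip: exp_add)
   ultimately show "- gamma_kernel (1 / 2) s - - (2 * exp (- ((exp (s / 2))\<^sup>2))) * (exp (s / 2) * (1 / 2)) = 0"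
    by simp
  qed
 qed
 from zero_derivative_imp_eq[OF this] obtain c where c: "\<And>s. upper_gamma (1 / 2) s - P (exp (s / 2)) = c"
  by metis
 show ?thesis
 proof (rule that[of "\<lambda>u. P u + c"])
  show "((\<lambda>u. P u + c) has_field_derivative - (2 * exp (- (u\<^sup>2)))) (at u)" for u
   using DERIV_add[OF P DERIV_const] by simp
  show "upper_gamma (1 / 2) s = P (exp (s / 2)) + c" for s
   using c[of s] by (simp add: algebra_simps)
 qed
qed

text \<open>The derivative of \<Phi> is even, hence \<Phi>(u) + \<Phi>(-u) is the constant 2
  \<Phi>(0). Most of the proof identifies \<Phi>(0) with the complete integral Gamma(1/2).\<close>

lemma upper_gamma_shift_half:
 "upper_gamma (1 / 2) s + upper_gamma (1 / 2) (s - 2 * of_real pi * \<i>) = 2 * of_real (Gamma (1 / 2))"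
proof -
 obtain \<Phi> where P: "\<And>u. (\<Phi> has_field_derivative - (2 * exp (- (u\<^sup>2)))) (at u)"
  "\<And>s. upper_gamma (1 / 2) s = \<Phi> (exp (s / 2))" by (rule upper_gamma_half) blast
 have "((\<lambda>u. \<Phi> u + \<Phi> (- u)) has_field_derivative 0) (at u)" for u
 proof -
  have "((\<lambda>u. \<Phi> (- u)) has_field_derivative - (2 * exp (- ((- u)\<^sup>2))) * (- 1)) (at u)"
   by (rule DERIV_chain2[OF P(1)]) (auto intro!: derivative_eq_intros)
  from DERIV_add[OF P(1)[of u] this] show ?thesis by simp
 qed
 from zero_derivative_imp_eq[OF this, of _ 0] have c: "\<Phi> u + \<Phi> (- u) = 2 * \<Phi> 0" for u
  by simp
 have "exp ((s - 2 * of_real pi * \<i>) / 2) = - exp (s / 2)"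
  by (simp add: diff_divide_distrib exp_diff)
 then have 1: "upper_gamma (1 / 2) s + upper_gamma (1 / 2) (s - 2 * of_real pi * \<i>) = 2 * \<Phi> 0"
  by (simp add: P(2) c)
 have i1: "set_integrable lborel {0<..} (\<lambda>t::real. t powr (1 / 2 - 1) * exp (- (1 * t)))"
  by (rule gamma_integral_scaled) auto
 have v: "(LBINT t:{0<..}. t powr (1 / 2 - 1) * exp (- (1 * t))) = Gamma (1 / 2 :: real)"
  using gamma_integral_scaled(2)[of "1 / 2" 1] by simp
 have lim1: "((\<lambda>X. of_real (LBINT t:{0<..X}. t powr (1 / 2 - 1) * exp (- (1 * t)))) \<longlongrightarrow> complex_of_real (Gamma (1 / 2))) at_top"
  using integral_half_line_tendsto[OF i1] unfolding v by (rule tendsto_of_real)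
 \<comment> \<open>The integral over (0, X] is evaluated with the primitive -\<Phi>(\<surd>t), which
   is continuous at 0 although the integrand is singular there; it equals \<Phi>(0) - Gamma(1/2,
   X).\<close>
 have lim2: "((\<lambda>X. of_real (LBINT t:{0<..X}. t powr (1 / 2 - 1) * exp (- (1 * t)))) \<longlongrightarrow> \<Phi> 0 - 0) at_top"
 proof (rule Lim_transform_eventually)
  have "((\<lambda>X. upper_gamma (1 / 2) (of_real (ln X))) \<longlongrightarrow> 0) at_top"
   by (rule filterlim_compose[OF upper_gamma_tendsto ln_at_top])
  then show "((\<lambda>X. \<Phi> 0 - upper_gamma (1 / 2) (of_real (ln X))) \<longlongrightarrow> \<Phi> 0 - 0) at_top"
   by (intro tendsto_intros)
  show "\<forall>\<^sub>F X in at_top. \<Phi> 0 - upper_gamma (1 / 2) (of_real (ln X)) = of_real (LBINT t:{0<..X}. t powr (1 / 2 - 1) * exp (- (1 * t)))"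
   using eventually_gt_at_top[of 0]
  proof eventually_elim
   case (elim X)
   let ?f = "\<lambda>t. t powr (1 / 2 - 1) * exp (- (1 * t))"
   have "((\<lambda>t. complex_of_real (?f t)) has_integral (- \<Phi> (of_real (sqrt X)) - - \<Phi> (of_real (sqrt 0)))) {0..X}"
   proof (rule fundamental_theorem_of_calculus_interior)
    have "continuous_on UNIV \<Phi>" using P(1) by (meson DERIV_isCont continuous_at_imp_continuous_on)
    then show "continuous_on {0..X} (\<lambda>t. - \<Phi> (of_real (sqrt t)))"
     by (auto intro!: continuous_intros continuous_on_compose2[of UNIV \<Phi>])
    fix t assume t: "t \<in> {0<..<X}"
    have "((\<lambda>t. sqrt t) has_real_derivative inverse (sqrt t) / 2) (at t)"
     using t by (auto intro!: derivative_eq_intros)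
    then have "((\<lambda>t. complex_of_real (sqrt t)) has_vector_derivative of_real (inverse (sqrt t) / 2)) (at t)"
     by (intro has_vector_derivative_of_real) (simp add: has_real_derivative_iff_has_vector_derivative)
    from field_vector_diff_chain_at[OF this DERIV_minus[OF P(1)]]
    have "((\<lambda>t. - \<Phi> (of_real (sqrt t))) has_vector_derivative of_real (inverse (sqrt t) / 2) * - (- (2 * exp (- ((of_real (sqrt t))\<^sup>2))))) (at t)"
     by (simp add: o_def)
    moreover have "of_real (inverse (sqrt t) / 2) * - (- (2 * exp (- ((of_real (sqrt t))\<^sup>2)))) = complex_of_real (?f t)"
    proof -
     have "complex_of_real (sqrt t) ^ 2 = of_real t" using t by (simp flip: of_real_power)
     moreover have "t powr (1 / 2 - 1) = inverse (sqrt t)" using t by (simp add: powr_half_sqrt powr_minus)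
     ultimately show ?thesis by (simp only: exp_of_real flip: of_real_minus) simp
    qed
    ultimately show "((\<lambda>t. - \<Phi> (of_real (sqrt t))) has_vector_derivative complex_of_real (?f t)) (at t)"
     by (simp only:)
   qed (use elim in auto)
   moreover have "exp (complex_of_real (ln X) / 2) = of_real (sqrt X)"
   proof -
    have "exp (complex_of_real (ln X) / 2) = of_real (exp (ln X / 2))" by (simp flip: exp_of_real)
    also have "exp (ln X / 2) = sqrt X" using elim by (simp add: powr_half_sqrt[symmetric] powr_def)
    finally show ?thesis .
   qed
   ultimately have h: "((\<lambda>t. complex_of_real (?f t)) has_integral \<Phi> 0 - upper_gamma (1 / 2) (of_real (ln X))) {0..X}"
    by (simp add: P(2))
   have "(?f has_integral (LBINT t:{0<..X}. ?f t)) {0<..X}"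
   proof -
    have i: "set_integrable lborel {0<..X} ?f" by (rule set_integrable_subset[OF i1]) auto
    show ?thesis
     using set_borel_integral_eq_integral[OF i] by (simp only: has_integral_integral)
   qed
   then have "(?f has_integral (LBINT t:{0<..X}. ?f t)) {0..X}"
    by (rule has_integral_spike_set_eq[THEN iffD1, rotated 2]) (auto intro: negligible_subset[of "{0}"])
   then have "((\<lambda>t. complex_of_real (?f t)) has_integral of_real (LBINT t:{0<..X}. ?f t)) {0..X}"
    by (rule has_integral_of_real)
   from has_integral_unique[OF h this] show ?case .
  qed
 qed
 have "\<Phi> 0 = of_real (Gamma (1 / 2))"
  using tendsto_unique[OF _ lim2 lim1] by simp
 with 1 show ?thesis by simp
qed

text \<open>The classical closed form of the scaled terminant, e^(\<pi>\<i>p) Gamma(p) Gamma(1-p, w)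
  / (2\<pi>\<i>), entire in log w.\<close>

definition terminant_ext :: "real \<Rightarrow> complex \<Rightarrow> complex" where
 "terminant_ext p L = exp (of_real (pi * p) * \<i>) * of_real (Gamma p) / (2 * of_real pi * \<i>) * upper_gamma p L"

text \<open>Two branches one turn apart add up to 1. Induction from p = 1/2: in the step to p + 1
  the recurrence brings a sign, absorbed by e^(\<pi>\<i>p), and a factor 1/p, absorbed by Gamma(p+1)
  = p Gamma(p); its elementary term cancels by \<open>gamma_kernel_shift\<close>.\<close>

lemma terminant_ext_shift:
 assumes "p = real k + 1 / 2"
 shows "terminant_ext p L + terminant_ext p (L - 2 * of_real pi * \<i>) = 1"
proof -
 have "exp (of_real (pi * (real k + 1 / 2)) * \<i>) * of_real (Gamma (real k + 1 / 2)) *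
  (upper_gamma (real k + 1 / 2) L + upper_gamma (real k + 1 / 2) (L - 2 * of_real pi * \<i>)) = 2 * of_real pi * \<i>" for L
 proof (induction k arbitrary: L)
  case 0
  have "exp (complex_of_real (pi * (0 + 1 / 2)) * \<i>) = \<i>"
   using cis_pi_half by (simp add: cis_conv_exp mult.commute)
  moreover have "complex_of_real (Gamma (1 / 2)) * of_real (Gamma (1 / 2)) = of_real pi"
   by (simp add: Gamma_one_half_real flip: of_real_mult)
  ultimately show ?case using upper_gamma_shift_half[of L] by (simp add: mult_ac)
 next
  case (Suc k)
  let ?p = "real k + 1 / 2"
  have p0: "?p \<noteq> 0" "?p \<notin> \<int>\<^sub>\<le>\<^sub>0" by (auto simp: nonpos_Ints_def)
  have pS: "real (Suc k) + 1 / 2 = ?p + 1" by simp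
  have "of_real ?p * (upper_gamma (?p + 1) L + upper_gamma (?p + 1) (L - 2 * of_real pi * \<i>))
   = - (upper_gamma ?p L + upper_gamma ?p (L - 2 * of_real pi * \<i>))"
   using gamma_kernel_shift[of "Suc k" L] by (simp only: distrib_left upper_gamma_recurrence pS) simp
  moreover have "exp (of_real (pi * (?p + 1)) * \<i>) = - exp (of_real (pi * ?p) * \<i>)"
  proof -
   have "of_real (pi * (?p + 1)) * \<i> = of_real (pi * ?p) * \<i> + of_real pi * \<i>" by (simp add: algebra_simps)
   then show ?thesis by (simp only: exp_add exp_pi_i) simp
  qed
  moreover have "Gamma (?p + 1) = ?p * Gamma ?p" by (rule Gamma_plus1[OF p0(2)])
  ultimately have "exp (of_real (pi * (?p + 1)) * \<i>) * of_real (Gamma (?p + 1)) *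
   (upper_gamma (?p + 1) L + upper_gamma (?p + 1) (L - 2 * of_real pi * \<i>))
   = - exp (of_real (pi * ?p) * \<i>) * of_real (Gamma ?p) * (- (upper_gamma ?p L + upper_gamma ?p (L - 2 * of_real pi * \<i>)))"
   by (simp only: of_real_mult mult.assoc mult.left_commute[of "of_real ?p"])
  then show ?case unfolding pS using Suc.IH[of L] by (simp only: mult_minus_left mult_minus_right minus_minus)
 qed
 from this[of L] show ?thesis
  unfolding terminant_ext_def assms by (simp add: field_simps)
qed

section \<open>The integral of the terminant as an incomplete gamma function\<close>

lemma laplace_exp_exp:
 assumes "0 < (a::real)"
 shows "set_integrable lborel {0<..} (\<lambda>x. complex_of_real (exp x * exp (- a * exp x)))"
  and "(LBINT x:{0<..}. complex_of_real (exp x * exp (- a * exp x))) = of_real (exp (- a) / a)"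
proof -
 obtain D where D: "\<And>a' b c x. a \<le> a' \<Longrightarrow> b \<le> 1 \<Longrightarrow> c \<le> 0 \<Longrightarrow> 0 \<le> x \<Longrightarrow> exp (- a' * exp x + b * x + c) \<le> D * exp (- x)"
  using exp_dominated[OF assms, of 1 0] by blast
 have D': "exp x * exp (- a * exp x) \<le> D * exp (- x)" if "0 \<le> x" for x
  using D[of a 1 0 x] that by (simp flip: exp_add)
 show int: "set_integrable lborel {0<..} (\<lambda>x. complex_of_real (exp x * exp (- a * exp x)))"
  by (rule set_integrable_exp_bound[where c=1 and D=D]) (use D' in \<open>auto intro!: continuous_intros simp: norm_mult\<close>)
 let ?F = "\<lambda>x. complex_of_real (- exp (- a * exp x) / a)"
 have "(LBINT x:{0<..}. complex_of_real (exp x * exp (- a * exp x))) = 0 - ?F 0"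
 proof (rule half_line_FTC[OF _ _ int])
  fix x :: real
  have "((\<lambda>x. - exp (- a * exp x) / a) has_real_derivative exp x * exp (- a * exp x)) (at x)"
   using assms by (auto intro!: derivative_eq_intros)
  then show "(?F has_vector_derivative complex_of_real (exp x * exp (- a * exp x))) (at x)"
   by (intro has_vector_derivative_of_real) (simp add: has_real_derivative_iff_has_vector_derivative)
 next
  show "(?F \<longlongrightarrow> 0) at_top"
  proof (rule Lim_null_comparison[OF _ tendsto_exp_decay[where c=1 and D="D / a"]])
   show "\<forall>\<^sub>F x in at_top. norm (?F x) \<le> D / a * exp (- 1 * x)"
    using eventually_ge_at_top[of 0]
   proof eventually_elim
    case (elim x)
    have "1 * exp (- a * exp x) \<le> exp x * exp (- a * exp x)" using elim by (intro mult_right_mono) auto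
    also have "\<dots> \<le> D * exp (- x)" by (rule D'[OF elim])
    finally show ?case using assms by (simp add: norm_divide divide_right_mono)
   qed
  qed auto
 qed (auto intro!: continuous_intros)
 then show "(LBINT x:{0<..}. complex_of_real (exp x * exp (- a * exp x))) = of_real (exp (- a) / a)"
  by simp
qed

text \<open>By \<open>laplace_exp_exp\<close>, e^(-(w+t))/(w+t) is the integral of e^(-(w+t)y) over
  y > 1, written with y = e^x. After exchanging the integrals, the one over t gives Gamma(p) y^(-p),
  and the kernel of Gamma(1-p, w) remains.\<close>

lemma stieltjes_upper_gamma_real:
 fixes p L :: real
 assumes p: "0 < p"
 shows "of_real (exp ((1 - p) * L) * exp (- exp L)) * (LBINT t:{0<..}. complex_of_real (t powr (p - 1) * exp (- t)) / (of_real (exp L) + of_real t))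
  = of_real (Gamma p) * upper_gamma p (of_real L)"
proof -
 define w where "w = exp L"
 have w: "w > 0" by (simp add: w_def)
 define k where "k t x = indicator {0<..} t *\<^sub>R (indicator {0<..} x *\<^sub>R complex_of_real (t powr (p - 1) * (exp x * exp (- (w + t) * exp x))))" for t x :: real
 have [measurable]: "(\<lambda>t::real. t powr (p - 1)) \<in> borel_measurable borel" by measurable
 have meas: "case_prod k \<in> borel_measurable (lborel \<Otimes>\<^sub>M lborel)"
  unfolding k_def by measurable
 have i1: "integrable lborel (\<lambda>t. indicator {0<..} t *\<^sub>R (t powr (p - 1) * exp (- (1 * t))))"
  using gamma_integral_scaled(1)[OF p, of 1] by (simp only: set_integrable_def)
 have i2: "integrable lborel (\<lambda>x. norm (indicator {0<..} x *\<^sub>R complex_of_real (exp x * exp (- w * exp x))))"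
  using laplace_exp_exp(1)[OF w] unfolding set_integrable_def by (rule integrable_norm)
 have int2: "integrable (lborel \<Otimes>\<^sub>M lborel) (case_prod k)"
 proof (rule Bochner_Integration.integrable_bound[OF integrable_product_mult[OF i1 i2] meas], rule AE_I2)
  fix z :: "real \<times> real"
  obtain t x where z: "z = (t, x)" by force
  have "norm (k t x) \<le> (indicator {0<..} t *\<^sub>R (t powr (p - 1) * exp (- (1 * t)))) * norm (indicator {0<..} x *\<^sub>R complex_of_real (exp x * exp (- w * exp x)))"
  proof (cases "0 < t \<and> 0 < x")
   case True
   have "t * 1 \<le> t * exp x" using True by (intro mult_left_mono) auto
   then have "exp (- (w + t) * exp x) \<le> exp (- (1 * t)) * exp (- w * exp x)"
    unfolding exp_add[symmetric] by (simp add: algebra_simps)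
   then have "t powr (p - 1) * (exp x * exp (- (w + t) * exp x)) \<le> t powr (p - 1) * (exp x * (exp (- (1 * t)) * exp (- w * exp x)))"
    by (intro mult_left_mono) auto
   with True show ?thesis by (simp add: k_def norm_mult mult_ac)
  qed (auto simp: k_def)
  then show "norm (case_prod k z) \<le> norm (case z of (t, x) \<Rightarrow> (indicator {0<..} t *\<^sub>R (t powr (p - 1) * exp (- (1 * t)))) * norm (indicator {0<..} x *\<^sub>R complex_of_real (exp x * exp (- w * exp x))))"
   unfolding z prod.case real_norm_def by (rule order_trans[OF _ abs_ge_self])
 qed
 have inner_x: "(LBINT x. k t x) = of_real (exp (- w)) * (indicator {0<..} t *\<^sub>R (complex_of_real (t powr (p - 1) * exp (- t)) / (of_real w + of_real t)))" for t
 proof (cases "0 < t")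
  case True
  have "(LBINT x. k t x) = of_real (t powr (p - 1)) * (LBINT x:{0<..}. complex_of_real (exp x * exp (- (w + t) * exp x)))"
   unfolding set_lebesgue_integral_def Bochner_Integration.integral_mult_right_zero[symmetric]
   by (rule Bochner_Integration.integral_cong) (use True in \<open>auto simp: k_def\<close>)
  also have "\<dots> = of_real (t powr (p - 1)) * of_real (exp (- (w + t)) / (w + t))"
   using laplace_exp_exp(2)[of "w + t"] w True by simp
  finally show ?thesis using True by (simp add: exp_diff exp_minus field_simps)
 qed (simp add: k_def)
 have inner_t: "(LBINT t. k t x) = of_real (Gamma p / exp ((1 - p) * L)) * (indicator {0<..} x *\<^sub>R gamma_kernel p (of_real L + of_real x))" for x
 proof (cases "0 < x")
  case True
  have "(LBINT t. k t x) = of_real (exp x * exp (- w * exp x)) * (LBINT t:{0<..}. complex_of_real (t powr (p - 1) * exp (- (exp x * t))))"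
   unfolding set_lebesgue_integral_def Bochner_Integration.integral_mult_right_zero[symmetric]
   by (rule Bochner_Integration.integral_cong) (use True in \<open>auto simp: k_def ring_distribs exp_add[symmetric] simp flip: of_real_mult\<close>)
  also have "(LBINT t:{0<..}. complex_of_real (t powr (p - 1) * exp (- (exp x * t)))) = of_real (Gamma p / exp x powr p)"
   using gamma_integral_scaled(2)[OF p, of "exp x"] by (simp only: set_integral_complex_of_real exp_gt_zero)
  also have "complex_of_real (exp x * exp (- w * exp x)) * of_real (Gamma p / exp x powr p)
   = of_real (Gamma p / exp ((1 - p) * L)) * of_real (exp ((1 - p) * (L + x) - exp (L + x)))"
   unfolding of_real_mult[symmetric] of_real_eq_iff
   by (simp add: powr_def w_def exp_add exp_diff exp_minus field_simps)
  also have "complex_of_real (exp ((1 - p) * (L + x) - exp (L + x))) = gamma_kernel p (of_real L + of_real x)"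
   by (simp add: gamma_kernel_def flip: exp_of_real)
  finally show ?thesis using True by simp
 qed (simp add: k_def)
 have "(LBINT x. LBINT t. k t x) = (LBINT t. LBINT x. k t x)"
  by (rule lborel_pair.Fubini_integral[OF int2])
 then have "of_real (Gamma p / exp ((1 - p) * L)) * upper_gamma p (of_real L)
  = of_real (exp (- w)) * (LBINT t:{0<..}. complex_of_real (t powr (p - 1) * exp (- t)) / (of_real w + of_real t))"
  unfolding inner_x inner_t upper_gamma_real set_lebesgue_integral_def Bochner_Integration.integral_mult_right_zero .
 then have "of_real (exp ((1 - p) * L)) * (of_real (Gamma p / exp ((1 - p) * L)) * upper_gamma p (of_real L))
  = of_real (exp ((1 - p) * L)) * (of_real (exp (- w)) * (LBINT t:{0<..}. complex_of_real (t powr (p - 1) * exp (- t)) / (of_real w + of_real t)))"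
  by (simp only:)
 then show ?thesis by (simp add: w_def mult_ac)
qed

definition stieltjes :: "real \<Rightarrow> complex \<Rightarrow> complex" where
 "stieltjes p w = (LBINT t:{0<..}. complex_of_real (t powr (p - 1) * exp (- t)) / (w + of_real t))"

lemma exp_notin_nonpos_Reals:
 assumes "\<bar>Im L\<bar> < pi"
 shows "exp L \<notin> \<real>\<^sub>\<le>\<^sub>0"
proof
 assume "exp L \<in> \<real>\<^sub>\<le>\<^sub>0"
 then have h: "Im (exp L) = 0" "Re (exp L) \<le> 0" by (auto simp: complex_nonpos_Reals_iff)
 then have "sin (Im L) = 0" by (simp add: Im_exp)
 then have "Im L = 0" using assms sin_eq_0_pi[of "Im L"] by auto
 with h(2) show False by (simp add: Re_exp)
qed

text \<open>A lower bound for |w + t| that is uniform near w0 and in t; it provides the dominating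
  function for the Stieltjes integral.\<close>

lemma cut_plane_dist:
 assumes "(w0 :: complex) \<notin> \<real>\<^sub>\<le>\<^sub>0"
 obtains d where "d > 0" "\<And>w t. norm (w - w0) < d \<Longrightarrow> 0 \<le> t \<Longrightarrow> d \<le> norm (w + of_real t)"
proof -
 obtain d where d: "d > 0" "\<And>z. z \<in> \<real>\<^sub>\<le>\<^sub>0 \<Longrightarrow> d \<le> dist w0 z"
  using separate_point_closed[OF closed_nonpos_Reals_complex assms] by blast
 show ?thesis
 proof (rule that[of "d / 2"])
  fix w and t :: real assume h: "norm (w - w0) < d / 2" "0 \<le> t"
  have "d \<le> dist w0 (- of_real t)" using h by (intro d(2)) (auto simp: complex_nonpos_Reals_iff)
  then have "d \<le> norm (w0 + of_real t)" by (simp add: dist_norm)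
  also have "\<dots> \<le> norm (w + of_real t) + norm (w - w0)"
   using norm_triangle_ineq4[of "w + of_real t" "w - w0"] by (simp add: add.commute)
  finally show "d / 2 \<le> norm (w + of_real t)" using h by linarith
 qed (use d in auto)
qed

lemma stieltjes_holomorphic:
 assumes p: "1 < p"
 shows "stieltjes p holomorphic_on (- \<real>\<^sub>\<le>\<^sub>0)"
proof -
 have "stieltjes p field_differentiable (at w0)" if w0: "w0 \<notin> \<real>\<^sub>\<le>\<^sub>0" for w0 :: complex
 proof -
  obtain d where d: "d > 0" "\<And>w t. norm (w - w0) < d \<Longrightarrow> 0 \<le> t \<Longrightarrow> d \<le> norm (w + of_real t)"
   using cut_plane_dist[OF w0] by blast
  have nz: "w + of_real t \<noteq> 0" if "w \<in> ball w0 d" "0 \<le> t" for w t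
   using d(2)[of w t] that d(1) by (auto simp: dist_norm norm_minus_commute)
  \<comment> \<open>This is where p > 1 enters: the power must be continuous up to t = 0.\<close>
  have c: "continuous_on {0..} (\<lambda>t::real. t powr (p - 1))"
   using p by (intro continuous_on_powr') (auto intro!: continuous_intros)
  have "stieltjes p holomorphic_on ball w0 d"
   unfolding stieltjes_def[abs_def]
  proof (rule holomorphic_half_line_integral[where k'="\<lambda>w t. - (complex_of_real (t powr (p - 1) * exp (- t)) / (w + of_real t)\<^sup>2)"
     and g="\<lambda>t. (1 / d) * (t powr (p - 1) * exp (- (1 * t)))"])
   show "((\<lambda>w. complex_of_real (t powr (p - 1) * exp (- t)) / (w + of_real t)) has_field_derivative - (complex_of_real (t powr (p - 1) * exp (- t)) / (w + of_real t)\<^sup>2)) (at w)"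
    if "w \<in> ball w0 d" "0 \<le> t" for w t
    using nz[OF that] by (auto intro!: derivative_eq_intros simp: power2_eq_square)
   show "continuous_on {0..} (\<lambda>t. complex_of_real (t powr (p - 1) * exp (- t)) / (w + of_real t))" if "w \<in> ball w0 d" for w
    using nz[OF that] by (intro continuous_intros c) auto
   show "continuous_on (ball w0 d \<times> {0..}) (\<lambda>(w, t). - (complex_of_real (t powr (p - 1) * exp (- t)) / (w + of_real t)\<^sup>2))"
    unfolding split_def using nz
    by (intro continuous_intros continuous_on_compose2[OF c, of _ snd]) auto
   show "set_integrable lborel {0<..} (\<lambda>t. (1 / d) * (t powr (p - 1) * exp (- (1 * t))))"
    using p by (intro set_integrable_mult_right gamma_integral_scaled) auto
   show "norm (complex_of_real (t powr (p - 1) * exp (- t)) / (w + of_real t)) \<le> (1 / d) * (t powr (p - 1) * exp (- (1 * t)))"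
    if "w \<in> ball w0 d" "0 < t" for w t
    using d(2)[of w t] that d(1) by (simp add: norm_divide norm_mult dist_norm norm_minus_commute frac_le)
  qed auto
  then show ?thesis using d(1) by (auto intro!: holomorphic_on_imp_differentiable_at[of _ "ball w0 d"])
 qed
 then show ?thesis
  by (auto simp: holomorphic_on_def intro: field_differentiable_at_within)
qed

lemma upper_gamma_holomorphic: "upper_gamma p holomorphic_on A"
 using upper_gamma_deriv by (auto simp: holomorphic_on_def field_differentiable_def intro: has_field_derivative_at_within)

text \<open>Identity theorem: both sides are holomorphic in the strip |Im L| < \<pi>, and the real
  case is known.\<close>

lemma stieltjes_upper_gamma:
 assumes p: "1 < p" and L: "\<bar>Im L\<bar> < pi"
 shows "exp (of_real (1 - p) * L) * exp (- exp L) * stieltjes p (exp L) = of_real (Gamma p) * upper_gamma p L"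
proof -
 define S where "S = {z. \<bar>Im z\<bar> < pi}"
 have S: "S = {z. Im z < pi} \<inter> {z. Im z > - pi}" by (auto simp: S_def)
 let ?f = "\<lambda>L. exp (of_real (1 - p) * L) * exp (- exp L) * stieltjes p (exp L) - of_real (Gamma p) * upper_gamma p L"
 have "?f L = 0"
 proof (rule analytic_continuation[of ?f S "\<real>" 0 L])
  have "(stieltjes p \<circ> exp) holomorphic_on S"
   by (rule holomorphic_on_compose_gen[OF _ stieltjes_holomorphic[OF p]])
    (use exp_notin_nonpos_Reals in \<open>auto simp: S_def intro!: holomorphic_intros\<close>)
  then show "?f holomorphic_on S"
   unfolding o_def by (intro holomorphic_intros upper_gamma_holomorphic)
  show "open S" unfolding S by (intro open_Int open_halfspace_Im_lt open_halfspace_Im_gt)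
  show "connected S" unfolding S by (intro convex_connected convex_Int convex_halfspace_Im_lt convex_halfspace_Im_gt)
  show "0 islimpt (\<real> :: complex set)"
   unfolding islimpt_approachable
  proof (intro allI impI)
   fix e :: real assume "0 < e"
   then show "\<exists>x'\<in>(\<real> :: complex set). x' \<noteq> 0 \<and> dist x' 0 < e"
    by (intro bexI[of _ "of_real (e / 2)"]) (auto simp: norm_divide)
  qed
  show "?f z = 0" if "z \<in> \<real>" for z
  proof -
   obtain x where x: "z = of_real x" using \<open>z \<in> \<real>\<close> by (auto elim: Reals_cases)
   have "exp (of_real (1 - p) * z) * exp (- exp z) = of_real (exp ((1 - p) * x) * exp (- exp x))"
    unfolding x by (simp flip: exp_of_real)
   then show ?thesis
    using stieltjes_upper_gamma_real[of p x] p by (simp add: stieltjes_def x exp_of_real)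
  qed
 qed (use L in \<open>auto simp: S_def elim: Reals_cases\<close>)
 then show ?thesis by simp
qed

lemma terminant_ext_holomorphic: "terminant_ext p holomorphic_on A"
 unfolding terminant_ext_def by (intro holomorphic_intros upper_gamma_holomorphic)

lemma terminant_eq:
 assumes p: "1 < p"
 shows "terminant p L = terminant_ext p L"
 unfolding terminant_def
proof (rule log_continuation_eqI[where L = "\<bar>Im L\<bar> + pi"])
 fix u :: complex assume u: "\<bar>Im u\<bar> < pi"
 show "terminant_ext p u = exp (of_real (pi * p) * \<i>) * exp (of_real (1 - p) * u) * exp (- exp u) /
      (2 * of_real pi * \<i>) *
     (LBINT t:{0<..}. of_real (t powr (p - 1) * exp (- t)) / (exp u + of_real t))"
  unfolding terminant_ext_def stieltjes_def[symmetric]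
  using stieltjes_upper_gamma[OF p u, symmetric] by (simp add: mult_ac)
qed (auto intro: terminant_ext_holomorphic)

lemma terminant_stieltjes:
 assumes p: "1 < p" and L: "\<bar>Im L\<bar> < pi"
 shows "exp (exp L) * terminant p L = exp (of_real (pi * p) * \<i>) / (2 * of_real pi * \<i>) * exp (of_real (1 - p) * L) * stieltjes p (exp L)"
proof -
 have "exp (exp L) * terminant p L = exp (exp L) * (exp (of_real (pi * p) * \<i>) / (2 * of_real pi * \<i>)) * (of_real (Gamma p) * upper_gamma p L)"
  by (simp add: terminant_eq[OF p] terminant_ext_def)
 also have "\<dots> = (exp (exp L) * exp (- exp L)) * (exp (of_real (pi * p) * \<i>) / (2 * of_real pi * \<i>)) * exp (of_real (1 - p) * L) * stieltjes p (exp L)"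
  unfolding stieltjes_upper_gamma[OF p L, symmetric] by (simp add: mult_ac)
 finally show ?thesis by (simp flip: exp_add)
qed

section \<open>The terms of the expansion and the connection formulas\<close>

lemma exp_i_half_pi_mult: "exp (\<i> * of_real (pi / 2) * of_nat k) = \<i> ^ k"
 using exp_of_nat_mult[of k "\<i> * of_real (pi / 2)"] exp_add_i_half_pi[of 0] by (simp add: mult.commute)

lemma eterm_algebra:
 fixes e1 :: "'a :: field"
 shows "i * (e1 * E) / (r * h) * (a * u / n * T) - i * (e2 * E') / (r * h) * (b * u / n * T')
  = i / (r * h * n) * u * (e1 * a * (E * T) - e2 * b * (E' * T'))"
proof -
 have "i * (e1 * E) / (r * h) * (a * u / n * T) = i / (r * h * n) * u * (e1 * a * (E * T))"
  "i * (e2 * E') / (r * h) * (b * u / n * T') = i / (r * h * n) * u * (e2 * b * (E' * T'))"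
  by (simp_all add: divide_inverse mult_ac)
 then show ?thesis by (simp only: right_diff_distrib)
qed

context phase_setup
begin

lemma \<xi>_pos: "0 < \<xi>"
proof -
 have "\<beta> * cos \<beta> < sin \<beta>" using \<beta> by (intro mult_cos_less_sin) auto
 then show ?thesis using cos_pos by (simp add: \<xi>_def tan_def field_simps)
qed

text \<open>Normalised by \<i>^m: the two terminant sums then carry the conjugate factors \<i>^m and
  (-\<i>)^m, and the number is real, as \<open>hcoef_nonzero_real\<close> implies.\<close>

definition ucoef :: "nat \<Rightarrow> complex" where
 "ucoef m = U_coeff m (\<i> * of_real (cot \<beta>)) * \<i> ^ m"

lemma U_coeff_ucoef: "U_coeff m (\<i> * of_real (cot \<beta>)) = (- \<i>) ^ m * ucoef m"
 by (simp add: ucoef_def mult.left_commute flip: power_mult_distrib)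

text \<open>The coefficient h_m of t^(-m-1/2) in the expansion of e^(t\<xi>) H(t). That U_m yields
  this coefficient is the outcome of the saddle point analysis further on; until then only the
  algebra is used.\<close>

definition hcoef :: "nat \<Rightarrow> complex" where
 "hcoef m = of_real (sqrt (2 * pi * cot \<beta>)) * ucoef m"

definition hrem :: "nat \<Rightarrow> complex \<Rightarrow> complex" where
 "hrem M s = exp (exp s * of_real \<xi>) * saddle_integral \<beta> s - (\<Sum>m<M. hcoef m * exp (- (of_nat m + 1 / 2) * s))"

definition rootc :: complex where "rootc = of_real (sqrt (pi * tan \<beta> / 2))"

lemma tan_pos: "0 < tan \<beta>" using \<beta> by (intro tan_gt_zero) auto

lemma rootc_nz: "rootc \<noteq> 0" using tan_pos by (simp add: rootc_def)

lemma hcoef_rootc: "hcoef m / of_real pi = ucoef m / rootc"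
proof -
 have "sqrt (2 * pi * cot \<beta>) * sqrt (pi * tan \<beta> / 2) = sqrt (pi\<^sup>2)"
 proof -
  have "cot \<beta> * tan \<beta> = 1" using tan_pos by (simp add: cot_altdef)
  then have "(2 * pi * cot \<beta>) * (pi * tan \<beta> / 2) = pi\<^sup>2" by (simp add: power2_eq_square)
  then show ?thesis by (simp only: real_sqrt_mult[symmetric])
 qed
 then have "sqrt (2 * pi * cot \<beta>) * sqrt (pi * tan \<beta> / 2) = pi" by simp
 then have "of_real (sqrt (2 * pi * cot \<beta>)) * rootc = of_real pi"
  unfolding rootc_def by (simp flip: of_real_mult)
 then have "hcoef m * rootc = ucoef m * of_real pi"
  by (simp add: hcoef_def mult_ac)
 then show ?thesis using rootc_nz by (simp add: field_simps)
qed

definition Tplus :: "nat \<Rightarrow> nat \<Rightarrow> complex \<Rightarrow> complex" where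
 "Tplus N m l = terminant (2 * real N - real m + 1 / 2) (l + \<i> * of_real (pi / 2) + of_real (ln \<xi>))"

definition Tminus :: "nat \<Rightarrow> nat \<Rightarrow> complex \<Rightarrow> complex" where
 "Tminus N m l = terminant (2 * real N - real m + 1 / 2) (l - \<i> * of_real (pi / 2) + of_real (ln \<xi>))"

text \<open>The m-th summands of both terminant sums together. Each exponential stays next to its
  terminant because e^w times the terminant of w is a Stieltjes integral.\<close>

definition eterm :: "nat \<Rightarrow> nat \<Rightarrow> complex \<Rightarrow> complex" where
 "eterm N m l = \<i> / (rootc * exp (l / 2) * exp l ^ m) * ucoef m *
  (exp (- \<i> * of_real (pi / 4)) * \<i> ^ m * (exp (\<i> * exp l * of_real \<xi>) * Tplus N m l)
   - exp (\<i> * of_real (pi / 4)) * (- \<i>) ^ m * (exp (- \<i> * exp l * of_real \<xi>) * Tminus N m l))"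

lemma R_NM_eq: "R_NM N M \<beta> l = R_N N \<beta> l - (\<Sum>m<M. eterm N m l)"
proof -
 have e: "(- 1) ^ m * (- \<i>) ^ m = \<i> ^ m" for m by (simp flip: power_mult_distrib)
 have "\<i> * exp (\<i> * exp l * of_real \<xi> - \<i> * of_real (pi / 4)) / (rootc * exp (l / 2)) *
       (\<Sum>m<M. (- 1) ^ m * (U_coeff m (\<i> * of_real (cot \<beta>)) / exp l ^ m) * Tplus N m l)
      - \<i> * exp (- (\<i> * exp l * of_real \<xi>) + \<i> * of_real (pi / 4)) / (rootc * exp (l / 2)) *
       (\<Sum>m<M. U_coeff m (\<i> * of_real (cot \<beta>)) / exp l ^ m * Tminus N m l) = (\<Sum>m<M. eterm N m l)"
  unfolding sum_distrib_left sum_subtractf[symmetric]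
 proof (rule sum.cong[OF refl])
  fix m
  have 1: "exp (\<i> * exp l * of_real \<xi> - \<i> * of_real (pi / 4)) = exp (- \<i> * of_real (pi / 4)) * exp (\<i> * exp l * of_real \<xi>)"
   "exp (- (\<i> * exp l * of_real \<xi>) + \<i> * of_real (pi / 4)) = exp (\<i> * of_real (pi / 4)) * exp (- \<i> * exp l * of_real \<xi>)"
   by (simp_all flip: exp_add)
  have 2: "(- 1) ^ m * (U_coeff m (\<i> * of_real (cot \<beta>)) / exp l ^ m) = \<i> ^ m * ucoef m / exp l ^ m"
   using e[of m] by (simp add: U_coeff_ucoef flip: mult.assoc)
  show "\<i> * exp (\<i> * exp l * of_real \<xi> - \<i> * of_real (pi / 4)) / (rootc * exp (l / 2)) *
       ((- 1) ^ m * (U_coeff m (\<i> * of_real (cot \<beta>)) / exp l ^ m) * Tplus N m l)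
      - \<i> * exp (- (\<i> * exp l * of_real \<xi>) + \<i> * of_real (pi / 4)) / (rootc * exp (l / 2)) *
       (U_coeff m (\<i> * of_real (cot \<beta>)) / exp l ^ m * Tminus N m l) = eterm N m l"
   unfolding 1 unfolding 2 unfolding U_coeff_ucoef eterm_def by (rule eterm_algebra)
 qed
 then show ?thesis
  unfolding R_NM_def Let_def Tplus_def[symmetric] Tminus_def[symmetric] \<xi>_def[symmetric] rootc_def[symmetric]
  by (simp only:)
qed

lemma anger_weber_ext_add:
 "anger_weber_ext \<beta> l + anger_weber_ext \<beta> (l - \<i> * of_real pi) = saddle_integral \<beta> (l - \<i> * of_real (pi / 2)) / of_real pi"
proof -
 have "l - \<i> * of_real (pi / 2) + \<i> * of_real (pi / 2) = l"
  "l - \<i> * of_real (pi / 2) - \<i> * of_real (pi / 2) = l - \<i> * of_real pi"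
  by (simp_all add: algebra_simps)
 then show ?thesis by (simp add: saddle_integral_def)
qed

lemma exp_diff_i_pi: "exp (l - \<i> * of_real pi) = - exp l"
 by (simp add: exp_diff)

text \<open>The finite sum is odd in \<nu> and cancels; the Anger-Weber parts add up to the saddle
  point integral by its very definition.\<close>

lemma R_N_connection:
 "R_N N \<beta> l + R_N N \<beta> (l - \<i> * of_real pi) = saddle_integral \<beta> (l - \<i> * of_real (pi / 2)) / of_real pi"
proof -
 have "(\<Sum>n<N. fact (2 * n) * a_coeff n \<beta> / exp (l - \<i> * of_real pi) ^ (2 * n + 1)) = - (\<Sum>n<N. fact (2 * n) * a_coeff n \<beta> / exp l ^ (2 * n + 1))"
  unfolding exp_diff_i_pi sum_negf[symmetric] by (intro sum.cong refl) simp
 then show ?thesis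
  using anger_weber_ext_add[of l] by (simp add: R_N_def anger_weber_sec_eq[OF cos_pos])
qed

text \<open>Lowering arg \<nu> by \<pi> turns \<open>Tplus\<close> into \<open>Tminus\<close>, and
  \<open>Tminus\<close> into the branch of \<open>Tplus\<close> one turn away, that is, into 1 -
  \<open>Tplus\<close>. All terminants cancel, and the 1 leaves e^(-t\<xi>) h_m t^(-m-1/2) at t =
  -\<i>\<nu>. The bound m < 2N makes the order p exceed 1.\<close>

lemma eterm_connection:
 assumes "m < 2 * N"
 shows "eterm N m l + eterm N m (l - \<i> * of_real pi) =
  exp (- (exp (l - \<i> * of_real (pi / 2)) * of_real \<xi>)) * (hcoef m * exp (- (of_nat m + 1 / 2) * (l - \<i> * of_real (pi / 2)))) / of_real pi"
proof -
 define p where "p = 2 * real N - real m + 1 / 2"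
 have p: "p = real (2 * N - m) + 1 / 2" "1 < p" using assms by (auto simp: p_def)
 have T: "Tplus N m l + Tminus N m (l - \<i> * of_real pi) = 1"
 proof -
  have e: "l - \<i> * of_real pi - \<i> * of_real (pi / 2) + of_real (ln \<xi>) = l + \<i> * of_real (pi / 2) + of_real (ln \<xi>) - 2 * of_real pi * \<i>"
   by (simp add: algebra_simps)
  show ?thesis
   unfolding Tplus_def Tminus_def e p_def[symmetric] terminant_eq[OF p(2)]
   by (rule terminant_ext_shift[OF p(1)])
 qed
 have T': "Tplus N m (l - \<i> * of_real pi) = Tminus N m l"
 proof -
  have e: "l - \<i> * of_real pi + \<i> * of_real (pi / 2) = l - \<i> * of_real (pi / 2)"
   by (simp add: algebra_simps)
  show ?thesis unfolding Tplus_def Tminus_def e ..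
 qed
 have T'': "Tminus N m (l - \<i> * of_real pi) = 1 - Tplus N m l"
  using T by (metis add_diff_cancel_left')
 define \<nu> where "\<nu> = exp l"
 define E where "E = exp (\<i> * \<nu> * of_real \<xi>)"
 define E' where "E' = exp (- \<i> * \<nu> * of_real \<xi>)"
 define q where "q = exp (- \<i> * of_real (pi / 4))"
 define q' where "q' = exp (\<i> * of_real (pi / 4))"
 have qq: "q' = \<i> * q" "q = - \<i> * q'"
 proof -
  have "q' * q' = exp (\<i> * of_real (pi / 2))" unfolding q'_def exp_add[symmetric] by (simp add: algebra_simps)
  then have "q' * q' = \<i>" using exp_add_i_half_pi[of 0] by simp
  moreover have "q' * q = 1" unfolding q'_def q_def exp_add[symmetric] by simp
  ultimately show "q' = \<i> * q" by (metis mult.assoc mult.commute mult.right_neutral)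
  then show "q = - \<i> * q'" by simp
 qed
 have h: "exp ((l - \<i> * of_real pi) / 2) = - \<i> * exp (l / 2)"
 proof -
  have "(l - \<i> * of_real pi) / 2 = l / 2 - \<i> * of_real (pi / 2)" by (simp add: diff_divide_distrib)
  then show ?thesis by (simp only: exp_diff_i_half_pi)
 qed
 have i1: "\<i> / (rootc * (- \<i> * exp (l / 2)) * (- \<nu>) ^ m) = (- 1) ^ m * \<i> * (\<i> / (rootc * exp (l / 2) * \<nu> ^ m))"
  by (cases "even m") (auto simp: field_simps)
 have m1: "(- 1) ^ m * (- \<i>) ^ m = \<i> ^ m" "(- 1) ^ m * \<i> ^ m = (- \<i>) ^ m" by (simp_all flip: power_mult_distrib)
 have "eterm N m (l - \<i> * of_real pi) = \<i> / (rootc * (- \<i> * exp (l / 2)) * (- \<nu>) ^ m) * ucoef m *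
  (q * \<i> ^ m * (E' * Tminus N m l) - q' * (- \<i>) ^ m * (E * (1 - Tplus N m l)))"
  unfolding eterm_def exp_diff_i_pi h T' \<nu>_def[symmetric] q_def[symmetric] q'_def[symmetric] E_def E'_def
  by (simp only: T'' mult_minus_left mult_minus_right minus_minus)
 also have "\<dots> = \<i> / (rootc * exp (l / 2) * \<nu> ^ m) * ucoef m * ((\<i> * q) * ((- 1) ^ m * \<i> ^ m) * (E' * Tminus N m l) - (\<i> * q') * ((- 1) ^ m * (- \<i>) ^ m) * (E * (1 - Tplus N m l)))"
  unfolding i1 by (simp add: algebra_simps)
 also have "\<dots> = \<i> / (rootc * exp (l / 2) * \<nu> ^ m) * ucoef m * (q' * (- \<i>) ^ m * (E' * Tminus N m l) + q * \<i> ^ m * (E * (1 - Tplus N m l)))"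
  unfolding m1 qq(1) by simp
 finally have e2: "eterm N m (l - \<i> * of_real pi) = \<i> / (rootc * exp (l / 2) * \<nu> ^ m) * ucoef m * (q' * (- \<i>) ^ m * (E' * Tminus N m l) + q * \<i> ^ m * (E * (1 - Tplus N m l)))" .
 have e1: "eterm N m l = \<i> / (rootc * exp (l / 2) * \<nu> ^ m) * ucoef m * (q * \<i> ^ m * (E * Tplus N m l) - q' * (- \<i>) ^ m * (E' * Tminus N m l))"
  unfolding eterm_def \<nu>_def[symmetric] q_def[symmetric] q'_def[symmetric] E_def E'_def ..
 have "eterm N m l + eterm N m (l - \<i> * of_real pi) = \<i> / (rootc * exp (l / 2) * \<nu> ^ m) * ucoef m * (q * \<i> ^ m * E)"
  unfolding e1 e2 by (simp add: algebra_simps)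
 also have "\<dots> = E * ((ucoef m / rootc) * (\<i> ^ m * q' / (exp (l / 2) * \<nu> ^ m)))"
  unfolding qq(2) by (simp add: mult_ac)
 also have "\<dots> = E * (hcoef m / of_real pi * exp (- (of_nat m + 1 / 2) * (l - \<i> * of_real (pi / 2))))"
 proof -
  have "exp (- (of_nat m + 1 / 2) * (l - \<i> * of_real (pi / 2))) = exp (\<i> * of_real (pi / 2) * of_nat m) * exp (\<i> * of_real (pi / 4)) * exp (- (l / 2)) * exp (- (of_nat m * l))"
   unfolding exp_add[symmetric] by (simp add: algebra_simps)
  also have "\<dots> = \<i> ^ m * q' / (exp (l / 2) * \<nu> ^ m)"
   unfolding exp_i_half_pi_mult q'_def \<nu>_def exp_of_nat_mult[symmetric] by (simp add: exp_minus field_simps)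
  finally show ?thesis by (simp only: hcoef_rootc)
 qed
 also have "E = exp (- (exp (l - \<i> * of_real (pi / 2)) * of_real \<xi>))"
  unfolding exp_diff_i_half_pi E_def \<nu>_def by simp
 finally show ?thesis by simp
qed

text \<open>Reduces \<open>R_NM\<close> outside the right half-plane to its values inside and to the
  remainder of the expansion of H, so that no integral representation is needed there.\<close>

lemma R_NM_connection:
 assumes "M \<le> 2 * N"
 shows "R_NM N M \<beta> l + R_NM N M \<beta> (l - \<i> * of_real pi) =
  exp (- (exp (l - \<i> * of_real (pi / 2)) * of_real \<xi>)) * hrem M (l - \<i> * of_real (pi / 2)) / of_real pi"
proof -
 let ?s = "l - \<i> * of_real (pi / 2)"
 let ?e = "exp (- (exp ?s * of_real \<xi>))"
 have "R_NM N M \<beta> l + R_NM N M \<beta> (l - \<i> * of_real pi) = saddle_integral \<beta> ?s / of_real pi - (\<Sum>m<M. eterm N m l + eterm N m (l - \<i> * of_real pi))"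
  unfolding R_NM_eq R_N_connection[of N l, symmetric] by (simp add: sum.distrib)
 also have "(\<Sum>m<M. eterm N m l + eterm N m (l - \<i> * of_real pi)) = (\<Sum>m<M. ?e * (hcoef m * exp (- (of_nat m + 1 / 2) * ?s)) / of_real pi)"
  using assms by (intro sum.cong refl eterm_connection) auto
 also have "saddle_integral \<beta> ?s = ?e * (exp (exp ?s * of_real \<xi>) * saddle_integral \<beta> ?s)"
  by (simp add: exp_minus field_simps)
 finally show ?thesis
  by (simp add: hrem_def sum_distrib_left sum_divide_distrib right_diff_distrib diff_divide_distrib)
qed

end

section \<open>The integral representation of \<open>R_NM\<close>\<close>

lemma stieltjes_integrable:
 assumes p: "0 < p" and c: "0 < c" and w: "(w :: complex) \<notin> \<real>\<^sub>\<le>\<^sub>0"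
 shows "set_integrable lborel {0<..} (\<lambda>t. complex_of_real (t powr (p - 1) * exp (- (c * t))) / (w + of_real t))"
proof -
 obtain d where d: "d > 0" "\<And>w' t. norm (w' - w) < d \<Longrightarrow> 0 \<le> t \<Longrightarrow> d \<le> norm (w' + of_real t)"
  using cut_plane_dist[OF w] by blast
 show ?thesis
  unfolding set_integrable_def
 proof (rule Bochner_Integration.integrable_bound)
  show "integrable lborel (\<lambda>t. (1 / d) * (indicator {0<..} t *\<^sub>R (t powr (p - 1) * exp (- (c * t)))))"
   using gamma_integral_scaled(1)[OF p c] unfolding set_integrable_def by (rule integrable_mult_right)
  show "(\<lambda>t. indicator {0<..} t *\<^sub>R (complex_of_real (t powr (p - 1) * exp (- (c * t))) / (w + of_real t))) \<in> borel_measurable lborel"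
   by measurable
  show "AE t in lborel. norm (indicator {0<..} t *\<^sub>R (complex_of_real (t powr (p - 1) * exp (- (c * t))) / (w + of_real t)))
   \<le> norm ((1 / d) * (indicator {0<..} t *\<^sub>R (t powr (p - 1) * exp (- (c * t)))))"
  proof (rule AE_I2)
   fix t :: real
   show "norm (indicator {0<..} t *\<^sub>R (complex_of_real (t powr (p - 1) * exp (- (c * t))) / (w + of_real t)))
   \<le> norm ((1 / d) * (indicator {0<..} t *\<^sub>R (t powr (p - 1) * exp (- (c * t)))))"
    using d(2)[of w t] d(1) by (cases "0 < t") (simp_all add: norm_divide norm_mult frac_le)
  qed
 qed
qed

lemma stieltjes_scaled:
 assumes p: "0 < p" and c: "0 < c" 
 shows "(LBINT t:{0<..}. complex_of_real (t powr (p - 1) * exp (- (c * t))) / (w + of_real t))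
  = of_real (c powr (1 - p)) * stieltjes p (of_real c * w)"
proof -
 let ?f = "\<lambda>t. indicator {0<..} t *\<^sub>R (complex_of_real (t powr (p - 1) * exp (- t)) / (of_real c * w + of_real t))"
 have "stieltjes p (of_real c * w) = c *\<^sub>R (LBINT t. ?f (0 + c * t))"
  unfolding stieltjes_def set_lebesgue_integral_def
  using lborel_integral_real_affine[of c ?f 0] c by simp
 also have "(LBINT t. ?f (0 + c * t)) = (LBINT t. of_real (c powr (p - 1) / c) * (indicator {0<..} t *\<^sub>R (complex_of_real (t powr (p - 1) * exp (- (c * t))) / (w + of_real t))))"
 proof (rule Bochner_Integration.integral_cong[OF refl])
  fix t :: real
  have "of_real c * w + of_real (c * t) = of_real c * (w + of_real t)" by (simp add: distrib_left)
  then show "?f (0 + c * t) = of_real (c powr (p - 1) / c) * (indicator {0<..} t *\<^sub>R (complex_of_real (t powr (p - 1) * exp (- (c * t))) / (w + of_real t)))"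
   using c by (cases "0 < t") (simp_all add: powr_mult zero_less_mult_iff)
 qed
 also have "\<dots> = of_real (c powr (p - 1) / c) * (LBINT t:{0<..}. complex_of_real (t powr (p - 1) * exp (- (c * t))) / (w + of_real t))"
  unfolding set_lebesgue_integral_def by (simp only: Bochner_Integration.integral_mult_right_zero)
 finally have "stieltjes p (of_real c * w) = of_real (c powr (p - 1)) * (LBINT t:{0<..}. complex_of_real (t powr (p - 1) * exp (- (c * t))) / (w + of_real t))"
  using c by (simp add: scaleR_conv_of_real)
 moreover have "complex_of_real (c powr (1 - p)) * of_real (c powr (p - 1)) = 1"
  using c by (simp flip: of_real_mult powr_add)
 ultimately show ?thesis by (simp flip: mult.assoc)
qed

lemma lorentz_partial_fractions:
 assumes "0 < Re \<nu>"
 shows "\<nu> / (\<nu>\<^sup>2 + of_real (t\<^sup>2)) = \<i> / 2 * (1 / (\<i> * \<nu> + of_real t) - 1 / (- \<i> * \<nu> + of_real t))"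
proof -
 have nz: "\<i> * \<nu> + of_real t \<noteq> 0" "- \<i> * \<nu> + of_real t \<noteq> 0" using assms by (auto simp: complex_eq_iff)
 have e: "\<nu>\<^sup>2 + of_real (t\<^sup>2) = (\<i> * \<nu> + of_real t) * (- \<i> * \<nu> + of_real t)"
  by (simp add: algebra_simps power2_eq_square)
 show ?thesis unfolding e using nz by (simp add: divide_simps) 
qed

context phase_setup
begin

text \<open>The linear functional behind the integral for \<open>R_N\<close>: applied to r(t) =
  e^(\<xi>t) H(t) it gives \<open>R_N\<close>. With e^(-\<xi>t) split off, single terms and
  remainders of the expansion can be inserted for r.\<close>

definition lorentz_integral :: "nat \<Rightarrow> complex \<Rightarrow> (real \<Rightarrow> complex) \<Rightarrow> complex" where
 "lorentz_integral N l r = (- 1) ^ N / (of_real (pi\<^sup>2) * exp l ^ (2 * N)) *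
  (LBINT t:{0<..}. of_real (t ^ (2 * N)) * (exp l / ((exp l)\<^sup>2 + of_real (t\<^sup>2))) * (of_real (exp (- (\<xi> * t))) * r t))"

text \<open>Partial fractions split the kernel into 1/(\<i>\<nu> + t) and 1/(-\<i>\<nu> + t), and
  each yields one of the two terminants after scaling t by \<xi>. The rest of the proof matches
  powers of \<i> and eighth roots of unity.\<close>

lemma eterm_integral:
 assumes l: "\<bar>Im l\<bar> < pi / 2" and m: "m < 2 * N"
 shows "eterm N m l = lorentz_integral N l (\<lambda>t. hcoef m * of_real (t powr (- (real m + 1 / 2))))"
  and "set_integrable lborel {0<..} (\<lambda>t. of_real (t ^ (2 * N)) * (exp l / ((exp l)\<^sup>2 + of_real (t\<^sup>2))) *
    (of_real (exp (- (\<xi> * t))) * (hcoef m * of_real (t powr (- (real m + 1 / 2))))))"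
proof -
 define \<nu> where "\<nu> = exp l"
 have \<nu>: "0 < Re \<nu>" using l by (auto simp: \<nu>_def Re_exp intro!: mult_pos_pos cos_gt_zero_pi)
 have \<nu>0: "\<nu> \<noteq> 0" by (simp add: \<nu>_def)
 define p where "p = 2 * real N - real m + 1 / 2"
 have p: "1 < p" using m by (auto simp: p_def)
 define lp where "lp = l + \<i> * of_real (pi / 2) + of_real (ln \<xi>)"
 define lm where "lm = l - \<i> * of_real (pi / 2) + of_real (ln \<xi>)"
 have exp_lp: "exp lp = of_real \<xi> * (\<i> * \<nu>)" and exp_lm: "exp lm = of_real \<xi> * (- \<i> * \<nu>)"
  using exp_add_i_half_pi[of l] exp_diff_i_half_pi[of l] \<xi>_pos
  unfolding lp_def lm_def exp_add[of _ "of_real (ln \<xi>)"] \<nu>_def by (simp_all add: exp_of_real)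
 have im: "\<bar>Im lp\<bar> < pi" "\<bar>Im lm\<bar> < pi" using l by (auto simp: lp_def lm_def)
 have w: "\<i> * \<nu> \<notin> \<real>\<^sub>\<le>\<^sub>0" "- \<i> * \<nu> \<notin> \<real>\<^sub>\<le>\<^sub>0"
  using \<nu> by (auto simp: complex_nonpos_Reals_iff)
 define S where "S w = (LBINT t:{0<..}. complex_of_real (t powr (p - 1) * exp (- (\<xi> * t))) / (w + of_real t))" for w
 \<comment> \<open>The prefactor common to both terminants; since p = 2N - m + 1/2 it is just
   (-1)^m/(2\<pi>).\<close>
 define X where "X = exp (of_real (pi * p) * \<i>) / (2 * of_real pi * \<i>)"
 have E: "exp (exp L) * terminant p L = X * exp (of_real (1 - p) * L) * (of_real (\<xi> powr (p - 1)) * S w)"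
  if "\<bar>Im L\<bar> < pi" "exp L = of_real \<xi> * w" for L w
 proof -
  have "of_real (\<xi> powr (p - 1)) * S w = (of_real (\<xi> powr (p - 1)) * of_real (\<xi> powr (1 - p))) * stieltjes p (exp L)"
   unfolding S_def that(2) using p \<xi>_pos by (subst stieltjes_scaled) auto
  also have "complex_of_real (\<xi> powr (p - 1)) * of_real (\<xi> powr (1 - p)) = 1"
   using \<xi>_pos by (simp flip: of_real_mult powr_add)
  finally show ?thesis
   using terminant_stieltjes[OF p that(1)] by (simp add: X_def)
 qed
 have shift: "exp (of_real (1 - p) * (u + of_real (ln \<xi>))) * of_real (\<xi> powr (p - 1)) = exp (of_real (1 - p) * u)" for u :: complex
 proof -
  have "complex_of_real (\<xi> powr (p - 1)) = exp (of_real ((p - 1) * ln \<xi>))"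
   using \<xi>_pos by (simp add: powr_def flip: exp_of_real)
  then show ?thesis unfolding exp_add[symmetric] by (simp add: algebra_simps flip: exp_add)
 qed
 have Tp: "exp (\<i> * \<nu> * of_real \<xi>) * Tplus N m l = X * exp (of_real (1 - p) * (l + \<i> * of_real (pi / 2))) * S (\<i> * \<nu>)"
  using E[OF im(1) exp_lp] unfolding Tplus_def p_def[symmetric] lp_def[symmetric] exp_lp
  using shift[of "l + \<i> * of_real (pi / 2)"] unfolding lp_def[symmetric] by (simp add: mult_ac)
 have Tm: "exp (- \<i> * \<nu> * of_real \<xi>) * Tminus N m l = X * exp (of_real (1 - p) * (l - \<i> * of_real (pi / 2))) * S (- \<i> * \<nu>)"
  using E[OF im(2) exp_lm] unfolding Tminus_def p_def[symmetric] lm_def[symmetric] exp_lm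
  using shift[of "l - \<i> * of_real (pi / 2)"] unfolding lm_def[symmetric] by (simp add: mult_ac)
 define q where "q = exp (- \<i> * of_real (pi / 4))"
 define q' where "q' = exp (\<i> * of_real (pi / 4))"
 have q: "q * q' = 1" "q' * q = 1" by (simp_all add: q_def q'_def flip: exp_add)
 have q2: "exp (of_real (pi / 2) * \<i>) = \<i>" using exp_add_i_half_pi[of 0] by (simp add: mult.commute)
 have expX: "exp (of_real (pi * p) * \<i>) = \<i> * (- 1) ^ m"
 proof -
  have "of_real (pi * p) * \<i> = of_nat N * (2 * of_real pi * \<i>) + of_real (pi / 2) * \<i> - of_nat m * (of_real pi * \<i>)"
   by (simp add: p_def algebra_simps)
  then show ?thesis
   by (simp only: exp_add exp_diff exp_of_nat_mult exp_two_pi_i exp_pi_i q2 power_one)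
    (cases "even m"; simp)
 qed
 have e1: "exp (of_real (1 - p) * l) = \<nu> ^ m * exp (l / 2) / \<nu> ^ (2 * N)"
 proof -
  have "of_real (1 - p) * l = of_nat m * l + l / 2 - of_nat (2 * N) * l"
   by (simp add: p_def algebra_simps)
  then show ?thesis by (simp only: exp_add exp_diff exp_of_nat_mult \<nu>_def)
 qed
 have sgnN: "(- 1) ^ N * (- 1) ^ N = (1 :: complex)" by (simp flip: power_add)
 have e2: "exp (of_real (1 - p) * (\<i> * of_real (pi / 2))) = \<i> ^ m * q' * (- 1) ^ N"
 proof -
  have "of_real (1 - p) * (\<i> * of_real (pi / 2)) = \<i> * of_real (pi / 2) * of_nat m + \<i> * of_real (pi / 4) - of_nat N * (of_real pi * \<i>)"
   by (simp add: p_def algebra_simps)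
  then show ?thesis
   by (simp only: exp_add exp_diff exp_of_nat_mult exp_i_half_pi_mult exp_pi_i q'_def) (cases "even N"; simp)
 qed
 have e3: "exp (of_real (1 - p) * (- (\<i> * of_real (pi / 2)))) = (- \<i>) ^ m * q * (- 1) ^ N"
 proof -
  have eq: "of_real (1 - p) * (- (\<i> * of_real (pi / 2))) = - \<i> * of_real (pi / 4) - \<i> * of_real (pi / 2) * of_nat m + of_nat N * (of_real pi * \<i>)"
   by (simp add: p_def algebra_simps)
  have "1 / \<i> ^ m = (- \<i>) ^ m"
   by (induction m) (simp_all add: field_simps)
  then have "q / \<i> ^ m = (- \<i>) ^ m * q" by (metis divide_inverse inverse_eq_divide mult.commute)
  moreover have "exp (of_real (1 - p) * (- (\<i> * of_real (pi / 2)))) = q / \<i> ^ m * (- 1) ^ N"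
   unfolding eq by (simp only: exp_add exp_diff exp_of_nat_mult exp_i_half_pi_mult exp_pi_i q_def)
  ultimately show ?thesis by (simp only:)
 qed
 have im_m: "\<i> ^ m * ((- 1) ^ m * \<i> ^ m) = 1" "(- \<i>) ^ m * ((- 1) ^ m * (- \<i>) ^ m) = 1"
  by (simp_all flip: power_mult_distrib)
 have "q * \<i> ^ m * (exp (\<i> * \<nu> * of_real \<xi>) * Tplus N m l) - q' * (- \<i>) ^ m * (exp (- \<i> * \<nu> * of_real \<xi>) * Tminus N m l)
  = (1 / (2 * of_real pi)) * (\<nu> ^ m * exp (l / 2) / \<nu> ^ (2 * N)) * (- 1) ^ N * (S (\<i> * \<nu>) - S (- \<i> * \<nu>))"
 proof -
  have X: "X = (- 1) ^ m / (2 * of_real pi)" unfolding X_def expX by simp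
  have a: "exp (of_real (1 - p) * (l + \<i> * of_real (pi / 2))) = \<nu> ^ m * exp (l / 2) / \<nu> ^ (2 * N) * (\<i> ^ m * q' * (- 1) ^ N)"
   unfolding distrib_left exp_add e1 e2 ..
  have b: "exp (of_real (1 - p) * (l - \<i> * of_real (pi / 2))) = \<nu> ^ m * exp (l / 2) / \<nu> ^ (2 * N) * ((- \<i>) ^ m * q * (- 1) ^ N)"
   unfolding diff_conv_add_uminus[of l] distrib_left exp_add e1 e3 ..
  define V where "V = \<nu> ^ m * exp (l / 2) / \<nu> ^ (2 * N)"
  have "q * \<i> ^ m * (X * (V * (\<i> ^ m * q' * (- 1) ^ N)) * S (\<i> * \<nu>)) = (q * q') * (\<i> ^ m * ((- 1) ^ m * \<i> ^ m)) * ((1 / (2 * of_real pi)) * V * (- 1) ^ N * S (\<i> * \<nu>))"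
   unfolding X by simp
  moreover have "q' * (- \<i>) ^ m * (X * (V * ((- \<i>) ^ m * q * (- 1) ^ N)) * S (- \<i> * \<nu>)) = (q' * q) * ((- \<i>) ^ m * ((- 1) ^ m * (- \<i>) ^ m)) * ((1 / (2 * of_real pi)) * V * (- 1) ^ N * S (- \<i> * \<nu>))"
   unfolding X by simp
  ultimately show ?thesis
   unfolding Tp Tm a b V_def[symmetric] q im_m by (simp only: mult_1_left right_diff_distrib)
 qed
 then have "eterm N m l = \<i> / (rootc * exp (l / 2) * \<nu> ^ m) * ucoef m * ((1 / (2 * of_real pi)) * (\<nu> ^ m * exp (l / 2) / \<nu> ^ (2 * N)) * (- 1) ^ N * (S (\<i> * \<nu>) - S (- \<i> * \<nu>)))"
  unfolding eterm_def \<nu>_def[symmetric] q_def[symmetric] q'_def[symmetric] by (simp only:)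
 also have "\<dots> = (- 1) ^ N / (of_real pi * \<nu> ^ (2 * N)) * (ucoef m / rootc) * (\<i> / 2 * (S (\<i> * \<nu>) - S (- \<i> * \<nu>)))"
  using \<nu>0 rootc_nz by (simp add: field_simps)
 also have "\<dots> = (- 1) ^ N / (of_real (pi\<^sup>2) * \<nu> ^ (2 * N)) * (hcoef m * (\<i> / 2 * (S (\<i> * \<nu>) - S (- \<i> * \<nu>))))"
  unfolding hcoef_rootc[symmetric] by (simp add: power2_eq_square mult_ac)
 finally have et: "eterm N m l = (- 1) ^ N / (of_real (pi\<^sup>2) * \<nu> ^ (2 * N)) * (hcoef m * (\<i> / 2 * (S (\<i> * \<nu>) - S (- \<i> * \<nu>))))" .
 let ?k = "\<lambda>w t. complex_of_real (t powr (p - 1) * exp (- (\<xi> * t))) / (w + of_real t)"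
 have p0: "0 < p" using p by simp
 note i1 = stieltjes_integrable[OF p0 \<xi>_pos w(1)] and i2 = stieltjes_integrable[OF p0 \<xi>_pos w(2)]
 have eq: "of_real (t ^ (2 * N)) * (\<nu> / (\<nu>\<^sup>2 + of_real (t\<^sup>2))) * (of_real (exp (- (\<xi> * t))) * (hcoef m * of_real (t powr (- (real m + 1 / 2)))))
  = hcoef m * (\<i> / 2 * (?k (\<i> * \<nu>) t - ?k (- \<i> * \<nu>) t))" if "t \<in> {0<..}" for t
 proof -
  have "t ^ (2 * N) * t powr (- (real m + 1 / 2)) = t powr (p - 1)"
   using that by (simp add: p_def powr_realpow[symmetric] powr_add[symmetric] algebra_simps)
  then have e: "complex_of_real (t ^ (2 * N)) * of_real (t powr (- (real m + 1 / 2))) = of_real (t powr (p - 1))"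
   by (simp only: of_real_mult[symmetric])
  have "of_real (t ^ (2 * N)) * (\<nu> / (\<nu>\<^sup>2 + of_real (t\<^sup>2))) * (of_real (exp (- (\<xi> * t))) * (hcoef m * of_real (t powr (- (real m + 1 / 2)))))
   = hcoef m * (of_real (t powr (p - 1)) * of_real (exp (- (\<xi> * t))) * (\<nu> / (\<nu>\<^sup>2 + of_real (t\<^sup>2))))"
   unfolding e[symmetric] by (simp only: mult_ac)
  then show ?thesis unfolding lorentz_partial_fractions[OF \<nu>] of_real_mult[symmetric]
   by (simp only: right_diff_distrib times_divide_eq_right mult_1_right mult.left_commute[of "_ / 2"] mult.assoc)
    (simp add: mult_ac)
 qed
 show "set_integrable lborel {0<..} (\<lambda>t. of_real (t ^ (2 * N)) * (exp l / ((exp l)\<^sup>2 + of_real (t\<^sup>2))) *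
    (of_real (exp (- (\<xi> * t))) * (hcoef m * of_real (t powr (- (real m + 1 / 2))))))"
  unfolding \<nu>_def[symmetric]
  by (subst set_integrable_cong[OF refl refl eq])
   (assumption, intro set_integrable_mult_right set_integral_diff(1) i1 i2)
 show "eterm N m l = lorentz_integral N l (\<lambda>t. hcoef m * of_real (t powr (- (real m + 1 / 2))))"
 proof -
  have "(LBINT t:{0<..}. of_real (t ^ (2 * N)) * (\<nu> / (\<nu>\<^sup>2 + of_real (t\<^sup>2))) * (of_real (exp (- (\<xi> * t))) * (hcoef m * of_real (t powr (- (real m + 1 / 2))))))
   = (LBINT t:{0<..}. hcoef m * (\<i> / 2 * (?k (\<i> * \<nu>) t - ?k (- \<i> * \<nu>) t)))"
   by (rule set_lebesgue_integral_cong) (use eq in auto)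
  also have "\<dots> = hcoef m * (\<i> / 2 * (S (\<i> * \<nu>) - S (- \<i> * \<nu>)))"
   by (simp only: set_integral_mult_right set_integral_diff(2)[OF i1 i2] S_def)
  finally show ?thesis
   unfolding et lorentz_integral_def \<nu>_def[symmetric] by (simp only:)
 qed
qed

lemma R_NM_integral:
 assumes l: "\<bar>Im l\<bar> < pi / 2" and M: "M \<le> 2 * N"
 shows "R_NM N M \<beta> l = lorentz_integral N l (\<lambda>t. hrem M (of_real (ln t)))"
proof -
 define \<nu> where "\<nu> = exp l"
 have \<nu>: "0 < Re \<nu>" using l by (auto simp: \<nu>_def Re_exp intro!: mult_pos_pos cos_gt_zero_pi)
 define C where "C = (- 1) ^ N / (of_real (pi\<^sup>2) * \<nu> ^ (2 * N))"
 define K where "K t = of_real (t ^ (2 * N)) * (\<nu> / (\<nu>\<^sup>2 + of_real (t\<^sup>2)))" for t :: real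
 define g where "g m t = K t * (of_real (exp (- (\<xi> * t))) * (hcoef m * of_real (t powr (- (real m + 1 / 2)))))" for m t
 have gi: "set_integrable lborel {0<..} (g m)" and ge: "eterm N m l = C * (LBINT t:{0<..}. g m t)" if "m < M" for m
 proof -
  have m: "m < 2 * N" using that M by simp
  show "set_integrable lborel {0<..} (g m)"
   using eterm_integral(2)[OF l m] unfolding g_def[abs_def] K_def[abs_def] \<nu>_def .
  show "eterm N m l = C * (LBINT t:{0<..}. g m t)"
   using eterm_integral(1)[OF l m] unfolding g_def[abs_def] K_def[abs_def] \<nu>_def C_def lorentz_integral_def .
 qed
 have wi: "set_integrable lborel {0<..} (\<lambda>t. K t * W t)"
  unfolding K_def by (rule lorentz_W_integrable[OF \<nu>])
 have we: "R_N N \<beta> l = C * (LBINT t:{0<..}. K t * W t)"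
  using R_N_integral[OF l, of N] unfolding K_def C_def \<nu>_def .
 have si: "set_integrable lborel {0<..} (\<lambda>t. \<Sum>m<M. g m t)"
  using gi unfolding set_integrable_def scaleR_sum_right by (intro Bochner_Integration.integrable_sum) auto
 have ss: "(LBINT t:{0<..}. (\<Sum>m<M. g m t)) = (\<Sum>m<M. LBINT t:{0<..}. g m t)"
  using gi unfolding set_integrable_def set_lebesgue_integral_def scaleR_sum_right by (intro Bochner_Integration.integral_sum) auto
 have eq: "K t * (of_real (exp (- (\<xi> * t))) * hrem M (of_real (ln t))) = K t * W t - (\<Sum>m<M. g m t)" if "t \<in> {0<..}" for t
 proof -
  have t: "t > 0" using that by simp
  have 1: "exp (- (of_nat m + 1 / 2) * complex_of_real (ln t)) = of_real (t powr (- (real m + 1 / 2)))" for m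
   using t by (simp add: powr_def exp_of_real[symmetric])
  have 2: "complex_of_real (exp (- (\<xi> * t))) * exp (exp (complex_of_real (ln t)) * of_real \<xi>) = 1"
   using t by (simp add: exp_of_real mult.commute flip: of_real_mult exp_add)
  have 3: "saddle_integral \<beta> (of_real (ln t)) = W t"
   using saddle_integral_real[of "ln t"] t by simp
  have "of_real (exp (- (\<xi> * t))) * hrem M (of_real (ln t)) = (of_real (exp (- (\<xi> * t))) * exp (exp (complex_of_real (ln t)) * of_real \<xi>)) * W t
   - (\<Sum>m<M. of_real (exp (- (\<xi> * t))) * (hcoef m * of_real (t powr (- (real m + 1 / 2)))))"
   unfolding hrem_def 1 3 by (simp only: right_diff_distrib sum_distrib_left mult.assoc)
  then show ?thesis unfolding 2 by (simp only: right_diff_distrib sum_distrib_left g_def mult_1_left)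
 qed
 have "lorentz_integral N l (\<lambda>t. hrem M (of_real (ln t))) = C * (LBINT t:{0<..}. K t * (of_real (exp (- (\<xi> * t))) * hrem M (of_real (ln t))))"
  by (simp only: lorentz_integral_def C_def K_def \<nu>_def)
 also have "(LBINT t:{0<..}. K t * (of_real (exp (- (\<xi> * t))) * hrem M (of_real (ln t)))) = (LBINT t:{0<..}. K t * W t - (\<Sum>m<M. g m t))"
  by (rule set_lebesgue_integral_cong) (use eq in auto)
 also have "\<dots> = (LBINT t:{0<..}. K t * W t) - (\<Sum>m<M. LBINT t:{0<..}. g m t)"
  by (subst set_integral_diff(2)[OF wi si]) (simp only: ss)
 finally show ?thesis
  unfolding R_NM_eq we using ge by (simp add: right_diff_distrib sum_distrib_left)
qed

end

section \<open>Rotating the line of integration\<close>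

text \<open>Both sides are limits, over [e^(-R), e^R] and [-R, R], of integrals for which the
  substitution rule for continuous integrands applies. In the variable s = log t a rotation of the
  line becomes a vertical shift.\<close>

lemma integral_exp_substitution:
 fixes f :: "real \<Rightarrow> complex"
 assumes cont: "continuous_on {0<..} f" and f: "set_integrable lborel {0<..} f"
  and g: "integrable lborel (\<lambda>s. of_real (exp s) * f (exp s))"
 shows "(LBINT t:{0<..}. f t) = (LBINT s. of_real (exp s) * f (exp s))"
proof -
 have fin: "(LBINT t:{exp (-R)..exp R}. f t) = (LBINT s:{-R..R}. of_real (exp s) * f (exp s))" if "0 \<le> R" for R
 proof -
  have c: "continuous_on {exp (-R)..exp R} f"
   by (rule continuous_on_subset[OF cont]) (auto intro: less_le_trans[OF exp_gt_zero])
  have c2: "continuous_on {-R..R} (\<lambda>s. of_real (exp s) * f (exp s))"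
   by (intro continuous_intros continuous_on_compose2[OF cont]) auto
  have "((\<lambda>s. exp s *\<^sub>R f (exp s)) has_integral (integral {exp (-R)..exp R} f)) {-R..R}"
   using that by (intro has_integral_substitution[where c="exp (-R)" and d="exp R"] c)
    (auto intro!: derivative_eq_intros)
  then show ?thesis
   by (simp add: set_integral_Icc_eq_integral[OF c] set_integral_Icc_eq_integral[OF c2] integral_unique scaleR_conv_of_real)
 qed
 have lim1: "((\<lambda>R. LBINT t:{exp (-R)..exp R}. f t) \<longlongrightarrow> (LBINT t:{0<..}. f t)) at_top"
 proof (rule tendsto_at_topI_sequentially)
  fix X :: "nat \<Rightarrow> real" assume X: "filterlim X at_top sequentially"
  show "(\<lambda>n. LBINT t:{exp (-X n)..exp (X n)}. f t) \<longlonglongrightarrow> (LBINT t:{0<..}. f t)"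
   unfolding set_lebesgue_integral_def
  proof (rule integral_dominated_convergence)
   show "integrable lborel (\<lambda>t. norm (indicator {0<..} t *\<^sub>R f t))"
    using f unfolding set_integrable_def by (rule integrable_norm)
   show m: "(\<lambda>t. indicator {0<..} t *\<^sub>R f t) \<in> borel_measurable lborel"
    using f unfolding set_integrable_def by (rule borel_measurable_integrable)
   have sub: "{exp (-X n)..exp (X n)} \<subseteq> {0<..}" for n by (auto intro: less_le_trans[OF exp_gt_zero])
   show "(\<lambda>t. indicator {exp (-X n)..exp (X n)} t *\<^sub>R f t) \<in> borel_measurable lborel" for n
    using borel_measurable_continuous_on_indicator[of "{exp (-X n)..exp (X n)}" f] continuous_on_subset[OF cont sub] by simp
   show "AE t in lborel. norm (indicator {exp (-X n)..exp (X n)} t *\<^sub>R f t) \<le> norm (indicator {0<..} t *\<^sub>R f t)" for n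
    by (rule AE_I2) (use sub[of n] in \<open>auto split: split_indicator\<close>)
   show "AE t in lborel. (\<lambda>n. indicator {exp (-X n)..exp (X n)} t *\<^sub>R f t) \<longlonglongrightarrow> indicator {0<..} t *\<^sub>R f t"
   proof
    fix t :: real
    show "(\<lambda>n. indicator {exp (-X n)..exp (X n)} t *\<^sub>R f t) \<longlonglongrightarrow> indicator {0<..} t *\<^sub>R f t"
    proof (cases "0 < t")
     case True
     from X have "eventually (\<lambda>n. \<bar>ln t\<bar> \<le> X n) sequentially"
      unfolding filterlim_at_top_ge[where c="\<bar>ln t\<bar>"] by auto
     then have "eventually (\<lambda>n. t \<in> {exp (-X n)..exp (X n)}) sequentially"
     proof eventually_elim
      case (elim n)
      then have "exp (- X n) \<le> exp (ln t)" "exp (ln t) \<le> exp (X n)" by (simp_all only: exp_le_cancel_iff)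
      then show ?case using True by simp
     qed
     then show ?thesis using True by (intro tendsto_eventually, elim eventually_mono) simp
    next
     case False
     then have "t \<notin> {exp (-X n)..exp (X n)}" for n using sub[of n] by auto
     then show ?thesis using False by simp
    qed
   qed
  qed
 qed
 have "((\<lambda>R. LBINT t:{exp (-R)..exp R}. f t) \<longlongrightarrow> (LBINT s. of_real (exp s) * f (exp s))) at_top"
 proof (rule Lim_transform_eventually[OF integral_symmetric_tendsto[OF g]])
  show "\<forall>\<^sub>F R in at_top. (LBINT s:{-R..R}. of_real (exp s) * f (exp s)) = (LBINT t:{exp (-R)..exp R}. f t)"
   using eventually_ge_at_top[of 0] by eventually_elim (simp add: fin)
 qed
 from tendsto_unique[OF _ lim1 this] show ?thesis by simp
qed

lemma exp_growth_decay_bound: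
 fixes p c :: real
 assumes "1 / 2 \<le> p" "0 < c"
 obtains D where "\<And>x. exp (p * x - c * exp x) \<le> D * exp (- (1 / 2) * \<bar>x\<bar>)"
proof -
 obtain D where D: "\<And>a b c' x. c \<le> a \<Longrightarrow> b \<le> p \<Longrightarrow> c' \<le> 0 \<Longrightarrow> 0 \<le> x \<Longrightarrow> exp (- a * exp x + b * x + c') \<le> D * exp (- x)"
  using exp_dominated[OF assms(2), of p 0] by blast
 show ?thesis
 proof (rule that[of "max D 1"])
  fix x :: real
  show "exp (p * x - c * exp x) \<le> max D 1 * exp (- (1 / 2) * \<bar>x\<bar>)"
  proof (cases "0 \<le> x")
   case True
   have "exp (p * x - c * exp x) \<le> D * exp (- x)" using D[of c p 0 x] True by (simp add: algebra_simps)
   also have "\<dots> \<le> max D 1 * exp (- (1 / 2) * \<bar>x\<bar>)" using True by (intro mult_mono) auto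
   finally show ?thesis .
  next
   case False
   have "p * x \<le> 1 / 2 * x" using assms False by (intro mult_right_mono_neg) auto
   moreover have "0 \<le> c * exp x" using assms by simp
   ultimately have "exp (p * x - c * exp x) \<le> exp (1 / 2 * x)"
    by (simp only: exp_le_cancel_iff)
   also have "\<dots> \<le> max D 1 * exp (1 / 2 * x)" using mult_right_mono[of 1 "max D 1" "exp (1 / 2 * x)"] by simp
   finally show ?thesis using False by simp
  qed
 qed
qed

lemma gamma_integral_exp:
 fixes p c :: real
 assumes "1 / 2 \<le> p" "0 < c"
 shows "integrable lborel (\<lambda>x. exp (p * x - c * exp x))"
  and "(LBINT x. exp (p * x - c * exp x)) = Gamma p / c powr p"
proof -
 obtain D where D: "\<And>x. exp (p * x - c * exp x) \<le> D * exp (- (1 / 2) * \<bar>x\<bar>)"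
  using exp_growth_decay_bound[OF assms] by blast
 have ic: "integrable lborel (\<lambda>x. complex_of_real (exp (p * x - c * exp x)))"
  by (rule integrable_exp_decay[where c="1 / 2" and D=D]) (use D in \<open>auto intro!: continuous_intros\<close>)
 then show "integrable lborel (\<lambda>x. exp (p * x - c * exp x))"
  by (simp add: complex_of_real_integrable_eq)
 have i2: "set_integrable lborel {0<..} (\<lambda>t. t powr (p - 1) * exp (- (c * t)))"
  using assms by (intro gamma_integral_scaled) auto
 have eq: "of_real (exp s) * complex_of_real (exp s powr (p - 1) * exp (- (c * exp s))) = complex_of_real (exp (p * s - c * exp s))" for s
  unfolding of_real_mult[symmetric] by (simp add: powr_def exp_add[symmetric] algebra_simps)
 have "complex_of_real (LBINT t:{0<..}. t powr (p - 1) * exp (- (c * t))) = (LBINT t:{0<..}. complex_of_real (t powr (p - 1) * exp (- (c * t))))"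
  by (simp only: set_integral_complex_of_real)
 also have "\<dots> = (LBINT s. complex_of_real (exp (p * s - c * exp s)))"
 proof (subst integral_exp_substitution)
  show "continuous_on {0<..} (\<lambda>t. complex_of_real (t powr (p - 1) * exp (- (c * t))))"
   by (intro continuous_intros) auto
  show "set_integrable lborel {0<..} (\<lambda>t. complex_of_real (t powr (p - 1) * exp (- (c * t))))"
   using i2 by (simp add: set_integrable_def complex_of_real_integrable_eq scaleR_conv_of_real flip: of_real_mult)
 qed (use ic in \<open>simp_all only: eq\<close>)
 also have "\<dots> = complex_of_real (LBINT s. exp (p * s - c * exp s))"
  by (rule integral_complex_of_real)
 finally show "(LBINT x. exp (p * x - c * exp x)) = Gamma p / c powr p"
  using gamma_integral_scaled(2)[of p c] assms by (simp only: of_real_eq_iff)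
qed

text \<open>If cos \<psi> \<ge> 0, the real part is at least 1. Otherwise the squared modulus is
  (\<rho> + cos \<psi>)^2 + (sin \<psi>)^2, so |sin \<psi>| is a lower bound.\<close>

lemma norm_one_plus_ge_sin:
 assumes "0 \<le> \<rho>" "\<bar>\<psi>\<bar> \<le> pi - \<delta>" "0 < \<delta>" "\<delta> \<le> pi / 2"
 shows "sin \<delta> \<le> norm (1 + of_real \<rho> * exp (\<i> * of_real \<psi>))"
proof (cases "\<bar>\<psi>\<bar> \<le> pi / 2")
 case True
 have "0 \<le> cos \<psi>" using True by (intro cos_ge_zero) auto
 then have "1 \<le> Re (1 + of_real \<rho> * exp (\<i> * of_real \<psi>))"
  using assms(1) by (simp add: Re_exp)
 also have "\<dots> \<le> norm (1 + of_real \<rho> * exp (\<i> * of_real \<psi>))" by (rule complex_Re_le_cmod)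
 finally show ?thesis using sin_le_one[of \<delta>] by linarith
next
 case False
 have "sin \<delta> \<le> sin (pi - \<bar>\<psi>\<bar>)"
  using False assms by (intro sin_monotone_2pi_le) auto
 then have s: "sin \<delta> \<le> \<bar>sin \<psi>\<bar>"
  by (cases "0 \<le> \<psi>") (auto simp: sin_diff)
 have "(sin \<psi>)\<^sup>2 \<le> (norm (1 + of_real \<rho> * exp (\<i> * of_real \<psi>)))\<^sup>2"
 proof -
  have "(norm (1 + of_real \<rho> * exp (\<i> * of_real \<psi>)))\<^sup>2 = (1 + \<rho> * cos \<psi>)\<^sup>2 + (\<rho> * sin \<psi>)\<^sup>2"
   by (simp add: cmod_power2 Re_exp Im_exp)
  also have "\<dots> = (sin \<psi>)\<^sup>2 + (\<rho> + cos \<psi>)\<^sup>2"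
  proof -
   have "\<rho>\<^sup>2 * (cos \<psi>)\<^sup>2 + \<rho>\<^sup>2 * (sin \<psi>)\<^sup>2 = \<rho>\<^sup>2" "(sin \<psi>)\<^sup>2 = 1 - (cos \<psi>)\<^sup>2"
    by (simp_all add: sin_squared_eq flip: distrib_left)
   then show ?thesis by (simp add: power2_eq_square algebra_simps)
  qed
  finally show ?thesis by simp
 qed
 then have "\<bar>sin \<psi>\<bar> \<le> norm (1 + of_real \<rho> * exp (\<i> * of_real \<psi>))"
  using abs_le_square_iff[of "sin \<psi>" "norm (1 + of_real \<rho> * exp (\<i> * of_real \<psi>))"] by simp
 with s show ?thesis by linarith
qed

text \<open>In s = log t the kernel has its poles at the heights arg \<nu> + \<pi>/2 and arg \<nu> -
  \<pi>/2. The line is moved by \<theta> in the direction of the sign of arg \<nu>, away from the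
  nearer pole, and is then at distance at least \<theta> from both. What remains on it is Euler's
  integral with \<xi> cos \<theta> in the exponent.\<close>

lemma rotated_bound:
 fixes l :: complex and r :: "complex \<Rightarrow> complex" and \<xi> \<theta> D :: real and N M :: nat
 defines "\<nu> \<equiv> exp l"
 assumes l: "\<bar>Im l\<bar> < pi / 2" and \<xi>: "0 < \<xi>" and \<theta>: "0 < \<theta>" "\<theta> \<le> pi / 4"
  and r: "r holomorphic_on UNIV" "\<And>s. \<bar>Im s\<bar> \<le> \<theta> \<Longrightarrow> norm (r s) \<le> D * exp (- (real M + 1 / 2) * Re s)"
  and p: "p = 2 * real N - real M + 1 / 2" "1 \<le> p"
 shows "norm (LBINT t:{0<..}. of_real (t ^ (2 * N)) * (\<nu> / (\<nu>\<^sup>2 + of_real (t\<^sup>2))) * (of_real (exp (- (\<xi> * t))) * r (of_real (ln t))))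
  \<le> D / (norm \<nu> * sin (2 * \<theta>)) * (Gamma p / (\<xi> * cos \<theta>) powr p)"
proof -
 define \<alpha> where "\<alpha> = Im l"
 define \<eta> where "\<eta> = (if 0 \<le> \<alpha> then \<theta> else - \<theta>)"
 define k where "k s = exp s * exp (of_nat (2 * N) * s) * (\<nu> / (\<nu>\<^sup>2 + (exp s)\<^sup>2)) * (exp (- (of_real \<xi> * exp s)) * r s)" for s
 define f where "f t = of_real (t ^ (2 * N)) * (\<nu> / (\<nu>\<^sup>2 + of_real (t\<^sup>2))) * (of_real (exp (- (\<xi> * t))) * r (of_real (ln t)))" for t
 have D0: "0 \<le> D" using order_trans[OF norm_ge_zero r(2)[of 0]] \<theta> by simp
 have \<nu>0: "0 < norm \<nu>" by (simp add: \<nu>_def)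
 have fact: "\<nu>\<^sup>2 + (exp s)\<^sup>2 = \<nu>\<^sup>2 * (1 + of_real (exp (2 * (Re s - Re l))) * exp (\<i> * of_real (2 * (Im s - \<alpha>))))" for s
 proof -
  have "of_real (exp (2 * (Re s - Re l))) * exp (\<i> * of_real (2 * (Im s - \<alpha>))) = exp (2 * (s - l))"
   unfolding exp_of_real[symmetric] exp_add[symmetric]
   by (rule arg_cong[where f=exp]) (simp add: complex_eq_iff \<alpha>_def)
  also have "\<dots> = (exp s)\<^sup>2 / \<nu>\<^sup>2"
   by (simp add: \<nu>_def exp_double[symmetric] exp_diff[symmetric] right_diff_distrib)
  finally have "of_real (exp (2 * (Re s - Re l))) * exp (\<i> * of_real (2 * (Im s - \<alpha>))) = (exp s)\<^sup>2 / \<nu>\<^sup>2" .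
  then show ?thesis using \<nu>0 by (simp add: field_simps)
 qed
 have kb: "norm (k s) \<le> D / (norm \<nu> * sin \<delta>) * exp (p * Re s - (\<xi> * cos (Im s)) * exp (Re s))"
  if s: "\<bar>Im s\<bar> \<le> \<theta>" "\<bar>2 * (Im s - \<alpha>)\<bar> \<le> pi - \<delta>" "0 < \<delta>" "\<delta> \<le> pi / 2" for s \<delta>
 proof -
  have sd: "0 < sin \<delta>" using s by (intro sin_gt_zero) auto
  have "sin \<delta> \<le> norm (1 + of_real (exp (2 * (Re s - Re l))) * exp (\<i> * of_real (2 * (Im s - \<alpha>))))"
   using s by (intro norm_one_plus_ge_sin) auto
  then have "(norm \<nu>)\<^sup>2 * sin \<delta> \<le> norm (\<nu>\<^sup>2 + (exp s)\<^sup>2)"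
   unfolding fact norm_mult norm_power by (intro mult_left_mono) auto
  moreover have "0 < (norm \<nu>)\<^sup>2 * sin \<delta>" using \<nu>0 sd by simp
  ultimately have "norm (\<nu> / (\<nu>\<^sup>2 + (exp s)\<^sup>2)) \<le> norm \<nu> / ((norm \<nu>)\<^sup>2 * sin \<delta>)"
   unfolding norm_divide by (intro frac_le) auto
  also have "\<dots> = 1 / (norm \<nu> * sin \<delta>)" using \<nu>0 by (simp add: power2_eq_square)
  finally have 1: "norm (\<nu> / (\<nu>\<^sup>2 + (exp s)\<^sup>2)) \<le> 1 / (norm \<nu> * sin \<delta>)" .
  have "norm (k s) = exp (Re s) * exp (real (2 * N) * Re s) * norm (\<nu> / (\<nu>\<^sup>2 + (exp s)\<^sup>2)) * (exp (- (\<xi> * (exp (Re s) * cos (Im s)))) * norm (r s))"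
   unfolding k_def norm_mult norm_exp_eq_Re by (simp add: Re_exp)
  also have "\<dots> \<le> exp (Re s) * exp (real (2 * N) * Re s) * (1 / (norm \<nu> * sin \<delta>)) * (exp (- (\<xi> * (exp (Re s) * cos (Im s)))) * (D * exp (- (real M + 1 / 2) * Re s)))"
   using 1 r(2)[OF s(1)] sd \<nu>0 D0
   by (intro mult_mono mult_left_mono mult_nonneg_nonneg order_refl) (simp_all add: less_imp_le)
  also have "\<dots> = D / (norm \<nu> * sin \<delta>) * (exp (Re s) * exp (real (2 * N) * Re s) * exp (- (\<xi> * (exp (Re s) * cos (Im s)))) * exp (- (real M + 1 / 2) * Re s))"
   by simp
  also have "exp (Re s) * exp (real (2 * N) * Re s) * exp (- (\<xi> * (exp (Re s) * cos (Im s)))) * exp (- (real M + 1 / 2) * Re s)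
   = exp (p * Re s - (\<xi> * cos (Im s)) * exp (Re s))"
   unfolding exp_add[symmetric] p(1) by (simp add: algebra_simps)
  finally show ?thesis .
 qed
 \<comment> \<open>This \<delta> degenerates as |arg \<nu>| tends to \<pi>/2. It only justifies the
   shift and is absent from the final bound, where 2\<theta> takes its place.\<close>
 define \<delta> where "\<delta> = min (pi - 2 * \<bar>\<alpha>\<bar>) (pi / 2)"
 have \<delta>: "0 < \<delta>" using l by (auto simp: \<delta>_def \<alpha>_def)
 have \<delta>2: "\<delta> \<le> pi / 2" unfolding \<delta>_def by (rule min.cobounded2)
 note \<delta> = \<delta> \<delta>2
 have p2: "1 / 2 \<le> p" using p(2) by simp
 define c where "c = \<xi> * cos \<theta>"
 have cos\<theta>: "0 < cos \<theta>" using \<theta> by (intro cos_gt_zero_pi) auto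
 have c: "0 < c" using \<xi> cos\<theta> by (simp add: c_def)
 have cle: "c \<le> \<xi> * cos y" if "\<bar>y\<bar> \<le> \<theta>" for y
  using cos_monotone_0_pi_le[of "\<bar>y\<bar>" \<theta>] that \<theta> \<xi> by (auto simp: c_def intro!: mult_left_mono)
 obtain D1 where D1: "\<And>x. exp (p * x - c * exp x) \<le> D1 * exp (- (1 / 2) * \<bar>x\<bar>)"
  using exp_growth_decay_bound[OF p2 c] by blast
 define A where "A = min 0 \<eta>"
 define B where "B = max 0 \<eta>"
 have between: "\<bar>y\<bar> \<le> \<theta>" "\<bar>2 * (y - \<alpha>)\<bar> \<le> pi - \<delta>" if "A \<le> y" "y \<le> B" for y
 proof -
  have d: "\<delta> \<le> pi - 2 * \<bar>\<alpha>\<bar>" unfolding \<delta>_def by (rule min.cobounded1)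
  show "\<bar>y\<bar> \<le> \<theta>" using that \<theta> by (auto simp: A_def B_def \<eta>_def split: if_splits)
  show "\<bar>2 * (y - \<alpha>)\<bar> \<le> pi - \<delta>"
  proof (cases "0 \<le> \<alpha>")
   case True
   then have "0 \<le> y" "y \<le> \<theta>" using that \<theta> by (auto simp: A_def B_def \<eta>_def)
   then show ?thesis unfolding abs_le_iff right_diff_distrib using True d \<delta>2 \<theta>(2) by (intro conjI) linarith+
  next
   case False
   then have "y \<le> 0" "- \<theta> \<le> y" using that \<theta> by (auto simp: A_def B_def \<eta>_def)
   then show ?thesis unfolding abs_le_iff right_diff_distrib using False d \<delta>2 \<theta>(2) by (intro conjI) linarith+
  qed
 qed
 have kdecay: "norm (k s) \<le> D / (norm \<nu> * sin \<delta>) * D1 * exp (- (1 / 2) * \<bar>Re s\<bar>)" if "A \<le> Im s" "Im s \<le> B" for s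
 proof -
  have "exp (p * Re s - (\<xi> * cos (Im s)) * exp (Re s)) \<le> exp (p * Re s - c * exp (Re s))"
   using cle[of "Im s"] between(1)[OF that] by (simp add: mult_right_mono)
  also have "\<dots> \<le> D1 * exp (- (1 / 2) * \<bar>Re s\<bar>)" by (rule D1)
  finally have "D / (norm \<nu> * sin \<delta>) * exp (p * Re s - (\<xi> * cos (Im s)) * exp (Re s)) \<le> D / (norm \<nu> * sin \<delta>) * (D1 * exp (- (1 / 2) * \<bar>Re s\<bar>))"
   using D0 \<nu>0 \<delta> by (intro mult_left_mono divide_nonneg_nonneg mult_nonneg_nonneg) (auto intro!: sin_ge_zero)
  with kb[OF between[OF that] \<delta>] show ?thesis by simp
 qed
 \<comment> \<open>The pole-free strip between the two pole heights; it contains both the real line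
   and the shifted one.\<close>
 define S where "S = {s. Im s < \<alpha> + pi / 2} \<inter> {s. Im s > \<alpha> - pi / 2}"
 have nz: "\<nu>\<^sup>2 + (exp s)\<^sup>2 \<noteq> 0" if "s \<in> S" for s
 proof -
  have "\<bar>2 * (Im s - \<alpha>)\<bar> < pi" using that by (auto simp: S_def)
  then have "0 < sin (min (pi - \<bar>2 * (Im s - \<alpha>)\<bar>) (pi / 2))" by (intro sin_gt_zero) auto
  also have "\<dots> \<le> norm (1 + of_real (exp (2 * (Re s - Re l))) * exp (\<i> * of_real (2 * (Im s - \<alpha>))))"
   using \<open>\<bar>2 * (Im s - \<alpha>)\<bar> < pi\<close> by (intro norm_one_plus_ge_sin min.cobounded2) auto
  finally show ?thesis unfolding fact using \<nu>0 by auto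
 qed
 have holk: "k holomorphic_on S"
  unfolding k_def using nz by (intro holomorphic_intros holomorphic_on_subset[OF r(1)]) auto
 have SAB: "{s. A \<le> Im s \<and> Im s \<le> B} \<subseteq> S"
  using \<theta> l by (auto simp: S_def A_def B_def \<eta>_def \<alpha>_def split: if_splits)
 have "(LBINT x. k (\<i> * of_real A + of_real x)) = (LBINT x. k (\<i> * of_real B + of_real x))"
 proof (rule strip_shift[where S=S and c="1 / 2" and D="D / (norm \<nu> * sin \<delta>) * D1"])
  show "open S" unfolding S_def by (intro open_Int open_halfspace_Im_lt open_halfspace_Im_gt)
  show "convex S" unfolding S_def by (intro convex_Int convex_halfspace_Im_lt convex_halfspace_Im_gt)
 qed (use kdecay holk SAB in \<open>auto simp: A_def B_def\<close>)
 then have shift: "(LBINT x. k (of_real x)) = (LBINT x. k (\<i> * of_real \<eta> + of_real x))"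
  by (cases "0 \<le> \<eta>") (auto simp: A_def B_def min_def max_def)
 have int_line: "integrable lborel (\<lambda>x. k (\<i> * of_real y + of_real x))" if "A \<le> y" "y \<le> B" for y
 proof (rule integrable_exp_decay[where c="1 / 2"])
  show "continuous_on UNIV (\<lambda>x. k (\<i> * of_real y + of_real x))"
   by (rule continuous_on_compose2[OF holomorphic_on_imp_continuous_on[OF holk]])
    (use SAB that in \<open>auto intro!: continuous_intros\<close>)
  show "norm (k (\<i> * of_real y + of_real x)) \<le> D / (norm \<nu> * sin \<delta>) * D1 * exp (- (1 / 2) * \<bar>x\<bar>)" for x
   using kdecay[of "\<i> * of_real y + of_real x"] that by simp
 qed simp
 have kf: "of_real (exp x) * f (exp x) = k (of_real x)" for x
 proof -
  have 1: "complex_of_real (exp x ^ (2 * N)) = exp (of_nat (2 * N) * of_real x)"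
   by (simp only: exp_of_nat_mult exp_of_real of_real_power)
  have 2: "complex_of_real ((exp x)\<^sup>2) = (exp (of_real x))\<^sup>2" by (simp only: exp_of_real of_real_power)
  have 3: "complex_of_real (exp (- (\<xi> * exp x))) = exp (- (of_real \<xi> * exp (of_real x)))"
   by (simp add: exp_of_real flip: of_real_mult of_real_minus)
  have 4: "complex_of_real (exp x) = exp (of_real x)" by (simp only: exp_of_real)
  show ?thesis unfolding f_def k_def 1 2 3 4 ln_exp by (simp only: mult.assoc)
 qed
 have 0: "A \<le> 0" "0 \<le> B" by (auto simp: A_def B_def)
 have "(LBINT t:{0<..}. f t) = (LBINT x. k (of_real x))"
 proof (subst integral_exp_substitution)
  have rc: "continuous_on UNIV r" using r(1) by (rule holomorphic_on_imp_continuous_on)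
  have nz': "\<nu>\<^sup>2 + of_real (t\<^sup>2) \<noteq> 0" for t
  proof (rule square_plus_square_nonzero)
   show "0 < Re \<nu>" using l by (auto simp: \<nu>_def Re_exp intro!: mult_pos_pos cos_gt_zero_pi)
  qed
  show cf: "continuous_on {0<..} f"
   unfolding f_def using nz' by (intro continuous_intros continuous_on_compose2[OF rc]) auto
  show "integrable lborel (\<lambda>s. of_real (exp s) * f (exp s))"
   using int_line[OF 0] by (simp add: kf)
  have p0: "0 < p" using p by simp
  show "set_integrable lborel {0<..} f"
   unfolding set_integrable_def
  proof (rule Bochner_Integration.integrable_bound)
   show "integrable lborel (\<lambda>t. D / (norm \<nu> * sin \<delta>) * (indicator {0<..} t *\<^sub>R (t powr (p - 1) * exp (- (\<xi> * t)))))"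
    using gamma_integral_scaled(1)[OF p0 \<xi>] unfolding set_integrable_def by (rule integrable_mult_right)
   show "(\<lambda>t. indicator {0<..} t *\<^sub>R f t) \<in> borel_measurable lborel"
    using borel_measurable_continuous_on_indicator[OF _ cf] by simp
   show "AE t in lborel. norm (indicator {0<..} t *\<^sub>R f t) \<le> norm (D / (norm \<nu> * sin \<delta>) * (indicator {0<..} t *\<^sub>R (t powr (p - 1) * exp (- (\<xi> * t)))))"
   proof (rule AE_I2)
    fix t :: real
    show "norm (indicator {0<..} t *\<^sub>R f t) \<le> norm (D / (norm \<nu> * sin \<delta>) * (indicator {0<..} t *\<^sub>R (t powr (p - 1) * exp (- (\<xi> * t)))))"
    proof (cases "0 < t")
     case True
     have "t * norm (f t) = norm (k (of_real (ln t)))" using kf[of "ln t"] True by (simp add: norm_mult flip: kf)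
     also have "\<dots> \<le> D / (norm \<nu> * sin \<delta>) * exp (p * ln t - \<xi> * t)"
      using kb[of "of_real (ln t)" \<delta>] between[OF 0] \<delta> True by simp
     also have "exp (p * ln t - \<xi> * t) = t * (t powr (p - 1) * exp (- (\<xi> * t)))"
      using True by (simp add: powr_def exp_diff exp_minus left_diff_distrib field_simps)
     finally have "t * norm (f t) \<le> t * (D / (norm \<nu> * sin \<delta>) * (t powr (p - 1) * exp (- (\<xi> * t))))" by (simp add: mult_ac)
     then have "norm (f t) \<le> D / (norm \<nu> * sin \<delta>) * (t powr (p - 1) * exp (- (\<xi> * t)))" by (rule mult_left_le_imp_le[OF _ True])
     from order_trans[OF this abs_ge_self] show ?thesis using True by simp
    qed simp
   qed
  qed
 qed (simp add: kf)
 then have "norm (LBINT t:{0<..}. f t) = norm (LBINT x. k (\<i> * of_real \<eta> + of_real x))"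
  by (simp only: shift)
 also have "\<dots> \<le> (LBINT x. D / (norm \<nu> * sin (2 * \<theta>)) * exp (p * x - c * exp x))"
 proof (rule Bochner_Integration.integral_norm_bound_integral)
  show "integrable lborel (\<lambda>x. k (\<i> * of_real \<eta> + of_real x))"
   by (rule int_line) (auto simp: A_def B_def)
  show "integrable lborel (\<lambda>x. D / (norm \<nu> * sin (2 * \<theta>)) * exp (p * x - c * exp x))"
   by (intro integrable_mult_right gamma_integral_exp p2 c)
  fix x
  have "\<bar>\<eta>\<bar> = \<theta>" using \<theta> by (auto simp: \<eta>_def)
  moreover have "\<bar>2 * (\<eta> - \<alpha>)\<bar> \<le> pi - 2 * \<theta>"
   using \<theta> l by (auto simp: \<eta>_def \<alpha>_def)
  ultimately show "norm (k (\<i> * of_real \<eta> + of_real x)) \<le> D / (norm \<nu> * sin (2 * \<theta>)) * exp (p * x - c * exp x)"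
   using kb[of "\<i> * of_real \<eta> + of_real x" "2 * \<theta>"] \<theta> by (auto simp: c_def \<eta>_def split: if_splits)
 qed
 also have "\<dots> = D / (norm \<nu> * sin (2 * \<theta>)) * (Gamma p / c powr p)"
  by (simp only: Bochner_Integration.integral_mult_right_zero gamma_integral_exp(2)[OF p2 c])
 finally show ?thesis by (simp only: f_def c_def)
qed

section \<open>Stirling-type bounds and the choice of the angle\<close>

lemma ln_one_plus_ge:
 assumes "0 \<le> (x::real)"
 shows "2 * x / (2 + x) \<le> ln (1 + x)"
proof -
 have "(\<lambda>x. ln (1 + x) - 2 * x / (2 + x)) 0 \<le> (\<lambda>x. ln (1 + x) - 2 * x / (2 + x)) x"
 proof (rule DERIV_nonneg_imp_nondecreasing[OF assms])
  fix y :: real assume y: "0 \<le> y" "y \<le> x"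
  have "((\<lambda>x. ln (1 + x) - 2 * x / (2 + x)) has_real_derivative 1 / (1 + y) - 4 / (2 + y)\<^sup>2) (at y)"
   using y by (auto intro!: derivative_eq_intros simp: power2_eq_square field_simps)
  moreover have "4 * (1 + y) \<le> (2 + y)\<^sup>2" by (simp add: power2_eq_square algebra_simps)
  then have "4 / (2 + y)\<^sup>2 \<le> 1 / (1 + y)" using y by (simp add: field_simps)
  ultimately show "\<exists>d. ((\<lambda>x. ln (1 + x) - 2 * x / (2 + x)) has_real_derivative d) (at y) \<and> 0 \<le> d"
   by (intro exI conjI) auto
 qed
 then show ?thesis by simp
qed

text \<open>With p = k + 1/2 the bound is a multiple of p^(p-1/2) e^(-p), the size in Stirling's
  formula. The induction step is (1 + 1/p)^(k+1) \<ge> e, which \<open>ln_one_plus_ge\<close> gives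
  because 2/(2p + 1) = 1/(k + 1).\<close>

lemma Gamma_half_integer_le:
 "Gamma (real k + 1 / 2) \<le> Gamma (1 / 2) * exp (1 / 2) * (real k + 1 / 2) ^ k * exp (- (real k + 1 / 2))"
proof (induction k)
 case 0
 show ?case by (simp add: mult.assoc flip: exp_add)
next
 case (Suc k)
 let ?p = "real k + 1 / 2"
 have p: "0 < ?p" by simp
 have pn: "?p \<notin> \<int>\<^sub>\<le>\<^sub>0" using p by (auto simp: nonpos_Ints_def)
 have "1 \<le> real (Suc k) * ln (1 + 1 / ?p)"
 proof -
  have "2 * (1 / q) / (2 + 1 / q) = 2 / (2 * q + 1)" if "0 < q" for q :: real using that by (simp add: field_simps)
  moreover have "2 / (2 * ?p + 1) = 1 / real (Suc k)"
  proof -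
   have "2 * ?p + 1 = 2 * real (Suc k)" by simp
   then show ?thesis by (simp only:) (simp add: field_simps)
  qed
  ultimately have "1 / real (Suc k) = 2 * (1 / ?p) / (2 + 1 / ?p)" using p by (simp only:)
  also have "\<dots> \<le> ln (1 + 1 / ?p)" by (rule ln_one_plus_ge) simp
  finally show ?thesis by (simp add: field_simps)
 qed
 have pos: "0 < 1 + 1 / ?p" by (rule add_pos_pos[OF zero_less_one divide_pos_pos[OF zero_less_one p]])
 from \<open>1 \<le> real (Suc k) * ln (1 + 1 / ?p)\<close> have "exp 1 \<le> exp (real (Suc k) * ln (1 + 1 / ?p))" by (simp only: exp_le_cancel_iff)
 also have "\<dots> = (1 + 1 / ?p) ^ Suc k" by (simp only: exp_of_nat_mult) (simp only: exp_ln[OF pos])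
 finally have "exp 1 * ?p ^ Suc k \<le> (1 + 1 / ?p) ^ Suc k * ?p ^ Suc k" by (intro mult_right_mono) auto
 also have "\<dots> = (?p + 1) ^ Suc k"   proof -
  have "(1 + 1 / q) * q = q + 1" if "0 < q" for q :: real using that by (simp add: field_simps)
  from this[OF p] show ?thesis by (simp only: power_mult_distrib[symmetric])
 qed
 finally have e: "exp 1 * ?p ^ Suc k \<le> (?p + 1) ^ Suc k" .
 have G: "0 \<le> Gamma (1 / 2 :: real)" by (simp add: Gamma_one_half_real)
 have "Gamma (?p + 1) = ?p * Gamma ?p" by (rule Gamma_plus1[OF pn])
 also have "\<dots> \<le> ?p * (Gamma (1 / 2) * exp (1 / 2) * ?p ^ k * exp (- ?p))"
  using Suc.IH by (intro mult_left_mono) auto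
 also have "\<dots> = Gamma (1 / 2) * exp (1 / 2) * exp (- ?p - 1) * (exp 1 * ?p ^ Suc k)"
 proof -
  have "exp (- ?p) = exp (- ?p - 1) * exp 1" unfolding exp_add[symmetric] by simp
  then show ?thesis by (simp only: mult_ac power_Suc)
 qed
 also have "\<dots> \<le> Gamma (1 / 2) * exp (1 / 2) * exp (- ?p - 1) * (?p + 1) ^ Suc k"
  using e G by (intro mult_left_mono mult_nonneg_nonneg) auto
 finally show ?case by (simp add: mult_ac add_ac)
qed

text \<open>Used with x^2 = 1/w, to bound (cos \<theta>)^(-p) by e^(p/w), which stays bounded as
  long as p - w does.\<close>

lemma cos_ge_exp:
 fixes x :: real
 assumes "0 \<le> x" "x \<le> 1"
 shows "exp (- (x\<^sup>2)) \<le> cos x"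
proof -
 have u: "x\<^sup>2 \<le> 1" using assms by (intro power_le_one)
 have "exp (- (x\<^sup>2)) \<le> 1 / (1 + x\<^sup>2)"
  using exp_ge_add_one_self[of "x\<^sup>2"] by (simp add: exp_minus divide_inverse le_imp_inverse_le add_pos_nonneg)
 also have "\<dots> \<le> 1 - x\<^sup>2 / 2"
 proof -
  have "x\<^sup>2 * x\<^sup>2 \<le> x\<^sup>2 * 1" using u by (intro mult_left_mono) auto
  then have "1 \<le> (1 - x\<^sup>2 / 2) * (1 + x\<^sup>2)" by (simp add: algebra_simps)
  then show ?thesis by (simp add: pos_divide_le_eq add_pos_nonneg)
 qed
 also have "\<dots> \<le> 1 - 2 * (sin (x / 2))\<^sup>2"
 proof -
  have "\<bar>sin (x / 2)\<bar> \<le> \<bar>x / 2\<bar>" by (rule abs_sin_x_le_abs_x)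
  then have "(sin (x / 2))\<^sup>2 \<le> (x / 2)\<^sup>2" by (simp only: abs_le_square_iff)
  then show ?thesis by (simp add: power_divide)
 qed
 also have "\<dots> = cos x" using cos_double_sin[of "x / 2"] by simp
 finally show ?thesis .
qed

text \<open>Here w = |\<nu>|\<xi>, and near the optimal N the order p differs from w by at most
  \<Delta>. Replacing p by w in the Stirling bound then costs only a factor depending on \<Delta>,
  thus on M and B: (p/w)^k \<le> exp(k\<Delta>/w) with k \<le> w(1 + \<Delta>), and e^(-p) \<le>
  e^(-w) e^\<Delta>.\<close>

lemma Gamma_shifted_le:
 fixes w B :: real and N M :: nat
 assumes w: "1 \<le> w" "2 * B + M + 1 \<le> w" and B: "\<bar>2 * real N - w\<bar> \<le> 2 * B"
 defines "p \<equiv> 2 * real N - real M + 1 / 2" and "\<Delta> \<equiv> 2 * B + real M + 1 / 2"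
 shows "1 \<le> p" "p \<le> w + \<Delta>"
  "Gamma p \<le> (Gamma (1 / 2) * exp (1 / 2 + \<Delta> * (1 + \<Delta>) + \<Delta>)) * w powr (p - 1 / 2) * exp (- w)"
proof -
 have \<Delta>: "0 \<le> \<Delta>" using B by (simp add: \<Delta>_def)
 have d: "\<bar>p - w\<bar> \<le> \<Delta>" using B by (simp add: p_def \<Delta>_def abs_le_iff)
 then show p2: "p \<le> w + \<Delta>" by linarith
 have B': "w - 2 * real N \<le> 2 * B" using B by linarith
 then have MN: "real M + 1 \<le> 2 * real N" using w(2) by linarith
 then show p1: "1 \<le> p" by (simp add: p_def)
 define k where "k = 2 * N - M"
 have "M \<le> 2 * N" using MN by linarith
 then have k: "real k = 2 * real N - real M" by (simp add: k_def of_nat_diff)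
 then have pk: "p = real k + 1 / 2" by (simp add: p_def)
 have w0: "0 < w" using w by simp
 have "Gamma p \<le> Gamma (1 / 2) * exp (1 / 2) * p ^ k * exp (- p)"
  using Gamma_half_integer_le[of k] by (simp only: pk)
 also have "\<dots> \<le> Gamma (1 / 2) * exp (1 / 2) * (w powr (p - 1 / 2) * exp (\<Delta> * (1 + \<Delta>))) * (exp (- w) * exp \<Delta>)"
 proof (intro mult_mono mult_left_mono)
  have "p / w \<le> exp (\<Delta> / w)"
  proof -
   have "p / w \<le> 1 + \<Delta> / w" using p2 w0 by (simp add: field_simps)
   also have "\<dots> \<le> exp (\<Delta> / w)" by (rule exp_ge_add_one_self)
   finally show ?thesis .
  qed
  then have "(p / w) ^ k \<le> exp (\<Delta> / w) ^ k" using p1 w0 by (intro power_mono) auto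
  also have "\<dots> = exp (real k * (\<Delta> / w))" by (simp only: exp_of_nat_mult)
  also have "\<dots> \<le> exp (\<Delta> * (1 + \<Delta>))"
  proof -
   have "real k \<le> w + \<Delta>" using p2 pk by simp
   also have "\<dots> \<le> w * (1 + \<Delta>)" using w(1) \<Delta> mult_right_mono[OF w(1) \<Delta>] by (simp add: algebra_simps)
   finally have "real k * \<Delta> \<le> w * (1 + \<Delta>) * \<Delta>" using \<Delta> by (intro mult_right_mono)
   then have "real k * (\<Delta> / w) \<le> \<Delta> * (1 + \<Delta>)" using w0 by (simp add: field_simps)
   then show ?thesis by simp
  qed
  finally have "p ^ k \<le> w ^ k * exp (\<Delta> * (1 + \<Delta>))" using w0 by (simp add: power_divide field_simps)
  also have "w ^ k = w powr (p - 1 / 2)" using w0 by (simp add: pk powr_realpow)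
  finally show "p ^ k \<le> w powr (p - 1 / 2) * exp (\<Delta> * (1 + \<Delta>))" .
  show "exp (- p) \<le> exp (- w) * exp \<Delta>" unfolding exp_add[symmetric] using d by simp
 qed (use p1 in \<open>auto simp: Gamma_one_half_real\<close>)
 also have "\<dots> = (Gamma (1 / 2) * exp (1 / 2 + \<Delta> * (1 + \<Delta>) + \<Delta>)) * w powr (p - 1 / 2) * exp (- w)"
  by (simp only: exp_add mult_ac)
 finally show "Gamma p \<le> (Gamma (1 / 2) * exp (1 / 2 + \<Delta> * (1 + \<Delta>) + \<Delta>)) * w powr (p - 1 / 2) * exp (- w)" .
qed

text \<open>The constant C is fixed before \<xi>, r and D. The powers of \<xi> in w^p = |\<nu>|^p
  \<xi>^p and in the denominator of \<open>rotated_bound\<close> cancel, and D enters only as a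
  factor.\<close>

lemma rotated_estimate:
 fixes M :: nat and B :: real
 obtains C where "0 < C"
  "\<And>\<xi> \<theta>0 D l r N. 0 < \<xi> \<Longrightarrow> 0 < \<theta>0 \<Longrightarrow> \<bar>Im l\<bar> < pi / 2 \<Longrightarrow> r holomorphic_on UNIV \<Longrightarrow>
   (\<And>s. \<bar>Im s\<bar> \<le> \<theta>0 \<Longrightarrow> norm (r s) \<le> D * exp (- (real M + 1 / 2) * Re s)) \<Longrightarrow>
   2 \<le> norm (exp l) * \<xi> \<Longrightarrow> 1 / \<theta>0\<^sup>2 \<le> norm (exp l) * \<xi> \<Longrightarrow> 2 * B + M + 1 \<le> norm (exp l) * \<xi> \<Longrightarrow>
   \<bar>2 * real N - norm (exp l) * \<xi>\<bar> \<le> 2 * B \<Longrightarrow>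
   norm (LBINT t:{0<..}. of_real (t ^ (2 * N)) * (exp l / ((exp l)\<^sup>2 + of_real (t\<^sup>2))) * (of_real (exp (- (\<xi> * t))) * r (of_real (ln t))))
    \<le> C * D * norm (exp l) ^ (2 * N) * norm (exp l) powr (- (real M + 1 / 2)) * exp (- (norm (exp l) * \<xi>))"
proof -
 define \<Delta> where "\<Delta> = 2 * B + real M + 1 / 2"
 define C1 where "C1 = Gamma (1 / 2) * exp (1 / 2 + \<Delta> * (1 + \<Delta>) + \<Delta>)"
 define C where "C = C1 * exp (1 + \<Delta>)"
 have C1: "0 < C1" by (simp add: C1_def Gamma_one_half_real)
 show ?thesis
 proof (rule that)
  show "0 < C" using C1 by (simp add: C_def)
  fix \<xi> \<theta>0 D l r and N :: nat
  assume \<xi>: "0 < \<xi>" and \<theta>0: "0 < \<theta>0" and l: "\<bar>Im l\<bar> < pi / 2" and hol: "r holomorphic_on UNIV"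
   and r: "\<And>s. \<bar>Im s\<bar> \<le> \<theta>0 \<Longrightarrow> norm (r s) \<le> D * exp (- (real M + 1 / 2) * Re s)"
   and w2: "2 \<le> norm (exp l) * \<xi>" and w\<theta>: "1 / \<theta>0\<^sup>2 \<le> norm (exp l) * \<xi>" and wB: "2 * B + M + 1 \<le> norm (exp l) * \<xi>"
   and NB: "\<bar>2 * real N - norm (exp l) * \<xi>\<bar> \<le> 2 * B"
  define R where "R = norm (exp l)"
  define w where "w = R * \<xi>"
  have R: "0 < R" by (simp add: R_def)
  have w: "2 \<le> w" "0 < w" using w2 by (simp_all add: w_def R_def)
  define p where "p = 2 * real N - real M + 1 / 2"
  have "1 \<le> w" using w by simp
  note Gs = Gamma_shifted_le[OF \<open>1 \<le> w\<close> wB[folded R_def w_def] NB[folded R_def w_def], folded p_def \<Delta>_def C1_def]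
  define \<theta> where "\<theta> = 1 / sqrt w"
  have sw: "1 < sqrt w" "0 < sqrt w" using w by auto
  have \<theta>: "0 < \<theta>" "\<theta> \<le> pi / 4" "\<theta> \<le> 1" "\<theta> \<le> \<theta>0" "\<theta>\<^sup>2 = 1 / w"
  proof -
   show "0 < \<theta>" "\<theta> \<le> 1" using sw by (simp_all add: \<theta>_def)
   show t2: "\<theta>\<^sup>2 = 1 / w" using w by (simp add: \<theta>_def power_divide)
   \<comment> \<open>w \<ge> 2 gives \<theta>^2 \<le> 1/2 < 9/16, and 3/4 < \<pi>/4.\<close>
   have "\<theta>\<^sup>2 \<le> (3 / 4)\<^sup>2" unfolding t2 using w by (simp add: power2_eq_square field_simps)
   then have "\<theta> \<le> 3 / 4" by (rule power2_le_imp_le) simp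
   then show "\<theta> \<le> pi / 4" using pi_gt3 by simp
   have "1 / w \<le> \<theta>0\<^sup>2" using w\<theta>[folded R_def w_def] w \<theta>0 by (simp add: field_simps)
   then have "\<theta>\<^sup>2 \<le> \<theta>0\<^sup>2" unfolding t2 .
   then show "\<theta> \<le> \<theta>0" using \<theta>0 by (rule power2_le_imp_le[OF _ less_imp_le])
  qed
  have D0: "0 \<le> D" using order_trans[OF norm_ge_zero r[of 0]] \<theta>0 by simp
  have "norm (LBINT t:{0<..}. of_real (t ^ (2 * N)) * (exp l / ((exp l)\<^sup>2 + of_real (t\<^sup>2))) * (of_real (exp (- (\<xi> * t))) * r (of_real (ln t))))
   \<le> D / (R * sin (2 * \<theta>)) * (Gamma p / (\<xi> * cos \<theta>) powr p)"
   unfolding R_def by (rule rotated_bound[OF l \<xi> \<theta>(1,2) hol _ p_def Gs(1)]) (use r \<theta> in auto)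
  also have "\<dots> \<le> D * (sqrt w / R) * ((C1 * w powr (p - 1 / 2) * exp (- w)) * (exp (1 + \<Delta>) / \<xi> powr p))"
  proof (rule mult_mono)
   have c2: "1 / 2 \<le> (cos \<theta>)\<^sup>2"
   proof -
    have "cos (pi / 4) \<le> cos \<theta>" using \<theta> by (intro cos_monotone_0_pi_le) auto
    then have "(cos (pi / 4))\<^sup>2 \<le> (cos \<theta>)\<^sup>2" by (intro power_mono) (auto simp: cos_45)
    then show ?thesis by (simp add: cos_45 power_divide)
   qed
   have c0: "0 < cos \<theta>" using \<theta> by (intro cos_gt_zero_pi) auto
   have "\<theta> * cos \<theta> < sin \<theta>" using \<theta> by (intro mult_cos_less_sin) auto
   then have "2 * (\<theta> * cos \<theta>) * cos \<theta> \<le> 2 * sin \<theta> * cos \<theta>" using c0 by simp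
   moreover have "\<theta> * (1 / 2) \<le> \<theta> * (cos \<theta>)\<^sup>2" using c2 \<theta> by (intro mult_left_mono) auto
   \<comment> \<open>So the kernel costs 1/\<theta> = \<surd>w, which completes the w^(p-1/2) of the
     gamma bound to w^p.\<close>
   ultimately have s: "\<theta> \<le> sin (2 * \<theta>)" by (simp add: sin_double power2_eq_square)
   have "D / (R * sin (2 * \<theta>)) \<le> D / (R * \<theta>)"
    using s \<theta> R D0 by (intro divide_left_mono mult_left_mono) auto
   also have "\<dots> = D * (sqrt w / R)" by (simp add: \<theta>_def)
   finally show "D / (R * sin (2 * \<theta>)) \<le> D * (sqrt w / R)" .
   have "1 / cos \<theta> powr p \<le> exp (1 + \<Delta>)"
   proof -
    have "exp (- (\<theta>\<^sup>2)) powr p \<le> cos \<theta> powr p" using cos_ge_exp[of \<theta>] \<theta> Gs(1) by (intro powr_mono2) auto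
    moreover have "exp (- (1 + \<Delta>)) \<le> exp (- (\<theta>\<^sup>2)) powr p"
    proof -
     have D: "0 \<le> \<Delta>" using NB by (simp add: \<Delta>_def)
     have "p / w \<le> (w + \<Delta>) / w" using Gs(2) w by (intro divide_right_mono) auto
     also have "\<dots> = 1 + \<Delta> / w" using w by (simp add: add_divide_distrib)
     also have "\<Delta> / w \<le> \<Delta> / 1" using D \<open>1 \<le> w\<close> by (intro divide_left_mono) auto
     finally show ?thesis unfolding \<theta>(5) by (simp add: powr_def)
    qed
    ultimately have "exp (- (1 + \<Delta>)) \<le> cos \<theta> powr p" by linarith
    then have "1 / cos \<theta> powr p \<le> 1 / exp (- (1 + \<Delta>))" using c0 by (intro divide_left_mono) (auto intro!: mult_pos_pos)
    moreover have "1 / exp (- z) = exp z" for z :: real by (simp add: exp_minus field_simps)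
    ultimately have "1 / cos \<theta> powr p \<le> exp (1 + \<Delta>)" by (simp only:)
    then show ?thesis .
   qed
   then have "1 / (\<xi> powr p * cos \<theta> powr p) \<le> exp (1 + \<Delta>) / \<xi> powr p" using \<xi> by (simp add: divide_simps)
   then have "Gamma p * (1 / (\<xi> powr p * cos \<theta> powr p)) \<le> (C1 * w powr (p - 1 / 2) * exp (- w)) * (exp (1 + \<Delta>) / \<xi> powr p)"
    using Gs(1,3) C1 by (intro mult_mono) (auto intro!: Gamma_real_nonneg simp: C1_def)
   then show "Gamma p / (\<xi> * cos \<theta>) powr p \<le> (C1 * w powr (p - 1 / 2) * exp (- w)) * (exp (1 + \<Delta>) / \<xi> powr p)"
    using \<xi> c0 by (simp add: powr_mult)
  qed (use D0 R w Gs(1) in \<open>auto intro!: Gamma_real_nonneg divide_nonneg_nonneg\<close>)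
  also have "\<dots> = C * D * exp (- w) * ((sqrt w * w powr (p - 1 / 2)) / (R * \<xi> powr p))"
   by (simp add: C_def)
  also have "sqrt w * w powr (p - 1 / 2) = R powr p * \<xi> powr p"
  proof -
   have "sqrt w * w powr (p - 1 / 2) = w powr p" using w by (simp add: powr_half_sqrt[symmetric] powr_add[symmetric])
   then show ?thesis using R \<xi> by (simp add: w_def powr_mult)
  qed
  also have "R powr p * \<xi> powr p / (R * \<xi> powr p) = R ^ (2 * N) * R powr (- (real M + 1 / 2))"
  proof -
   have "R powr p * \<xi> powr p / (R * \<xi> powr p) = R powr (p - 1)" using R \<xi> by (simp add: powr_diff)
   also have "p - 1 = real (2 * N) + (- (real M + 1 / 2))" by (simp add: p_def)
   finally show ?thesis using R by (simp only: powr_add powr_realpow)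
  qed
  finally show "norm (LBINT t:{0<..}. of_real (t ^ (2 * N)) * (exp l / ((exp l)\<^sup>2 + of_real (t\<^sup>2))) * (of_real (exp (- (\<xi> * t))) * r (of_real (ln t))))
    \<le> C * D * norm (exp l) ^ (2 * N) * norm (exp l) powr (- (real M + 1 / 2)) * exp (- (norm (exp l) * \<xi>))"
   by (simp add: w_def R_def mult_ac)
 qed
qed

section \<open>Expansion at the saddle point\<close>

lemma gaussian_moment_real:
 fixes k :: nat and c :: real
 assumes "0 < c"
 shows "integrable lborel (\<lambda>x. exp (real (k + 1) * x - c * exp (2 * x)))"
  and "(LBINT x. exp (real (k + 1) * x - c * exp (2 * x))) = Gamma (real (k + 1) / 2) / c powr (real (k + 1) / 2) / 2"
proof -
 let ?p = "real (k + 1) / 2"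
 have p: "1 / 2 \<le> ?p" by simp
 note g = gamma_integral_exp[OF p assms]
 have "integrable lborel (\<lambda>x. exp (?p * (0 + 2 * x) - c * exp (0 + 2 * x)))"
  by (rule lborel_integrable_real_affine[OF g(1)]) simp
 then show "integrable lborel (\<lambda>x. exp (real (k + 1) * x - c * exp (2 * x)))" by simp
 show "(LBINT x. exp (real (k + 1) * x - c * exp (2 * x))) = Gamma ?p / c powr ?p / 2"
  using lborel_integral_real_affine[of 2 "\<lambda>x. exp (?p * x - c * exp x)" 0] g(2) by simp
qed

text \<open>In u = e^x this is the integral of u^k exp(-e^\<zeta> u^2) over the positive axis.
  Shifting x by \<zeta>/2 makes the coefficient of u^2 equal to 1; the imaginary part of that shift
  is a change of line, allowed while |Im \<zeta>| < \<pi>/2.\<close>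

lemma gaussian_moment:
 fixes k :: nat and \<zeta> :: complex
 assumes "\<bar>Im \<zeta>\<bar> < pi / 2"
 shows "integrable lborel (\<lambda>x. exp (of_nat (k + 1) * of_real x - exp (\<zeta> + 2 * of_real x)))"
  and "(LBINT x. exp (of_nat (k + 1) * of_real x - exp (\<zeta> + 2 * of_real x)))
   = of_real (Gamma (real (k + 1) / 2) / 2) * exp (- (of_nat (k + 1) / 2 * \<zeta>))"
proof -
 let ?p = "real (k + 1) / 2"
 define h where "h z = exp (of_nat (k + 1) * z - exp (2 * z))" for z :: complex
 define b where "b = Im \<zeta> / 2"
 define a where "a = Re \<zeta> / 2"
 define S where "S = {z. min 0 b - 1 < Im z \<and> Im z < max 0 b + 1}"
 define c where "c = cos (Im \<zeta>)"
 have c: "0 < c" using assms by (auto simp: c_def intro!: cos_gt_zero_pi)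
 obtain D where D: "\<And>x. exp (?p * x - c * exp x) \<le> D * exp (- (1 / 2) * \<bar>x\<bar>)"
  using exp_growth_decay_bound[of ?p c] c by auto
 have hb: "norm (h z) \<le> D * exp (- 1 * \<bar>Re z\<bar>)" if "min 0 b \<le> Im z" "Im z \<le> max 0 b" for z
 proof -
  have "\<bar>2 * Im z\<bar> \<le> \<bar>Im \<zeta>\<bar>" using that by (auto simp: b_def min_def max_def split: if_splits)
  then have "cos \<bar>Im \<zeta>\<bar> \<le> cos \<bar>2 * Im z\<bar>" using assms by (intro cos_monotone_0_pi_le) auto
  then have "c \<le> cos (2 * Im z)" by (simp add: c_def)
  then have "c * exp (2 * Re z) \<le> exp (2 * Re z) * cos (2 * Im z)" by simp
  then have "norm (h z) \<le> exp (?p * (2 * Re z) - c * exp (2 * Re z))"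
   by (simp add: h_def norm_exp_eq_Re Re_exp)
  also have "\<dots> \<le> D * exp (- (1 / 2) * \<bar>2 * Re z\<bar>)" by (rule D)
  finally show ?thesis by (simp add: abs_mult)
 qed
 have "(LBINT x. h (\<i> * of_real (min 0 b) + of_real x)) = (LBINT x. h (\<i> * of_real (max 0 b) + of_real x))"
 proof (rule strip_shift[where S=S and c=1 and D=D])
  have S: "S = {z. min 0 b - 1 < Im z} \<inter> {z. Im z < max 0 b + 1}" by (auto simp: S_def)
  show "open S" unfolding S by (intro open_Int open_halfspace_Im_lt open_halfspace_Im_gt)
  show "convex S" unfolding S by (intro convex_Int convex_halfspace_Im_lt convex_halfspace_Im_gt)
  show "h holomorphic_on S" unfolding h_def by (intro holomorphic_intros)
 qed (use hb in \<open>auto simp: S_def\<close>)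
 then have shift: "(LBINT x. h (\<i> * of_real b + of_real x)) = (LBINT x. h (of_real x))"
  by (cases "0 \<le> b") (auto simp: min_def max_def)
 have int: "integrable lborel (\<lambda>x. h (\<i> * of_real b + of_real x))"
  by (rule integrable_exp_decay[where c=1 and D=D])
   (use hb[of "\<i> * of_real b + of_real x" for x] in \<open>auto simp: h_def intro!: continuous_intros\<close>)
 have eq: "exp (of_nat (k + 1) * of_real x - exp (\<zeta> + 2 * of_real x))
   = exp (- (of_nat (k + 1) / 2 * \<zeta>)) * h (\<i> * of_real b + of_real (a + x))" for x
 proof -
  have z: "\<zeta> = 2 * (of_real a + \<i> * of_real b)" by (simp add: a_def b_def complex_eq_iff)
  have e: "2 * (\<i> * of_real b + of_real (a + x)) = \<zeta> + 2 * of_real x" by (simp add: z algebra_simps)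
  have "- (of_nat (k + 1) / 2 * \<zeta>) + (of_nat (k + 1) * (\<i> * of_real b + of_real (a + x)) - exp (\<zeta> + 2 * of_real x))
   = of_nat (k + 1) * of_real x - exp (\<zeta> + 2 * of_real x)" by (subst z) (simp add: algebra_simps add_divide_distrib)
  then show ?thesis unfolding h_def e exp_add[symmetric] by (simp only:)
 qed
 have "integrable lborel (\<lambda>x. h (\<i> * of_real b + of_real (a + 1 * x)))"
  by (rule lborel_integrable_real_affine[OF int]) simp
 then show "integrable lborel (\<lambda>x. exp (of_nat (k + 1) * of_real x - exp (\<zeta> + 2 * of_real x)))"
  unfolding eq by (intro integrable_mult_right) simp
 have "(LBINT x. h (\<i> * of_real b + of_real (a + x))) = (LBINT x. h (\<i> * of_real b + of_real x))"
  using lborel_integral_real_affine[of 1 "\<lambda>x. h (\<i> * of_real b + of_real x)" a] by simp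
 also have "\<dots> = (LBINT x. h (of_real x))" by (rule shift)
 also have "\<dots> = (LBINT x. of_real (exp (real (k + 1) * x - 1 * exp (2 * x))))"
  unfolding h_def by (simp add: exp_of_real[symmetric])
 also have "\<dots> = of_real (Gamma ?p / 2)"
  unfolding integral_complex_of_real gaussian_moment_real(2)[OF zero_less_one] by simp
 finally show "(LBINT x. exp (of_nat (k + 1) * of_real x - exp (\<zeta> + 2 * of_real x)))
   = of_real (Gamma ?p / 2) * exp (- (of_nat (k + 1) / 2 * \<zeta>))"
  unfolding eq by (simp add: mult.commute)
qed

text \<open>For the signs \<sigma> = 1 and \<sigma> = -1 used later, with z = \<omega> e^(-x) and t
  = e^s, the integral is that of e^(-t z^2) Y(z) over the segment from 0 to \<omega>. Prescribing
  the logarithm \<Lambda> of \<sigma>\<omega> makes the half-integral powers of t come out on the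
  right branch.\<close>

lemma watson:
 fixes Y :: "complex \<Rightarrow> complex" and c :: "nat \<Rightarrow> complex" and \<sigma> A :: real
 assumes \<omega>: "\<omega> = of_real \<sigma> * exp \<Lambda>" and \<mu>: "0 < \<mu>"
  and cont: "continuous_on {0..1} (\<lambda>u. Y (\<omega> * of_real u))"
  and V: "\<And>u. 0 < u \<Longrightarrow> u \<le> 1 \<Longrightarrow> norm (Y (\<omega> * of_real u) - (\<Sum>k<K. c k * (\<omega> * of_real u) ^ k)) \<le> A * u ^ K"
 obtains D where "\<And>s. \<bar>Im (s + 2 * \<Lambda>)\<bar> < pi / 2 \<Longrightarrow> \<mu> * exp (Re s) \<le> Re (exp (s + 2 * \<Lambda>)) \<Longrightarrow>
  set_integrable lborel {0<..} (\<lambda>x. exp (- exp (s + 2 * \<Lambda> - 2 * of_real x)) * (Y (\<omega> * of_real (exp (- x))) * (\<omega> * of_real (exp (- x))))) \<and>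
  norm ((LBINT x:{0<..}. exp (- exp (s + 2 * \<Lambda> - 2 * of_real x)) * (Y (\<omega> * of_real (exp (- x))) * (\<omega> * of_real (exp (- x)))))
   - (\<Sum>k<K. of_real (\<sigma> ^ (k + 1)) * c k * of_real (Gamma (real (k + 1) / 2) / 2) * exp (- (of_nat (k + 1) / 2 * s))))
  \<le> D * exp (- (real (K + 1) / 2) * Re s)"
proof -
 define S where "S = (\<Sum>k<K. norm (c k) * norm \<omega> ^ k)"
 \<comment> \<open>Beyond the end of the segment, where u \<ge> 1, the integrand is replaced by 0
   and the Taylor polynomial alone is at most S u^K. So one bound A' u^K holds for all u > 0, and no
   separate tail estimate is needed.\<close>
 define A' where "A' = \<bar>A\<bar> + S"
 have S0: "0 \<le> S" unfolding S_def by (intro sum_nonneg) auto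
 define q where "q = real (K + 1) / 2"
 define D where "D = norm \<omega> * A' * (Gamma q / \<mu> powr q / 2)"
 have cY: "continuous_on {0..} (\<lambda>x::real. Y (\<omega> * of_real (exp (- x))))"
  by (rule continuous_on_compose2[OF cont]) (auto intro!: continuous_intros)
 have "bounded ((\<lambda>u. Y (\<omega> * of_real u)) ` {0..1})"
  by (intro compact_imp_bounded compact_continuous_image cont) auto
 then obtain b where "\<forall>u\<in>{0..1}. norm (Y (\<omega> * of_real u)) \<le> b"
  unfolding bounded_iff by blast
 then have b: "\<And>u. u \<in> {0..1} \<Longrightarrow> norm (Y (\<omega> * of_real u)) \<le> b" by blast
 show ?thesis
 proof (rule that[of D])
  fix s :: complex
  let ?\<zeta> = "s + 2 * \<Lambda>"
  assume \<zeta>: "\<bar>Im ?\<zeta>\<bar> < pi / 2" and re: "\<mu> * exp (Re s) \<le> Re (exp ?\<zeta>)"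
  define C where "C = Re (exp ?\<zeta>)"
  have C: "0 < C" using re \<mu> by (auto simp: C_def intro: less_le_trans[rotated])
  define m where "m k x = exp (of_nat (k + 1) * of_real x - exp (?\<zeta> + 2 * of_real x))" for k and x :: real
  define G where "G x = exp (- exp (?\<zeta> - 2 * of_real x)) * (Y (\<omega> * of_real (exp (- x))) * (\<omega> * of_real (exp (- x))))" for x :: real
  define H where "H x = (if x < 0 then exp (- exp (?\<zeta> + 2 * of_real x)) * (Y (\<omega> * of_real (exp x)) * (\<omega> * of_real (exp x))) else 0)" for x :: real
  have nexp: "norm (exp (- exp (?\<zeta> + 2 * of_real x))) = exp (- (C * exp (2 * x)))" for x
  proof -
   have "exp (?\<zeta> + 2 * of_real x) = exp ?\<zeta> * of_real (exp (2 * x))"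
    by (simp add: exp_add exp_of_real[symmetric])
   then show ?thesis by (simp only:) (simp add: C_def)
  qed
  have nexp': "norm (exp (- exp (?\<zeta> - 2 * of_real x))) \<le> 1" for x
   using nexp[of "- x"] C by simp
  have Gi: "set_integrable lborel {0<..} G"
  proof (rule set_integrable_exp_bound[where c=1 and D="b * norm \<omega>"])
   show "norm (G x) \<le> b * norm \<omega> * exp (- 1 * x)" if "0 < x" for x
   proof -
    have "norm (G x) \<le> 1 * (b * (norm \<omega> * exp (- x)))"
     unfolding G_def norm_mult using that nexp'[of x] b[of "exp (-x)"] order_trans[OF norm_ge_zero b[of 0]] by (intro mult_mono) auto
    then show ?thesis by (simp add: mult_ac)
   qed
   show "continuous_on {0<..} G" unfolding G_def
    by (intro continuous_intros continuous_on_subset[OF cY]) auto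
  qed simp
  have HG: "indicator {0<..} (- x) *\<^sub>R G (- x) = H x" for x
   by (simp add: H_def G_def indicator_def)
  have GH: "indicator {0<..} x *\<^sub>R G x = H (- x)" for x using HG[of "- x"] by simp
  have Gint: "integrable lborel (\<lambda>x. H (- x))" using Gi unfolding set_integrable_def GH .
  then have Hint: "integrable lborel H"
   using lborel_integrable_real_affine[OF Gint, of "-1" 0] by simp
  have IH: "(LBINT x:{0<..}. G x) = (LBINT x. H x)"
   unfolding set_lebesgue_integral_def GH by (rule integral_line_reflect)
  have mint: "integrable lborel (m k)" for k
   unfolding m_def by (rule gaussian_moment(1)[OF \<zeta>])
  let ?P = "\<lambda>x. \<Sum>k<K. c k * \<omega> ^ (k + 1) * m k x"
  have Pint: "integrable lborel ?P" by (intro Bochner_Integration.integrable_sum integrable_mult_right mint)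
  have IP: "(LBINT x. ?P x) = (\<Sum>k<K. of_real (\<sigma> ^ (k + 1)) * c k * of_real (Gamma (real (k + 1) / 2) / 2) * exp (- (of_nat (k + 1) / 2 * s)))"
  proof -
   have "(LBINT x. ?P x) = (\<Sum>k<K. LBINT x. c k * \<omega> ^ (k + 1) * m k x)"
    by (rule Bochner_Integration.integral_sum) (intro integrable_mult_right mint)
   also have "\<dots> = (\<Sum>k<K. of_real (\<sigma> ^ (k + 1)) * c k * of_real (Gamma (real (k + 1) / 2) / 2) * exp (- (of_nat (k + 1) / 2 * s)))"
   proof (rule sum.cong[OF refl])
    fix k
    have "exp \<Lambda> ^ (k + 1) * exp (- (of_nat (k + 1) / 2 * ?\<zeta>)) = exp (- (of_nat (k + 1) / 2 * s))"
     unfolding exp_of_nat_mult[symmetric] exp_add[symmetric] by (simp add: algebra_simps add_divide_distrib)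
    then show "(LBINT x. c k * \<omega> ^ (k + 1) * m k x) = of_real (\<sigma> ^ (k + 1)) * c k * of_real (Gamma (real (k + 1) / 2) / 2) * exp (- (of_nat (k + 1) / 2 * s))"
     unfolding Bochner_Integration.integral_mult_right_zero m_def gaussian_moment(2)[OF \<zeta>] \<omega> power_mult_distrib
     by (simp only: of_real_power mult_ac)
   qed
   finally show ?thesis .
  qed
  have pt: "norm (H x - ?P x) \<le> norm \<omega> * A' * exp (real (K + 1) * x - C * exp (2 * x))" for x
  proof -
   let ?u = "exp x"
   let ?E = "exp (- exp (?\<zeta> + 2 * of_real x))"
   have m: "m k x = ?E * (of_real ?u ^ k * of_real ?u)" for k
    unfolding m_def by (simp add: exp_diff exp_minus field_simps exp_of_nat_mult[symmetric] exp_of_real[symmetric] exp_add[symmetric])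
   have P: "?P x = ?E * ((\<Sum>k<K. c k * (\<omega> * of_real ?u) ^ k) * (\<omega> * of_real ?u))"
    unfolding sum_distrib_left sum_distrib_right m
    by (intro sum.cong refl) (simp add: power_mult_distrib mult_ac)
   define Z where "Z = (if x < 0 then Y (\<omega> * of_real ?u) else 0)"
   have "norm (Z - (\<Sum>k<K. c k * (\<omega> * of_real ?u) ^ k)) \<le> A' * ?u ^ K"
   proof (cases "x < 0")
    case True
    have "norm (Z - (\<Sum>k<K. c k * (\<omega> * of_real ?u) ^ k)) \<le> A * ?u ^ K"
     using V[of ?u] True by (simp add: Z_def)
    also have "\<dots> \<le> A' * ?u ^ K" using S0 by (intro mult_right_mono) (auto simp: A'_def)
    finally show ?thesis .
   next
    case False
    have "norm (\<Sum>k<K. c k * (\<omega> * of_real ?u) ^ k) \<le> (\<Sum>k<K. norm (c k) * norm \<omega> ^ k * ?u ^ K)"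
    proof (rule sum_norm_le)
     fix k assume "k \<in> {..<K}"
     then have "?u ^ k \<le> ?u ^ K" using False by (intro power_increasing) auto
     then show "norm (c k * (\<omega> * of_real ?u) ^ k) \<le> norm (c k) * norm \<omega> ^ k * ?u ^ K"
      by (simp add: norm_mult norm_power power_mult_distrib mult_left_mono flip: mult.assoc)
    qed
    also have "\<dots> = S * ?u ^ K" by (simp add: S_def sum_distrib_right)
    also have "\<dots> \<le> A' * ?u ^ K" by (intro mult_right_mono) (auto simp: A'_def)
    finally show ?thesis using False by (simp add: Z_def)
   qed
   note Zb = this
   have "H x - ?P x = ?E * ((Z - (\<Sum>k<K. c k * (\<omega> * of_real ?u) ^ k)) * (\<omega> * of_real ?u))"
    unfolding P H_def Z_def by (simp add: algebra_simps)
   then have "norm (H x - ?P x) = exp (- (C * exp (2 * x))) * (norm (Z - (\<Sum>k<K. c k * (\<omega> * of_real ?u) ^ k)) * (norm \<omega> * ?u))"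
    unfolding nexp[symmetric] norm_mult[symmetric] by (simp only: norm_mult) simp
   also have "\<dots> \<le> exp (- (C * exp (2 * x))) * (A' * ?u ^ K * (norm \<omega> * ?u))"
    using Zb by (intro mult_left_mono mult_right_mono) auto
   also have "\<dots> = norm \<omega> * A' * (exp (- (C * exp (2 * x))) * (?u ^ K * ?u))" by (simp only: mult_ac)
   also have "exp (- (C * exp (2 * x))) * (?u ^ K * ?u) = exp (real (K + 1) * x - C * exp (2 * x))"
    by (simp add: exp_of_nat_mult[symmetric] exp_add[symmetric] algebra_simps)
   finally show ?thesis .
  qed
  have "norm ((LBINT x. H x) - (LBINT x. ?P x)) = norm (LBINT x. H x - ?P x)"
   by (simp only: Bochner_Integration.integral_diff[OF Hint Pint])
  also have "\<dots> \<le> (LBINT x. norm \<omega> * A' * exp (real (K + 1) * x - C * exp (2 * x)))"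
   by (rule Bochner_Integration.integral_norm_bound_integral[OF Bochner_Integration.integrable_diff[OF Hint Pint]])
    (intro integrable_mult_right gaussian_moment_real(1) C pt)+
  also have "\<dots> = norm \<omega> * A' * (Gamma q / C powr q / 2)"
   unfolding Bochner_Integration.integral_mult_right_zero gaussian_moment_real(2)[OF C] q_def ..
  also have "\<dots> \<le> norm \<omega> * A' * (Gamma q / (\<mu> * exp (Re s)) powr q / 2)"
  proof -
   have "(\<mu> * exp (Re s)) powr q \<le> C powr q"
    using re \<mu> by (intro powr_mono2) (auto simp: C_def q_def)
   then show ?thesis using \<mu> S0 C
    by (intro mult_left_mono divide_right_mono divide_left_mono Gamma_real_nonneg mult_pos_pos) (auto simp: q_def A'_def)
  qed
  also have "\<dots> = D * exp (- q * Re s)"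
   using \<mu> by (simp add: D_def powr_mult exp_powr_real exp_minus field_simps)
  finally show "set_integrable lborel {0<..} (\<lambda>x. exp (- exp (s + 2 * \<Lambda> - 2 * of_real x)) * (Y (\<omega> * of_real (exp (- x))) * (\<omega> * of_real (exp (- x))))) \<and>
  norm ((LBINT x:{0<..}. exp (- exp (s + 2 * \<Lambda> - 2 * of_real x)) * (Y (\<omega> * of_real (exp (- x))) * (\<omega> * of_real (exp (- x)))))
   - (\<Sum>k<K. of_real (\<sigma> ^ (k + 1)) * c k * of_real (Gamma (real (k + 1) / 2) / 2) * exp (- (of_nat (k + 1) / 2 * s))))
  \<le> D * exp (- (real (K + 1) / 2) * Re s)"
   using Gi IH IP by (simp add: G_def[abs_def] q_def)
 qed
qed

section \<open>Lagrange inversion and the local coordinate at the saddle\<close>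

lemma taylor_remainder:
 fixes f :: "complex \<Rightarrow> complex"
 assumes "f holomorphic_on ball 0 r"
 obtains c V where "\<And>K. V K holomorphic_on ball 0 r"
  "\<And>K z. f z = (\<Sum>k<K. c k * z ^ k) + z ^ K * V K z"
proof -
 \<comment> \<open>Iterating the difference quotient at 0 yields the Taylor remainders; the
   expansion is then an algebraic identity at every z, and only holomorphy is restricted to the
   ball.\<close>
 define step where "step g = (\<lambda>z. if z = 0 then deriv g 0 else (g z - g 0) / (z - 0))" for g :: "complex \<Rightarrow> complex"
 define V where "V = rec_nat f (\<lambda>_. step)"
 have V: "V 0 = f" "V (Suc K) = step (V K)" for K by (simp_all add: V_def)
 have step: "g z = g 0 + z * step g z" for g z by (simp add: step_def)
 show ?thesis
 proof (rule that[of V "\<lambda>k. V k 0"])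
  show "V K holomorphic_on ball 0 r" for K
  proof (induction K)
   case (Suc K)
   then show ?case unfolding V step_def by (rule pole_lemma_open) simp
  qed (simp add: V assms)
  show "f z = (\<Sum>k<K. V k 0 * z ^ k) + z ^ K * V K z" for K z
  proof (induction K)
   case (Suc K)
   then show ?case using step[of "V K" z] V(2)[of K] by (simp add: algebra_simps)
  qed (simp add: V)
 qed
qed

lemma residue_derivative_eq_0:
 assumes "0 < r" and F: "\<And>z. z \<in> ball a r - {a} \<Longrightarrow> (F has_field_derivative f z) (at z)"
  and f: "f holomorphic_on ball a r - {a}"
 shows "residue f a = 0"
proof -
 have "(f has_contour_integral 2 * pi * \<i> * residue f a) (circlepath a (r / 2))"
  by (rule base_residue[where s="ball a r"]) (use assms in auto)
 moreover have "(f has_contour_integral 0) (circlepath a (r / 2))"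
 proof (rule Cauchy_theorem_primitive[where S="ball a r - {a}"])
  show "(F has_field_derivative f z) (at z within ball a r - {a})" if "z \<in> ball a r - {a}" for z
   using F[OF that] by (rule has_field_derivative_at_within)
 qed (use assms(1) in \<open>auto simp: dist_norm\<close>)
 ultimately show ?thesis using has_contour_integral_unique by fastforce
qed

lemma residue_sum:
 assumes "open S" "z \<in> S" "finite I" "\<And>i. i \<in> I \<Longrightarrow> f i holomorphic_on S - {z}"
 shows "residue (\<lambda>w. \<Sum>i\<in>I. f i w) z = (\<Sum>i\<in>I. residue (f i) z)"
 using assms(3,4)
proof (induction I rule: finite_induct)
 case (insert i I)
 have "residue (\<lambda>w. f i w + (\<Sum>i\<in>I. f i w)) z = residue (f i) z + residue (\<lambda>w. \<Sum>i\<in>I. f i w) z"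
  using insert by (intro residue_add[OF assms(1,2)] holomorphic_intros) auto
 then show ?case using insert by simp
qed (simp add: residue_const)

text \<open>Lagrange inversion, by comparing residues of \<open>w'(y) f(w(y)) / w(y)\<^sup>n\<^sup>+\<^sup>1\<close>.\<close>

lemma lagrange_inversion:
 fixes g :: "complex \<Rightarrow> complex"
 assumes r: "0 < r" and g: "g holomorphic_on ball 0 r" and gnz: "\<And>y. y \<in> ball 0 r \<Longrightarrow> g y \<noteq> 0"
  and w: "w = (\<lambda>y. y * g y)"
  and inv: "\<And>y. y \<in> ball 0 r \<Longrightarrow> (\<Sum>k\<le>n. c k * w y ^ k) * deriv w y + w y ^ Suc n * U y = 1"
  and U: "U holomorphic_on ball 0 r"
 shows "c n = (deriv ^^ n) (\<lambda>y. 1 / g y ^ Suc n) 0 / fact n"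
proof -
 let ?B = "ball (0::complex) r"
 have wh: "w holomorphic_on ?B" unfolding w using g by (intro holomorphic_intros)
 have dw: "deriv w holomorphic_on ?B" by (rule holomorphic_deriv[OF wh open_ball])
 have wd: "(w has_field_derivative deriv w y) (at y)" if "y \<in> ?B" for y
  by (rule holomorphic_derivI[OF wh open_ball that])
 have wnz: "w y \<noteq> 0" if "y \<in> ?B - {0}" for y using gnz that by (auto simp: w)
 have dw_eq: "deriv w y = g y + y * deriv g y" if "y \<in> ?B" for y
  using holomorphic_derivI[OF g open_ball that] unfolding w
  by (intro DERIV_imp_deriv) (auto intro!: derivative_eq_intros)
 have hol: "(\<lambda>y. deriv w y / w y ^ j) holomorphic_on ?B - {0}" for j
  using wnz by (intro holomorphic_intros holomorphic_on_subset[OF dw] holomorphic_on_subset[OF wh]) auto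
 have holc: "(\<lambda>y. a * (deriv w y / w y ^ j)) holomorphic_on ?B - {0}" for a j
  by (intro holomorphic_on_mult holomorphic_on_const hol)
 have res0: "residue (\<lambda>y. deriv w y / w y ^ Suc (Suc j)) 0 = 0" for j
 proof (rule residue_derivative_eq_0[OF r _ hol])
  fix y assume y: "y \<in> ?B - {0}"
  have n: "of_nat (Suc j) \<noteq> (0::complex)" by (simp del: of_nat_Suc)
  have P: "((\<lambda>y. w y ^ Suc j) has_field_derivative of_nat (Suc j) * (deriv w y * w y ^ j)) (at y)"
   using DERIV_power[OF wd[of y], of "Suc j"] y by simp
  have "((\<lambda>y. - 1 / of_nat (Suc j) * inverse (w y ^ Suc j)) has_field_derivative
   - 1 / of_nat (Suc j) * - (inverse (w y ^ Suc j) * (of_nat (Suc j) * (deriv w y * w y ^ j)) * inverse (w y ^ Suc j))) (at y)"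
   by (rule DERIV_cmult[OF DERIV_inverse'[OF P]]) (use wnz[OF y] in simp)
  moreover have "- 1 / of_nat (Suc j) * - (inverse (w y ^ Suc j) * (of_nat (Suc j) * (deriv w y * w y ^ j)) * inverse (w y ^ Suc j)) = deriv w y / w y ^ Suc (Suc j)"
   using wnz[OF y] n by (simp add: field_simps del: of_nat_Suc)
  ultimately show "((\<lambda>y. - 1 / of_nat (Suc j) * inverse (w y ^ Suc j)) has_field_derivative deriv w y / w y ^ Suc (Suc j)) (at y)" by simp
 qed
 have res1: "residue (\<lambda>y. deriv w y / w y ^ Suc 0) 0 = 1"
 proof -
  have "residue (\<lambda>y. deriv w y / w y ^ Suc 0) 0 = residue (\<lambda>y. (deriv w y / g y) / (y - 0)) 0"
   by (rule residue_cong) (simp_all add: w mult.commute)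
  also have "\<dots> = deriv w 0 / g 0"
   by (rule residue_simple[where s="?B"]) (use r gnz g dw in \<open>auto intro!: holomorphic_intros\<close>)
  also have "\<dots> = 1" using r gnz[of 0] dw_eq[of 0] by simp
  finally show ?thesis .
 qed
 have "(deriv ^^ n) (\<lambda>y. 1 / g y ^ Suc n) 0 / fact n = residue (\<lambda>y. (1 / g y ^ Suc n) / y ^ Suc n) 0"
  by (rule residue_holomorphic_over_power'[symmetric, where A="?B"]) (use r gnz g in \<open>auto intro!: holomorphic_intros\<close>)
 \<comment> \<open>The relation \<open>inv\<close> divided by w^(n+1). Only k = n leaves a residue:
   w'/w has residue 1, while w' over a higher power of w is a derivative.\<close>
 also have "\<dots> = residue (\<lambda>y. (\<Sum>k\<le>n. c k * (deriv w y / w y ^ (Suc n - k))) + U y) 0"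
 proof (rule residue_cong)
  have "eventually (\<lambda>y. y \<in> ?B - {0}) (at 0)" by (rule eventually_at_in_open) (use r in auto)
  then show "eventually (\<lambda>y. (1 / g y ^ Suc n) / y ^ Suc n = (\<Sum>k\<le>n. c k * (deriv w y / w y ^ (Suc n - k))) + U y) (at 0)"
  proof eventually_elim
   case (elim y)
   have nz: "w y ^ Suc n \<noteq> 0" using wnz[OF elim] by simp
   have "(1 / g y ^ Suc n) / y ^ Suc n = 1 / w y ^ Suc n" by (simp add: w power_mult_distrib mult_ac)
   also have "\<dots> = ((\<Sum>k\<le>n. c k * w y ^ k) * deriv w y + w y ^ Suc n * U y) / w y ^ Suc n"
    using inv[of y] elim by simp
   also have "\<dots> = (\<Sum>k\<le>n. c k * w y ^ k * deriv w y / w y ^ Suc n) + U y"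
    using nz by (simp add: add_divide_distrib sum_distrib_right sum_divide_distrib del: power_Suc)
   also have "(\<Sum>k\<le>n. c k * w y ^ k * deriv w y / w y ^ Suc n) = (\<Sum>k\<le>n. c k * (deriv w y / w y ^ (Suc n - k)))"
   proof (rule sum.cong[OF refl])
    fix k assume "k \<in> {..n}"
    then have "w y ^ Suc n = w y ^ k * w y ^ (Suc n - k)" by (simp flip: power_add)
    then show "c k * w y ^ k * deriv w y / w y ^ Suc n = c k * (deriv w y / w y ^ (Suc n - k))"
     using wnz[OF elim] by simp
   qed
   finally show ?case .
  qed
 qed simp
 also have "\<dots> = residue (\<lambda>y. \<Sum>k\<le>n. c k * (deriv w y / w y ^ (Suc n - k))) 0 + residue U 0"
  by (rule residue_add[where s="?B"]) (use r in \<open>auto intro!: holomorphic_on_sum holc intro: holomorphic_on_subset[OF U] simp del: times_divide_eq_right\<close>)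
 also have "residue U 0 = 0" by (rule residue_holo[OF open_ball _ U]) (use r in simp)
 also have "residue (\<lambda>y. \<Sum>k\<le>n. c k * (deriv w y / w y ^ (Suc n - k))) 0 = (\<Sum>k\<le>n. residue (\<lambda>y. c k * (deriv w y / w y ^ (Suc n - k))) 0)"
  by (rule residue_sum[where S="?B"]) (use r holc in \<open>auto simp del: times_divide_eq_right\<close>)
 also have "\<dots> = (\<Sum>k\<le>n. if k = n then c n else 0)"
 proof (rule sum.cong[OF refl])
  fix k assume k: "k \<in> {..n}"
  have "residue (\<lambda>y. c k * (deriv w y / w y ^ (Suc n - k))) 0 = c k * residue (\<lambda>y. deriv w y / w y ^ (Suc n - k)) 0"
   by (rule residue_lmul[OF open_ball _ hol]) (use r in simp)
  also have "residue (\<lambda>y. deriv w y / w y ^ (Suc n - k)) 0 = (if k = n then 1 else 0)"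
  proof (cases "k = n")
   case True
   then show ?thesis using res1 by simp
  next
   case False
   then obtain j where "Suc n - k = Suc (Suc j)" using k
    by (metis Suc_diff_le atMost_iff diff_Suc_Suc diff_is_0_eq le_antisym not0_implies_Suc)
   then show ?thesis using res0[of j] False by simp
  qed
  finally show "residue (\<lambda>y. c k * (deriv w y / w y ^ (Suc n - k))) 0 = (if k = n then c n else 0)" by auto
 qed
 also have "\<dots> + 0 = c n" by simp
 finally show ?thesis by simp
qed

text \<open>The function has a double zero at 0. The value of h there comes from writing the first
  derivative in two ways and differentiating once more at 0.\<close>

lemma cosh_minus_one_factor:
 fixes x :: complex
 obtains h where "h holomorphic_on UNIV" "h 0 = 1 / 2"
  "\<And>y. x * (y - sinh y) + cosh y - 1 = y\<^sup>2 * h y"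
proof -
 define p where "p y = x * (y - sinh y) + cosh y - 1" for y
 define p' where "p' y = x * (1 - cosh y) + sinh y" for y
 have hs: "sinh holomorphic_on UNIV" "cosh holomorphic_on UNIV"
  unfolding sinh_field_def[abs_def] cosh_field_def[abs_def] by (intro holomorphic_intros; simp)+
 have p: "(p has_field_derivative p' y) (at y)" for y
  unfolding p_def[abs_def] p'_def by (auto intro!: derivative_eq_intros)
 have "p holomorphic_on UNIV" using p by (auto simp: holomorphic_on_open)
 moreover have "p 0 = 0" by (simp add: p_def)
 ultimately obtain q where q: "q holomorphic_on UNIV" "\<And>z. p z = z * q z" "q 0 = deriv p 0"
  by (rule holomorphic_factor_zero) blast
 have "q 0 = 0" unfolding q(3) using DERIV_imp_deriv[OF p[of 0]] by (simp add: p'_def)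
 with q(1) obtain h where h: "h holomorphic_on UNIV" "\<And>z. q z = z * h z"
  by (rule holomorphic_factor_zero) blast
 have dh: "(h has_field_derivative deriv h y) (at y)" for y
  by (rule holomorphic_derivI[OF h(1)]) auto
 have dh2: "(deriv h has_field_derivative deriv (deriv h) y) (at y)" for y
  by (rule holomorphic_derivI[OF holomorphic_deriv[OF h(1)]]) auto
 have ph: "p = (\<lambda>y. y\<^sup>2 * h y)" by (simp add: fun_eq_iff q h power2_eq_square)
 have "p' = (\<lambda>y. 2 * y * h y + y\<^sup>2 * deriv h y)"
 proof
  fix y
  have "(p has_field_derivative 2 * y * h y + y\<^sup>2 * deriv h y) (at y)"
   unfolding ph by (auto intro!: derivative_eq_intros dh)
  then show "p' y = 2 * y * h y + y\<^sup>2 * deriv h y" using DERIV_unique p by blast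
 qed
 moreover have "((\<lambda>y. 2 * y * h y + y\<^sup>2 * deriv h y) has_field_derivative 2 * h 0) (at 0)"
  by (auto intro!: derivative_eq_intros dh dh2)
 moreover have "(p' has_field_derivative 1) (at 0)"
  unfolding p'_def[abs_def] by (auto intro!: derivative_eq_intros)
 ultimately have "2 * h 0 = 1" using DERIV_unique by metis
 then have "h 0 = 1 / 2" by (simp add: field_simps)
 then show ?thesis using that[OF h(1)] ph unfolding p_def by metis
qed

context phase_setup
begin

text \<open>The phase seen from the saddle \<i>\<beta>, with its value there removed and the factor
  \<i> divided out. It vanishes to second order with leading term (tan \<beta>/2) y^2, and Re (t
  \<open>phi\<close>) measures the decay relative to e^(-t\<xi>).\<close>

definition phi :: "complex \<Rightarrow> complex" where
 "phi y = of_real (tan \<beta>) * (cosh y - 1) - \<i> * (sinh y - y)"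

lemma phase_phi: "phase \<beta> (\<i> * of_real \<beta> + y) = \<i> * of_real \<xi> + \<i> * phi y"
proof -
 have s: "sinh (\<i> * of_real \<beta>) = \<i> * of_real (sin \<beta>)" "cosh (\<i> * of_real \<beta>) = of_real (cos \<beta>)"
  by (simp_all add: sinh_field_def cosh_field_def exp_Euler exp_minus_Euler sin_of_real cos_of_real mult.commute)
 have "sinh (\<i> * of_real \<beta> + y) = \<i> * of_real (sin \<beta>) * cosh y + of_real (cos \<beta>) * sinh y"
  by (simp add: sinh_add s)
 then show ?thesis using cos_pos
  by (simp add: phase_def phi_def \<xi>_def tan_def field_simps)
qed

lemma phase_wave_phi:
 "phase_wave \<beta> s (\<i> * of_real \<beta> + y) = exp (- (exp s * of_real \<xi>)) * exp (- (exp s * phi y))"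
 unfolding phase_wave_def phase_phi exp_add[symmetric] by (simp add: algebra_simps)

lemma csqrt_power:
 assumes "z \<notin> \<real>\<^sub>\<le>\<^sub>0"
 shows "(1 / z) powr (of_nat m + 1 / 2) = 1 / csqrt z ^ (2 * m + 1)"
proof -
 have z: "z \<noteq> 0" using assms by auto
 have "Ln (1 / z) = - Ln z" using Ln_inverse[OF assms] by (simp add: inverse_eq_divide)
 then have "(1 / z) powr (of_nat m + 1 / 2) = exp (- (of_nat (2 * m + 1) * (Ln z / 2)))"
  using z by (simp add: powr_def algebra_simps add_divide_distrib)
 also have "\<dots> = 1 / exp (Ln z / 2) ^ (2 * m + 1)"
  by (simp only: exp_minus exp_of_nat_mult inverse_eq_divide)
 finally show ?thesis using z by (simp add: csqrt_exp_Ln)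
qed

text \<open>A root of \<open>phi\<close> is y g(y) with g = \<surd>(tan \<beta>/2) csqrt(2h). The
  power m + 1/2 in \<open>U_coeff\<close> is g^(-2m-1) up to a constant, so U_m is a multiple of the
  Lagrange coefficient of order 2m. The factorials match by Gamma(m + 1/2) = (2m)! \<surd>\<pi> /
  (4^m m!).\<close>

lemma hcoef_eq:
 assumes r: "0 < r" and h: "h holomorphic_on UNIV" "\<And>y. y \<in> ball 0 r \<Longrightarrow> 2 * h y \<notin> \<real>\<^sub>\<le>\<^sub>0"
  "\<And>y. \<i> * of_real (cot \<beta>) * (y - sinh y) + cosh y - 1 = y\<^sup>2 * h y"
 shows "hcoef m = (deriv ^^ (2 * m)) (\<lambda>y. 1 / (of_real (sqrt (tan \<beta> / 2)) * csqrt (2 * h y)) ^ Suc (2 * m)) 0 / fact (2 * m)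
  * of_real (Gamma (real m + 1 / 2))"
proof -
 let ?c = "sqrt (tan \<beta> / 2)"
 let ?B = "ball (0::complex) r"
 define f where "f y = 1 / csqrt (2 * h y) ^ Suc (2 * m)" for y
 have hnz: "h y \<noteq> 0" if "y \<in> ?B" for y using h(2)[OF that] by auto
 have f: "f holomorphic_on ?B" unfolding f_def
  using h(2) hnz by (intro holomorphic_intros holomorphic_on_subset[OF h(1)]) auto
 have "U_coeff m (\<i> * of_real (cot \<beta>)) = (- 1) ^ m * ((\<i> * of_real (cot \<beta>)) ^ m / (2 ^ m * fact m)) * (deriv ^^ (2 * m)) f 0"
 proof -
  have rs: "remove_sings (\<lambda>t. 1 / 2 * (t\<^sup>2 / (\<i> * of_real (cot \<beta>) * (t - sinh t) + cosh t - 1))) y = 1 / (2 * h y)"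
   if "y \<in> ?B" for y
   by (rule remove_sings_eq_analytic[OF open_ball _ _ that, where ?z0.0=0])
    (use h(3) hnz in \<open>auto intro!: holomorphic_intros holomorphic_on_subset[OF h(1)]\<close>)
  have "eventually (\<lambda>y. y \<in> ?B) (nhds 0)" using r by (intro eventually_nhds_in_open) auto
  then have "eventually (\<lambda>y. remove_sings (\<lambda>t. 1 / 2 * (t\<^sup>2 / (\<i> * of_real (cot \<beta>) * (t - sinh t) + cosh t - 1))) y powr (of_nat m + 1 / 2) = f y) (nhds 0)"
   by eventually_elim (simp only: rs f_def csqrt_power[OF h(2)] Suc_eq_plus1)
  then show ?thesis unfolding U_coeff_def by (simp add: higher_deriv_cong_ev)
 qed
 moreover have "(- 1) ^ m * (\<i> * of_real (cot \<beta>)) ^ m * \<i> ^ m = of_real (cot \<beta>) ^ m"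
 proof -
  have "(- 1) * (\<i> * of_real (cot \<beta>)) * \<i> = complex_of_real (cot \<beta>)" by (simp add: complex_eq_iff)
  then show ?thesis by (simp only: power_mult_distrib[symmetric])
 qed
 ultimately have u: "ucoef m = of_real (cot \<beta> ^ m / (2 ^ m * fact m)) * (deriv ^^ (2 * m)) f 0"
  by (simp add: ucoef_def mult_ac)
 have "(\<lambda>y. 1 / (of_real ?c * csqrt (2 * h y)) ^ Suc (2 * m)) = (\<lambda>y. of_real (1 / ?c ^ Suc (2 * m)) * f y)"
  by (simp add: fun_eq_iff f_def power_mult_distrib)
 moreover have "(deriv ^^ (2 * m)) (\<lambda>y. of_real (1 / ?c ^ Suc (2 * m)) * f y) 0 = of_real (1 / ?c ^ Suc (2 * m)) * (deriv ^^ (2 * m)) f 0"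
  by (rule higher_deriv_cmult[OF f]) (use r in auto)
 ultimately have R: "(deriv ^^ (2 * m)) (\<lambda>y. 1 / (of_real ?c * csqrt (2 * h y)) ^ Suc (2 * m)) 0 = of_real (1 / ?c ^ Suc (2 * m)) * (deriv ^^ (2 * m)) f 0"
  by simp
 have G: "Gamma (real m + 1 / 2) = fact (2 * m) / (4 ^ m * fact m) * sqrt pi"
 proof (induction m)
  case (Suc m)
  have "real m + 1 / 2 \<notin> \<int>\<^sub>\<le>\<^sub>0" by (auto simp: nonpos_Ints_def)
  from Gamma_plus1[OF this] have "Gamma (real (Suc m) + 1 / 2) = (real m + 1 / 2) * Gamma (real m + 1 / 2)"
   by (simp add: add_ac)
  moreover have "((2 * n + 2) * ((2 * n + 1) * F)) / (4 * q * ((n + 1) * q')) = (n + 1 / 2) * (F / (q * q'))"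
   if "0 \<le> n" for n F q q' :: real using that by (simp add: divide_simps) (simp add: algebra_simps)
  from this[of "real m" "fact (2 * m)" "4 ^ m" "fact m"]
  have "fact (2 * Suc m) / (4 ^ Suc m * fact (Suc m)) = (real m + 1 / 2) * (fact (2 * m) / (4 ^ m * fact m))"
   by (simp add: add_ac mult_ac)
  ultimately show ?case unfolding Suc.IH by simp
 qed (simp add: Gamma_one_half_real)
 have "sqrt (2 * pi * cot \<beta>) * (cot \<beta> ^ m / (2 ^ m * fact m)) = 1 / ?c ^ Suc (2 * m) / fact (2 * m) * Gamma (real m + 1 / 2)"
 proof -
  have t: "tan \<beta> / 2 > 0" using tan_pos by simp
  have "1 / ?c ^ Suc (2 * m) = (2 * cot \<beta>) ^ m * sqrt (2 * cot \<beta>)"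
  proof -
   have "?c ^ (2 * m) = (tan \<beta> / 2) ^ m" using t by (simp add: power_mult)
   moreover have "1 / (tan \<beta> / 2) ^ m = (2 * cot \<beta>) ^ m" by (simp add: cot_altdef power_divide power_mult_distrib field_simps)
   moreover have "1 / ?c = sqrt (2 * cot \<beta>)"
    by (simp add: real_sqrt_divide[symmetric] real_sqrt_inverse[symmetric] cot_altdef inverse_eq_divide)
     (simp add: real_sqrt_divide)
   ultimately show ?thesis by (metis (no_types) mult.commute mult.right_neutral power_Suc times_divide_times_eq)
  qed
  moreover have "sqrt (2 * pi * cot \<beta>) = sqrt (2 * cot \<beta>) * sqrt pi" by (simp add: real_sqrt_mult)
  moreover have "(4::real) ^ m = 2 ^ m * 2 ^ m" by (simp flip: power_mult_distrib)
  ultimately show ?thesis unfolding G by (simp add: power_mult_distrib field_simps)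
 qed
 then have "complex_of_real (sqrt (2 * pi * cot \<beta>)) * of_real (cot \<beta> ^ m / (2 ^ m * fact m)) = of_real (1 / ?c ^ Suc (2 * m)) / fact (2 * m) * of_real (Gamma (real m + 1 / 2))"
  by (metis of_real_divide of_real_fact of_real_mult)
 moreover have "s * (k * D) = a * D / F * G" if "s * k = a / F * G" for s k a F G D :: complex
 proof -
  have "s * (k * D) = s * k * D" by simp
  then show ?thesis unfolding that by simp
 qed
 ultimately show ?thesis unfolding hcoef_def u R by blast
qed

text \<open>w is the root of \<open>phi\<close> close to \<surd>(tan \<beta>/2) y, Y its local
  inverse, and c the Taylor coefficients of the derivative of Y, the density that Watson's lemma
  needs. The closeness of w decides on each leg which of the two roots is meant.\<close>

lemma local_inverse:
 obtains w Y :: "complex \<Rightarrow> complex" and c r \<rho>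
 where "0 < r" "0 < \<rho>" "Y holomorphic_on ball 0 \<rho>" "Y 0 = 0"
  "\<And>y. norm y < r \<Longrightarrow> norm (w y) < \<rho> \<and> Y (w y) = y"
  "\<And>y. norm y < r \<Longrightarrow> norm (w y / of_real (sqrt (tan \<beta> / 2)) - y) \<le> norm y / 4"
  "\<And>y. norm y < r \<Longrightarrow> (w y)\<^sup>2 = phi y"
  "\<And>\<omega>. norm \<omega> < \<rho> \<Longrightarrow> phi (Y \<omega>) = \<omega>\<^sup>2"
  "\<And>K. \<exists>A. \<forall>\<omega>. norm \<omega> < \<rho> \<longrightarrow> norm (deriv Y \<omega> - (\<Sum>k<K. c k * \<omega> ^ k)) \<le> A * norm \<omega> ^ K"
  "\<And>m. hcoef m = c (2 * m) * of_real (Gamma (real m + 1 / 2))"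
proof -
 let ?x = "\<i> * complex_of_real (cot \<beta>)"
 let ?c = "sqrt (tan \<beta> / 2)"
 have c0: "0 < ?c" using tan_pos by simp
 obtain h where h: "h holomorphic_on UNIV" "h 0 = 1 / 2" "\<And>y. ?x * (y - sinh y) + cosh y - 1 = y\<^sup>2 * h y"
  by (rule cosh_minus_one_factor[of ?x]) blast
 have phih: "phi y = of_real (tan \<beta>) * (y\<^sup>2 * h y)" for y
 proof -
  have "of_real (tan \<beta>) * (?x * (y - sinh y) + cosh y - 1) = \<i> * of_real (tan \<beta> * cot \<beta>) * (y - sinh y) + of_real (tan \<beta>) * (cosh y - 1)"
   by (simp add: algebra_simps)
  also have "tan \<beta> * cot \<beta> = 1" using tan_pos by (simp add: cot_altdef)
  finally show ?thesis unfolding h(3) by (simp add: phi_def algebra_simps)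
 qed
 have "isCont h 0" using holomorphic_on_imp_continuous_on[OF h(1)] by (simp add: continuous_on_eq_continuous_at)
 \<comment> \<open>1/8 gives |2h - 1| < 1/4. This keeps 2h in the right half-plane and its root q
   within 1/4 of 1, because |q - 1| |q + 1| = |q^2 - 1| and |q + 1| \<ge> 1.\<close>
 then obtain r0 where r0: "0 < r0" "\<And>y. dist y 0 < r0 \<Longrightarrow> dist (h y) (h 0) < 1 / 8"
  unfolding continuous_at_eps_delta by (metis zero_less_divide_1_iff zero_less_numeral)
 have hb: "norm (2 * h y - 1) < 1 / 4" if "norm y < r0" for y
 proof -
  have "norm (2 * (h y - h 0)) < 2 * (1 / 8)" using r0(2)[of y] that unfolding norm_mult by (simp add: dist_norm)
  then show ?thesis by (simp add: h(2) right_diff_distrib)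
 qed
 have re: "0 < Re (2 * h y)" if "norm y < r0" for y
  using hb[OF that] abs_Re_le_cmod[of "2 * h y - 1"] by simp
 have hR: "2 * h y \<notin> \<real>\<^sub>\<le>\<^sub>0" if "norm y < r0" for y
  using re[OF that] by (auto simp: complex_nonpos_Reals_iff)
 have cs: "norm (csqrt (2 * h y) - 1) \<le> 1 / 4" if "norm y < r0" for y
 proof -
  define q where "q = csqrt (2 * h y)"
  have q2: "q\<^sup>2 = 2 * h y" by (simp add: q_def)
  have "0 \<le> Re q" unfolding q_def by (rule csqrt_principal[THEN disjE, of "2 * h y"]) auto
  then have "1 \<le> norm (q + 1)" using abs_Re_le_cmod[of "q + 1"] by simp
  then have "norm (q - 1) * 1 \<le> norm (q - 1) * norm (q + 1)" by (intro mult_left_mono) auto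
  also have "\<dots> = norm (q\<^sup>2 - 1)" unfolding norm_mult[symmetric] by (simp add: power2_eq_square algebra_simps)
  finally show ?thesis using hb[OF that] unfolding q_def[symmetric] q2 by simp
 qed
 define g where "g y = of_real ?c * csqrt (2 * h y)" for y
 define w where "w = (\<lambda>y. y * g y)"
 have gh: "g holomorphic_on ball 0 r0" unfolding g_def using hR
  by (intro holomorphic_intros holomorphic_on_subset[OF h(1)]) auto
 have gnz: "g y \<noteq> 0" if "norm y < r0" for y using hR[OF that] c0 tan_pos by (auto simp: g_def)
 have wh: "w holomorphic_on ball 0 r0" unfolding w_def using gh by (intro holomorphic_intros)
 have wphi: "(w y)\<^sup>2 = phi y" for y
 proof -
  have "(of_real ?c)\<^sup>2 = complex_of_real (?c\<^sup>2)" by simp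
  also have "?c\<^sup>2 = tan \<beta> / 2" using tan_pos by simp
  finally have "(of_real ?c)\<^sup>2 = complex_of_real (tan \<beta> / 2)" .
  then show ?thesis unfolding w_def g_def phih power_mult_distrib power2_csqrt by simp
 qed
 have wapprox: "norm (w y / of_real ?c - y) \<le> norm y / 4" if "norm y < r0" for y
 proof -
  have "w y / of_real ?c - y = y * (csqrt (2 * h y) - 1)"
   using c0 tan_pos by (simp add: w_def g_def algebra_simps)
  then show ?thesis using mult_left_mono[OF cs[OF that] norm_ge_zero[of y]] by (simp add: norm_mult)
 qed
 have "deriv w 0 = g 0"
  unfolding w_def using holomorphic_derivI[OF gh open_ball, of 0] r0(1)
  by (intro DERIV_imp_deriv) (auto intro!: derivative_eq_intros)
 then have dw0: "deriv w 0 \<noteq> 0" using gnz[of 0] r0(1) by simp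
 have "0 \<in> ball (0::complex) r0" using r0(1) by simp
 note inj = has_complex_derivative_locally_injective[OF wh this open_ball dw0]
 obtain r1 where r1: "0 < r1" "ball 0 r1 \<subseteq> ball (0::complex) r0" "inj_on w (ball 0 r1)"
 proof (rule inj)
  fix r assume r: "0 < r" "ball 0 r \<subseteq> ball (0::complex) r0" "inj_on w (ball 0 r)"
  show thesis by (rule that[OF r])
 qed
 have wh1: "w holomorphic_on ball 0 r1" using wh r1(2) by (rule holomorphic_on_subset)
 obtain Y where Y: "Y holomorphic_on w ` ball 0 r1" "\<And>z. z \<in> ball 0 r1 \<Longrightarrow> deriv w z * deriv Y (w z) = 1"
  "\<And>z. z \<in> ball 0 r1 \<Longrightarrow> Y (w z) = z"
 proof (rule holomorphic_has_inverse[OF wh1 open_ball r1(3)])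
  fix g assume g: "g holomorphic_on w ` ball 0 r1" "\<And>z. z \<in> ball 0 r1 \<Longrightarrow> deriv w z * deriv g (w z) = 1"
   "\<And>z. z \<in> ball 0 r1 \<Longrightarrow> g (w z) = z"
  show thesis by (rule that[OF g])
 qed
 have w0: "w 0 = 0" by (simp add: w_def)
 have "open (w ` ball 0 r1)" by (rule open_mapping_thm3[OF wh1 open_ball r1(3)])
 moreover have "0 \<in> w ` ball 0 r1" using w0 r1(1) by (metis centre_in_ball imageI)
 ultimately obtain \<rho>0 where \<rho>0: "0 < \<rho>0" "ball 0 \<rho>0 \<subseteq> w ` ball 0 r1"
  using open_contains_ball_eq by metis
 \<comment> \<open>Half the radius, so that the Taylor remainders are bounded on a compact
   disc.\<close>
 define \<rho> where "\<rho> = \<rho>0 / 2"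
 have \<rho>: "0 < \<rho>" "\<rho> < \<rho>0" using \<rho>0 by (auto simp: \<rho>_def)
 have Yh: "Y holomorphic_on ball 0 \<rho>0" by (rule holomorphic_on_subset[OF Y(1) \<rho>0(2)])
 have dYh: "deriv Y holomorphic_on ball 0 \<rho>0" by (rule holomorphic_deriv[OF Yh open_ball])
 obtain c V where cV: "\<And>K. V K holomorphic_on ball 0 \<rho>0" "\<And>K z. deriv Y z = (\<Sum>k<K. c k * z ^ k) + z ^ K * V K z"
 proof (rule taylor_remainder[OF dYh])
  fix c V assume cV: "\<And>K. V K holomorphic_on ball 0 \<rho>0" "\<And>K z. deriv Y z = (\<Sum>k<K. c k * z ^ k) + z ^ K * V K z"
  show thesis by (rule that[OF cV])
 qed
 have "isCont w 0"
  using holomorphic_on_imp_continuous_on[OF wh] r0(1) by (simp add: continuous_on_eq_continuous_at)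
 then obtain r2 where r2: "0 < r2" "\<And>y. norm y < r2 \<Longrightarrow> norm (w y) < \<rho>"
  using \<rho>(1) w0 unfolding continuous_at_eps_delta by (metis diff_zero dist_norm)
 define r where "r = min r1 r2"
 have r: "0 < r" "r \<le> r1" "r \<le> r2" "r \<le> r0"
  using r1 r2(1) by (auto simp: r_def ball_subset_ball_iff)
 show ?thesis
 proof (rule that[of r \<rho> Y w c])
  show "0 < r" "0 < \<rho>" by fact+
  show "Y holomorphic_on ball 0 \<rho>" by (rule holomorphic_on_subset[OF Yh]) (use \<rho>(2) in auto)
  show "Y 0 = 0" using Y(3)[of 0] w0 r1(1) by simp
  show "norm (w y) < \<rho> \<and> Y (w y) = y" if "norm y < r" for y
   using r2(2)[of y] Y(3)[of y] r that by auto
  show "norm (w y / of_real ?c - y) \<le> norm y / 4" if "norm y < r" for y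
   using wapprox[of y] r that by auto
  show "(w y)\<^sup>2 = phi y" for y by (rule wphi)
  show "phi (Y \<omega>) = \<omega>\<^sup>2" if "norm \<omega> < \<rho>" for \<omega>
  proof -
   have "\<omega> \<in> ball 0 \<rho>0" using that \<rho>(2) by simp
   then obtain y where "y \<in> ball 0 r1" "\<omega> = w y" using \<rho>0(2) by blast
   then show ?thesis using Y(3) wphi by simp
  qed
  show "\<exists>A. \<forall>\<omega>. norm \<omega> < \<rho> \<longrightarrow> norm (deriv Y \<omega> - (\<Sum>k<K. c k * \<omega> ^ k)) \<le> A * norm \<omega> ^ K" for K
  proof -
   have "bounded (V K ` cball 0 \<rho>)"
    using \<rho>(2) by (intro compact_imp_bounded compact_continuous_image holomorphic_on_imp_continuous_on holomorphic_on_subset[OF cV(1)[of K]]) auto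
   then obtain A where A: "\<forall>z\<in>cball 0 \<rho>. norm (V K z) \<le> A" unfolding bounded_iff by blast
   have "norm (deriv Y \<omega> - (\<Sum>k<K. c k * \<omega> ^ k)) \<le> A * norm \<omega> ^ K" if "norm \<omega> < \<rho>" for \<omega>
   proof -
    have "norm (V K \<omega>) \<le> A" using A that by simp
    then have "norm \<omega> ^ K * norm (V K \<omega>) \<le> norm \<omega> ^ K * A" by (intro mult_left_mono) auto
    then show ?thesis by (subst cV(2)[of \<omega> K]) (simp add: norm_mult norm_power mult.commute)
   qed
   then show ?thesis by blast
  qed
  show "hcoef m = c (2 * m) * of_real (Gamma (real m + 1 / 2))" for m
  proof -
   have sub: "ball 0 r \<subseteq> ball (0::complex) r1" "ball 0 r \<subseteq> ball (0::complex) r0" "w ` ball 0 r \<subseteq> ball 0 \<rho>0"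
    using r less_trans[OF r2(2) \<rho>(2)] by auto
   have "c (2 * m) = (deriv ^^ (2 * m)) (\<lambda>y. 1 / g y ^ Suc (2 * m)) 0 / fact (2 * m)"
   proof (rule lagrange_inversion[OF r(1) _ _ w_def])
    show "g holomorphic_on ball 0 r" using gh sub(2) by (rule holomorphic_on_subset)
    show "g y \<noteq> 0" if "y \<in> ball 0 r" for y using gnz[of y] that r by auto
    let ?V = "V (Suc (2 * m))"
    show "(\<lambda>y. ?V (w y) * deriv w y) holomorphic_on ball 0 r"
     using holomorphic_on_compose_gen[OF holomorphic_on_subset[OF wh sub(2)] cV(1) sub(3)]
      holomorphic_on_subset[OF holomorphic_deriv[OF wh open_ball] sub(2)]
     by (intro holomorphic_on_mult) (auto simp: o_def)
    show "(\<Sum>k\<le>2 * m. c k * w y ^ k) * deriv w y + w y ^ Suc (2 * m) * (?V (w y) * deriv w y) = 1" if "y \<in> ball 0 r" for y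
    proof -
     have "deriv Y (w y) * deriv w y = 1" using Y(2)[of y] sub(1) that by (auto simp: mult.commute)
     then show ?thesis unfolding cV(2)[of "w y" "Suc (2 * m)"] lessThan_Suc_atMost
      by (simp add: algebra_simps)
    qed
   qed
   then show ?thesis unfolding g_def
    by (subst hcoef_eq[OF r0(1) h(1) _ h(3)]) (use hR in auto)
  qed
 qed
qed

end

section \<open>Polygonal legs through the saddle\<close>

lemma DERIV2_pos_imp_pos:
 fixes f f' f'' :: "real \<Rightarrow> real"
 assumes f: "\<And>x. (f has_real_derivative f' x) (at x)" "\<And>x. (f' has_real_derivative f'' x) (at x)"
  and 0: "f 0 = 0" "f' 0 = 0" and pos: "\<And>x. 0 < x \<Longrightarrow> x < A \<Longrightarrow> 0 < f'' x" and a: "0 < a" "a \<le> A"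
 shows "0 < f a"
proof -
 have c: "continuous_on B f" "continuous_on B f'" for B
  using f by (auto intro!: continuous_at_imp_continuous_on DERIV_isCont)
 have f'pos: "0 < f' x" if "0 < x" "x < A" for x
 proof -
  have "f' 0 < f' x"
  proof (rule DERIV_pos_imp_increasing_open[OF that(1)])
   fix y assume "0 < y" "y < x"
   then show "\<exists>d. (f' has_real_derivative d) (at y) \<and> 0 < d" using f(2) pos[of y] that by auto
  qed (rule c)
  then show ?thesis using 0 by simp
 qed
 have "f 0 < f a"
 proof (rule DERIV_pos_imp_increasing_open[OF a(1)])
  fix y assume "0 < y" "y < a"
  then show "\<exists>d. (f has_real_derivative d) (at y) \<and> 0 < d" using f(1) f'pos[of y] a by auto
 qed (rule c)
 then show ?thesis using 0 by simp
qed

lemma sinh_add_ge: "0 \<le> x \<Longrightarrow> 0 \<le> a \<Longrightarrow> x * cosh a \<le> sinh (a + x) - sinh (a::real)"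
 and cosh_add_ge: "0 \<le> x \<Longrightarrow> 0 \<le> a \<Longrightarrow> x * sinh a \<le> cosh (a + x) - cosh (a::real)"
proof -
 assume x: "0 \<le> x" "0 \<le> a"
 have "(\<lambda>x. sinh (a + x) - x * cosh a) 0 \<le> (\<lambda>x. sinh (a + x) - x * cosh a) x"
 proof (rule DERIV_nonneg_imp_nondecreasing[OF x(1)])
  fix y :: real assume y: "0 \<le> y"
  have "cosh a \<le> cosh (a + y)" using x y by (simp add: cosh_real_nonneg_le_iff)
  then show "\<exists>d. ((\<lambda>x. sinh (a + x) - x * cosh a) has_real_derivative d) (at y) \<and> 0 \<le> d"
   by (intro exI[of _ "cosh (a + y) - cosh a"]) (auto intro!: derivative_eq_intros)
 qed
 then show "x * cosh a \<le> sinh (a + x) - sinh a" by simp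
next
 assume x: "0 \<le> x" "0 \<le> a"
 have "(\<lambda>x. cosh (a + x) - x * sinh a) 0 \<le> (\<lambda>x. cosh (a + x) - x * sinh a) x"
 proof (rule DERIV_nonneg_imp_nondecreasing[OF x(1)])
  fix y :: real assume y: "0 \<le> y"
  have "sinh a \<le> sinh (a + y)" using x y by simp
  then show "\<exists>d. ((\<lambda>x. cosh (a + x) - x * sinh a) has_real_derivative d) (at y) \<and> 0 \<le> d"
   by (intro exI[of _ "sinh (a + y) - sinh a"]) (auto intro!: derivative_eq_intros)
 qed
 then show "x * sinh a \<le> cosh (a + x) - cosh a" by simp
qed

lemma sinh_gt_self: "0 < a \<Longrightarrow> a < sinh (a::real)"
proof -
 assume a: "0 < a"
 have "0 < sinh a - a"
  by (rule DERIV2_pos_imp_pos[where f="\<lambda>a. sinh a - a" and f'="\<lambda>a. cosh a - 1" and f''=sinh and A=a])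
   (use a in \<open>auto intro!: derivative_eq_intros\<close>)
 then show ?thesis by simp
qed

lemma sinh_le_mult_cosh: "0 \<le> a \<Longrightarrow> sinh a \<le> a * cosh (a::real)"
proof -
 assume a: "0 \<le> a"
 have "(\<lambda>a. a * cosh a - sinh a) 0 \<le> (\<lambda>a. a * cosh a - sinh a) a"
 proof (rule DERIV_nonneg_imp_nondecreasing[OF a])
  fix x :: real assume "0 \<le> x"
  then show "\<exists>d. ((\<lambda>a. a * cosh a - sinh a) has_real_derivative d) (at x) \<and> 0 \<le> d"
   by (intro exI[of _ "x * sinh x"]) (auto intro!: derivative_eq_intros)
 qed
 then show ?thesis by simp
qed

lemma cosh_gt_1: "0 < a \<Longrightarrow> 1 < cosh (a::real)"
proof -
 assume a: "0 < a"
 have "0 < a / 2 * sinh (a / 2)" using a by (intro mult_pos_pos) auto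
 also have "\<dots> \<le> cosh (a / 2 + a / 2) - cosh (a / 2)" using a by (intro cosh_add_ge) auto
 finally show ?thesis using cosh_real_ge_1[of "a / 2"] by simp
qed

context phase_setup
begin

text \<open>\<open>leg_P\<close> and \<open>leg_Q\<close> are the real part of the phase at a +
  \<i>b and its imaginary part less the saddle value \<xi>. In Re (t \<open>phi\<close>) they are
  weighted by sin (arg t) and cos (arg t), so fixed signs of both give decay for a whole quadrant of
  arg t.\<close>

definition leg_P :: "real \<Rightarrow> real \<Rightarrow> real" where "leg_P a b = sinh a * cos b / cos \<beta> - a"
definition leg_Q :: "real \<Rightarrow> real \<Rightarrow> real" where "leg_Q a b = cosh a * sin b / cos \<beta> - b - \<xi>"

lemma phi_parts: "Re (phi (Complex a v)) = leg_Q a (\<beta> + v)" "Im (phi (Complex a v)) = - leg_P a (\<beta> + v)"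
proof -
 have c: "\<i> * of_real \<beta> + Complex a v = Complex a (\<beta> + v)" by (simp add: complex_eq_iff)
 have "phase \<beta> (Complex a (\<beta> + v)) = \<i> * of_real \<xi> + \<i> * phi (Complex a v)"
  using phase_phi[of "Complex a v"] unfolding c .
 with phase_parts[of \<beta> a "\<beta> + v"] show "Re (phi (Complex a v)) = leg_Q a (\<beta> + v)" "Im (phi (Complex a v)) = - leg_P a (\<beta> + v)"
  by (auto simp: leg_P_def leg_Q_def)
qed

lemma \<xi>_cos: "\<xi> * cos \<beta> = sin \<beta> - \<beta> * cos \<beta>"
 using cos_pos by (simp add: \<xi>_def tan_def field_simps)

lemma leg_P_right: "0 < a \<Longrightarrow> cos \<beta> \<le> cos b \<Longrightarrow> 0 < leg_P a b"
proof -
 assume a: "0 < a" "cos \<beta> \<le> cos b"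
 have "sinh a * 1 \<le> sinh a * (cos b / cos \<beta>)" using a cos_pos by (intro mult_left_mono) auto
 then show ?thesis using sinh_gt_self[OF a(1)] by (simp add: leg_P_def)
qed

text \<open>Once the height passes \<pi>/2, cos is nonpositive and there is nothing to beat. Before
  that, the second derivative along the leg is positive; for k < 1 this argument needs 2k^2 > 1 -
  k^2, that is k > 1/\<surd>3, and 3/5 just satisfies it. The threshold is natural: for small
  \<beta> the phase is nearly T^3/6, and Re T^3 > 0 in the direction -1 + \<i>k means 3k^2 >
  1.\<close>

lemma leg_P_left:
 assumes a: "0 < a" and k: "k = 3 / 5 \<or> k = 2" and b: "\<beta> + k * a \<le> 3 * pi / 2"
 shows "0 < leg_P (- a) (\<beta> + k * a)"
proof (cases "\<beta> + k * a \<le> pi / 2")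
 case False
 then have "0 \<le> - cos (\<beta> + k * a)"
  using b cos_ge_zero[of "\<beta> + k * a - pi"] by (simp add: cos_diff)
 then have "0 \<le> sinh a * (- cos (\<beta> + k * a)) / cos \<beta>" using a cos_pos by (intro divide_nonneg_pos mult_nonneg_nonneg) auto
 then show ?thesis using a by (simp add: leg_P_def)
next
 case True
 have "0 < a * cos \<beta> - sinh a * cos (\<beta> + k * a)"
 proof (rule DERIV2_pos_imp_pos[where A=a and f="\<lambda>a. a * cos \<beta> - sinh a * cos (\<beta> + k * a)"
    and f'="\<lambda>a. cos \<beta> - cosh a * cos (\<beta> + k * a) + k * (sinh a * sin (\<beta> + k * a))"
    and f''="\<lambda>a. 2 * k * (cosh a * sin (\<beta> + k * a)) - (1 - k\<^sup>2) * (sinh a * cos (\<beta> + k * a))"])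
  fix x assume x: "0 < x" "x < a"
  let ?b = "\<beta> + k * x"
  have kp: "0 < k" using k by auto
  have kx: "k * x \<le> k * a" "0 < k * x" using x kp by auto
  have b: "0 < ?b" "?b \<le> pi / 2" "k * x \<le> ?b" using kx True \<beta> by linarith+
  have cb: "0 \<le> cos ?b" using b by (intro cos_ge_zero) auto
  have sb: "0 < sin ?b" using b by (intro sin_gt_zero) auto
  show "0 < 2 * k * (cosh x * sin ?b) - (1 - k\<^sup>2) * (sinh x * cos ?b)"
   using k
  proof
   assume k: "k = 3 / 5"
   have "?b * cos ?b < sin ?b" using b by (intro mult_cos_less_sin) auto
   moreover have "k * x * cos ?b \<le> ?b * cos ?b" using b(3) cb by (rule mult_right_mono)
   ultimately have "k * x * cos ?b < sin ?b" by linarith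
   then have "cosh x * (k * x * cos ?b) < cosh x * sin ?b" by simp
   then have "3 / 5 * (x * cosh x * cos ?b) < cosh x * sin ?b" by (simp only: k mult_ac)
   moreover have "sinh x * cos ?b \<le> x * cosh x * cos ?b" using sinh_le_mult_cosh[of x] x cb by (intro mult_right_mono) auto
   moreover have "0 \<le> sinh x * cos ?b" using x cb by simp
   ultimately have F: "0 < 2 * (3 / 5) * (cosh x * sin ?b) - 16 / 25 * (sinh x * cos ?b)" by linarith
   have e: "1 - k\<^sup>2 = 16 / 25" by (simp add: k power2_eq_square)
   show ?thesis unfolding e using F by (simp only: k)
  next
   assume k: "k = 2"
   have "0 < cosh x * sin ?b" using sb by simp
   moreover have "0 \<le> sinh x * cos ?b" using x cb by simp
   ultimately show ?thesis unfolding k by simp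
  qed
 qed (use a in \<open>auto intro!: derivative_eq_intros simp: algebra_simps power2_eq_square\<close>)
 then show ?thesis using cos_pos by (simp add: leg_P_def field_simps)
qed

text \<open>At the saddle \<open>leg_Q\<close> vanishes together with its derivative along the leg,
  so the sign of the second derivative decides; the assumption \<open>pos\<close> is that second
  derivative multiplied by cos \<beta>.\<close>

lemma leg_Q_sign:
 assumes a: "0 < a" "a \<le> A"
  and pos: "\<And>x. 0 < x \<Longrightarrow> x < A \<Longrightarrow> 0 < \<epsilon> * ((1 - \<tau>\<^sup>2) * (cosh x * sin (\<beta> + \<tau> * x)) + 2 * \<tau> * (sinh x * cos (\<beta> + \<tau> * x)))"
 shows "0 < \<epsilon> * leg_Q a (\<beta> + \<tau> * a)"
proof -
 have "0 < \<epsilon> * (cosh a * sin (\<beta> + \<tau> * a) - (\<beta> + \<tau> * a) * cos \<beta> - \<xi> * cos \<beta>)"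
 proof (rule DERIV2_pos_imp_pos[OF _ _ _ _ pos a, where f="\<lambda>a. \<epsilon> * (cosh a * sin (\<beta> + \<tau> * a) - (\<beta> + \<tau> * a) * cos \<beta> - \<xi> * cos \<beta>)"
   and f'="\<lambda>a. \<epsilon> * (sinh a * sin (\<beta> + \<tau> * a) + \<tau> * (cosh a * cos (\<beta> + \<tau> * a)) - \<tau> * cos \<beta>)"])
 qed (auto intro!: derivative_eq_intros simp: algebra_simps power2_eq_square \<xi>_cos)
 then have "0 < \<epsilon> * (cosh a * sin (\<beta> + \<tau> * a) - (\<beta> + \<tau> * a) * cos \<beta> - \<xi> * cos \<beta>) / cos \<beta>"
  using cos_pos by simp
 also have "\<dots> = \<epsilon> * leg_Q a (\<beta> + \<tau> * a)"
  using cos_pos by (simp add: leg_Q_def diff_divide_distrib[symmetric] field_simps)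
 finally show ?thesis .
qed

text \<open>A leg leaves \<i>\<beta> along \<i>\<beta> + a(\<sigma> + \<i>\<tau>) up to a = A and
  continues horizontally, to the right for \<sigma> = 1 and to the left for \<sigma> = -1.
  \<epsilon> is the sign of cos (arg t) for which it is designed. The conditions on sin and cos at
  the final height let both quantities grow on the horizontal part.\<close>

definition is_leg :: "real \<Rightarrow> real \<Rightarrow> real \<Rightarrow> real \<Rightarrow> bool" where
 "is_leg \<epsilon> \<sigma> \<tau> A \<longleftrightarrow> (\<epsilon> = 1 \<or> \<epsilon> = -1) \<and> (\<sigma> = 1 \<or> \<sigma> = -1) \<and> \<bar>\<tau>\<bar> \<le> 2 \<and> 0 < A \<and>
  (\<forall>a. 0 < a \<and> a \<le> A \<longrightarrow> 0 < leg_P (\<sigma> * a) (\<beta> + \<tau> * a) \<and> 0 < \<epsilon> * leg_Q (\<sigma> * a) (\<beta> + \<tau> * a)) \<and>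
  0 < \<epsilon> * sin (\<beta> + \<tau> * A) \<and> (\<sigma> = 1 \<and> cos (\<beta> + \<tau> * A) = cos \<beta> \<or> \<sigma> = -1 \<and> cos (\<beta> + \<tau> * A) \<le> 0)"

lemma is_legD:
 assumes "is_leg \<epsilon> \<sigma> \<tau> A"
 shows "\<epsilon> = 1 \<or> \<epsilon> = -1" "\<sigma> = 1 \<or> \<sigma> = -1" "\<bar>\<tau>\<bar> \<le> 2" "0 < A"
  "\<And>a. 0 < a \<Longrightarrow> a \<le> A \<Longrightarrow> 0 < leg_P (\<sigma> * a) (\<beta> + \<tau> * a)"
  "\<And>a. 0 < a \<Longrightarrow> a \<le> A \<Longrightarrow> 0 < \<epsilon> * leg_Q (\<sigma> * a) (\<beta> + \<tau> * a)"
  "0 < \<epsilon> * sin (\<beta> + \<tau> * A)"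
  "\<sigma> = 1 \<and> cos (\<beta> + \<tau> * A) = cos \<beta> \<or> \<sigma> = -1 \<and> cos (\<beta> + \<tau> * A) \<le> 0"
 using assms unfolding is_leg_def by blast+

lemma leg_Q_minus: "leg_Q (- a) b = leg_Q a b" by (simp add: leg_Q_def)

text \<open>The whole leg is the horizontal ray from the saddle, where \<open>leg_Q\<close> is tan
  \<beta> (cosh a - 1); A = 1 is merely a cut.\<close>

lemma right_leg_1: "is_leg 1 1 0 1"
proof -
 have "leg_Q a \<beta> = tan \<beta> * (cosh a - 1)" for a
  by (simp add: leg_Q_def \<xi>_def tan_def right_diff_distrib)
 then show ?thesis
  unfolding is_leg_def using leg_P_right[of _ \<beta>] \<beta> tan_pos cosh_gt_1
  by (auto intro!: sin_gt_zero)
qed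

text \<open>A left ray converges when its height minus arg t lies in (0, \<pi>); height \<pi>/2
  suits all arg t in [0, \<pi>/2). The slope must exceed 1/\<surd>3 for \<open>leg_P\<close> and
  stay below 1, so that 1 - \<tau>^2 keeps \<open>leg_Q\<close> positive.\<close>

lemma left_leg_1: "is_leg 1 (- 1) (3 / 5) (5 / 3 * (pi / 2 - \<beta>))"
 unfolding is_leg_def
proof (intro conjI allI impI)
 have b1: "\<beta> + 3 / 5 * (5 / 3 * (pi / 2 - \<beta>)) = pi / 2"
 proof -
  have "3 / 5 * (5 / 3 * z) = z" for z :: real by simp
  then show ?thesis by (simp only:)
 qed
 show "0 < 1 * sin (\<beta> + 3 / 5 * (5 / 3 * (pi / 2 - \<beta>)))" unfolding b1 by simp
 show "- 1 = (1::real) \<and> cos (\<beta> + 3 / 5 * (5 / 3 * (pi / 2 - \<beta>))) = cos \<beta> \<or> - 1 = (-1::real) \<and> cos (\<beta> + 3 / 5 * (5 / 3 * (pi / 2 - \<beta>))) \<le> 0"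
  unfolding b1 by simp
 fix a assume a: "0 < a \<and> a \<le> 5 / 3 * (pi / 2 - \<beta>)"
 show "0 < leg_P (- 1 * a) (\<beta> + 3 / 5 * a)"
 proof -
  have "3 / 5 * a \<le> pi / 2 - \<beta>" using a by auto
  with pi_gt_zero have "\<beta> + 3 / 5 * a \<le> 3 * pi / 2" by linarith
  then have "0 < leg_P (- a) (\<beta> + 3 / 5 * a)" using a by (intro leg_P_left) auto
  then show ?thesis by simp
 qed
 show "0 < 1 * leg_Q (- 1 * a) (\<beta> + 3 / 5 * a)"
 proof -
  have "0 < 1 * leg_Q a (\<beta> + 3 / 5 * a)"
  proof (rule leg_Q_sign[where A="5 / 3 * (pi / 2 - \<beta>)"])
   fix x assume x: "0 < x" "x < 5 / 3 * (pi / 2 - \<beta>)"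
   let ?b = "\<beta> + 3 / 5 * x"
   have b: "0 < ?b" "?b < pi / 2" using x \<beta> by auto
   have "0 < cosh x * sin ?b" "0 < sinh x * cos ?b"
    using x b by (auto intro!: mult_pos_pos sin_gt_zero cos_gt_zero_pi)
   then show "0 < 1 * ((1 - (3 / 5)\<^sup>2) * (cosh x * sin ?b) + 2 * (3 / 5) * (sinh x * cos ?b))"
    by (simp add: power2_eq_square)
  qed (use a in auto)
  then show ?thesis by (simp add: leg_Q_minus)
 qed
qed (use \<beta> in auto)

text \<open>For \<epsilon> = -1 the slope must exceed 1 in modulus, which makes 1 - \<tau>^2
  negative. The leg descends to height -\<beta>, where cos equals cos \<beta> again. Down to height
  0 the second derivative decides; below it sin is negative and v cos \<beta> < sin v
  suffices.\<close>

lemma right_leg_2: "is_leg (- 1) 1 (- 2) \<beta>"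
 unfolding is_leg_def
proof (intro conjI allI impI)
 fix a assume a: "0 < a \<and> a \<le> \<beta>"
 have "cos \<beta> \<le> cos \<bar>\<beta> + - 2 * a\<bar>" using a \<beta> by (intro cos_monotone_0_pi_le) auto
 then have c: "cos \<beta> \<le> cos (\<beta> + - 2 * a)" by simp
 show "0 < leg_P (1 * a) (\<beta> + - 2 * a)" using leg_P_right[OF _ c] a by simp
 show "0 < - 1 * leg_Q (1 * a) (\<beta> + - 2 * a)"
 proof (cases "a \<le> \<beta> / 2")
  case True
  have "0 < - 1 * leg_Q a (\<beta> + - 2 * a)"
  proof (rule leg_Q_sign[where A="\<beta> / 2"])
   fix x assume x: "0 < x" "x < \<beta> / 2"
   let ?b = "\<beta> + - 2 * x"
   have b: "0 < ?b" "?b < pi / 2" using x \<beta> by auto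
   have "0 < cosh x * sin ?b" "0 < sinh x * cos ?b"
    using x b by (auto intro!: mult_pos_pos sin_gt_zero cos_gt_zero_pi)
   then show "0 < - 1 * ((1 - (- 2)\<^sup>2) * (cosh x * sin ?b) + 2 * (- 2) * (sinh x * cos ?b))"
    by simp
  qed (use a True in auto)
  then show ?thesis by simp
 next
  case False
  define v where "v = 2 * a - \<beta>"
  have v: "0 < v" "v \<le> \<beta>" "\<beta> + - 2 * a = - v" using a False by (auto simp: v_def)
  have "v * cos \<beta> < sin v" using v \<beta> by (intro mult_cos_less_sin') auto
  also have "sin v \<le> cosh a * sin v" using v \<beta> cosh_real_ge_1[of a] sin_gt_zero[of v] by simp
  finally have "v < cosh a * sin v / cos \<beta>" using cos_pos by (simp add: field_simps)
  then show ?thesis unfolding v(3) using \<xi>_pos by (simp add: leg_Q_def)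
 qed
qed (use \<beta> cos_pos in \<open>auto simp: sin_gt_zero\<close>)

text \<open>The final height 5\<pi>/4 minus arg t lies between \<pi>/4 and 3\<pi>/4 for \<pi>/2
  \<le> arg t \<le> \<pi>, so the left ray converges. Up to height \<pi> the second derivative has
  the right sign because sinh x cos b is at most half of cosh x sin b, by 2x \<le> b and b cos b <
  sin b; above \<pi> sin is nonpositive.\<close>

lemma left_leg_2: "is_leg (- 1) (- 1) 2 ((5 * pi / 4 - \<beta>) / 2)"
 unfolding is_leg_def
proof (intro conjI allI impI)
 have b1: "\<beta> + 2 * ((5 * pi / 4 - \<beta>) / 2) = pi / 4 + pi" by (simp add: field_simps)
 show "0 < - 1 * sin (\<beta> + 2 * ((5 * pi / 4 - \<beta>) / 2))" unfolding b1 sin_periodic_pi sin_45 by simp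
 show "- 1 = (1::real) \<and> cos (\<beta> + 2 * ((5 * pi / 4 - \<beta>) / 2)) = cos \<beta> \<or> - 1 = (-1::real) \<and> cos (\<beta> + 2 * ((5 * pi / 4 - \<beta>) / 2)) \<le> 0"
  unfolding b1 cos_periodic_pi cos_45 by simp
 fix a assume a: "0 < a \<and> a \<le> (5 * pi / 4 - \<beta>) / 2"
 show "0 < leg_P (- 1 * a) (\<beta> + 2 * a)" 
 proof -
  have "2 * a \<le> 5 * pi / 4 - \<beta>" using a by auto
  with pi_gt_zero have "\<beta> + 2 * a \<le> 3 * pi / 2" by linarith
  then have "0 < leg_P (- a) (\<beta> + 2 * a)" using a by (intro leg_P_left) auto
  then show ?thesis by simp
 qed
 show "0 < - 1 * leg_Q (- 1 * a) (\<beta> + 2 * a)"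
 proof (cases "\<beta> + 2 * a \<le> pi")
  case True
  have "0 < - 1 * leg_Q a (\<beta> + 2 * a)"
  proof (rule leg_Q_sign[where A="(pi - \<beta>) / 2"])
   fix x assume x: "0 < x" "x < (pi - \<beta>) / 2"
   let ?b = "\<beta> + 2 * x"
   have b: "0 < ?b" "?b < pi" "2 * x \<le> ?b" using x \<beta> by auto
   have s: "0 < cosh x * sin ?b" using b by (intro mult_pos_pos sin_gt_zero) auto
   have "sinh x * cos ?b \<le> (1 / 2) * (cosh x * sin ?b)"
   proof (cases "0 \<le> cos ?b")
    case cb: True
    have "sinh x * cos ?b \<le> x * cosh x * cos ?b" using sinh_le_mult_cosh[of x] x cb by (intro mult_right_mono) auto
    also have "\<dots> = (1 / 2) * (cosh x * (2 * x * cos ?b))" by simp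
    also have "\<dots> \<le> (1 / 2) * (cosh x * (?b * cos ?b))" using b cb by (intro mult_left_mono mult_right_mono) auto
    also have "\<dots> \<le> (1 / 2) * (cosh x * sin ?b)" using mult_cos_less_sin[of ?b] b by (intro mult_left_mono) auto
    finally show ?thesis .
   next
    case False
    then have "sinh x * cos ?b \<le> 0" using x by (intro mult_nonneg_nonpos) auto
    then show ?thesis using s by linarith
   qed
   then show "0 < - 1 * ((1 - 2\<^sup>2) * (cosh x * sin ?b) + 2 * 2 * (sinh x * cos ?b))" using s by simp
  qed (use a True in auto)
  then show ?thesis by (simp add: leg_Q_minus)
 next
  case False
  have "0 \<le> sin (\<beta> + 2 * a - pi)" using a False by (intro sin_ge_zero) auto
  then have "0 \<le> cosh a * (- sin (\<beta> + 2 * a)) / cos \<beta>" using cos_pos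
   by (intro divide_nonneg_pos mult_nonneg_nonneg) (auto simp: sin_diff)
  moreover have "0 < \<beta> + 2 * a + \<xi>" using \<beta> a \<xi>_pos by auto
  ultimately show ?thesis by (simp add: leg_Q_def)
 qed
qed (use \<beta> in auto)

text \<open>Along a leg \<open>Re (e\<^sup>s \<phi>)\<close> is a combination of two positive quantities with weights \<open>sin arg t\<close>, \<open>\<bar>cos arg t\<bar>\<close>.\<close>

lemma leg_decay:
 assumes "is_leg \<epsilon> \<sigma> \<tau> A" "0 \<le> Im s" "Im s \<le> pi" "0 \<le> \<epsilon> * cos (Im s)"
  and P: "\<kappa> \<le> leg_P a (\<beta> + v)" and Q: "\<kappa> \<le> \<epsilon> * leg_Q a (\<beta> + v)" and \<kappa>: "0 \<le> \<kappa>"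
 shows "\<kappa> * exp (Re s) \<le> Re (exp s * phi (Complex a v))"
proof -
 let ?c = "cos (Im s)" and ?s = "sin (Im s)"
 have e: "\<epsilon> * \<epsilon> = 1" using is_legD(1)[OF assms(1)] by auto
 have s0: "0 \<le> ?s" by (rule sin_ge_zero[OF assms(2,3)])
 \<comment> \<open>The two nonnegative weights have square sum 1, hence sum at least 1, so \<kappa>
   survives without a loss.\<close>
 have "1 \<le> ?s + \<epsilon> * ?c"
 proof (rule power2_le_imp_le)
  have "(?s + \<epsilon> * ?c)\<^sup>2 = ?s\<^sup>2 + (\<epsilon> * \<epsilon>) * ?c\<^sup>2 + 2 * (?s * (\<epsilon> * ?c))" by (simp add: power2_eq_square algebra_simps)
  moreover have "0 \<le> ?s * (\<epsilon> * ?c)" using s0 assms(4) by (rule mult_nonneg_nonneg)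
  ultimately show "1\<^sup>2 \<le> (?s + \<epsilon> * ?c)\<^sup>2" unfolding e by simp
 qed (use s0 assms(4) in simp)
 then have "\<kappa> * 1 \<le> \<kappa> * (?s + \<epsilon> * ?c)" using \<kappa> by (rule mult_left_mono)
 moreover have "?s * \<kappa> \<le> ?s * leg_P a (\<beta> + v)" using P s0 by (rule mult_left_mono)
 moreover have "\<epsilon> * ?c * \<kappa> \<le> \<epsilon> * ?c * (\<epsilon> * leg_Q a (\<beta> + v))" using Q assms(4) by (rule mult_left_mono)
 moreover have "\<epsilon> * ?c * (\<epsilon> * leg_Q a (\<beta> + v)) = (\<epsilon> * \<epsilon>) * (?c * leg_Q a (\<beta> + v))" by (simp add: mult_ac)
 moreover have "\<kappa> * (?s + \<epsilon> * ?c) = ?s * \<kappa> + \<epsilon> * ?c * \<kappa>" by (simp add: algebra_simps)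
 ultimately have "\<kappa> \<le> ?c * leg_Q a (\<beta> + v) + ?s * leg_P a (\<beta> + v)" unfolding e by linarith
 then have "exp (Re s) * \<kappa> \<le> exp (Re s) * (?c * leg_Q a (\<beta> + v) + ?s * leg_P a (\<beta> + v))" by simp
 also have "\<dots> = Re (exp s * phi (Complex a v))"
  by (simp add: phi_parts Re_exp Im_exp algebra_simps)
 finally show ?thesis by (simp add: mult.commute)
qed

text \<open>Linear growth on the horizontal part serves two purposes: the part \<kappa>x makes the
  tail integral converge, and \<kappa> itself leaves a factor exp(-\<kappa>|t|).\<close>

lemma leg_tail:
 assumes leg: "is_leg \<epsilon> \<sigma> \<tau> A"
 obtains \<kappa> where "0 < \<kappa>"
  "\<And>x. 0 \<le> x \<Longrightarrow> \<kappa> * (1 + x) \<le> leg_P (\<sigma> * (A + x)) (\<beta> + \<tau> * A)"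
  "\<And>x. 0 \<le> x \<Longrightarrow> \<kappa> * (1 + x) \<le> \<epsilon> * leg_Q (\<sigma> * (A + x)) (\<beta> + \<tau> * A)"
proof -
 let ?b = "\<beta> + \<tau> * A"
 note A = is_legD(4)[OF leg] and \<sigma> = is_legD(2)[OF leg] and sb = is_legD(7)[OF leg]
 note p0 = is_legD(5)[OF leg A order_refl] and q0 = is_legD(6)[OF leg A order_refl]
 define d1 where "d1 = min (cosh A - 1) 1"
 have d1: "0 < d1" using cosh_gt_1[OF A] by (simp add: d1_def)
 define d2 where "d2 = \<epsilon> * sin ?b / cos \<beta> * sinh A"
 have d2: "0 < d2" unfolding d2_def using A by (intro mult_pos_pos[OF divide_pos_pos[OF sb cos_pos]]) simp
 have P: "leg_P (\<sigma> * A) ?b + d1 * x \<le> leg_P (\<sigma> * (A + x)) ?b" if x: "0 \<le> x" for x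
 proof -
  have s: "x * cosh A \<le> sinh (A + x) - sinh A" by (rule sinh_add_ge) (use x A in auto)
  have "d1 \<le> cosh A - 1" "d1 \<le> 1" by (auto simp: d1_def)
  note dx = mult_right_mono[OF this(1) x] mult_right_mono[OF this(2) x]
  have "\<sigma> = 1 \<and> cos ?b = cos \<beta> \<or> \<sigma> = -1 \<and> cos ?b \<le> 0" by (rule is_legD(8)[OF leg])
  then show ?thesis
  proof (elim disjE conjE)
   assume "\<sigma> = 1" "cos ?b = cos \<beta>"
   then show ?thesis using dx s cos_pos by (simp add: leg_P_def algebra_simps)
  next
   assume a: "\<sigma> = -1" "cos ?b \<le> 0"
   have "sinh (A + x) * cos ?b / cos \<beta> \<le> sinh A * cos ?b / cos \<beta>"
    using a x cos_pos by (intro divide_right_mono mult_right_mono_neg) auto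
   moreover have "sinh (- A - x) = - sinh (A + x)" using sinh_minus[of "A + x"] by simp
   ultimately show ?thesis using a dx(2) by (simp add: leg_P_def)
  qed
 qed
 have Q: "\<epsilon> * leg_Q (\<sigma> * A) ?b + d2 * x \<le> \<epsilon> * leg_Q (\<sigma> * (A + x)) ?b" if x: "0 \<le> x" for x
 proof -
  have "x * sinh A \<le> cosh (A + x) - cosh A" by (rule cosh_add_ge) (use x A in auto)
  then have "\<epsilon> * sin ?b / cos \<beta> * (x * sinh A) \<le> \<epsilon> * sin ?b / cos \<beta> * (cosh (A + x) - cosh A)"
   using sb cos_pos by (intro mult_left_mono) auto
  moreover have c: "cosh (\<sigma> * y) = cosh y" for y using \<sigma> by auto
  ultimately show ?thesis unfolding leg_Q_def c d2_def by (simp add: algebra_simps diff_divide_distrib)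
 qed
 define \<kappa> where "\<kappa> = min (min (leg_P (\<sigma> * A) ?b) d1) (min (\<epsilon> * leg_Q (\<sigma> * A) ?b) d2)"
 show ?thesis
 proof (rule that[of \<kappa>])
  show "0 < \<kappa>" using p0 q0 d1 d2 by (simp add: \<kappa>_def)
  fix x :: real assume x: "0 \<le> x"
  have "\<kappa> * x \<le> d1 * x" "\<kappa> * x \<le> d2 * x" using x by (auto simp: \<kappa>_def intro!: mult_right_mono)
  moreover have "\<kappa> \<le> leg_P (\<sigma> * A) ?b" "\<kappa> \<le> \<epsilon> * leg_Q (\<sigma> * A) ?b" by (auto simp: \<kappa>_def)
  ultimately show "\<kappa> * (1 + x) \<le> leg_P (\<sigma> * (A + x)) ?b" "\<kappa> * (1 + x) \<le> \<epsilon> * leg_Q (\<sigma> * (A + x)) ?b"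
   using P[OF x] Q[OF x] by (simp_all add: distrib_left)
 qed
qed

text \<open>Compactness; a0 > 0 keeps away from the saddle, where both quantities vanish.\<close>

lemma leg_segment:
 assumes leg: "is_leg \<epsilon> \<sigma> \<tau> A" and a0: "0 < a0"
 obtains \<kappa> where "0 < \<kappa>"
  "\<And>a. a0 \<le> a \<Longrightarrow> a \<le> A \<Longrightarrow> \<kappa> \<le> leg_P (\<sigma> * a) (\<beta> + \<tau> * a) \<and> \<kappa> \<le> \<epsilon> * leg_Q (\<sigma> * a) (\<beta> + \<tau> * a)"
proof (cases "a0 \<le> A")
 case True
 let ?f = "\<lambda>a. min (leg_P (\<sigma> * a) (\<beta> + \<tau> * a)) (\<epsilon> * leg_Q (\<sigma> * a) (\<beta> + \<tau> * a))"
 have "continuous_on {a0..A} ?f" unfolding leg_P_def leg_Q_def using cos_pos by (intro continuous_intros) auto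
 moreover have "{a0..A} \<noteq> {}" using True by simp
 ultimately obtain a1 where a1: "a1 \<in> {a0..A}" "\<And>a. a \<in> {a0..A} \<Longrightarrow> ?f a1 \<le> ?f a"
  using continuous_attains_inf[of "{a0..A}" ?f] by auto
 have "0 < ?f a1" using a1(1) a0 is_legD(5,6)[OF leg, of a1] by auto
 then show ?thesis using a1(2) by (intro that[of "?f a1"]) (auto simp: min_le_iff_disj)
qed (use that[of 1] in auto)

end

section \<open>The coefficients of the expansion do not vanish\<close>

lemma nonneg_Reals_sum:
 fixes f :: "'i \<Rightarrow> complex"
 assumes "\<And>i. i \<in> I \<Longrightarrow> f i \<in> \<real>\<^sub>\<ge>\<^sub>0"
 shows "sum f I \<in> \<real>\<^sub>\<ge>\<^sub>0"
 using assms by (induction I rule: infinite_finite_induct) (auto intro: nonneg_Reals_add_I)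

lemma fps_nonneg_mult:
 fixes F G :: "complex fps"
 assumes "\<And>n. fps_nth F n \<in> \<real>\<^sub>\<ge>\<^sub>0" "\<And>n. fps_nth G n \<in> \<real>\<^sub>\<ge>\<^sub>0"
 shows "fps_nth (F * G) n \<in> \<real>\<^sub>\<ge>\<^sub>0"
 unfolding fps_mult_nth by (intro nonneg_Reals_sum nonneg_Reals_mult_I assms)

lemma nonneg_Reals_of_nat_divide:
 fixes z a :: complex
 assumes "of_nat k * z = a" "a \<in> \<real>\<^sub>\<ge>\<^sub>0" "0 < k"
 shows "z \<in> \<real>\<^sub>\<ge>\<^sub>0"
proof -
 have "z = a / of_nat k" using assms by (simp add: field_simps)
 then show ?thesis using assms(2) by (simp add: complex_nonneg_Reals_iff)
qed

text \<open>The geometric series in recursive form: R = 1 + G R, and G without constant term refers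
  only to earlier coefficients of R.\<close>

lemma fps_nonneg_inverse:
 fixes G :: "complex fps"
 assumes G: "\<And>n. fps_nth G n \<in> \<real>\<^sub>\<ge>\<^sub>0" and G0: "fps_nth G 0 = 0"
 shows "fps_nth (inverse (1 - G)) n \<in> \<real>\<^sub>\<ge>\<^sub>0"
proof (induction n rule: less_induct)
 case (less n)
 let ?R = "inverse (1 - G)"
 have "?R * (1 - G) = 1" by (rule inverse_mult_eq_1) (simp add: G0)
 then have "?R = 1 + G * ?R" by (simp add: algebra_simps)
 then have "fps_nth ?R n = fps_nth (1 + G * ?R) n" by simp
 also have "\<dots> = fps_nth 1 n + (\<Sum>i=0..n. fps_nth G i * fps_nth ?R (n - i))"
  by (simp only: fps_add_nth fps_mult_nth)
 also have "\<dots> \<in> \<real>\<^sub>\<ge>\<^sub>0"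
 proof (intro nonneg_Reals_add_I nonneg_Reals_sum)
  fix i assume "i \<in> {0..n}"
  then show "fps_nth G i * fps_nth ?R (n - i) \<in> \<real>\<^sub>\<ge>\<^sub>0"
   using G0 less.IH[of "n - i"] G[of i] by (cases "i = 0") (auto intro: nonneg_Reals_mult_I)
 qed (simp add: fps_one_nth)
 finally show ?case .
qed

text \<open>\<open>\<kappa>(v) = 1/v - cot v\<close> satisfies \<open>v \<kappa>' + 2 \<kappa> = v + v \<kappa>\<^sup>2\<close>, which makes its Taylor coefficients nonnegative.\<close>

lemma sinc_log_derivative:
 obtains s \<kappa> q :: "complex fps"
 where "fps_X * s = fps_sin 1" "fps_nth s 0 = 1" "fps_deriv s = - \<kappa> * s"
  "\<And>n. fps_nth \<kappa> n \<in> \<real>\<^sub>\<ge>\<^sub>0" "\<And>n. fps_nth q n \<in> \<real>\<^sub>\<ge>\<^sub>0" "fps_nth q 0 = 0" "fps_nth q 1 = 2 / 3"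
  "(fps_sin 1)\<^sup>2 * q = fps_X - fps_sin 1 * fps_cos 1"
proof -
 define s :: "complex fps" where "s = fps_shift 1 (fps_sin 1)"
 have Xs: "fps_X * s = fps_sin 1"
  by (rule fps_ext) (simp add: s_def fps_sin_def)
 have s0: "fps_nth s 0 = 1" by (simp add: s_def fps_sin_def)
 have snz: "s \<noteq> 0" using s0 by auto
 define \<kappa> where "\<kappa> = - fps_deriv s * inverse s"
 have ds: "fps_deriv s = - \<kappa> * s"
  using inverse_mult_eq_1[of s] s0 by (simp add: \<kappa>_def mult.assoc)
 have cos: "fps_cos 1 = s * (1 - fps_X * \<kappa>)"
 proof -
  have "fps_deriv (fps_X * s) = fps_cos 1" unfolding Xs by (simp add: fps_sin_deriv)
  then show ?thesis by (simp add: ds algebra_simps)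
 qed
 have dcos: "fps_deriv (fps_cos 1) = - fps_sin (1 :: complex)"
  by (simp add: fps_cos_deriv) (metis fps_const_1_eq_1 fps_const_neg mult_minus1)
 have "fps_deriv (s * (1 - fps_X * \<kappa>)) = - fps_sin 1"
  unfolding cos[symmetric] by (rule dcos)
 then have "s * (fps_X * fps_deriv \<kappa> + 2 * \<kappa>) = s * (fps_X + fps_X * \<kappa>\<^sup>2)"
  unfolding Xs[symmetric] by (simp add: ds algebra_simps power2_eq_square)
 then have ode: "fps_X * fps_deriv \<kappa> + 2 * \<kappa> = fps_X + fps_X * \<kappa>\<^sup>2" using snz by simp
 have co: "of_nat (n + 2) * fps_nth \<kappa> n = (if n = 1 then 1 else 0) + (if n = 0 then 0 else fps_nth (\<kappa>\<^sup>2) (n - 1))" for n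
 proof -
  have "fps_nth (fps_X * fps_deriv \<kappa> + 2 * \<kappa>) n = of_nat (n + 2) * fps_nth \<kappa> n"
   by (cases n) (simp_all add: numeral_fps_const algebra_simps)
  moreover have "fps_nth (fps_X + fps_X * \<kappa>\<^sup>2) n = (if n = 1 then 1 else 0) + (if n = 0 then 0 else fps_nth (\<kappa>\<^sup>2) (n - 1))"
   by (auto simp: fps_X_nth)
  ultimately show ?thesis unfolding ode by simp
 qed
 have nn: "fps_nth \<kappa> n \<in> \<real>\<^sub>\<ge>\<^sub>0" for n
 proof (induction n rule: less_induct)
  case (less n)
  show ?case
  proof (rule nonneg_Reals_of_nat_divide[OF co])
   show "(if n = 1 then 1 else 0) + (if n = 0 then 0 else fps_nth (\<kappa>\<^sup>2) (n - 1)) \<in> \<real>\<^sub>\<ge>\<^sub>0"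
    unfolding power2_eq_square fps_mult_nth
    by (auto intro!: nonneg_Reals_add_I nonneg_Reals_sum nonneg_Reals_mult_I less.IH)
  qed simp
 qed
 have k0: "fps_nth \<kappa> 0 = 0" using co[of 0] by simp
 have k1: "fps_nth \<kappa> 1 = 1 / 3" using co[of 1] k0 by (simp add: power2_eq_square field_simps)
 define q where "q = fps_deriv (fps_X * \<kappa>)"
 have qn: "fps_nth q n = of_nat (n + 1) * fps_nth \<kappa> n" for n by (cases n) (simp_all add: q_def algebra_simps)
 have "fps_X * fps_cos 1 = fps_sin 1 * (1 - fps_X * \<kappa>)" unfolding cos Xs[symmetric] by (simp only: mult_ac)
 then have A: "fps_sin 1 * (1 - fps_X * \<kappa>) = fps_X * fps_cos 1" by simp
 then have "fps_deriv (fps_sin 1 * (1 - fps_X * \<kappa>)) = fps_deriv (fps_X * fps_cos 1)" by simp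
 then have "fps_cos 1 * (1 - fps_X * \<kappa>) - fps_sin 1 * q = fps_cos 1 - fps_X * fps_sin 1"
  by (simp add: fps_sin_deriv dcos q_def algebra_simps)
 then have "fps_sin 1 * (fps_cos 1 * (1 - fps_X * \<kappa>) - fps_sin 1 * q) = fps_sin 1 * (fps_cos 1 - fps_X * fps_sin 1)" by simp
 then have "fps_cos 1 * (fps_sin 1 * (1 - fps_X * \<kappa>)) - (fps_sin 1)\<^sup>2 * q = fps_sin 1 * fps_cos 1 - fps_X * (fps_sin 1)\<^sup>2"
  by (simp add: algebra_simps power2_eq_square)
 then have "(fps_sin 1)\<^sup>2 * q = fps_X * ((fps_cos 1)\<^sup>2 + (fps_sin 1)\<^sup>2) - fps_sin 1 * fps_cos 1"
  unfolding A by (simp add: algebra_simps power2_eq_square)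
 then have Q: "(fps_sin 1)\<^sup>2 * q = fps_X - fps_sin 1 * fps_cos 1"
  using fps_sin_cos_sum_of_squares[of "1::complex"] by simp
 show ?thesis
 proof (rule that[OF Xs s0 ds nn _ _ _ Q])
  show "fps_nth q n \<in> \<real>\<^sub>\<ge>\<^sub>0" for n unfolding qn
   by (intro nonneg_Reals_mult_I nn) (simp add: complex_nonneg_Reals_iff)
 qed (simp_all add: qn k0 k1[unfolded One_nat_def])
qed

text \<open>F solves F' = (p/2) K F. In the recursion for the next coefficient all summands are
  nonnegative, and the one from the constant term of K is positive.\<close>

lemma fps_positive_exponential:
 fixes F K :: "complex fps"
 assumes K: "\<And>n. fps_nth K n \<in> \<real>\<^sub>\<ge>\<^sub>0" "fps_nth K 0 \<noteq> 0" and F0: "fps_nth F 0 \<in> \<real>\<^sub>\<ge>\<^sub>0" "fps_nth F 0 \<noteq> 0"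
  and p: "0 < p" and F: "2 * fps_deriv F = of_nat p * (K * F)"
 shows "fps_nth F n \<in> \<real>\<^sub>\<ge>\<^sub>0 \<and> fps_nth F n \<noteq> 0"
proof (induction n rule: less_induct)
 case (less n)
 show ?case
 proof (cases n)
  case (Suc k)
  let ?a = "of_nat p * (\<Sum>i=0..k. fps_nth K i * fps_nth F (k - i))"
  have "fps_nth (2 * fps_deriv F) k = of_nat (2 * n) * fps_nth F n"
   by (simp add: Suc numeral_fps_const algebra_simps)
  moreover have "fps_nth (of_nat p * (K * F)) k = ?a"
   by (simp only: fps_of_nat[symmetric] fps_mult_left_const_nth) (simp only: fps_mult_nth)
  ultimately have e: "of_nat (2 * n) * fps_nth F n = ?a" unfolding F by simp
  have S: "(\<Sum>i=0..k. fps_nth K i * fps_nth F (k - i)) = fps_nth K 0 * fps_nth F k + (\<Sum>i=1..k. fps_nth K i * fps_nth F (k - i))"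
   by (simp add: sum.atLeast_Suc_atMost)
  have t: "(\<Sum>i=1..k. fps_nth K i * fps_nth F (k - i)) \<in> \<real>\<^sub>\<ge>\<^sub>0"
   using less.IH Suc by (intro nonneg_Reals_sum nonneg_Reals_mult_I K) auto
  have f: "fps_nth F k \<in> \<real>\<^sub>\<ge>\<^sub>0" "fps_nth F k \<noteq> 0" using less.IH[of k] Suc by auto
  have "0 < Re (fps_nth K 0) * Re (fps_nth F k)"
   using K(1)[of 0] K(2) f by (intro mult_pos_pos) (auto simp: complex_nonneg_Reals_iff complex_eq_iff)
  then have "0 < Re (\<Sum>i=0..k. fps_nth K i * fps_nth F (k - i))"
   using t K(1)[of 0] f(1) unfolding S by (auto simp: complex_nonneg_Reals_iff)
  then have "(\<Sum>i=0..k. fps_nth K i * fps_nth F (k - i)) \<noteq> 0"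
   by (metis less_irrefl zero_complex.sel(1))
  then have "?a \<noteq> 0" using p by simp
  moreover have "fps_nth F n \<in> \<real>\<^sub>\<ge>\<^sub>0"
  proof (rule nonneg_Reals_of_nat_divide[OF e])
   show "?a \<in> \<real>\<^sub>\<ge>\<^sub>0" unfolding S
    by (intro nonneg_Reals_mult_I nonneg_Reals_add_I t K f) (simp add: complex_nonneg_Reals_iff)
  qed (simp add: Suc)
  ultimately show ?thesis using e by auto
 qed (use F0 in simp)
qed

context phase_setup
begin

text \<open>After y = -2\<i>v the function 2h becomes s^2 (1 - c q) with s = sin v / v, c = cot
  \<beta> > 0 and q = (v - sin v cos v)/sin^2 v. Its power -(m + 1/2) has logarithmic derivative (m
  + 1/2)(2\<kappa> + c q'/(1 - c q)), a series with nonnegative coefficients and positive constant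
  term. Hence all Taylor coefficients of the power are positive, and \<open>hcoef m\<close> is the
  one of order 2m times Gamma(m + 1/2)/(-4)^m.\<close>

lemma hcoef_nonzero_real: "hcoef m \<noteq> 0" "hcoef m \<in> \<real>"
proof -
 let ?x = "\<i> * complex_of_real (cot \<beta>)"
 let ?c = "sqrt (tan \<beta> / 2)"
 define c where "c = complex_of_real (cot \<beta>)"
 have cpos: "0 < cot \<beta>" using tan_pos by (simp add: cot_altdef)
 have c0: "0 < ?c" using tan_pos by simp
 obtain h where h: "h holomorphic_on UNIV" "h 0 = 1 / 2" "\<And>y. ?x * (y - sinh y) + cosh y - 1 = y\<^sup>2 * h y"
  by (rule cosh_minus_one_factor[of ?x]) blast
 have "isCont h 0" using holomorphic_on_imp_continuous_on[OF h(1)] by (simp add: continuous_on_eq_continuous_at)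
 then obtain r where r: "0 < r" "\<And>y. dist y 0 < r \<Longrightarrow> dist (h y) (h 0) < 1 / 4"
  unfolding continuous_at_eps_delta by (metis zero_less_divide_1_iff zero_less_numeral)
 have hR: "2 * h y \<notin> \<real>\<^sub>\<le>\<^sub>0" if "norm y < r" for y
 proof -
  have "norm (h y - 1 / 2) < 1 / 4" using r(2)[of y] that by (simp add: dist_norm h(2))
  then have "0 < Re (h y)" using abs_Re_le_cmod[of "h y - 1 / 2"] by simp
  then show ?thesis by (auto simp: complex_nonpos_Reals_iff)
 qed
 define f where "f y = 1 / (of_real ?c * csqrt (2 * h y)) ^ Suc (2 * m)" for y
 define z where "z v = - 2 * \<i> * v" for v :: complex
 define fz where "fz v = f (z v)" for v
 define hz where "hz v = 2 * h (z v)" for v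
 have hnz: "csqrt (2 * h y) \<noteq> 0" if "norm y < r" for y using hR[OF that] by auto
 have fh: "f holomorphic_on ball 0 r" unfolding f_def
  using hR hnz c0 tan_pos by (intro holomorphic_intros holomorphic_on_subset[OF h(1)]) auto
 have zb: "z v \<in> ball 0 r" if "v \<in> ball 0 (r / 2)" for v using that by (simp add: z_def norm_mult)
 have zh: "z holomorphic_on A" for A unfolding z_def by (intro holomorphic_intros)
 have fzh: "fz holomorphic_on ball 0 (r / 2)" unfolding fz_def
  using holomorphic_on_compose_gen[OF zh fh] zb unfolding o_def by blast
 have hzh: "hz holomorphic_on ball 0 (r / 2)" unfolding hz_def
  using holomorphic_on_compose_gen[OF zh h(1)] unfolding o_def by (intro holomorphic_intros) auto
 have r2: "0 < r / 2" using r(1) by simp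
 define F where "F = fps_expansion fz 0"
 define S where "S = fps_expansion hz 0"
 have F: "fz has_fps_expansion F" unfolding F_def
  by (rule has_fps_expansion_fps_expansion[OF open_ball _ fzh]) (use r2 in simp)
 have S: "hz has_fps_expansion S" unfolding S_def
  by (rule has_fps_expansion_fps_expansion[OF open_ball _ hzh]) (use r2 in simp)
 define d where "d = 1 / (complex_of_real ?c ^ Suc (2 * m))\<^sup>2"
 \<comment> \<open>Encodes F as a constant times S^(-m-1/2) without taking roots of power series;
   differentiating it gives the equation \<open>Fode\<close>.\<close>
 have FS: "F\<^sup>2 * S ^ Suc (2 * m) = fps_const d"
 proof -
  have 1: "(\<lambda>v. (fz v)\<^sup>2 * hz v ^ Suc (2 * m)) has_fps_expansion F\<^sup>2 * S ^ Suc (2 * m)"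
   by (intro fps_expansion_intros F S)
  have ev: "eventually (\<lambda>v. (fz v)\<^sup>2 * hz v ^ Suc (2 * m) = d) (nhds 0)"
  proof -
   have "eventually (\<lambda>v. v \<in> ball 0 (r / 2)) (nhds (0::complex))" using r2 by (intro eventually_nhds_in_open) auto
   then show ?thesis
   proof eventually_elim
    case (elim v)
    define Q where "Q = csqrt (hz v)"
    have Q: "Q\<^sup>2 = hz v" by (simp add: Q_def)
    have "Q \<noteq> 0" using hnz[of "z v"] zb[OF elim] by (simp add: Q_def hz_def)
    moreover have "(fz v)\<^sup>2 = d / (Q ^ Suc (2 * m))\<^sup>2"
     unfolding fz_def f_def d_def Q_def hz_def by (simp only: power_divide power_mult_distrib) simp
    moreover have "hz v ^ Suc (2 * m) = (Q ^ Suc (2 * m))\<^sup>2" unfolding Q[symmetric] by (simp only: power_mult[symmetric] mult.commute)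
    ultimately show ?case by simp
   qed
  qed
  have "(\<lambda>_. d) has_fps_expansion F\<^sup>2 * S ^ Suc (2 * m)"
   by (rule has_fps_expansion_cong[THEN iffD1, OF ev refl 1])
  then show ?thesis using has_fps_expansion_const fps_expansion_unique_complex by blast
 qed
 obtain s \<kappa> q :: "complex fps" where s: "fps_X * s = fps_sin 1" "fps_nth s 0 = 1" "fps_deriv s = - \<kappa> * s"
  "\<And>n. fps_nth \<kappa> n \<in> \<real>\<^sub>\<ge>\<^sub>0" "\<And>n. fps_nth q n \<in> \<real>\<^sub>\<ge>\<^sub>0" "fps_nth q 0 = 0" "fps_nth q 1 = 2 / 3"
  "(fps_sin 1)\<^sup>2 * q = fps_X - fps_sin 1 * fps_cos 1"
  using sinc_log_derivative by metis
 have XS: "fps_X\<^sup>2 * S = (fps_sin 1)\<^sup>2 - fps_const c * (fps_X - fps_sin 1 * fps_cos 1)"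
 proof -
  have 1: "(\<lambda>v. v\<^sup>2 * hz v) has_fps_expansion fps_X\<^sup>2 * S" by (intro fps_expansion_intros S)
  have 2: "(\<lambda>v. (sin (1 * v))\<^sup>2 - c * (v - sin (1 * v) * cos (1 * v))) has_fps_expansion (fps_sin 1)\<^sup>2 - fps_const c * (fps_X - fps_sin 1 * fps_cos 1)"
   by (intro fps_expansion_intros)
  have "v\<^sup>2 * hz v = (sin (1 * v))\<^sup>2 - c * (v - sin (1 * v) * cos (1 * v))" for v
  proof -
   have sh: "sinh (z v) = - \<i> * sin (2 * v)" "cosh (z v) = cos (2 * v)"
    by (simp_all add: z_def sinh_field_def cosh_field_def sin_exp_eq cos_exp_eq field_simps)
   have "- 4 * (v\<^sup>2 * h (z v)) = (z v)\<^sup>2 * h (z v)" by (simp add: z_def power_mult_distrib)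
   also have "\<dots> = \<i> * c * (- 2 * \<i> * v + \<i> * sin (2 * v)) + cos (2 * v) - 1"
    unfolding h(3)[symmetric] sh by (simp add: z_def c_def)
   also have "\<dots> = c * (2 * v - sin (2 * v)) + cos (2 * v) - 1" by (simp add: algebra_simps)
   also have "\<dots> = 2 * c * (v - sin v * cos v) - 2 * (sin v)\<^sup>2"
    unfolding sin_double cos_double_sin by (simp add: algebra_simps)
   finally have "4 * (v\<^sup>2 * h (z v)) = 2 * ((sin v)\<^sup>2 - c * (v - sin v * cos v))"
    by (simp add: algebra_simps)
   then have "2 * (v\<^sup>2 * hz v) = 2 * ((sin v)\<^sup>2 - c * (v - sin v * cos v))"
    by (simp add: hz_def)
   then have "v\<^sup>2 * hz v = (sin v)\<^sup>2 - c * (v - sin v * cos v)"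
    using mult_left_cancel[of "2::complex"] zero_neq_numeral by metis
   then show ?thesis by simp
  qed
  then have "(\<lambda>v. v\<^sup>2 * hz v) = (\<lambda>v. (sin (1 * v))\<^sup>2 - c * (v - sin (1 * v) * cos (1 * v)))" by blast
  then show ?thesis using 1 2 fps_expansion_unique_complex by metis
 qed
 define G where "G = 1 - fps_const c * q"
 have SG: "S = s\<^sup>2 * G"
 proof -
  have "fps_X\<^sup>2 * S = fps_X\<^sup>2 * (s\<^sup>2 * G)"
   unfolding XS s(8)[symmetric] unfolding G_def s(1)[symmetric] by (simp add: algebra_simps power_mult_distrib)
  then show ?thesis by simp
 qed
 define K where "K = 2 * \<kappa> + fps_const c * fps_deriv q * inverse G"
 have G0: "fps_nth G 0 = 1" by (simp add: G_def s(6))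
 have dS: "fps_deriv S = - (K * S)"
 proof -
  have "inverse G * G = 1" by (rule inverse_mult_eq_1) (simp add: G0)
  then have "K * S = s\<^sup>2 * (2 * \<kappa> * G + fps_const c * fps_deriv q)"
   unfolding SG K_def by (simp add: algebra_simps)
  moreover have "fps_deriv G = - (fps_const c * fps_deriv q)" by (simp add: G_def)
  moreover have "fps_deriv S = 2 * s * fps_deriv s * G + s\<^sup>2 * fps_deriv G"
   unfolding SG by (simp add: power2_eq_square algebra_simps)
  ultimately show ?thesis by (simp add: s(3) power2_eq_square algebra_simps)
 qed
 have cnn: "c \<in> \<real>\<^sub>\<ge>\<^sub>0" using cpos by (simp add: c_def)
 have Knn: "fps_nth K n \<in> \<real>\<^sub>\<ge>\<^sub>0" for n
 proof -
  have cq: "fps_nth (fps_const c * q) n \<in> \<real>\<^sub>\<ge>\<^sub>0" for n using cnn s(5) by (simp add: nonneg_Reals_mult_I)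
  have A: "fps_nth (inverse G) n \<in> \<real>\<^sub>\<ge>\<^sub>0" for n
   unfolding G_def by (rule fps_nonneg_inverse) (use cq s(6) in auto)
  have B: "fps_nth (fps_const c * fps_deriv q) n \<in> \<real>\<^sub>\<ge>\<^sub>0" for n
   using s(5)[of "n + 1"] cnn
   by (simp only: fps_mult_left_const_nth fps_deriv_nth) (intro nonneg_Reals_mult_I, simp_all add: complex_nonneg_Reals_iff)
  have "fps_nth (fps_const c * fps_deriv q * inverse G) n \<in> \<real>\<^sub>\<ge>\<^sub>0" by (rule fps_nonneg_mult[OF B A])
  moreover have "fps_nth (2 * \<kappa>) n \<in> \<real>\<^sub>\<ge>\<^sub>0"
   using s(4)[of n] by (simp add: numeral_fps_const complex_nonneg_Reals_iff)
  ultimately show ?thesis unfolding K_def fps_add_nth by (rule nonneg_Reals_add_I[rotated])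
 qed
 have "fps_nth (fps_const c * fps_deriv q * inverse G) 0 = c * (2 / 3)"
  using s(7) G0 by simp
 then have K0: "fps_nth K 0 \<noteq> 0"
 proof -
  have "fps_nth K 0 = fps_nth (2 * \<kappa>) 0 + c * (2 / 3)"
   unfolding K_def fps_add_nth by (simp only: \<open>fps_nth (fps_const c * fps_deriv q * inverse G) 0 = c * (2 / 3)\<close>)
  then have "Re (fps_nth K 0) = 2 * Re (fps_nth \<kappa> 0) + cot \<beta> * (2 / 3)"
   by (simp add: numeral_fps_const c_def)
  moreover have "0 \<le> Re (fps_nth \<kappa> 0)" using s(4)[of 0] by (simp add: complex_nonneg_Reals_iff)
  ultimately have "Re (fps_nth K 0) > 0" using cpos by simp
  then show ?thesis by auto
 qed
 have F00: "fps_nth F 0 = of_real (1 / ?c ^ Suc (2 * m))"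
  using has_fps_expansion_imp_0_eq_fps_nth_0[OF F] by (simp add: fz_def z_def f_def h(2))
 have Fode: "2 * fps_deriv F = of_nat (2 * m + 1) * (K * F)"
 proof -
  have "fps_deriv (F\<^sup>2 * S ^ Suc (2 * m)) = 0" unfolding FS by simp
  define n where "n = (of_nat (2 * m + 1) :: complex fps)"
  define Q where "Q = S ^ (2 * m)"
  have dP: "fps_deriv (S * Q) = n * fps_deriv S * Q"
   using fps_deriv_power'[of S "Suc (2 * m)"] by (simp add: n_def Q_def)
  have "fps_deriv (F * F * P) = 2 * F * fps_deriv F * P + F * F * fps_deriv P" for P
   by (simp add: algebra_simps)
  from this[of "S * Q"] \<open>fps_deriv (F\<^sup>2 * S ^ Suc (2 * m)) = 0\<close>
  have "2 * F * fps_deriv F * (S * Q) + F * F * (n * fps_deriv S * Q) = 0"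
   unfolding dP power2_eq_square power_Suc Q_def[symmetric] by (simp only:)
  then have "(F * (S * Q)) * (2 * fps_deriv F - n * (K * F)) = 0"
   unfolding dS by (simp add: algebra_simps)
  then have "(F * S ^ Suc (2 * m)) * (2 * fps_deriv F - of_nat (2 * m + 1) * (K * F)) = 0"
   by (simp only: n_def Q_def power_Suc)
  moreover have "F \<noteq> 0" using F00 c0 tan_pos by auto
  moreover have "S \<noteq> 0" using FS c0 tan_pos by (auto simp: d_def)
  ultimately show ?thesis by simp
 qed
 have Fpos: "fps_nth F n \<in> \<real>\<^sub>\<ge>\<^sub>0 \<and> fps_nth F n \<noteq> 0" for n
  by (rule fps_positive_exponential[OF Knn K0 _ _ _ Fode]) (use F00 c0 tan_pos in auto)
 have "fps_nth F (2 * m) = (deriv ^^ (2 * m)) fz 0 / fact (2 * m)"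
  by (simp add: F_def fps_expansion_def)
 also have "(deriv ^^ (2 * m)) fz 0 = (- 2 * \<i>) ^ (2 * m) * (deriv ^^ (2 * m)) f (- 2 * \<i> * 0)"
  unfolding fz_def z_def
  by (rule higher_deriv_compose_linear[where S="ball 0 (r / 2)", OF fh open_ball open_ball]) (use r2 in \<open>auto simp: norm_mult\<close>)
 also have "(- 2 * \<i>) ^ (2 * m) = of_real ((- 4) ^ m)" by (simp add: power_mult power_mult_distrib)
 finally have E: "fps_nth F (2 * m) = of_real ((- 4) ^ m) * ((deriv ^^ (2 * m)) f 0 / fact (2 * m))" by simp
 have G1: "Gamma (real m + 1 / 2) > 0" by (rule Gamma_real_pos) simp
 have H: "hcoef m = (deriv ^^ (2 * m)) f 0 / fact (2 * m) * of_real (Gamma (real m + 1 / 2))"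
  unfolding f_def by (rule hcoef_eq[OF r(1) h(1) _ h(3)]) (use hR in auto)
 also have "\<dots> = fps_nth F (2 * m) * of_real (Gamma (real m + 1 / 2) / (- 4) ^ m)" unfolding E by simp
 finally have H: "hcoef m = fps_nth F (2 * m) * of_real (Gamma (real m + 1 / 2) / (- 4) ^ m)" .
 show "hcoef m \<noteq> 0" unfolding H using Fpos[of "2 * m"] less_imp_neq[OF G1] by (simp add: eq_commute[of 0])
 show "hcoef m \<in> \<real>" unfolding H using Fpos[of "2 * m"] nonneg_Reals_subset_Reals by (intro Reals_mult) auto
qed

end

section \<open>Uniform bounds for the remainder of the expansion of H\<close>

lemma sum_even_odd: "(\<Sum>k<2 * n. f k) = (\<Sum>m<n. f (2 * m) + f (Suc (2 * m)))" for f :: "nat \<Rightarrow> 'a :: comm_monoid_add"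
 by (induction n) (simp_all add: add.assoc)

lemma exp_decay_le_powr:
 assumes "1 / 2 \<le> p" "0 < \<kappa>"
 obtains D :: real where "0 \<le> D" "\<And>x. exp (- (\<kappa> * exp x)) \<le> D * exp (- p * x)"
proof -
 obtain D where D: "\<And>x. exp (p * x - \<kappa> * exp x) \<le> D * exp (- (1 / 2) * \<bar>x\<bar>)"
  using exp_growth_decay_bound[OF assms] by blast
 have D0: "0 \<le> D" using order_trans[OF exp_ge_zero D[of 0]] by simp
 have "exp (- (\<kappa> * exp x)) \<le> D * exp (- p * x)" for x
 proof -
  have "exp (- (\<kappa> * exp x)) = exp (p * x - \<kappa> * exp x) * exp (- p * x)" by (simp flip: exp_add)
  also have "\<dots> \<le> (D * exp (- (1 / 2) * \<bar>x\<bar>)) * exp (- p * x)" using D by (intro mult_right_mono) auto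
  also have "\<dots> \<le> (D * 1) * exp (- p * x)" using D0 by (intro mult_right_mono mult_left_mono) auto
  finally show ?thesis by simp
 qed
 then show ?thesis using D0 that by blast
qed

context phase_setup
begin

lemma norm_scaled_phase_wave:
 "norm (phase_wave \<beta> s (\<i> * of_real \<beta> + y)) = norm (exp (- (exp s * of_real \<xi>))) * exp (- Re (exp s * phi y))"
 unfolding phase_wave_phi norm_mult by simp

text \<open>The curve Y(\<omega> e^(-x)) runs from Y \<omega> to the saddle as x grows, and along it
  \<open>phi\<close> equals \<omega>^2 e^(-2x). It may replace the first piece of the leg because
  only the end points enter through the primitive F.\<close>

lemma leg_local:
 assumes Yh: "Y holomorphic_on ball 0 \<rho>" and Y0: "Y 0 = 0" and Yphi: "\<And>\<omega>. norm \<omega> < \<rho> \<Longrightarrow> phi (Y \<omega>) = \<omega>\<^sup>2"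
  and \<omega>: "norm \<omega> < \<rho>" "\<omega>\<^sup>2 = exp (2 * \<Lambda>)"
  and F: "\<And>T. (F has_field_derivative phase_wave \<beta> s T) (at T)"
  and int: "set_integrable lborel {0<..} (\<lambda>x. exp (- exp (s + 2 * \<Lambda> - 2 * of_real x)) * (deriv Y (\<omega> * of_real (exp (- x))) * (\<omega> * of_real (exp (- x)))))"
 shows "exp (exp s * of_real \<xi>) * (F (\<i> * of_real \<beta> + Y \<omega>) - F (\<i> * of_real \<beta>))
  = (LBINT x:{0<..}. exp (- exp (s + 2 * \<Lambda> - 2 * of_real x)) * (deriv Y (\<omega> * of_real (exp (- x))) * (\<omega> * of_real (exp (- x)))))"
proof -
 let ?e = "exp (- (exp s * of_real \<xi>))"
 define W where "W x = exp (- exp (s + 2 * \<Lambda> - 2 * of_real x)) * (deriv Y (\<omega> * of_real (exp (- x))) * (\<omega> * of_real (exp (- x))))" for x :: real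
 define G where "G z = F (\<i> * of_real \<beta> + Y (\<omega> * exp (- z)))" for z :: complex
 have \<rho>: "0 < \<rho>" using \<omega>(1) norm_ge_zero[of \<omega>] by linarith
 have small: "norm (\<omega> * of_real (exp (- x))) < \<rho>" if "0 \<le> x" for x
 proof -
  have "norm \<omega> * exp (- x) \<le> norm \<omega> * 1" using that by (intro mult_left_mono) auto
  then show ?thesis using \<omega>(1) by (simp add: norm_mult)
 qed
 have Yd: "(Y has_field_derivative deriv Y z) (at z)" if "norm z < \<rho>" for z
  by (rule holomorphic_derivI[OF Yh open_ball]) (use that in simp)
 have dYc: "continuous_on (ball 0 \<rho>) (deriv Y)"
  by (intro holomorphic_on_imp_continuous_on holomorphic_deriv[OF Yh open_ball])
 have ex: "exp (- complex_of_real x) = of_real (exp (- x))" for x by (simp add: exp_of_real[symmetric])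
 have der: "((\<lambda>x. G (of_real x)) has_vector_derivative - ?e * W x) (at x)" if x: "0 \<le> x" for x
 proof -
  let ?z = "\<omega> * exp (- of_real x)"
  have z: "norm ?z < \<rho>" using small[OF x] by (simp only: ex)
  have inner: "((\<lambda>u. \<omega> * exp (- u)) has_field_derivative - ?z) (at (of_real x))"
   by (auto intro!: derivative_eq_intros)
  have "((\<lambda>u. \<i> * of_real \<beta> + Y (\<omega> * exp (- u))) has_field_derivative 0 + deriv Y ?z * - ?z) (at (of_real x))"
   by (intro DERIV_add DERIV_const DERIV_chain2[OF Yd[OF z] inner])
  then have "(G has_field_derivative phase_wave \<beta> s (\<i> * of_real \<beta> + Y ?z) * (0 + deriv Y ?z * - ?z)) (at (of_real x))"
   unfolding G_def[abs_def] by (rule DERIV_chain2[OF F])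
  moreover have "phase_wave \<beta> s (\<i> * of_real \<beta> + Y ?z) * (0 + deriv Y ?z * - ?z) = - ?e * W x"
  proof -
   have "exp s * ?z\<^sup>2 = exp s * (exp (2 * \<Lambda>) * (exp (- of_real x))\<^sup>2)" by (simp add: power_mult_distrib \<omega>(2))
   also have "(exp (- of_real x))\<^sup>2 = exp (- 2 * complex_of_real x)" by (simp add: power2_eq_square flip: exp_add)
   also have "exp s * (exp (2 * \<Lambda>) * exp (- 2 * complex_of_real x)) = exp (s + 2 * \<Lambda> - 2 * of_real x)"
    by (simp flip: exp_add add: algebra_simps)
   finally show ?thesis unfolding phase_wave_phi Yphi[OF z] W_def ex[symmetric] by simp
  qed
  ultimately have "(G has_field_derivative - ?e * W x) (at (of_real x))" by simp
  then show ?thesis by (rule has_vector_derivative_real_field)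
 qed
 have cW: "continuous_on {0..} W" unfolding W_def
  by (intro continuous_intros continuous_on_compose2[OF dYc]) (use small in auto)
 have "(LBINT x:{0<..}. - ?e * W x) = F (\<i> * of_real \<beta>) - G (of_real 0)"
 proof (rule half_line_FTC[OF der])
  show "continuous_on {0..} (\<lambda>x. - ?e * W x)" using cW by (intro continuous_intros)
  show "set_integrable lborel {0<..} (\<lambda>x. - ?e * W x)" using int unfolding W_def by (rule set_integrable_mult_right)
  have "isCont F (\<i> * of_real \<beta> + Y 0)" using F DERIV_isCont by blast
  moreover have "isCont Y 0" using Yd[of 0] \<rho> DERIV_isCont by auto
  ultimately have "isCont (\<lambda>z. F (\<i> * of_real \<beta> + Y z)) 0"
   by (intro isCont_o2[where g=F and f="\<lambda>z. \<i> * of_real \<beta> + Y z"] continuous_intros)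
  moreover have "((\<lambda>x. \<omega> * of_real (exp (- x))) \<longlongrightarrow> \<omega> * of_real 0) at_top"
   by (intro tendsto_intros filterlim_compose[OF exp_at_bot] filterlim_uminus_at_bot_at_top)
  ultimately show "((\<lambda>x. G (of_real x)) \<longlongrightarrow> F (\<i> * of_real \<beta>)) at_top"
   using isCont_tendsto_compose[of "\<omega> * of_real 0" "\<lambda>z. F (\<i> * of_real \<beta> + Y z)" "\<lambda>x. \<omega> * of_real (exp (- x))" at_top]
   by (simp add: G_def ex Y0)
 qed
 then have I: "- ?e * (LBINT x:{0<..}. W x) = F (\<i> * of_real \<beta>) - F (\<i> * of_real \<beta> + Y \<omega>)"
  unfolding set_integral_mult_right by (simp add: G_def)
 have "exp (exp s * of_real \<xi>) * ?e = 1" by (simp flip: exp_add)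
 then have "exp (exp s * of_real \<xi>) * (?e * (LBINT x:{0<..}. W x)) = (LBINT x:{0<..}. W x)"
  by (simp only: mult.assoc[symmetric] mult_1)
 moreover have "?e * (LBINT x:{0<..}. W x) = F (\<i> * of_real \<beta> + Y \<omega>) - F (\<i> * of_real \<beta>)"
  using I by (simp add: algebra_simps)
 ultimately show ?thesis unfolding W_def by simp
qed

text \<open>From a0 on, the rest of the segment and the horizontal ray both carry a factor
  exp(-\<kappa>|t|) relative to e^(-t\<xi>), which is below any prescribed power of |t|. Re s \<ge>
  0, that is |t| \<ge> 1, makes the decay along the ray independent of t.\<close>

lemma leg_outer:
 assumes leg: "is_leg \<epsilon> \<sigma> \<tau> A" and a0: "0 < a0" "a0 \<le> A" and p: "1 / 2 \<le> p"
 obtains D where "\<And>s F. 0 \<le> Im s \<Longrightarrow> Im s \<le> pi \<Longrightarrow> 0 \<le> \<epsilon> * cos (Im s) \<Longrightarrow> 0 \<le> Re s \<Longrightarrow>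
   (\<And>T. (F has_field_derivative phase_wave \<beta> s T) (at T)) \<Longrightarrow>
  norm (exp (exp s * of_real \<xi>) * (F (\<i> * of_real \<beta> + Complex (\<sigma> * A) (\<tau> * A)) - F (\<i> * of_real \<beta> + Complex (\<sigma> * a0) (\<tau> * a0))
   + of_real \<sigma> * (LBINT x:{0<..}. phase_wave \<beta> s (\<i> * of_real \<beta> + Complex (\<sigma> * A) (\<tau> * A) + of_real (\<sigma> * x)))))
  \<le> D * exp (- p * Re s)"
proof -
 let ?y = "\<lambda>a. Complex (\<sigma> * a) (\<tau> * a)"
 obtain \<kappa>1 where \<kappa>1: "0 < \<kappa>1" "\<And>a. a0 \<le> a \<Longrightarrow> a \<le> A \<Longrightarrow> \<kappa>1 \<le> leg_P (\<sigma> * a) (\<beta> + \<tau> * a) \<and> \<kappa>1 \<le> \<epsilon> * leg_Q (\<sigma> * a) (\<beta> + \<tau> * a)"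
  using leg_segment[OF leg a0(1)] by metis
 obtain \<kappa>2 where \<kappa>2: "0 < \<kappa>2"
  "\<And>x. 0 \<le> x \<Longrightarrow> \<kappa>2 * (1 + x) \<le> leg_P (\<sigma> * (A + x)) (\<beta> + \<tau> * A)"
  "\<And>x. 0 \<le> x \<Longrightarrow> \<kappa>2 * (1 + x) \<le> \<epsilon> * leg_Q (\<sigma> * (A + x)) (\<beta> + \<tau> * A)"
  using leg_tail[OF leg] by metis
 obtain D1 where D1: "0 \<le> D1" "\<And>x. exp (- (\<kappa>1 * exp x)) \<le> D1 * exp (- p * x)"
  using exp_decay_le_powr[OF p \<kappa>1(1)] by metis
 obtain D2 where D2: "0 \<le> D2" "\<And>x. exp (- (\<kappa>2 * exp x)) \<le> D2 * exp (- p * x)"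
  using exp_decay_le_powr[OF p \<kappa>2(1)] by metis
 define L where "L = norm (?y A - ?y a0)"
 show ?thesis
 proof (rule that[of "L * D1 + D2 / \<kappa>2"])
  fix s F
  assume s: "0 \<le> Im s" "Im s \<le> pi" "0 \<le> \<epsilon> * cos (Im s)" "0 \<le> Re s"
   and F: "\<And>T. (F has_field_derivative phase_wave \<beta> s T) (at T)"
  let ?i = "\<i> * complex_of_real \<beta>"
  define E where "E = exp (exp s * of_real \<xi>)"
  define e where "e = norm (exp (- (exp s * of_real \<xi>)))"
  have Ee: "norm E * e = 1" unfolding E_def e_def norm_mult[symmetric] by (simp flip: exp_add)
  have e0: "0 < e" by (simp add: e_def)
  have r1: "1 \<le> exp (Re s)" using s(4) by simp
  note decay = leg_decay[OF leg s(1-3)]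
  have seg: "norm (F (?i + ?y A) - F (?i + ?y a0)) \<le> e * exp (- (\<kappa>1 * exp (Re s))) * norm ((?i + ?y A) - (?i + ?y a0))"
  proof (rule field_differentiable_bound[OF convex_closed_segment])
   show "(F has_field_derivative phase_wave \<beta> s z) (at z within closed_segment (?i + ?y a0) (?i + ?y A))" for z
    using F by (rule has_field_derivative_at_within)
   fix z assume "z \<in> closed_segment (?i + ?y a0) (?i + ?y A)"
   then obtain u where u: "0 \<le> u" "u \<le> 1" "z = (1 - u) *\<^sub>R (?i + ?y a0) + u *\<^sub>R (?i + ?y A)"
    by (auto simp: in_segment)
   define a where "a = a0 + u * (A - a0)"
   have z: "z = ?i + ?y a" unfolding u(3) a_def by (simp add: complex_eq_iff algebra_simps)
   have "u * (A - a0) \<le> 1 * (A - a0)" "0 \<le> u * (A - a0)" by (intro mult_right_mono mult_nonneg_nonneg; use u a0 in simp)+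
   then have a: "a0 \<le> a" "a \<le> A" by (auto simp: a_def)
   have "\<kappa>1 * exp (Re s) \<le> Re (exp s * phi (?y a))"
    by (rule decay) (use \<kappa>1 a in auto)
   then show "norm (phase_wave \<beta> s z) \<le> e * exp (- (\<kappa>1 * exp (Re s)))"
    unfolding z norm_scaled_phase_wave e_def[symmetric] using e0 by simp
  qed auto
  have "norm (E * (F (?i + ?y A) - F (?i + ?y a0))) \<le> norm E * (e * exp (- (\<kappa>1 * exp (Re s))) * L)"
   unfolding norm_mult using seg by (intro mult_left_mono) (auto simp: L_def)
  also have "\<dots> = (norm E * e) * (exp (- (\<kappa>1 * exp (Re s))) * L)" by (simp only: mult_ac)
  also have "\<dots> \<le> L * D1 * exp (- p * Re s)"
   unfolding Ee using mult_left_mono[OF D1(2)[of "Re s"], of L] by (simp add: L_def mult_ac)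
  finally have 1: "norm (E * (F (?i + ?y A) - F (?i + ?y a0))) \<le> L * D1 * exp (- p * Re s)" .
  let ?g = "\<lambda>x. phase_wave \<beta> s (?i + ?y A + of_real (\<sigma> * x))"
  have gb: "norm (?g x) \<le> e * exp (- (\<kappa>2 * exp (Re s))) * exp (- \<kappa>2 * x)" if x: "0 < x" for x
  proof -
   have y: "?i + ?y A + of_real (\<sigma> * x) = ?i + Complex (\<sigma> * (A + x)) (\<tau> * A)"
    by (simp add: complex_eq_iff algebra_simps)
   have "\<kappa>2 * (1 + x) * exp (Re s) \<le> Re (exp s * phi (Complex (\<sigma> * (A + x)) (\<tau> * A)))"
    by (rule decay) (use \<kappa>2 x in auto)
   moreover have "\<kappa>2 * exp (Re s) + \<kappa>2 * x * 1 \<le> \<kappa>2 * exp (Re s) + \<kappa>2 * x * exp (Re s)"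
    using r1 \<kappa>2(1) x by (intro add_left_mono mult_left_mono) auto
   ultimately have "- Re (exp s * phi (Complex (\<sigma> * (A + x)) (\<tau> * A))) \<le> - (\<kappa>2 * exp (Re s)) + - \<kappa>2 * x"
    by (simp add: algebra_simps)
   then have "exp (- Re (exp s * phi (Complex (\<sigma> * (A + x)) (\<tau> * A)))) \<le> exp (- (\<kappa>2 * exp (Re s)) + - \<kappa>2 * x)" by simp
   then show ?thesis unfolding y norm_scaled_phase_wave e_def[symmetric] exp_add mult.assoc using e0 by (intro mult_left_mono) auto
  qed
  have gi: "set_integrable lborel {0<..} ?g"
   by (rule set_integrable_exp_bound[OF _ \<kappa>2(1) gb]) (intro continuous_intros)
  have "norm (LBINT x:{0<..}. ?g x) \<le> (LBINT x:{0<..}. e * exp (- (\<kappa>2 * exp (Re s))) * exp (- \<kappa>2 * x))"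
  proof (rule order_trans[OF set_integral_norm_bound[OF gi]])
   show "(LBINT x:{0<..}. norm (?g x)) \<le> (LBINT x:{0<..}. e * exp (- (\<kappa>2 * exp (Re s))) * exp (- \<kappa>2 * x))"
    by (rule set_integral_mono[OF set_integrable_norm[OF gi] set_integrable_mult_right[OF set_integrable_exp_half_line[OF \<kappa>2(1)]]])
     (use gb in auto)
  qed
  also have "\<dots> = e * exp (- (\<kappa>2 * exp (Re s))) * (1 / \<kappa>2)"
   unfolding set_integral_mult_right laplace_exp_real[OF \<kappa>2(1)] ..
  finally have "norm (E * (of_real \<sigma> * (LBINT x:{0<..}. ?g x))) \<le> norm E * (1 * (e * exp (- (\<kappa>2 * exp (Re s))) * (1 / \<kappa>2)))"
   unfolding norm_mult using is_legD(2)[OF leg] e0 \<kappa>2(1) by (intro mult_left_mono mult_mono) auto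
  also have "\<dots> = (norm E * e) * (exp (- (\<kappa>2 * exp (Re s))) / \<kappa>2)" by simp
  also have "\<dots> \<le> D2 * exp (- p * Re s) / \<kappa>2"
   unfolding Ee using D2(2)[of "Re s"] \<kappa>2(1) by (simp add: divide_right_mono)
  finally have 2: "norm (E * (of_real \<sigma> * (LBINT x:{0<..}. ?g x))) \<le> D2 / \<kappa>2 * exp (- p * Re s)" by simp
  have "norm (E * (F (?i + ?y A) - F (?i + ?y a0) + of_real \<sigma> * (LBINT x:{0<..}. ?g x)))
   \<le> norm (E * (F (?i + ?y A) - F (?i + ?y a0))) + norm (E * (of_real \<sigma> * (LBINT x:{0<..}. ?g x)))"
   unfolding distrib_left[of E] by (rule norm_triangle_ineq)
  also have "\<dots> \<le> (L * D1 + D2 / \<kappa>2) * exp (- p * Re s)" using add_mono[OF 1 2] by (simp only: distrib_right)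
  finally show "norm (exp (exp s * of_real \<xi>) * (F (?i + ?y A) - F (?i + ?y a0) + of_real \<sigma> * (LBINT x:{0<..}. ?g x)))
   \<le> (L * D1 + D2 / \<kappa>2) * exp (- p * Re s)" unfolding E_def .
 qed
qed

text \<open>K terms of the expansion of the integral over one whole leg, from the saddle to
  infinity. Here k runs over all powers t^(-(k+1)/2); half of them cancel only between opposite
  legs. As a predicate it fixes D before s and F.\<close>

definition leg_bound :: "(nat \<Rightarrow> complex) \<Rightarrow> nat \<Rightarrow> real \<Rightarrow> real \<Rightarrow> real \<Rightarrow> real \<Rightarrow> real \<Rightarrow> bool" where
 "leg_bound c K \<epsilon> \<sigma> \<tau> A D \<longleftrightarrow> (\<forall>s F. 0 \<le> Im s \<and> Im s \<le> pi \<and> 0 \<le> \<epsilon> * cos (Im s) \<and> 0 \<le> Re s \<and>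
   (\<forall>T. (F has_field_derivative phase_wave \<beta> s T) (at T)) \<longrightarrow>
  norm (exp (exp s * of_real \<xi>) * (F (\<i> * of_real \<beta> + Complex (\<sigma> * A) (\<tau> * A)) - F (\<i> * of_real \<beta>)
   + of_real \<sigma> * (LBINT x:{0<..}. phase_wave \<beta> s (\<i> * of_real \<beta> + Complex (\<sigma> * A) (\<tau> * A) + of_real (\<sigma> * x))))
   - (\<Sum>k<K. of_real (\<sigma> ^ (k + 1)) * c k * of_real (Gamma (real (k + 1) / 2) / 2) * exp (- (of_nat (k + 1) / 2 * s))))
  \<le> D * exp (- (real (K + 1) / 2) * Re s))"

text \<open>\<open>watson\<close> in the coordinate w treats the part of the leg near the saddle,
  \<open>leg_outer\<close> the remainder. A single sequence c serves all legs and all K.\<close>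

lemma leg_expansion:
 obtains c :: "nat \<Rightarrow> complex" where "\<And>m. hcoef m = c (2 * m) * of_real (Gamma (real m + 1 / 2))"
  "\<And>\<epsilon> \<sigma> \<tau> A K. is_leg \<epsilon> \<sigma> \<tau> A \<Longrightarrow> \<exists>D. leg_bound c K \<epsilon> \<sigma> \<tau> A D"
proof (rule local_inverse)
 let ?c = "sqrt (tan \<beta> / 2)"
 have c0: "0 < ?c" using tan_pos by simp
 fix w Y :: "complex \<Rightarrow> complex" and c r \<rho>
 assume r: "0 < r" "0 < \<rho>"
  and Y: "Y holomorphic_on ball 0 \<rho>" "Y 0 = 0" "\<And>y. norm y < r \<Longrightarrow> norm (w y) < \<rho> \<and> Y (w y) = y"
  and w: "\<And>y. norm y < r \<Longrightarrow> norm (w y / of_real ?c - y) \<le> norm y / 4" "\<And>y. norm y < r \<Longrightarrow> (w y)\<^sup>2 = phi y"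
  and Yphi: "\<And>\<omega>. norm \<omega> < \<rho> \<Longrightarrow> phi (Y \<omega>) = \<omega>\<^sup>2"
  and V: "\<And>K. \<exists>A. \<forall>\<omega>. norm \<omega> < \<rho> \<longrightarrow> norm (deriv Y \<omega> - (\<Sum>k<K. c k * \<omega> ^ k)) \<le> A * norm \<omega> ^ K"
  and c: "\<And>m. hcoef m = c (2 * m) * of_real (Gamma (real m + 1 / 2))"
 show ?thesis
 proof (rule that[OF c])
  fix \<epsilon> \<sigma> \<tau> A :: real and K :: nat
  assume leg: "is_leg \<epsilon> \<sigma> \<tau> A"
  let ?y = "\<lambda>a. Complex (\<sigma> * a) (\<tau> * a)"
  have \<sigma>: "\<sigma> * \<sigma> = 1" "\<bar>\<sigma>\<bar> = 1" and \<tau>: "\<bar>\<tau>\<bar> \<le> 2" and A: "0 < A" using is_legD(2,3,4)[OF leg] by auto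
  \<comment> \<open>As |\<tau>| \<le> 2, the point with parameter a0 has modulus at most 3 a0 < r
    and lies within reach of the local coordinate.\<close>
  define a0 where "a0 = min A (r / 4)"
  have a0: "0 < a0" "a0 \<le> A" "a0 \<le> r / 4" using A r(1) by (auto simp: a0_def)
  have ny: "norm (?y a0) \<le> 3 * a0"
  proof -
   have "norm (?y a0) \<le> \<bar>\<sigma> * a0\<bar> + \<bar>\<tau> * a0\<bar>" using cmod_le[of "?y a0"] by simp
   also have "\<dots> = a0 + \<bar>\<tau>\<bar> * a0" using a0(1) by (simp add: abs_mult \<sigma>(2))
   also have "\<bar>\<tau>\<bar> * a0 \<le> 2 * a0" using \<tau> a0(1) by (intro mult_right_mono) auto
   finally show ?thesis by simp
  qed
  then have yr: "norm (?y a0) < r" using a0 r(1) by linarith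
  define \<omega> where "\<omega> = w (?y a0)"
  have \<omega>: "norm \<omega> < \<rho>" "Y \<omega> = ?y a0" "\<omega>\<^sup>2 = phi (?y a0)" using Y(3)[OF yr] w(2)[OF yr] by (auto simp: \<omega>_def)
  \<comment> \<open>\<omega>/\<surd>(tan \<beta>/2) is within 3 a0/4 of a point with real part
    \<sigma> a0, so \<sigma>\<omega> lies in the right half-plane and its principal logarithm can
    serve as \<Lambda>.\<close>
  have re: "0 < Re (of_real \<sigma> * \<omega>)"
  proof -
   have "norm (of_real \<sigma> * (\<omega> / of_real ?c - ?y a0)) \<le> 3 * a0 / 4"
    using w(1)[OF yr] ny \<sigma>(2) by (simp add: norm_mult \<omega>_def)
   then have "\<bar>Re (of_real \<sigma> * (\<omega> / of_real ?c - ?y a0))\<bar> \<le> 3 * a0 / 4"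
    using abs_Re_le_cmod order_trans by blast
   moreover have "Re (of_real \<sigma> * (\<omega> / of_real ?c - ?y a0)) = Re (of_real \<sigma> * \<omega>) / ?c - (\<sigma> * \<sigma>) * a0"
    by (simp add: Re_divide_of_real algebra_simps)
   ultimately have "0 < Re (of_real \<sigma> * \<omega>) / ?c" unfolding \<sigma>(1) using a0(1) by linarith
   then show ?thesis using c0 by (simp add: zero_less_divide_iff)
  qed
  define \<Lambda> where "\<Lambda> = Ln (of_real \<sigma> * \<omega>)"
  have nz: "of_real \<sigma> * \<omega> \<noteq> 0" using re by auto
  have eL: "exp \<Lambda> = of_real \<sigma> * \<omega>" using nz by (simp add: \<Lambda>_def)
  have \<omega>L: "\<omega> = of_real \<sigma> * exp \<Lambda>" unfolding eL using \<sigma>(1) by (simp add: mult.assoc[symmetric] flip: of_real_mult)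
  have \<omega>2: "\<omega>\<^sup>2 = exp (2 * \<Lambda>)"
  proof -
   have "\<omega>\<^sup>2 = of_real (\<sigma> * \<sigma>) * (exp \<Lambda>)\<^sup>2" unfolding \<omega>L power_mult_distrib by (simp add: power2_eq_square)
   then show ?thesis unfolding \<sigma>(1) by (simp add: exp_double)
  qed
  have ImL: "\<bar>Im \<Lambda>\<bar> < pi / 2" unfolding \<Lambda>_def by (rule Re_Ln_pos_lt_imp[OF re])
  have P0: "0 < leg_P (\<sigma> * a0) (\<beta> + \<tau> * a0)" by (rule is_legD(5)[OF leg a0(1,2)])
  \<comment> \<open>Im (\<omega>^2) is the negative of \<open>leg_P\<close>, hence negative.\<close>
  have ImL0: "Im \<Lambda> < 0"
  proof (rule ccontr)
   assume "\<not> Im \<Lambda> < 0"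
   then have "0 \<le> sin (2 * Im \<Lambda>)" using ImL by (intro sin_ge_zero) auto
   then have "0 \<le> Im (exp (2 * \<Lambda>))" by (simp add: Im_exp)
   then show False using P0 phi_parts(2)[of "\<sigma> * a0" "\<tau> * a0"] \<omega>(3) \<omega>2 by simp
  qed
  obtain \<kappa> where \<kappa>: "0 < \<kappa>" "\<And>a. a0 \<le> a \<Longrightarrow> a \<le> A \<Longrightarrow> \<kappa> \<le> leg_P (\<sigma> * a) (\<beta> + \<tau> * a) \<and> \<kappa> \<le> \<epsilon> * leg_Q (\<sigma> * a) (\<beta> + \<tau> * a)"
   using leg_segment[OF leg a0(1)] by metis
  obtain B where B: "\<And>z. norm z < \<rho> \<Longrightarrow> norm (deriv Y z - (\<Sum>k<K. c k * z ^ k)) \<le> B * norm z ^ K"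
   using V by metis
  have small: "norm (\<omega> * of_real u) < \<rho>" if "0 \<le> u" "u \<le> 1" for u
  proof -
   have "norm \<omega> * u \<le> norm \<omega> * 1" using that by (intro mult_left_mono) auto
   then show ?thesis using \<omega>(1) that by (simp add: norm_mult)
  qed
  have dYc: "continuous_on (ball 0 \<rho>) (deriv Y)"
   by (intro holomorphic_on_imp_continuous_on holomorphic_deriv[OF Y(1) open_ball])
  have cont: "continuous_on {0..1} (\<lambda>u. deriv Y (\<omega> * of_real u))"
   by (rule continuous_on_compose2[OF dYc]) (use small in \<open>auto intro!: continuous_intros\<close>)
  have Vb: "norm (deriv Y (\<omega> * of_real u) - (\<Sum>k<K. c k * (\<omega> * of_real u) ^ k)) \<le> (B * norm \<omega> ^ K) * u ^ K" if "0 < u" "u \<le> 1" for u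
   using B[OF small[of u]] that by (simp add: norm_mult power_mult_distrib mult.assoc)
  obtain D1 where D1: "\<And>s. \<bar>Im (s + 2 * \<Lambda>)\<bar> < pi / 2 \<Longrightarrow> \<kappa> * exp (Re s) \<le> Re (exp (s + 2 * \<Lambda>)) \<Longrightarrow>
  set_integrable lborel {0<..} (\<lambda>x. exp (- exp (s + 2 * \<Lambda> - 2 * of_real x)) * (deriv Y (\<omega> * of_real (exp (- x))) * (\<omega> * of_real (exp (- x))))) \<and>
  norm ((LBINT x:{0<..}. exp (- exp (s + 2 * \<Lambda> - 2 * of_real x)) * (deriv Y (\<omega> * of_real (exp (- x))) * (\<omega> * of_real (exp (- x)))))
   - (\<Sum>k<K. of_real (\<sigma> ^ (k + 1)) * c k * of_real (Gamma (real (k + 1) / 2) / 2) * exp (- (of_nat (k + 1) / 2 * s))))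
  \<le> D1 * exp (- (real (K + 1) / 2) * Re s)"
   using watson[OF \<omega>L \<kappa>(1) cont Vb] by blast
  have p: "1 / 2 \<le> real (K + 1) / 2" by simp
  obtain D2 where D2: "\<And>s F. 0 \<le> Im s \<Longrightarrow> Im s \<le> pi \<Longrightarrow> 0 \<le> \<epsilon> * cos (Im s) \<Longrightarrow> 0 \<le> Re s \<Longrightarrow>
   (\<And>T. (F has_field_derivative phase_wave \<beta> s T) (at T)) \<Longrightarrow>
   norm (exp (exp s * of_real \<xi>) * (F (\<i> * of_real \<beta> + ?y A) - F (\<i> * of_real \<beta> + ?y a0)
   + of_real \<sigma> * (LBINT x:{0<..}. phase_wave \<beta> s (\<i> * of_real \<beta> + ?y A + of_real (\<sigma> * x)))))
  \<le> D2 * exp (- (real (K + 1) / 2) * Re s)"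
   using leg_outer[OF leg a0(1,2) p] by blast
  show "\<exists>D. leg_bound c K \<epsilon> \<sigma> \<tau> A D" unfolding leg_bound_def
  proof (intro exI[of _ "D1 + D2"] allI impI, elim conjE)
   fix s F
   assume s: "0 \<le> Im s" "Im s \<le> pi" "0 \<le> \<epsilon> * cos (Im s)" "0 \<le> Re s"
    and "\<forall>T. (F has_field_derivative phase_wave \<beta> s T) (at T)"
   then have F: "\<And>T. (F has_field_derivative phase_wave \<beta> s T) (at T)" by blast
   have "\<kappa> * exp (Re s) \<le> Re (exp s * phi (?y a0))"
    by (rule leg_decay[OF leg s(1-3)]) (use \<kappa>(1) \<kappa>(2)[of a0] a0 in auto)
   then have re\<zeta>: "\<kappa> * exp (Re s) \<le> Re (exp (s + 2 * \<Lambda>))" unfolding exp_add \<omega>2[symmetric] \<omega>(3) .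
   \<comment> \<open>Positive real part of the exponential determines the angle only modulo 2\<pi>.
     Im s in [0, \<pi>] and 2 Im \<Lambda> in (-\<pi>, 0) exclude the other branches.\<close>
   have im: "\<bar>Im (s + 2 * \<Lambda>)\<bar> < pi / 2"
   proof -
    have "0 < \<kappa> * exp (Re s)" using \<kappa>(1) by simp
    then have "0 < Re (exp (s + 2 * \<Lambda>))" using re\<zeta> by linarith
    then have c: "0 < cos (Im (s + 2 * \<Lambda>))" unfolding Re_exp by (simp add: zero_less_mult_iff)
    have b: "\<bar>Im (s + 2 * \<Lambda>)\<bar> \<le> pi" using s ImL ImL0 by auto
    show ?thesis
    proof (rule ccontr)
     assume "\<not> ?thesis"
     then have "cos \<bar>Im (s + 2 * \<Lambda>)\<bar> \<le> cos (pi / 2)" using b by (intro cos_monotone_0_pi_le) auto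
     then show False using c by simp
    qed
   qed
   note W = D1[OF im re\<zeta>]
   note O = D2[OF s F]
   let ?E = "exp (exp s * of_real \<xi>)" and ?i = "\<i> * complex_of_real \<beta>"
   have loc: "?E * (F (?i + Y \<omega>) - F ?i) = (LBINT x:{0<..}. exp (- exp (s + 2 * \<Lambda> - 2 * of_real x)) * (deriv Y (\<omega> * of_real (exp (- x))) * (\<omega> * of_real (exp (- x)))))"
    by (rule leg_local[OF Y(1,2) Yphi \<omega>(1) \<omega>2 F conjunct1[OF W]])
   let ?S = "\<Sum>k<K. of_real (\<sigma> ^ (k + 1)) * c k * of_real (Gamma (real (k + 1) / 2) / 2) * exp (- (of_nat (k + 1) / 2 * s))"
   define T where "T = of_real \<sigma> * (LBINT x:{0<..}. phase_wave \<beta> s (?i + ?y A + of_real (\<sigma> * x)))"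
   have "?E * (F (?i + ?y A) - F ?i + T) - ?S = (?E * (F (?i + Y \<omega>) - F ?i) - ?S) + ?E * (F (?i + ?y A) - F (?i + ?y a0) + T)"
    unfolding \<omega>(2) by (simp add: algebra_simps)
   then have "norm (?E * (F (?i + ?y A) - F ?i + T) - ?S) \<le> norm (?E * (F (?i + Y \<omega>) - F ?i) - ?S) + norm (?E * (F (?i + ?y A) - F (?i + ?y a0) + T))"
    by (simp only: norm_triangle_ineq)
   also have "\<dots> \<le> D1 * exp (- (real (K + 1) / 2) * Re s) + D2 * exp (- (real (K + 1) / 2) * Re s)"
    using conjunct2[OF W, folded loc] O[folded T_def] by (rule add_mono)
   finally show "norm (?E * (F (?i + ?y A) - F ?i + of_real \<sigma> * (LBINT x:{0<..}. phase_wave \<beta> s (?i + ?y A + of_real (\<sigma> * x)))) - ?S)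
    \<le> (D1 + D2) * exp (- (real (K + 1) / 2) * Re s)" unfolding T_def by (simp only: distrib_right)
  qed
 qed
qed


lemma hrem_holomorphic: "hrem M holomorphic_on UNIV"
 unfolding hrem_def by (intro holomorphic_intros saddle_integral_holomorphic[OF cos_pos])

text \<open>H is the integral over the right leg minus that over the left one. The factor
  \<sigma>^(k+1) makes odd k cancel and doubles even k = 2m, where Gamma(m + 1/2)/2 doubled times
  c(2m) is h_m. Thus 2M terms per leg leave M terms and an error of order |t|^(-M-1/2).\<close>

lemma hrem_two_legs:
 fixes c :: "nat \<Rightarrow> complex"
 assumes c: "\<And>m. hcoef m = c (2 * m) * of_real (Gamma (real m + 1 / 2))"
  and b: "0 < \<beta> + \<tau> * A + Im s" "\<beta> + \<tau> * A + Im s < pi" "0 < \<beta> + \<tau>' * A' - Im s" "\<beta> + \<tau>' * A' - Im s < pi"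
  and s: "0 \<le> Im s" "Im s \<le> pi" "0 \<le> \<epsilon> * cos (Im s)" "0 \<le> Re s"
  and R: "leg_bound c (2 * M) \<epsilon> 1 \<tau> A D" and L: "leg_bound c (2 * M) \<epsilon> (- 1) \<tau>' A' D'"
 shows "norm (hrem M s) \<le> (D + D') * exp (- (real M + 1 / 2) * Re s)"
proof -
 obtain F where F: "\<And>T. (F has_field_derivative phase_wave \<beta> s T) (at T)"
  using phase_wave_primitive[of \<beta> s] by blast
 let ?E = "exp (exp s * of_real \<xi>)" and ?i = "\<i> * complex_of_real \<beta>"
 let ?P = "?i + Complex A (\<tau> * A)" and ?Q = "?i + Complex (- A') (\<tau>' * A')"
 define SR where "SR = (\<Sum>k<2 * M. c k * of_real (Gamma (real (k + 1) / 2) / 2) * exp (- (of_nat (k + 1) / 2 * s)))"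
 define SL where "SL = (\<Sum>k<2 * M. of_real ((- 1) ^ (k + 1)) * c k * of_real (Gamma (real (k + 1) / 2) / 2) * exp (- (of_nat (k + 1) / 2 * s)))"
 define IR where "IR = (LBINT x:{0<..}. phase_wave \<beta> s (?P + of_real x))"
 define IL where "IL = (LBINT x:{0<..}. phase_wave \<beta> s (?Q - of_real x))"
 have sad: "saddle_integral \<beta> s = F ?P - F ?Q + IR + IL"
  unfolding IR_def IL_def by (rule saddle_integral_eq(1)[OF cos_pos _ _ _ _ F]) (use b in auto)
 have 1: "norm (?E * (F ?P - F ?i + IR) - SR) \<le> D * exp (- (real (2 * M + 1) / 2) * Re s)"
  using R[unfolded leg_bound_def, rule_format, of s F] s F unfolding IR_def SR_def by simp
 have 2: "norm (?E * (F ?Q - F ?i - IL) - SL) \<le> D' * exp (- (real (2 * M + 1) / 2) * Re s)"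
  using L[unfolded leg_bound_def, rule_format, of s F] s F unfolding IL_def SL_def by simp
 have eq: "hrem M s = (?E * (F ?P - F ?i + IR) - SR) - (?E * (F ?Q - F ?i - IL) - SL)"
 proof -
  have "SR - SL = (\<Sum>k<2 * M. (1 - of_real ((- 1) ^ (k + 1))) * (c k * of_real (Gamma (real (k + 1) / 2) / 2) * exp (- (of_nat (k + 1) / 2 * s))))"
   unfolding SR_def SL_def sum_subtractf[symmetric] by (intro sum.cong refl) (simp add: algebra_simps)
  also have "\<dots> = (\<Sum>m<M. hcoef m * exp (- (of_nat m + 1 / 2) * s))"
  proof -
   have "real (2 * m + 1) / 2 = real m + 1 / 2" "complex_of_nat (2 * m + 1) / 2 = of_nat m + 1 / 2" for m
    by (simp_all add: add_divide_distrib)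
   then show ?thesis unfolding sum_even_odd by (intro sum.cong refl) (simp only: mult_minus_left, simp add: c add_divide_distrib distrib_right)
  qed
  finally have "SR - SL = (\<Sum>m<M. hcoef m * exp (- (of_nat m + 1 / 2) * s))" .
  then show ?thesis unfolding hrem_def sad by (simp add: algebra_simps)
 qed
 have "norm (hrem M s) \<le> D * exp (- (real (2 * M + 1) / 2) * Re s) + D' * exp (- (real (2 * M + 1) / 2) * Re s)"
  unfolding eq by (rule order_trans[OF norm_triangle_ineq4 add_mono[OF 1 2]])
 moreover have "real (2 * M + 1) / 2 = real M + 1 / 2" by (simp add: add_divide_distrib)
 ultimately show ?thesis by (simp only: distrib_right)
qed

text \<open>The first pair of legs serves arg t < \<pi>/2, the second arg t > \<pi>/2. At \<pi>/2,
  where the left ray of the first pair reaches the edge of its convergence sector, the bound follows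
  by continuity.\<close>

lemma hrem_upper:
 obtains D where "\<And>s. 0 \<le> Re s \<Longrightarrow> 0 \<le> Im s \<Longrightarrow> Im s \<le> pi \<Longrightarrow> norm (hrem M s) \<le> D * exp (- (real M + 1 / 2) * Re s)"
proof -
 obtain c where c: "\<And>m. hcoef m = c (2 * m) * of_real (Gamma (real m + 1 / 2))"
  and ex: "\<And>\<epsilon> \<sigma> \<tau> A K. is_leg \<epsilon> \<sigma> \<tau> A \<Longrightarrow> \<exists>D. leg_bound c K \<epsilon> \<sigma> \<tau> A D"
  by (rule leg_expansion) blast
 obtain R1 where R1: "leg_bound c (2 * M) 1 1 0 1 R1" using ex[OF right_leg_1] by blast
 obtain L1 where L1: "leg_bound c (2 * M) 1 (- 1) (3 / 5) (5 / 3 * (pi / 2 - \<beta>)) L1" using ex[OF left_leg_1] by blast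
 obtain R2 where R2: "leg_bound c (2 * M) (- 1) 1 (- 2) \<beta> R2" using ex[OF right_leg_2] by blast
 obtain L2 where L2: "leg_bound c (2 * M) (- 1) (- 1) 2 ((5 * pi / 4 - \<beta>) / 2) L2" using ex[OF left_leg_2] by blast
 define D where "D = max (R1 + L1) (R2 + L2)"
 have off: "norm (hrem M s) \<le> D * exp (- (real M + 1 / 2) * Re s)"
  if s: "0 \<le> Re s" "0 \<le> Im s" "Im s \<le> pi" "Im s \<noteq> pi / 2" for s
 proof (cases "Im s < pi / 2")
  case True
  have cp: "0 \<le> 1 * cos (Im s)" using True s by (auto intro!: cos_ge_zero)
  have "norm (hrem M s) \<le> (R1 + L1) * exp (- (real M + 1 / 2) * Re s)"
  proof (rule hrem_two_legs[OF c _ _ _ _ s(2,3) cp s(1) R1 L1])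
   have b: "\<beta> + 3 / 5 * (5 / 3 * (pi / 2 - \<beta>)) = pi / 2"
   proof -
    have "3 / 5 * (5 / 3 * z) = z" for z :: real by simp
    then show ?thesis by (simp only:)
   qed
   show "0 < \<beta> + 3 / 5 * (5 / 3 * (pi / 2 - \<beta>)) - Im s" "\<beta> + 3 / 5 * (5 / 3 * (pi / 2 - \<beta>)) - Im s < pi"
    unfolding b using True s by auto
  qed (use True s \<beta> in auto)
  also have "\<dots> \<le> D * exp (- (real M + 1 / 2) * Re s)" by (intro mult_right_mono) (auto simp: D_def)
  finally show ?thesis .
 next
  case False
  have cp: "0 \<le> - 1 * cos (Im s)"
  proof -
   have "cos (Im s) \<le> cos (pi / 2)" using False s by (intro cos_monotone_0_pi_le) auto
   then show ?thesis by simp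
  qed
  have "norm (hrem M s) \<le> (R2 + L2) * exp (- (real M + 1 / 2) * Re s)"
  proof (rule hrem_two_legs[OF c _ _ _ _ s(2,3) cp s(1) R2 L2])
   have b: "\<beta> + 2 * ((5 * pi / 4 - \<beta>) / 2) = 5 * pi / 4"
   proof -
    have "2 * (z / 2) = z" for z :: real by simp
    then show ?thesis by (simp only:)
   qed
   show "0 < \<beta> + 2 * ((5 * pi / 4 - \<beta>) / 2) - Im s" "\<beta> + 2 * ((5 * pi / 4 - \<beta>) / 2) - Im s < pi"
    unfolding b using False s by auto
  qed (use False s \<beta> in auto)
  also have "\<dots> \<le> D * exp (- (real M + 1 / 2) * Re s)" by (intro mult_right_mono) (auto simp: D_def)
  finally show ?thesis .
 qed
 show ?thesis
 proof (rule that[of D])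
  fix s assume s: "0 \<le> Re s" "0 \<le> Im s" "Im s \<le> pi"
  show "norm (hrem M s) \<le> D * exp (- (real M + 1 / 2) * Re s)"
  proof (cases "Im s = pi / 2")
   case True
   have "continuous_on UNIV (\<lambda>u. norm (hrem M (Complex (Re s) u)))"
    by (intro continuous_on_norm continuous_on_compose2[OF holomorphic_on_imp_continuous_on[OF hrem_holomorphic[of M]]])
     (auto simp: Complex_eq intro!: continuous_intros)
   then have "isCont (\<lambda>u. norm (hrem M (Complex (Re s) u))) (pi / 2)" by (simp add: continuous_on_eq_continuous_at)
   then have lim: "((\<lambda>u. norm (hrem M (Complex (Re s) u))) \<longlongrightarrow> norm (hrem M (Complex (Re s) (pi / 2)))) (at_left (pi / 2))"
    unfolding isCont_def by (rule filterlim_mono) (auto simp: at_le)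
   have "norm (hrem M (Complex (Re s) (pi / 2))) \<le> D * exp (- (real M + 1 / 2) * Re s)"
   proof (rule tendsto_upperbound[OF lim])
    have "eventually (\<lambda>u. u \<in> {0<..<pi / 2}) (at_left (pi / 2))" by (rule eventually_at_left_real) simp
    then show "eventually (\<lambda>u. norm (hrem M (Complex (Re s) u)) \<le> D * exp (- (real M + 1 / 2) * Re s)) (at_left (pi / 2))"
    proof eventually_elim
     case (elim u)
     then show ?case using off[of "Complex (Re s) u"] s(1) by simp
    qed
   qed simp
   moreover have "Complex (Re s) (pi / 2) = s" using True by (simp add: complex_eq_iff)
   ultimately show ?thesis by simp
  qed (use off s in auto)
 qed
qed

text \<open>On the line Im T = \<pi>/2, reflection in the imaginary axis turns the phase into minus
  its conjugate. This gives the symmetry for |Im s| < \<pi>/2, and the identity theorem extends it.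
  With real h_m it reduces negative arg t to positive.\<close>

lemma saddle_integral_cnj: "saddle_integral \<beta> (cnj s) = cnj (saddle_integral \<beta> s)"
proof -
 let ?S = "{s. Im s < pi / 2} \<inter> {s. Im s > - (pi / 2)}"
 have strip: "cnj (saddle_integral \<beta> (cnj s)) = saddle_integral \<beta> s" if "s \<in> ?S" for s
 proof -
  have b: "\<bar>Im s\<bar> < pi / 2" "pi / 2 < pi - \<bar>Im s\<bar>" "\<bar>Im (cnj s)\<bar> < pi / 2" "pi / 2 < pi - \<bar>Im (cnj s)\<bar>" using that by auto
  have pw: "cnj (phase_wave \<beta> (cnj s) (\<i> * of_real (pi / 2) + of_real x)) = phase_wave \<beta> s (\<i> * of_real (pi / 2) + of_real (- x))" for x
  proof -
   have "phase \<beta> (\<i> * of_real (pi / 2) + of_real (- x)) = - cnj (phase \<beta> (\<i> * of_real (pi / 2) + of_real x))"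
   proof -
    have "\<i> * of_real (pi / 2) + of_real y = Complex y (pi / 2)" for y by (simp add: complex_eq_iff)
    then show ?thesis by (simp only:) (rule complex_eqI; simp add: phase_parts)
   qed
   then show ?thesis unfolding phase_wave_def by (simp add: exp_cnj)
  qed
  have "cnj (saddle_integral \<beta> (cnj s)) = (LBINT x. cnj (phase_wave \<beta> (cnj s) (\<i> * of_real (pi / 2) + of_real x)))"
   unfolding saddle_integral_line(1)[OF cos_pos b(3,4)] by simp
  also have "\<dots> = (LBINT x. phase_wave \<beta> s (\<i> * of_real (pi / 2) + of_real x))"
   unfolding pw by (rule integral_line_reflect)
  also have "\<dots> = saddle_integral \<beta> s" unfolding saddle_integral_line(1)[OF cos_pos b(1,2)] ..
  finally show ?thesis .
 qed
 have hol: "saddle_integral \<beta> holomorphic_on UNIV" by (rule saddle_integral_holomorphic[OF cos_pos])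
 have "(cnj \<circ> saddle_integral \<beta> \<circ> cnj) s = saddle_integral \<beta> s"
 proof (rule analytic_continuation_open[where f="cnj \<circ> saddle_integral \<beta> \<circ> cnj" and g="saddle_integral \<beta>" and s="?S" and s'=UNIV])
  show "open ?S" by (intro open_Int open_halfspace_Im_lt open_halfspace_Im_gt)
  have "0 \<in> ?S" by simp
  then show "?S \<noteq> {}" by blast
  show "cnj \<circ> saddle_integral \<beta> \<circ> cnj holomorphic_on UNIV"
   by (rule holomorphic_on_compose_cnj_cnj) (auto intro: holomorphic_on_subset[OF hol])
 qed (use strip hol in auto)
 then show ?thesis by (metis comp_apply complex_cnj_cnj)
qed

lemma hrem_cnj: "hrem M (cnj s) = cnj (hrem M s)"
proof -
 have h: "cnj (hcoef m) = hcoef m" for m using hcoef_nonzero_real(2)[of m] by (simp add: Reals_cnj_iff)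
 show ?thesis by (simp add: hrem_def saddle_integral_cnj exp_cnj h)
qed

lemma hrem_sides:
 obtains D where "\<And>s. 0 \<le> Re s \<Longrightarrow> \<bar>Im s\<bar> \<le> pi \<Longrightarrow> norm (hrem M s) \<le> D * exp (- (real M + 1 / 2) * Re s)"
proof -
 obtain D where D: "\<And>s. 0 \<le> Re s \<Longrightarrow> 0 \<le> Im s \<Longrightarrow> Im s \<le> pi \<Longrightarrow> norm (hrem M s) \<le> D * exp (- (real M + 1 / 2) * Re s)"
  using hrem_upper by metis
 show ?thesis
 proof (rule that[of D])
  fix s assume s: "0 \<le> Re s" "\<bar>Im s\<bar> \<le> pi"
  show "norm (hrem M s) \<le> D * exp (- (real M + 1 / 2) * Re s)"
  proof (cases "0 \<le> Im s")
   case False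
   then show ?thesis using D[of "cnj s"] s by (simp add: hrem_cnj)
  qed (use D s in auto)
 qed
qed

text \<open>On Im T = \<pi>/2 the phase has real part -x and imaginary part cosh x/cos \<beta> -
  \<pi>/2 \<ge> 2|x| - 5. For |arg t| \<le> \<pi>/4 this leaves decay exp(-|t||x|/2), whose integral
  is 4/|t|; the 5 becomes the factor e^5.\<close>

lemma saddle_integral_small:
 assumes s: "\<bar>Im s\<bar> \<le> pi / 4" "Re s \<le> 0"
 shows "norm (saddle_integral \<beta> s) \<le> 4 * exp 5 * exp (- Re s)"
proof -
 let ?c = "cos (Im s)" and ?r = "exp (Re s)"
 have c: "1 / 2 \<le> ?c" "\<bar>sin (Im s)\<bar> \<le> ?c"
 proof -
  have "cos (pi / 4) \<le> cos \<bar>Im s\<bar>" using s by (intro cos_monotone_0_pi_le) auto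
  then have c4: "sqrt 2 / 2 \<le> ?c" by (simp add: cos_45)
  moreover have "1 \<le> sqrt (2::real)" by simp
  ultimately show "1 / 2 \<le> ?c" by linarith
  have "sin \<bar>Im s\<bar> \<le> sin (pi / 4)" using s by (intro sin_monotone_2pi_le) auto
  moreover have "0 \<le> sin \<bar>Im s\<bar>" using s by (intro sin_ge_zero) auto
  moreover have "\<bar>sin (Im s)\<bar> = sin \<bar>Im s\<bar>" using \<open>0 \<le> sin \<bar>Im s\<bar>\<close> by (auto simp: abs_if split: if_splits)
  ultimately show "\<bar>sin (Im s)\<bar> \<le> ?c" using c4 by (simp add: sin_45)
 qed
 have r: "0 < ?r" "?r \<le> 1" using s by auto
 have pt: "norm (phase_wave \<beta> s (\<i> * of_real (pi / 2) + of_real x)) \<le> exp 5 * exp (- (?r / 2) * \<bar>x\<bar>)" for x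
 proof -
  have Cx: "\<i> * of_real (pi / 2) + of_real x = Complex x (pi / 2)" by (simp add: complex_eq_iff)
  define J where "J = cosh x / cos \<beta> - pi / 2"
  have J: "2 * \<bar>x\<bar> - 5 \<le> J"
  proof -
   have e: "1 + \<bar>x\<bar> + \<bar>x\<bar>\<^sup>2 / 2 \<le> exp \<bar>x\<bar>" by (rule exp_lower_Taylor_quadratic) simp
   have "1 - \<bar>x\<bar> \<le> exp (- \<bar>x\<bar>)" using exp_ge_add_one_self[of "- \<bar>x\<bar>"] by simp
   with e have "1 + \<bar>x\<bar>\<^sup>2 / 4 \<le> cosh \<bar>x\<bar>" by (simp add: cosh_def field_simps)
   also have "cosh \<bar>x\<bar> \<le> cosh x / cos \<beta>" using cos_pos by (simp add: field_simps)
   finally have "1 + \<bar>x\<bar>\<^sup>2 / 4 - pi / 2 \<le> J" by (simp add: J_def)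
   moreover have "0 \<le> (\<bar>x\<bar> / 2 - 2)\<^sup>2" by simp
   then have "2 * \<bar>x\<bar> - 4 \<le> \<bar>x\<bar>\<^sup>2 / 4" by (simp add: power2_eq_square algebra_simps)
   ultimately show ?thesis using pi_less_4 by linarith
  qed
  have "\<bar>x\<bar> / 2 - 5 \<le> ?c * J - sin (Im s) * x"
  proof -
   have "sin (Im s) * x \<le> \<bar>sin (Im s)\<bar> * \<bar>x\<bar>" by (simp flip: abs_mult)
   also have "\<dots> \<le> ?c * \<bar>x\<bar>" using c(2) by (intro mult_right_mono) auto
   finally have 1: "sin (Im s) * x \<le> ?c * \<bar>x\<bar>" .
   have 2: "?c * (2 * \<bar>x\<bar> - 5) \<le> ?c * J" using J c(1) by (intro mult_left_mono) auto
   have 3: "1 / 2 * \<bar>x\<bar> \<le> ?c * \<bar>x\<bar>" using c(1) by (intro mult_right_mono) auto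
   have 4: "?c * 5 \<le> 5" by simp
   have "?c * (2 * \<bar>x\<bar> - 5) = 2 * (?c * \<bar>x\<bar>) - ?c * 5" by (simp add: algebra_simps)
   then show ?thesis using 1 2 3 4 by linarith
  qed
  then have "?r * (\<bar>x\<bar> / 2 - 5) \<le> ?r * (?c * J - sin (Im s) * x)" using r by (intro mult_left_mono) auto
  moreover have "?r * 5 \<le> 1 * 5" using r(2) by (rule mult_right_mono) simp
  moreover have "?r * (\<bar>x\<bar> / 2 - 5) = ?r / 2 * \<bar>x\<bar> - ?r * 5" by (simp add: right_diff_distrib)
  moreover have "- (?r / 2) * \<bar>x\<bar> = - (?r / 2 * \<bar>x\<bar>)" by simp
  ultimately have "- (?r * (?c * J - sin (Im s) * x)) \<le> 5 + - (?r / 2) * \<bar>x\<bar>" by linarith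
  moreover have "norm (phase_wave \<beta> s (Complex x (pi / 2))) = exp (- (?r * (?c * J - sin (Im s) * x)))"
   unfolding phase_wave_def norm_exp_eq_Re
   by (simp add: phase_parts Re_exp Im_exp J_def algebra_simps)
  ultimately show ?thesis unfolding Cx exp_add[symmetric] by simp
 qed
 have b: "\<bar>Im s\<bar> < pi / 2" "pi / 2 < pi - \<bar>Im s\<bar>" using s pi_gt_zero by linarith+
 have r2: "0 < ?r / 2" by simp
 have I: "(LBINT x. exp (- (?r / 2) * \<bar>x\<bar>)) = 4 * exp (- Re s)"
 proof -
  have "(LBINT x. exp (- (?r / 2) * \<bar>x\<bar>)) = (LBINT x:{0<..}. exp (- (?r / 2) * \<bar>x\<bar>)) + (LBINT x:{0<..}. exp (- (?r / 2) * \<bar>- x\<bar>))"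
   by (rule integral_line_split[OF integrable_exp_abs[OF r2]])
  also have "(LBINT x:{0<..}. exp (- (?r / 2) * \<bar>- x\<bar>)) = (LBINT x:{0<..}. exp (- (?r / 2) * \<bar>x\<bar>))" by simp
  also have "(LBINT x:{0<..}. exp (- (?r / 2) * \<bar>x\<bar>)) = (LBINT x:{0<..}. exp (- (?r / 2) * x))"
   by (rule set_lebesgue_integral_cong) auto
  also have "\<dots> = 1 / (?r / 2)" by (rule laplace_exp_real[OF r2])
  finally show ?thesis by (simp add: exp_minus field_simps)
 qed
 have "norm (saddle_integral \<beta> s) \<le> (LBINT x. exp 5 * exp (- (?r / 2) * \<bar>x\<bar>))"
  unfolding saddle_integral_line(1)[OF cos_pos b]
  by (rule Bochner_Integration.integral_norm_bound_integral[OF saddle_integral_line(2)[OF cos_pos b]])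
   (use pt integrable_exp_abs[OF r2] in auto)
 also have "\<dots> = exp 5 * (4 * exp (- Re s))" unfolding Bochner_Integration.integral_mult_right_zero I ..
 finally show ?thesis by (simp add: mult_ac)
qed

text \<open>The rotated integral reaches down to t = 0, where the expansion says nothing. There the
  bound of order 1/|t| for H and every subtracted power are dominated by |t|^(-M-3/2). The index
  \<open>Suc M\<close> ensures an exponent of at least 1.\<close>

lemma hrem_strip:
 obtains D where "\<And>s. \<bar>Im s\<bar> \<le> pi / 4 \<Longrightarrow> norm (hrem (Suc M) s) \<le> D * exp (- (real (Suc M) + 1 / 2) * Re s)"
proof -
 let ?p = "real (Suc M) + 1 / 2"
 obtain D where D: "\<And>s. 0 \<le> Re s \<Longrightarrow> \<bar>Im s\<bar> \<le> pi \<Longrightarrow> norm (hrem (Suc M) s) \<le> D * exp (- ?p * Re s)"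
  using hrem_sides by metis
 define D' where "D' = exp \<xi> * (4 * exp 5) + (\<Sum>m<Suc M. norm (hcoef m))"
 show ?thesis
 proof (rule that[of "max D D'"])
  fix s assume s: "\<bar>Im s\<bar> \<le> pi / 4"
  show "norm (hrem (Suc M) s) \<le> max D D' * exp (- ?p * Re s)"
  proof (cases "0 \<le> Re s")
   case True
   have "\<bar>Im s\<bar> \<le> pi" using s pi_gt_zero by linarith
   then have "norm (hrem (Suc M) s) \<le> D * exp (- ?p * Re s)" by (rule D[OF True])
   also have "\<dots> \<le> max D D' * exp (- ?p * Re s)" by (intro mult_right_mono) auto
   finally show ?thesis .
  next
   case False
   have mono: "exp (- q * Re s) \<le> exp (- ?p * Re s)" if "q \<le> ?p" for q
   proof -
    have "?p * Re s \<le> q * Re s" using that by (rule mult_right_mono_neg) (use False in simp)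
    then show ?thesis by (simp only: exp_le_cancel_iff mult_minus_left neg_le_iff_le)
   qed
   have "norm (exp (exp s * of_real \<xi>)) \<le> exp \<xi>"
   proof -
    have "Re (exp s) \<le> norm (exp s)" by (rule complex_Re_le_cmod)
    also have "\<dots> \<le> 1" using False by simp
    finally have "Re (exp s) * \<xi> \<le> 1 * \<xi>" using \<xi>_pos by (intro mult_right_mono) auto
    then show ?thesis by simp
   qed
   moreover have "norm (saddle_integral \<beta> s) \<le> 4 * exp 5 * exp (- ?p * Re s)"
    using saddle_integral_small[OF s] False mono[of 1] by (auto intro: order_trans)
   ultimately have 1: "norm (exp (exp s * of_real \<xi>) * saddle_integral \<beta> s) \<le> exp \<xi> * (4 * exp 5 * exp (- ?p * Re s))"
    unfolding norm_mult by (rule mult_mono) auto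
   have 2: "norm (\<Sum>m<Suc M. hcoef m * exp (- (of_nat m + 1 / 2) * s)) \<le> (\<Sum>m<Suc M. norm (hcoef m) * exp (- ?p * Re s))"
   proof (rule sum_norm_le)
    fix m assume "m \<in> {..<Suc M}"
    then have "exp (- (real m + 1 / 2) * Re s) \<le> exp (- ?p * Re s)" by (intro mono) auto
    then show "norm (hcoef m * exp (- (of_nat m + 1 / 2) * s)) \<le> norm (hcoef m) * exp (- ?p * Re s)"
     unfolding norm_mult by (intro mult_left_mono) auto
   qed
   have "norm (hrem (Suc M) s) \<le> exp \<xi> * (4 * exp 5 * exp (- ?p * Re s)) + (\<Sum>m<Suc M. norm (hcoef m) * exp (- ?p * Re s))"
    unfolding hrem_def using order_trans[OF norm_triangle_ineq4 add_mono[OF 1 2]] .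
   also have "\<dots> = D' * exp (- ?p * Re s)" by (simp only: D'_def sum_distrib_right[symmetric] distrib_right mult.assoc)
   also have "\<dots> \<le> max D D' * exp (- ?p * Re s)" by (intro mult_right_mono) auto
   finally show ?thesis .
  qed
 qed
qed

end

section \<open>The error bounds\<close>

text \<open>The conclusion of \<open>rotated_estimate\<close> as a predicate, so that the constants
  for M and M + 1 can be fixed before \<beta> is.\<close>

definition rotation_bound :: "nat \<Rightarrow> real \<Rightarrow> real \<Rightarrow> bool" where
 "rotation_bound M B C \<longleftrightarrow> 0 < C \<and> (\<forall>x \<theta> D l r N. 0 < x \<longrightarrow> 0 < \<theta> \<longrightarrow> \<bar>Im l\<bar> < pi / 2 \<longrightarrow> r holomorphic_on UNIV \<longrightarrow>
   (\<forall>s. \<bar>Im s\<bar> \<le> \<theta> \<longrightarrow> norm (r s) \<le> D * exp (- (real M + 1 / 2) * Re s)) \<longrightarrow>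
   2 \<le> norm (exp l) * x \<longrightarrow> 1 / \<theta>\<^sup>2 \<le> norm (exp l) * x \<longrightarrow> 2 * B + M + 1 \<le> norm (exp l) * x \<longrightarrow>
   \<bar>2 * real N - norm (exp l) * x\<bar> \<le> 2 * B \<longrightarrow>
   norm (LBINT t:{0<..}. of_real (t ^ (2 * N)) * (exp l / ((exp l)\<^sup>2 + of_real (t\<^sup>2))) * (of_real (exp (- (x * t))) * r (of_real (ln t))))
    \<le> C * D * norm (exp l) ^ (2 * N) * norm (exp l) powr (- (real M + 1 / 2)) * exp (- (norm (exp l) * x)))"

lemma rotation_bound_exists:
 obtains C where "rotation_bound M B C"
proof (rule rotated_estimate[of M B])
 fix C :: real
 assume C: "0 < C" and rot: "\<And>\<xi> \<theta>0 D l r N. 0 < \<xi> \<Longrightarrow> 0 < \<theta>0 \<Longrightarrow> \<bar>Im l\<bar> < pi / 2 \<Longrightarrow> r holomorphic_on UNIV \<Longrightarrow>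
   (\<And>s. \<bar>Im s\<bar> \<le> \<theta>0 \<Longrightarrow> norm (r s) \<le> D * exp (- (real M + 1 / 2) * Re s)) \<Longrightarrow>
   2 \<le> norm (exp l) * \<xi> \<Longrightarrow> 1 / \<theta>0\<^sup>2 \<le> norm (exp l) * \<xi> \<Longrightarrow> 2 * B + M + 1 \<le> norm (exp l) * \<xi> \<Longrightarrow>
   \<bar>2 * real N - norm (exp l) * \<xi>\<bar> \<le> 2 * B \<Longrightarrow>
   norm (LBINT t:{0<..}. of_real (t ^ (2 * N)) * (exp l / ((exp l)\<^sup>2 + of_real (t\<^sup>2))) * (of_real (exp (- (\<xi> * t))) * r (of_real (ln t))))
    \<le> C * D * norm (exp l) ^ (2 * N) * norm (exp l) powr (- (real M + 1 / 2)) * exp (- (norm (exp l) * \<xi>))"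
 have "rotation_bound M B C" unfolding rotation_bound_def
 proof (intro conjI C allI impI)
  fix x \<theta> D :: real and l :: complex and r and N :: nat
  assume "0 < x" "0 < \<theta>" "\<bar>Im l\<bar> < pi / 2" "r holomorphic_on UNIV"
   "\<forall>s. \<bar>Im s\<bar> \<le> \<theta> \<longrightarrow> norm (r s) \<le> D * exp (- (real M + 1 / 2) * Re s)"
   "2 \<le> norm (exp l) * x" "1 / \<theta>\<^sup>2 \<le> norm (exp l) * x" "2 * B + real M + 1 \<le> norm (exp l) * x"
   "\<bar>2 * real N - norm (exp l) * x\<bar> \<le> 2 * B"
  then show "norm (LBINT t:{0<..}. of_real (t ^ (2 * N)) * (exp l / ((exp l)\<^sup>2 + of_real (t\<^sup>2))) * (of_real (exp (- (x * t))) * r (of_real (ln t))))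
    \<le> C * D * norm (exp l) ^ (2 * N) * norm (exp l) powr (- (real M + 1 / 2)) * exp (- (norm (exp l) * x))"
   by (intro rot) auto
 qed
 then show ?thesis by (rule that)
qed

context phase_setup
begin

lemma R_NM_holomorphic:
 assumes M: "M \<le> 2 * N"
 shows "R_NM N M \<beta> holomorphic_on UNIV"
proof -
 have T: "(\<lambda>l. terminant_ext p (l + c)) holomorphic_on UNIV" for p c
 proof -
  have "(\<lambda>l. l + c) holomorphic_on UNIV" by (intro holomorphic_intros)
  from holomorphic_on_compose_gen[OF this terminant_ext_holomorphic[of p UNIV]] show ?thesis by (simp add: o_def)
 qed
 have e: "eterm N m holomorphic_on UNIV" if "m < M" for m
 proof -
  have p: "1 < 2 * real N - real m + 1 / 2" using that M by linarith
  have T1: "Tplus N m = (\<lambda>l. terminant_ext (2 * real N - real m + 1 / 2) (l + (\<i> * of_real (pi / 2) + of_real (ln \<xi>))))"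
   "Tminus N m = (\<lambda>l. terminant_ext (2 * real N - real m + 1 / 2) (l + (- \<i> * of_real (pi / 2) + of_real (ln \<xi>))))"
   by (simp_all only: fun_eq_iff Tplus_def Tminus_def terminant_eq[OF p]) (simp_all add: algebra_simps)
  have "Tplus N m holomorphic_on UNIV" "Tminus N m holomorphic_on UNIV" unfolding T1 by (rule T)+
  then show ?thesis unfolding eterm_def[abs_def] using rootc_nz by (intro holomorphic_intros) auto
 qed
 have "(\<lambda>l. R_N N \<beta> l - (\<Sum>m<M. eterm N m l)) holomorphic_on UNIV"
  unfolding R_N_def anger_weber_sec_eq[OF cos_pos]
  by (intro holomorphic_intros anger_weber_ext_holomorphic[OF cos_pos] e) auto
 then show ?thesis by (simp add: R_NM_eq[abs_def])
qed

lemma lorentz_rotation: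
 assumes rot: "rotation_bound M B C" and l: "\<bar>Im l\<bar> < pi / 2" "r holomorphic_on UNIV"
  and r: "\<And>s. \<bar>Im s\<bar> \<le> pi / 4 \<Longrightarrow> norm (r s) \<le> D * exp (- (real M + 1 / 2) * Re s)"
  and w: "2 \<le> norm (exp l) * \<xi>" "1 / (pi / 4)\<^sup>2 \<le> norm (exp l) * \<xi>" "2 * B + real M + 1 \<le> norm (exp l) * \<xi>"
  and N: "\<bar>2 * real N - norm (exp l) * \<xi>\<bar> \<le> 2 * B"
 shows "norm (lorentz_integral N l (\<lambda>t. r (of_real (ln t)))) \<le> C * D / pi\<^sup>2 * (norm (exp l) powr (- (real M + 1 / 2)) * exp (- (norm (exp l) * \<xi>)))"
proof -
 define R where "R = norm (exp l)"
 have R0: "0 < R" by (simp add: R_def)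
 then have R: "0 < R ^ (2 * N)" by simp
 have "norm (LBINT t:{0<..}. of_real (t ^ (2 * N)) * (exp l / ((exp l)\<^sup>2 + of_real (t\<^sup>2))) * (of_real (exp (- (\<xi> * t))) * r (of_real (ln t))))
    \<le> C * D * R ^ (2 * N) * R powr (- (real M + 1 / 2)) * exp (- (R * \<xi>))"
  using rot[unfolded rotation_bound_def, THEN conjunct2, rule_format, of \<xi> "pi / 4" l r D N] \<xi>_pos l r w N unfolding R_def by simp
 then have "1 / (pi\<^sup>2 * R ^ (2 * N)) * norm (LBINT t:{0<..}. of_real (t ^ (2 * N)) * (exp l / ((exp l)\<^sup>2 + of_real (t\<^sup>2))) * (of_real (exp (- (\<xi> * t))) * r (of_real (ln t))))
  \<le> 1 / (pi\<^sup>2 * R ^ (2 * N)) * (C * D * R ^ (2 * N) * R powr (- (real M + 1 / 2)) * exp (- (R * \<xi>)))"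
  using R by (intro mult_left_mono) auto
 also have "\<dots> = (1 / R ^ (2 * N) * R ^ (2 * N)) * (C * D / pi\<^sup>2 * (R powr (- (real M + 1 / 2)) * exp (- (R * \<xi>))))"
  by simp
 also have "1 / R ^ (2 * N) * R ^ (2 * N) = 1" using R0 by simp
 also have "1 / (pi\<^sup>2 * R ^ (2 * N)) = norm ((- 1) ^ N / (of_real (pi\<^sup>2) * exp l ^ (2 * N)))"
  by (simp add: norm_divide norm_mult norm_power R_def)
 finally show ?thesis unfolding lorentz_integral_def norm_mult[of "(- 1) ^ N / (of_real (pi\<^sup>2) * exp l ^ (2 * N))"] by (simp add: R_def)
qed

lemma hrem_Suc: "hrem M s = hcoef M * exp (- (of_nat M + 1 / 2) * s) + hrem (Suc M) s"
 by (simp add: hrem_def)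

text \<open>\<open>R_NM\<close> for M is the one for M + 1 plus the M-th term. That term comes from
  h_M t^(-M-1/2) and is estimated with a constant free of \<beta>. The remainder for M + 1 has the
  constant D, which depends on \<beta>, but gains 1/|\<nu>|.\<close>

lemma R_NM_inner:
 assumes C1: "rotation_bound M B C1" and C2: "rotation_bound (Suc M) B C2"
 obtains K where "0 < K" "\<And>l N. \<bar>Im l\<bar> \<le> pi / 2 \<Longrightarrow> K \<le> norm (exp l) \<Longrightarrow> \<bar>2 * real N - norm (exp l) * \<xi>\<bar> \<le> 2 * B \<Longrightarrow>
  norm (R_NM N M \<beta> l) \<le> (C1 + 1) / pi\<^sup>2 * (norm (hcoef M) * norm (exp l) powr (- (real M + 1 / 2)) * exp (- (norm (exp l) * \<xi>)))
  \<and> M < 2 * N"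
proof -
 define h where "h = norm (hcoef M)"
 have h: "0 < h" using hcoef_nonzero_real(1)[of M] by (simp add: h_def)
 obtain D where D: "\<And>s. \<bar>Im s\<bar> \<le> pi / 4 \<Longrightarrow> norm (hrem (Suc M) s) \<le> D * exp (- (real (Suc M) + 1 / 2) * Re s)"
  using hrem_strip by metis
 define w where "w = 2 + 1 / (pi / 4)\<^sup>2 + 2 * \<bar>B\<bar> + real M + 3"
 have w0: "0 < w" unfolding w_def by (intro add_pos_nonneg) auto
 \<comment> \<open>The last summand makes the remainder for M + 1 at most the size of |h_M|, which
   is possible because h_M is nonzero; w/\<xi> provides the lower bounds on |\<nu>|\<xi> and M <
   2N.\<close>
 define K where "K = 1 + w / \<xi> + \<bar>C2 * D\<bar> / h"
 have strict: "norm (R_NM N M \<beta> l) \<le> (C1 + 1) / pi\<^sup>2 * (h * norm (exp l) powr (- (real M + 1 / 2)) * exp (- (norm (exp l) * \<xi>))) \<and> M < 2 * N"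
  if l: "\<bar>Im l\<bar> < pi / 2" and K: "K \<le> norm (exp l)" and N: "\<bar>2 * real N - norm (exp l) * \<xi>\<bar> \<le> 2 * B" for l N
 proof -
  define R where "R = norm (exp l)"
  have KR: "1 + w / \<xi> + \<bar>C2 * D\<bar> / h \<le> R" using K by (simp add: K_def R_def)
  have nn: "0 \<le> w / \<xi>" "0 \<le> \<bar>C2 * D\<bar> / h" using w0 \<xi>_pos h by auto
  have R: "1 \<le> R" "w / \<xi> \<le> R" "\<bar>C2 * D\<bar> / h \<le> R" using KR nn by linarith+
  have wR: "w \<le> R * \<xi>" using R(2) \<xi>_pos by (simp add: field_simps)
  have q0: "0 \<le> 1 / (pi / 4)\<^sup>2" by simp
  have B0: "B \<le> \<bar>B\<bar>" by simp
  have ws: "2 \<le> R * \<xi>" "1 / (pi / 4)\<^sup>2 \<le> R * \<xi>" "2 * B + real M + 1 \<le> R * \<xi>" "2 * B + real (Suc M) + 1 \<le> R * \<xi>" "2 * B + real M + 2 \<le> R * \<xi>"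
   using wR q0 B0 abs_ge_zero[of B] unfolding w_def of_nat_Suc by linarith+
  have "real M < 2 * real N" using N ws(5) unfolding R_def by linarith
  then have MN: "M < 2 * N" by linarith
  let ?X = "R powr (- (real M + 1 / 2)) * exp (- (R * \<xi>))"
  have 1: "norm (R_NM N (Suc M) \<beta> l) \<le> C2 * D / pi\<^sup>2 * (R powr (- (real (Suc M) + 1 / 2)) * exp (- (R * \<xi>)))"
  proof -
   have "R_NM N (Suc M) \<beta> l = lorentz_integral N l (\<lambda>t. hrem (Suc M) (of_real (ln t)))"
    by (rule R_NM_integral[OF l]) (use MN in simp)
   then show ?thesis unfolding R_def
    using lorentz_rotation[OF C2 l hrem_holomorphic D] ws N by (simp only: R_def)
  qed
  let ?e = "\<lambda>s. hcoef M * exp (- (of_nat M + 1 / 2) * s)"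
  have 2: "norm (eterm N M l) \<le> C1 * h / pi\<^sup>2 * ?X"
  proof -
   have pw: "complex_of_real (t powr (- (real M + 1 / 2))) = exp (- (of_nat M + 1 / 2) * of_real (ln t))" if "0 < t" for t
    using that by (simp add: powr_def exp_of_real[symmetric])
   have "eterm N M l = lorentz_integral N l (\<lambda>t. ?e (of_real (ln t)))"
    unfolding eterm_integral(1)[OF l MN] lorentz_integral_def
    by (intro arg_cong2[where f="(*)"] refl set_lebesgue_integral_cong allI impI) (simp, simp only: greaterThan_iff pw)
   moreover have "norm (lorentz_integral N l (\<lambda>t. ?e (of_real (ln t)))) \<le> C1 * h / pi\<^sup>2 * (norm (exp l) powr (- (real M + 1 / 2)) * exp (- (norm (exp l) * \<xi>)))"
   proof (rule lorentz_rotation[OF C1 l])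
    show "?e holomorphic_on UNIV" by (intro holomorphic_intros)
    show "norm (?e s) \<le> h * exp (- (real M + 1 / 2) * Re s)" for s by (simp add: norm_mult h_def)
   qed (use ws N in \<open>simp_all add: R_def\<close>)
   ultimately show ?thesis by (simp add: R_def)
  qed
  have 3: "C2 * D / pi\<^sup>2 * (R powr (- (real (Suc M) + 1 / 2)) * exp (- (R * \<xi>))) \<le> h / pi\<^sup>2 * ?X"
  proof -
   have "- (real (Suc M) + 1 / 2) = - (real M + 1 / 2) - 1" by simp
   then have "R powr (- (real (Suc M) + 1 / 2)) = R powr (- (real M + 1 / 2)) / R"
    using R(1) by (simp only: powr_diff) simp
   then have "C2 * D / pi\<^sup>2 * (R powr (- (real (Suc M) + 1 / 2)) * exp (- (R * \<xi>))) = (C2 * D / R) * (?X / pi\<^sup>2)" by simp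
   also have "C2 * D / R \<le> h"
   proof -
    have "C2 * D \<le> \<bar>C2 * D\<bar>" by simp
    also have "\<dots> \<le> h * R" using R(3) h by (simp add: field_simps)
    finally show ?thesis using R(1) by (simp add: field_simps)
   qed
   then have "(C2 * D / R) * (?X / pi\<^sup>2) \<le> h * (?X / pi\<^sup>2)" by (intro mult_right_mono) auto
   finally show ?thesis by simp
  qed
  have "R_NM N M \<beta> l = R_NM N (Suc M) \<beta> l + eterm N M l" by (simp add: R_NM_eq)
  then have "norm (R_NM N M \<beta> l) \<le> norm (R_NM N (Suc M) \<beta> l) + norm (eterm N M l)" by (simp only: norm_triangle_ineq)
  also have "\<dots> \<le> h / pi\<^sup>2 * ?X + C1 * h / pi\<^sup>2 * ?X" using 1 2 3 by linarith
  also have "\<dots> = (C1 + 1) / pi\<^sup>2 * (h * R powr (- (real M + 1 / 2)) * exp (- (R * \<xi>)))"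
   by (simp add: add_divide_distrib distrib_right distrib_left mult_ac)
  finally show ?thesis using MN by (simp add: R_def)
 qed
 show ?thesis
 proof (rule that[of K])
  show "0 < K" unfolding K_def using w0 \<xi>_pos h by (intro add_pos_nonneg) auto
  fix l N assume l: "\<bar>Im l\<bar> \<le> pi / 2" and K: "K \<le> norm (exp l)" and N: "\<bar>2 * real N - norm (exp l) * \<xi>\<bar> \<le> 2 * B"
  \<comment> \<open>Points of the open sector with the same modulus of \<nu>, tending to l: the
    estimate there passes to the closed sector by continuity.\<close>
  define L where "L n = Complex (Re l) (real n / real (Suc n) * Im l)" for n
  have nL: "norm (exp (L n)) = norm (exp l)" for n by (simp add: L_def)
  have ImL: "\<bar>Im (L n)\<bar> < pi / 2" for n
  proof -
   have "\<bar>Im (L n)\<bar> = real n / real (Suc n) * \<bar>Im l\<bar>" by (simp add: L_def abs_mult)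
   also have "\<dots> \<le> real n / real (Suc n) * (pi / 2)" using l by (intro mult_left_mono) auto
   also have "\<dots> < 1 * (pi / 2)" by (intro mult_strict_right_mono) auto
   finally show ?thesis by simp
  qed
  note b = strict[OF ImL, unfolded nL, OF K N]
  have MN: "M < 2 * N" using b by blast
  have "isCont (R_NM N M \<beta>) l"
   using holomorphic_on_imp_continuous_on[OF R_NM_holomorphic[of M N]] MN by (simp add: continuous_on_eq_continuous_at)
  moreover have "L \<longlonglongrightarrow> l"
  proof -
   have "(\<lambda>n. Complex (Re l) (real n / real (Suc n) * Im l)) \<longlonglongrightarrow> Complex (Re l) (1 * Im l)"
    by (intro tendsto_Complex tendsto_const tendsto_mult LIMSEQ_n_over_Suc_n)
   then show ?thesis unfolding L_def[abs_def] by simp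
  qed
  ultimately have "(\<lambda>n. R_NM N M \<beta> (L n)) \<longlonglongrightarrow> R_NM N M \<beta> l" by (rule isCont_tendsto_compose)
  then have "(\<lambda>n. norm (R_NM N M \<beta> (L n))) \<longlonglongrightarrow> norm (R_NM N M \<beta> l)" by (rule tendsto_norm)
  then have "norm (R_NM N M \<beta> l) \<le> (C1 + 1) / pi\<^sup>2 * (h * norm (exp l) powr (- (real M + 1 / 2)) * exp (- (norm (exp l) * \<xi>)))"
   by (rule LIMSEQ_le_const2) (use b in blast)
  then show "norm (R_NM N M \<beta> l) \<le> (C1 + 1) / pi\<^sup>2 * (norm (hcoef M) * norm (exp l) powr (- (real M + 1 / 2)) * exp (- (norm (exp l) * \<xi>))) \<and> M < 2 * N"
   using MN by (simp add: h_def)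
 qed
qed

text \<open>The first omitted term dominates once |t| exceeds a threshold depending on \<beta>,
  again since h_M is nonzero; hence the absolute factor 2.\<close>

lemma hrem_bound:
 obtains K where "0 < K" "\<And>s. \<bar>Im s\<bar> \<le> pi \<Longrightarrow> K \<le> exp (Re s) \<Longrightarrow>
  norm (hrem M s) \<le> 2 * (norm (hcoef M) * exp (Re s) powr (- (real M + 1 / 2)))"
proof -
 define h where "h = norm (hcoef M)"
 have h: "0 < h" using hcoef_nonzero_real(1)[of M] by (simp add: h_def)
 obtain D where D: "\<And>s. 0 \<le> Re s \<Longrightarrow> \<bar>Im s\<bar> \<le> pi \<Longrightarrow> norm (hrem (Suc M) s) \<le> D * exp (- (real (Suc M) + 1 / 2) * Re s)"
  using hrem_sides by metis
 show ?thesis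
 proof (rule that[of "1 + \<bar>D\<bar> / h"])
  show "0 < 1 + \<bar>D\<bar> / h" using h by (intro add_pos_nonneg) auto
  fix s assume s: "\<bar>Im s\<bar> \<le> pi" and K: "1 + \<bar>D\<bar> / h \<le> exp (Re s)"
  let ?X = "exp (- (real M + 1 / 2) * Re s)"
  have nn: "0 \<le> \<bar>D\<bar> / h" using h by simp
  have e1: "1 \<le> exp (Re s)" and e2: "\<bar>D\<bar> / h \<le> exp (Re s)" using K nn by linarith+
  have "D * exp (- (real (Suc M) + 1 / 2) * Re s) \<le> h * ?X"
  proof -
   have "exp (- (real (Suc M) + 1 / 2) * Re s) = ?X * exp (- Re s)"
    unfolding exp_add[symmetric] by (simp add: algebra_simps)
   then have "D * exp (- (real (Suc M) + 1 / 2) * Re s) = D * exp (- Re s) * ?X" by simp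
   also have "D * exp (- Re s) \<le> h"
   proof -
    have "D \<le> h * exp (Re s)" using e2 h by (simp add: field_simps)
    then show ?thesis by (simp add: exp_minus field_simps)
   qed
   then have "D * exp (- Re s) * ?X \<le> h * ?X" by (intro mult_right_mono) auto
   finally show ?thesis .
  qed
  moreover have "norm (hrem (Suc M) s) \<le> D * exp (- (real (Suc M) + 1 / 2) * Re s)"
   by (rule D[OF _ s]) (use e1 in simp)
  moreover have "norm (hcoef M * exp (- (of_nat M + 1 / 2) * s)) = h * ?X" by (simp add: norm_mult h_def)
  moreover have "norm (hrem M s) \<le> norm (hcoef M * exp (- (of_nat M + 1 / 2) * s)) + norm (hrem (Suc M) s)"
   unfolding hrem_Suc[of M s] by (rule norm_triangle_ineq)
  ultimately have "norm (hrem M s) \<le> 2 * (h * ?X)" by linarith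
  moreover have "exp (Re s) powr (- (real M + 1 / 2)) = ?X" by (simp add: powr_def)
  ultimately show "norm (hrem M s) \<le> 2 * (norm (hcoef M) * exp (Re s) powr (- (real M + 1 / 2)))" by (simp only: h_def)
 qed
qed

text \<open>|h_M| = \<surd>(2\<pi> cot \<beta>) |U_M|, and \<surd>(2\<pi> cot \<beta>) \<surd>(\<pi>
  tan \<beta>/2) = \<pi>. This is the only conversion between the scale natural for H and that of
  the theorem.\<close>

lemma scale_eq:
 assumes "0 < R"
 shows "norm (hcoef M) * R powr (- (real M + 1 / 2)) * E
  = pi * (E / sqrt (1 / 2 * R * pi * tan \<beta>) * (norm (U_coeff M (\<i> * of_real (cot \<beta>))) / R ^ M))"
proof -
 let ?u = "norm (U_coeff M (\<i> * of_real (cot \<beta>)))"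
 have cot: "cot \<beta> = 1 / tan \<beta>" by (simp add: cot_altdef inverse_eq_divide)
 have "norm (hcoef M) = sqrt (2 * pi * cot \<beta>) * ?u"
  using tan_pos by (simp add: hcoef_def ucoef_def norm_mult norm_power cot)
 moreover have "R powr (- (real M + 1 / 2)) = 1 / (R ^ M * sqrt R)"
 proof -
  have "R powr (real M + 1 / 2) = R ^ M * sqrt R" using assms by (simp add: powr_add powr_realpow powr_half_sqrt)
  then show ?thesis unfolding powr_minus by (simp add: inverse_eq_divide)
 qed
 moreover have "sqrt (1 / 2 * R * pi * tan \<beta>) = sqrt R * sqrt (pi * tan \<beta> / 2)"
  by (simp add: mult_ac flip: real_sqrt_mult)
 moreover have "sqrt (2 * pi * cot \<beta>) * sqrt (pi * tan \<beta> / 2) = pi"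
 proof -
  have "(2 * pi * cot \<beta>) * (pi * tan \<beta> / 2) = pi\<^sup>2" using tan_pos by (simp add: cot power2_eq_square)
  then have "sqrt (2 * pi * cot \<beta>) * sqrt (pi * tan \<beta> / 2) = sqrt (pi\<^sup>2)" by (simp only: real_sqrt_mult[symmetric])
  then show ?thesis by simp
 qed
 then have "sqrt (2 * pi * cot \<beta>) = pi / sqrt (pi * tan \<beta> / 2)" using tan_pos by (simp add: field_simps)
 ultimately show ?thesis by (simp add: mult_ac)
qed

text \<open>For \<pi>/2 \<le> arg \<nu> \<le> 3\<pi>/2 the point turned back by \<pi> lies in the
  closed right half-plane, and its contribution of size e^(-|\<nu>|\<xi>) is dominated. The other
  term of the connection formula has t = -\<i>\<nu>, so Re t = Im \<nu>, which explains the
  exponential in the bound. Negative arguments use the same formula started at the point turned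
  forward by \<pi>.\<close>

lemma R_NM_bounds:
 assumes C1: "rotation_bound M B C1" and C2: "rotation_bound (Suc M) B C2"
 obtains K where "0 < K" "\<And>l N. K \<le> norm (exp l) \<Longrightarrow> \<bar>2 * real N - norm (exp l) * \<xi>\<bar> \<le> 2 * B \<Longrightarrow> \<bar>Im l\<bar> \<le> 3 * pi / 2 \<Longrightarrow>
  (\<bar>Im l\<bar> \<le> pi / 2 \<longrightarrow> norm (R_NM N M \<beta> l) \<le> ((C1 + 1) / pi\<^sup>2 + 1) * (norm (hcoef M) * norm (exp l) powr (- (real M + 1 / 2)) * exp (- norm (exp l) * \<xi>))) \<and>
  (pi / 2 \<le> Im l \<longrightarrow> norm (R_NM N M \<beta> l) \<le> ((C1 + 1) / pi\<^sup>2 + 1) * (norm (hcoef M) * norm (exp l) powr (- (real M + 1 / 2)) * exp (- Im (exp l) * \<xi>))) \<and>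
  (pi / 2 \<le> - Im l \<longrightarrow> norm (R_NM N M \<beta> l) \<le> ((C1 + 1) / pi\<^sup>2 + 1) * (norm (hcoef M) * norm (exp l) powr (- (real M + 1 / 2)) * exp (Im (exp l) * \<xi>)))"
proof -
 obtain K1 where K1: "0 < K1" "\<And>l N. \<bar>Im l\<bar> \<le> pi / 2 \<Longrightarrow> K1 \<le> norm (exp l) \<Longrightarrow> \<bar>2 * real N - norm (exp l) * \<xi>\<bar> \<le> 2 * B \<Longrightarrow>
  norm (R_NM N M \<beta> l) \<le> (C1 + 1) / pi\<^sup>2 * (norm (hcoef M) * norm (exp l) powr (- (real M + 1 / 2)) * exp (- (norm (exp l) * \<xi>)))
  \<and> M < 2 * N"
  using R_NM_inner[OF C1 C2] by blast
 obtain K2 where K2: "0 < K2" "\<And>s. \<bar>Im s\<bar> \<le> pi \<Longrightarrow> K2 \<le> exp (Re s) \<Longrightarrow>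
  norm (hrem M s) \<le> 2 * (norm (hcoef M) * exp (Re s) powr (- (real M + 1 / 2)))"
  using hrem_bound by blast
 have Ca: "0 < (C1 + 1) / pi\<^sup>2" using C1 by (simp add: rotation_bound_def)
 define Ca where "Ca = (C1 + 1) / pi\<^sup>2"
 show ?thesis
 proof (rule that[of "max K1 K2"])
  show "0 < max K1 K2" using K1(1) by simp
  fix l N assume K: "max K1 K2 \<le> norm (exp l)" and N: "\<bar>2 * real N - norm (exp l) * \<xi>\<bar> \<le> 2 * B" and l: "\<bar>Im l\<bar> \<le> 3 * pi / 2"
  define R where "R = norm (exp l)"
  define H where "H = norm (hcoef M) * R powr (- (real M + 1 / 2))"
  have H0: "0 \<le> H" by (simp add: H_def)
  have Rl: "R = exp (Re l)" by (simp add: R_def)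
  have ImR: "\<bar>Im (exp l)\<bar> \<le> R" unfolding R_def by (rule abs_Im_le_cmod)
  have A: "norm (R_NM N M \<beta> u) \<le> Ca * (H * exp (- (R * \<xi>))) \<and> M < 2 * N" if "\<bar>Im u\<bar> \<le> pi / 2" "Re u = Re l" for u
  proof -
   have "norm (exp u) = norm (exp l)" using that(2) by simp
   then show ?thesis using K1(2)[of u N] that(1) K N unfolding Ca_def H_def R_def by simp
  qed
  have Hb: "norm (hrem M u) \<le> 2 * H" if "\<bar>Im u\<bar> \<le> pi" "Re u = Re l" for u
   using K2(2)[of u] that K by (simp add: H_def Rl)
  \<comment> \<open>t stands for -Im \<nu> or Im \<nu>; the factor 2 of \<open>hrem_bound\<close>
    disappears by 2/\<pi> \<le> 1.\<close>
  have outer: "Ca * (H * exp (- (R * \<xi>))) + exp (t * \<xi>) * (2 * H) / pi \<le> (Ca + 1) * (H * exp (t * \<xi>))" if "- R \<le> t" for t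
  proof -
   have "- R * \<xi> \<le> t * \<xi>" using that \<xi>_pos by (intro mult_right_mono) auto
   then have "Ca * (H * exp (- (R * \<xi>))) \<le> Ca * (H * exp (t * \<xi>))" using Ca H0 by (intro mult_left_mono) (auto simp: Ca_def)
   moreover have "exp (t * \<xi>) * (2 * H) / pi \<le> 1 * (H * exp (t * \<xi>))"
   proof -
    have "2 / pi \<le> 1" using pi_gt3 by simp
    then have "2 / pi * (H * exp (t * \<xi>)) \<le> 1 * (H * exp (t * \<xi>))" using H0 by (intro mult_right_mono) auto
    then show ?thesis by (simp add: mult_ac)
   qed
   ultimately show ?thesis by (simp only: distrib_right)
  qed
  have I: "norm (R_NM N M \<beta> l) \<le> (Ca + 1) * (H * exp (- R * \<xi>))" if "\<bar>Im l\<bar> \<le> pi / 2"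
  proof -
   have "norm (R_NM N M \<beta> l) \<le> Ca * (H * exp (- R * \<xi>))" using A[of l] that by simp
   also have "\<dots> \<le> (Ca + 1) * (H * exp (- R * \<xi>))" using H0 by (intro mult_right_mono) auto
   finally show ?thesis .
  qed
  have II: "norm (R_NM N M \<beta> l) \<le> (Ca + 1) * (H * exp (- Im (exp l) * \<xi>))" if "pi / 2 \<le> Im l"
  proof -
   let ?u = "l - \<i> * of_real pi" and ?s = "l - \<i> * of_real (pi / 2)"
   have "\<bar>Im l - pi\<bar> \<le> pi / 2" "\<bar>Im l - pi / 2\<bar> \<le> pi" using that l by linarith+
   then have u: "\<bar>Im ?u\<bar> \<le> pi / 2" "Re ?u = Re l" and s: "\<bar>Im ?s\<bar> \<le> pi" "Re ?s = Re l" by simp_all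
   note Au = A[OF u]
   have "R_NM N M \<beta> l = exp (- (exp ?s * of_real \<xi>)) * hrem M ?s / of_real pi - R_NM N M \<beta> ?u"
    using R_NM_connection[of M N l] Au by (simp add: algebra_simps)
   then have "norm (R_NM N M \<beta> l) \<le> norm (exp (- (exp ?s * of_real \<xi>)) * hrem M ?s / of_real pi) + norm (R_NM N M \<beta> ?u)"
    by (simp only: norm_triangle_ineq4)
   also have "norm (exp (- (exp ?s * of_real \<xi>)) * hrem M ?s / of_real pi) = exp (- Im (exp l) * \<xi>) * norm (hrem M ?s) / pi"
    unfolding exp_diff_i_half_pi by (simp add: norm_mult norm_divide)
   also have "\<dots> \<le> exp (- Im (exp l) * \<xi>) * (2 * H) / pi"
    using Hb[OF s] by (intro divide_right_mono mult_left_mono) auto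
   finally have "norm (R_NM N M \<beta> l) \<le> Ca * (H * exp (- (R * \<xi>))) + exp (- Im (exp l) * \<xi>) * (2 * H) / pi"
    using Au by linarith
   then show ?thesis using outer[of "- Im (exp l)"] ImR by linarith
  qed
  have III: "norm (R_NM N M \<beta> l) \<le> (Ca + 1) * (H * exp (Im (exp l) * \<xi>))" if "pi / 2 \<le> - Im l"
  proof -
   let ?u = "l + \<i> * of_real pi" and ?s = "l + \<i> * of_real (pi / 2)"
   have "\<bar>Im l + pi\<bar> \<le> pi / 2" "\<bar>Im l + pi / 2\<bar> \<le> pi" using that l by linarith+
   then have u: "\<bar>Im ?u\<bar> \<le> pi / 2" "Re ?u = Re l" and s: "\<bar>Im ?s\<bar> \<le> pi" "Re ?s = Re l" by simp_all
   note Au = A[OF u]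
   have us: "?u - \<i> * of_real pi = l" "?u - \<i> * of_real (pi / 2) = ?s" by (simp_all add: algebra_simps)
   have "R_NM N M \<beta> l = exp (- (exp ?s * of_real \<xi>)) * hrem M ?s / of_real pi - R_NM N M \<beta> ?u"
    using R_NM_connection[of M N ?u, unfolded us] Au by (simp add: algebra_simps)
   then have "norm (R_NM N M \<beta> l) \<le> norm (exp (- (exp ?s * of_real \<xi>)) * hrem M ?s / of_real pi) + norm (R_NM N M \<beta> ?u)"
    by (simp only: norm_triangle_ineq4)
   also have "norm (exp (- (exp ?s * of_real \<xi>)) * hrem M ?s / of_real pi) = exp (Im (exp l) * \<xi>) * norm (hrem M ?s) / pi"
    unfolding exp_add_i_half_pi by (simp add: norm_mult norm_divide)
   also have "\<dots> \<le> exp (Im (exp l) * \<xi>) * (2 * H) / pi"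
    using Hb[OF s] by (intro divide_right_mono mult_left_mono) auto
   finally have "norm (R_NM N M \<beta> l) \<le> Ca * (H * exp (- (R * \<xi>))) + exp (Im (exp l) * \<xi>) * (2 * H) / pi"
    using Au by linarith
   then show ?thesis using outer[of "Im (exp l)"] ImR by linarith
  qed
  show "(\<bar>Im l\<bar> \<le> pi / 2 \<longrightarrow> norm (R_NM N M \<beta> l) \<le> ((C1 + 1) / pi\<^sup>2 + 1) * (norm (hcoef M) * norm (exp l) powr (- (real M + 1 / 2)) * exp (- norm (exp l) * \<xi>))) \<and>
  (pi / 2 \<le> Im l \<longrightarrow> norm (R_NM N M \<beta> l) \<le> ((C1 + 1) / pi\<^sup>2 + 1) * (norm (hcoef M) * norm (exp l) powr (- (real M + 1 / 2)) * exp (- Im (exp l) * \<xi>))) \<and>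
  (pi / 2 \<le> - Im l \<longrightarrow> norm (R_NM N M \<beta> l) \<le> ((C1 + 1) / pi\<^sup>2 + 1) * (norm (hcoef M) * norm (exp l) powr (- (real M + 1 / 2)) * exp (Im (exp l) * \<xi>)))"
   using I II III unfolding Ca_def H_def R_def by (intro conjI impI)
 qed
qed

end

theorem theorem1p3:
 fixes M :: nat and B :: real
 shows "\<exists>C>0. \<forall>\<beta>::real. 0 < \<beta> \<and> \<beta> < pi / 2 \<longrightarrow>
  (\<exists>K>0. \<forall>(l::complex) (N::nat) (\<rho>::real).
   \<bar>Im l\<bar> \<le> 3 * pi / 2 \<and> norm (exp l) \<ge> K \<and> N > 0 \<and>
   real N = 1 / 2 * norm (exp l) * (tan \<beta> - \<beta>) + \<rho> \<and> \<bar>\<rho>\<bar> \<le> B \<longrightarrow>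
   (\<bar>Im l\<bar> \<le> pi / 2 \<longrightarrow>
    norm (R_NM N M \<beta> l) \<le>
     C * (exp (- norm (exp l) * (tan \<beta> - \<beta>)) / sqrt (1 / 2 * norm (exp l) * pi * tan \<beta>)
      * (norm (U_coeff M (\<i> * of_real (cot \<beta>))) / norm (exp l) ^ M))) \<and>
   (pi / 2 \<le> Im l \<longrightarrow>
    norm (R_NM N M \<beta> l) \<le>
     C * (exp (- Im (exp l) * (tan \<beta> - \<beta>)) / sqrt (1 / 2 * norm (exp l) * pi * tan \<beta>)
      * (norm (U_coeff M (\<i> * of_real (cot \<beta>))) / norm (exp l) ^ M))) \<and>
   (pi / 2 \<le> - Im l \<longrightarrow>
    norm (R_NM N M \<beta> l) \<le>
     C * (exp (Im (exp l) * (tan \<beta> - \<beta>)) / sqrt (1 / 2 * norm (exp l) * pi * tan \<beta>)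
      * (norm (U_coeff M (\<i> * of_real (cot \<beta>))) / norm (exp l) ^ M))))"
proof -
 obtain C1 where C1: "rotation_bound M B C1" by (rule rotation_bound_exists)
 obtain C2 where C2: "rotation_bound (Suc M) B C2" by (rule rotation_bound_exists)
 \<comment> \<open>Built from the constant for M alone, hence from M and B; the constant for M + 1
   only influences the threshold K, chosen after \<beta>. The factor \<pi> is that of
   \<open>scale_eq\<close>.\<close>
 define C where "C = ((C1 + 1) / pi\<^sup>2 + 1) * pi"
 have "0 < C1" using C1 by (simp add: rotation_bound_def)
 then have C0: "0 < C" unfolding C_def by (intro mult_pos_pos add_pos_pos divide_pos_pos) auto
 show ?thesis
 proof (rule exI[of _ C], intro conjI C0 allI impI)
  fix \<beta> :: real assume \<beta>: "0 < \<beta> \<and> \<beta> < pi / 2"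
  interpret phase_setup \<beta> by unfold_locales (use \<beta> in auto)
  obtain K where K: "0 < K" "\<And>l N. K \<le> norm (exp l) \<Longrightarrow> \<bar>2 * real N - norm (exp l) * \<xi>\<bar> \<le> 2 * B \<Longrightarrow> \<bar>Im l\<bar> \<le> 3 * pi / 2 \<Longrightarrow>
  (\<bar>Im l\<bar> \<le> pi / 2 \<longrightarrow> norm (R_NM N M \<beta> l) \<le> ((C1 + 1) / pi\<^sup>2 + 1) * (norm (hcoef M) * norm (exp l) powr (- (real M + 1 / 2)) * exp (- norm (exp l) * \<xi>))) \<and>
  (pi / 2 \<le> Im l \<longrightarrow> norm (R_NM N M \<beta> l) \<le> ((C1 + 1) / pi\<^sup>2 + 1) * (norm (hcoef M) * norm (exp l) powr (- (real M + 1 / 2)) * exp (- Im (exp l) * \<xi>))) \<and>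
  (pi / 2 \<le> - Im l \<longrightarrow> norm (R_NM N M \<beta> l) \<le> ((C1 + 1) / pi\<^sup>2 + 1) * (norm (hcoef M) * norm (exp l) powr (- (real M + 1 / 2)) * exp (Im (exp l) * \<xi>)))"
   by (rule R_NM_bounds[OF C1 C2]) blast
  have scale: "((C1 + 1) / pi\<^sup>2 + 1) * (norm (hcoef M) * norm (exp l) powr (- (real M + 1 / 2)) * E)
   = C * (E / sqrt (1 / 2 * norm (exp l) * pi * tan \<beta>) * (norm (U_coeff M (\<i> * of_real (cot \<beta>))) / norm (exp l) ^ M))" for l E
  proof -
   have "0 < norm (exp l)" by simp
   from scale_eq[OF this] show ?thesis unfolding C_def by (simp only: mult.assoc)
  qed
  show "\<exists>K>0. \<forall>(l::complex) (N::nat) (\<rho>::real).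
   \<bar>Im l\<bar> \<le> 3 * pi / 2 \<and> norm (exp l) \<ge> K \<and> N > 0 \<and>
   real N = 1 / 2 * norm (exp l) * (tan \<beta> - \<beta>) + \<rho> \<and> \<bar>\<rho>\<bar> \<le> B \<longrightarrow>
   (\<bar>Im l\<bar> \<le> pi / 2 \<longrightarrow>
    norm (R_NM N M \<beta> l) \<le>
     C * (exp (- norm (exp l) * (tan \<beta> - \<beta>)) / sqrt (1 / 2 * norm (exp l) * pi * tan \<beta>)
      * (norm (U_coeff M (\<i> * of_real (cot \<beta>))) / norm (exp l) ^ M))) \<and>
   (pi / 2 \<le> Im l \<longrightarrow>
    norm (R_NM N M \<beta> l) \<le>
     C * (exp (- Im (exp l) * (tan \<beta> - \<beta>)) / sqrt (1 / 2 * norm (exp l) * pi * tan \<beta>)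
      * (norm (U_coeff M (\<i> * of_real (cot \<beta>))) / norm (exp l) ^ M))) \<and>
   (pi / 2 \<le> - Im l \<longrightarrow>
    norm (R_NM N M \<beta> l) \<le>
     C * (exp (Im (exp l) * (tan \<beta> - \<beta>)) / sqrt (1 / 2 * norm (exp l) * pi * tan \<beta>)
      * (norm (U_coeff M (\<i> * of_real (cot \<beta>))) / norm (exp l) ^ M)))"
  proof (rule exI[of _ K], rule conjI[OF K(1)], intro allI impI)
   fix l N \<rho>
   assume a: "\<bar>Im l\<bar> \<le> 3 * pi / 2 \<and> norm (exp l) \<ge> K \<and> N > 0 \<and>
    real N = 1 / 2 * norm (exp l) * (tan \<beta> - \<beta>) + \<rho> \<and> \<bar>\<rho>\<bar> \<le> B"
   have "real N = 1 / 2 * norm (exp l) * \<xi> + \<rho>" using a by (simp only: \<xi>_def)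
   then have "2 * real N - norm (exp l) * \<xi> = 2 * \<rho>" by linarith
   then have "\<bar>2 * real N - norm (exp l) * \<xi>\<bar> \<le> 2 * B" using a by linarith
   from K(2)[OF _ this, unfolded scale \<xi>_def] a
   show "(\<bar>Im l\<bar> \<le> pi / 2 \<longrightarrow>
    norm (R_NM N M \<beta> l) \<le>
     C * (exp (- norm (exp l) * (tan \<beta> - \<beta>)) / sqrt (1 / 2 * norm (exp l) * pi * tan \<beta>)
      * (norm (U_coeff M (\<i> * of_real (cot \<beta>))) / norm (exp l) ^ M))) \<and>
   (pi / 2 \<le> Im l \<longrightarrow>
    norm (R_NM N M \<beta> l) \<le>
     C * (exp (- Im (exp l) * (tan \<beta> - \<beta>)) / sqrt (1 / 2 * norm (exp l) * pi * tan \<beta>)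
      * (norm (U_coeff M (\<i> * of_real (cot \<beta>))) / norm (exp l) ^ M))) \<and>
   (pi / 2 \<le> - Im l \<longrightarrow>
    norm (R_NM N M \<beta> l) \<le>
     C * (exp (Im (exp l) * (tan \<beta> - \<beta>)) / sqrt (1 / 2 * norm (exp l) * pi * tan \<beta>)
      * (norm (U_coeff M (\<i> * of_real (cot \<beta>))) / norm (exp l) ^ M)))"
    by blast
  qed
 qed
qed

end
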